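(* Let $d\ge1$, $u,\gamma\in(0,\infty)$ and $U\in C^1(\mathbb R^d)$ satisfy Assumption 1 with constants $L,A\in(0,\infty)$, $\lambda\in(0,1/4]$. Let $\eta\in(0,\infty)$, $\alpha=(1+\eta)Lu\gamma^{-2}$, and let $\epsilon=4\gamma^{-1}c/(d+A)$ for a positive constant $c$ such that $$c\le\gamma\min\Big(\frac29u\gamma^{-2}\Big/\int_0^{R_1}\frac{\Phi(s)}{\varphi(s)}ds,\ \ \frac1{18}\frac{\eta}{1+\eta}\inf_{s\in(0,R_1]}\frac{s\varphi(s)}{\Phi(s)},\ \ \frac1{16}\lambda\Big),$$ where $R_1=4(6/5)^{1/2}(1+2\alpha+2\alpha^2)^{1/2}(d+A)^{1/2}u^{1/2}\gamma^{-1}(\lambda-2\lambda^2)^{-1/2}$, $\varphi(s)=\exp\big(-(1+\eta)Ls^2/8-\gamma^2u^{-1}\epsilon\max(1,(2\alpha)^{-1})s^2/2\big)$ and $\Phi(s)=\int_0^s\varphi(x)dx$. Let $f(r)=\int_0^{r\wedge R_1}\varphi(s)g(s)ds$ with $g(r)=1-\frac94c\gamma u^{-1}\int_0^r\Phi(s)\varphi(s)^{-1}ds$. Then for all $t\ge0$ and all probability measures $\mu,\nu$ on $\mathbb R^{2d}$, $$\mathcal W_\rho(\mu p_t,\nu p_t)\le e^{-ct}\mathcal W_\rho(\mu,\nu).$$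
   Context: Setting: $(X_t,V_t)$ is the Langevin diffusion on $\mathbb R^{2d}$: $dX_t=V_t\,dt$, $dV_t=-\gamma V_t\,dt-u\nabla U(X_t)\,dt+\sqrt{2\gamma u}\,dB_t$; $(p_t)$ its transition semigroup, $\mu p_t$ the law at time $t$ for initial law $\mu$. Assumption 1: $U\ge0$, $|\nabla U(x)-\nabla U(y)|\le L|x-y|$, $x\cdot\nabla U(x)/2\ge\lambda(U(x)+u^{-1}\gamma^2|x|^2/4)-A$ for all $x,y\in\mathbb R^d$. $\mathcal H(x,v)=U(x)+\tfrac14u^{-1}\gamma^2(|x+\gamma^{-1}v|^2+|\gamma^{-1}v|^2-\lambda|x|^2)$. Semimetric $\rho((x,v),(x',v'))=f(\alpha|x-x'|+|x-x'+\gamma^{-1}(v-v')|)\,(1+\epsilon\mathcal H(x,v)+\epsilon\mathcal H(x',v'))$, and $\mathcal W_\rho(\mu,\nu)=\inf_\Gamma\int\rho\,d\Gamma$ over all couplings $\Gamma$ of $\mu$ and $\nu$. *)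

theory Defs
  imports "HOL-Probability.Probability"
begin

definition brownian_motion :: "'a measure \<Rightarrow> (real \<Rightarrow> 'a \<Rightarrow> real^'d) \<Rightarrow> bool" where
  "brownian_motion M B \<longleftrightarrow>
     prob_space M \<and>
     (\<forall>t. B t \<in> borel_measurable M) \<and>
     (\<forall>\<omega>\<in>space M. B 0 \<omega> = 0 \<and> continuous_on {0..} (\<lambda>t. B t \<omega>)) \<and>
     (\<forall>s t. 0 \<le> s \<and> s < t \<longrightarrow>
        distributed M lborel (\<lambda>\<omega>. B t \<omega> - B s \<omega>)
          (\<lambda>x. ennreal ((2 * pi * (t - s)) powr (- real CARD('d) / 2)
                          * exp (- (norm x)\<^sup>2 / (2 * (t - s)))))) \<and>
     (\<forall>ts. sorted ts \<and> (\<forall>t\<in>set ts. 0 \<le> t) \<longrightarrow>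
        prob_space.indep_vars M (\<lambda>_. borel) (\<lambda>i \<omega>. B (ts ! Suc i) \<omega> - B (ts ! i) \<omega>)
          {..<length ts - 1})"

text \<open>(X,V) solves dX = V dt, dV = -\<gamma> V dt - u \<nabla>U(X) dt + sqrt(2 \<gamma> u) dB on M,
  with initial condition (X_0,V_0) independent of the Brownian motion B. Since the noise
  is additive, the SDE is written in its (equivalent) integral form.\<close>
definition langevin_solution ::
  "'a measure \<Rightarrow> real \<Rightarrow> real \<Rightarrow> (real^'d \<Rightarrow> real^'d) \<Rightarrow> (real \<Rightarrow> 'a \<Rightarrow> real^'d)
   \<Rightarrow> (real \<Rightarrow> 'a \<Rightarrow> real^'d) \<Rightarrow> (real \<Rightarrow> 'a \<Rightarrow> real^'d) \<Rightarrow> bool" where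
  "langevin_solution M u \<gamma> gradU B X V \<longleftrightarrow>
     brownian_motion M B \<and>
     prob_space.indep_set M
        (sigma_sets (space M)
           {(\<lambda>\<omega>. (X 0 \<omega>, V 0 \<omega>)) -` S \<inter> space M | S. S \<in> sets borel})
        (sigma_sets (space M)
           {(\<lambda>\<omega>. B r \<omega>) -` S \<inter> space M | r S. S \<in> sets borel}) \<and>
     (\<forall>t. (\<lambda>\<omega>. (X t \<omega>, V t \<omega>)) \<in> borel_measurable M) \<and>
     (\<forall>\<omega>\<in>space M.
        continuous_on {0..} (\<lambda>t. X t \<omega>) \<and> continuous_on {0..} (\<lambda>t. V t \<omega>) \<and>
        (\<forall>t\<ge>0.
           X t \<omega> = X 0 \<omega> + integral {0..t} (\<lambda>s. V s \<omega>) \<and>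
           V t \<omega> = V 0 \<omega> - integral {0..t} (\<lambda>s. \<gamma> *\<^sub>R V s \<omega> + u *\<^sub>R gradU (X s \<omega>))
                    + sqrt (2 * \<gamma> * u) *\<^sub>R B t \<omega>))"

text \<open>Law of (X_t,V_t), i.e. \<mu> p_t when the law of (X_0,V_0) is \<mu>.\<close>
definition law_at :: "'a measure \<Rightarrow> (real \<Rightarrow> 'a \<Rightarrow> real^'d) \<Rightarrow> (real \<Rightarrow> 'a \<Rightarrow> real^'d)
   \<Rightarrow> real \<Rightarrow> ((real^'d) \<times> (real^'d)) measure" where
  "law_at M X V t = distr M borel (\<lambda>\<omega>. (X t \<omega>, V t \<omega>))"

definition couplings :: "'b::topological_space measure \<Rightarrow> 'b measure \<Rightarrow> ('b \<times> 'b) measure set" where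
  "couplings \<mu> \<nu> = {\<Gamma>. prob_space \<Gamma> \<and> sets \<Gamma> = sets borel \<and>
                        distr \<Gamma> borel fst = \<mu> \<and> distr \<Gamma> borel snd = \<nu>}"

definition W_rho :: "('b::topological_space \<Rightarrow> 'b \<Rightarrow> real) \<Rightarrow> 'b measure \<Rightarrow> 'b measure \<Rightarrow> ennreal" where
  "W_rho \<rho> \<mu> \<nu> = (INF \<Gamma>\<in>couplings \<mu> \<nu>. \<integral>\<^sup>+ z. ennreal (\<rho> (fst z) (snd z)) \<partial>\<Gamma>)"

definition lphi :: "real \<Rightarrow> real \<Rightarrow> real \<Rightarrow> real \<Rightarrow> real \<Rightarrow> real \<Rightarrow> real \<Rightarrow> real" where
  "lphi L \<eta> \<gamma> u \<epsilon> \<alpha> s =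
     exp (- (1 + \<eta>) * L * s\<^sup>2 / 8 - \<gamma>\<^sup>2 / u * \<epsilon> * max 1 (1 / (2 * \<alpha>)) * s\<^sup>2 / 2)"

definition lPhi :: "real \<Rightarrow> real \<Rightarrow> real \<Rightarrow> real \<Rightarrow> real \<Rightarrow> real \<Rightarrow> real \<Rightarrow> real" where
  "lPhi L \<eta> \<gamma> u \<epsilon> \<alpha> s = integral {0..s} (lphi L \<eta> \<gamma> u \<epsilon> \<alpha>)"

definition R1 :: "real \<Rightarrow> real \<Rightarrow> real \<Rightarrow> real \<Rightarrow> real \<Rightarrow> real \<Rightarrow> real" where
  "R1 d A u \<gamma> lam \<alpha> =
     4 * sqrt (6 / 5) * sqrt (1 + 2 * \<alpha> + 2 * \<alpha>\<^sup>2) * sqrt (d + A) * sqrt u / \<gamma>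
       / sqrt (lam - 2 * lam\<^sup>2)"

definition lg :: "real \<Rightarrow> real \<Rightarrow> real \<Rightarrow> real \<Rightarrow> real \<Rightarrow> real \<Rightarrow> real \<Rightarrow> real \<Rightarrow> real" where
  "lg L \<eta> \<gamma> u \<epsilon> \<alpha> c r =
     1 - 9 / 4 * c * \<gamma> / u * integral {0..r} (\<lambda>s. lPhi L \<eta> \<gamma> u \<epsilon> \<alpha> s / lphi L \<eta> \<gamma> u \<epsilon> \<alpha> s)"

definition lf :: "real \<Rightarrow> real \<Rightarrow> real \<Rightarrow> real \<Rightarrow> real \<Rightarrow> real \<Rightarrow> real \<Rightarrow> real \<Rightarrow> real \<Rightarrow> real" where
  "lf L \<eta> \<gamma> u \<epsilon> \<alpha> c R r =
     integral {0..min r R} (\<lambda>s. lphi L \<eta> \<gamma> u \<epsilon> \<alpha> s * lg L \<eta> \<gamma> u \<epsilon> \<alpha> c s)"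

definition lH :: "(real^'d \<Rightarrow> real) \<Rightarrow> real \<Rightarrow> real \<Rightarrow> real \<Rightarrow> (real^'d) \<times> (real^'d) \<Rightarrow> real" where
  "lH U u \<gamma> lam z = (case z of (x, v) \<Rightarrow>
     U x + 1 / 4 * (1 / u) * \<gamma>\<^sup>2 *
       ((norm (x + (1 / \<gamma>) *\<^sub>R v))\<^sup>2 + (norm ((1 / \<gamma>) *\<^sub>R v))\<^sup>2 - lam * (norm x)\<^sup>2))"

definition lrho :: "(real \<Rightarrow> real) \<Rightarrow> ((real^'d) \<times> (real^'d) \<Rightarrow> real) \<Rightarrow> real \<Rightarrow> real \<Rightarrow> real
     \<Rightarrow> (real^'d) \<times> (real^'d) \<Rightarrow> (real^'d) \<times> (real^'d) \<Rightarrow> real" where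
  "lrho f H \<alpha> \<gamma> \<epsilon> z z' = (case z of (x, v) \<Rightarrow> case z' of (x', v') \<Rightarrow>
     f (\<alpha> * norm (x - x') + norm (x - x' + (1 / \<gamma>) *\<^sub>R (v - v')))
       * (1 + \<epsilon> * H (x, v) + \<epsilon> * H (x', v')))"

end

theory Submission
  imports Defs
begin

text \<open>
  The noise is additive, so the solution is a deterministic function of the Brownian path, the limit
  of Euler chains; no stochastic integration is needed. Write \<open>z\<close> and \<open>w\<close> for the differences of
  positions and of velocities. For a short time \<open>h\<close>, drive the second copy by the path reflected in
  the direction of \<open>q = z + w / \<gamma>\<close> if \<open>norm q \<ge> \<delta>\<close>, and by the same path otherwise; Gaussian
  increments are rotation invariant, so this couples the two transition kernels. A second-order
  expansion, the differential inequality satisfied by \<open>f\<close> and the drift condition for \<open>H\<close> show that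
  one such step multiplies \<open>\<rho>\<close> by at most \<open>1 - c h\<close>, with an error of order \<open>h powr (3/2) + \<delta> h\<close> times a
  cubic moment. Iterating \<open>t / h\<close> steps and letting \<open>\<delta>\<close> and then \<open>h\<close> tend to zero gives the claim;
  the error is made uniform by choosing \<open>\<delta>\<close> and \<open>h\<close> according to the size of the initial points.
\<close>

section \<open>Euler chains with additive noise\<close>

text \<open>The direction \<open>qq\<close> carries all the noise of the distance: in the difference
  of two copies \<open>zz\<close> relaxes towards \<open>qq\<close> at rate \<gamma>, and friction
  cancels in the drift of \<open>qq\<close>. Two obstacles shape the argument. Reflection is
  singular at \<open>qq = 0\<close>, so it is switched off below \<delta>; there the factor 1 +
  \<eta> in \<alpha> makes the distance contract by drift alone, up to an error proportional to
  \<delta>. The constant of the remainder of order \<open>h powr (3/2)\<close> blows up as \<delta>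
  shrinks, hence \<delta> is fixed before h, and the moment bounds are made independent of both.
  Moreover both marginals of a coupled step must be exact: the reflection is frozen during a step,
  and equality of laws is proved for Euler chains, where it is rotation invariance of one Gaussian,
  and passed to the limit. The constants balance as follows. The choice of \<epsilon> gives
  \<open>GG\<close> a drift of at most 8c; the integral in g produces a term -9c \<Phi>, which pays
  for these 8c and leaves the rate c. \<open>R1\<close> is the distance beyond which the Lyapunov
  drift alone yields the rate.\<close>

primrec euler_chain :: "('e::real_vector \<Rightarrow> 'e) \<Rightarrow> ('n \<Rightarrow> 'e) \<Rightarrow> real \<Rightarrow> (nat \<Rightarrow> 'n) \<Rightarrow> 'e \<Rightarrow> nat \<Rightarrow> 'e" where
  "euler_chain F S \<tau> \<xi> z 0 = z"
| "euler_chain F S \<tau> \<xi> z (Suc k) =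
     euler_chain F S \<tau> \<xi> z k + \<tau> *\<^sub>R F (euler_chain F S \<tau> \<xi> z k) + S (\<xi> k)"

definition increments :: "real \<Rightarrow> (real \<Rightarrow> 'n::minus) \<Rightarrow> nat \<Rightarrow> 'n" where
  "increments \<tau> b k = b (real (Suc k) * \<tau>) - b (real k * \<tau>)"

definition euler :: "('e::real_vector \<Rightarrow> 'e) \<Rightarrow> ('n::minus \<Rightarrow> 'e) \<Rightarrow> real \<Rightarrow> nat \<Rightarrow> (real \<Rightarrow> 'n) \<Rightarrow> 'e \<Rightarrow> 'e" where
  "euler F S T m b z = euler_chain F S (T / real m) (increments (T / real m) b) z m"

text \<open>\<open>lim\<close> is meaningful only when the Euler schemes converge;
  \<open>convergent_euler\<close> secures this for continuous paths starting at 0. Taking the limit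
  path by path makes the solution a function of the path and the starting point, defined on every
  probability space at once.\<close>

definition flow :: "('e::real_normed_vector \<Rightarrow> 'e) \<Rightarrow> ('n::minus \<Rightarrow> 'e) \<Rightarrow> real \<Rightarrow> (real \<Rightarrow> 'n) \<Rightarrow> 'e \<Rightarrow> 'e" where
  "flow F S T b z = lim (\<lambda>m. euler F S T m b z)"

lemma sum_increments:
  fixes b :: "real \<Rightarrow> 'n::ab_group_add"
  shows "(\<Sum>i<k. increments \<tau> b i) = b (real k * \<tau>) - b 0"
  by (induction k) (simp_all add: increments_def)

lemma euler_chain_add:
  "euler_chain F S \<tau> \<xi> z (j + k) = euler_chain F S \<tau> (\<lambda>i. \<xi> (j + i)) (euler_chain F S \<tau> \<xi> z j) k"
  by (induction k) simp_all

lemma euler_chain_cong: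
  "(\<And>i. i < k \<Longrightarrow> \<xi> i = \<xi>' i) \<Longrightarrow> euler_chain F S \<tau> \<xi> z k = euler_chain F S \<tau> \<xi>' z k"
  by (induction k) simp_all

text \<open>\<open>S\<close> is kept general so that the reflected copy, where \<open>S\<close> is
  composed with an orthogonal map, is another instance with the same constants.\<close>

locale lipschitz_field =
  fixes F :: "'e::banach \<Rightarrow> 'e" and S :: "'n::real_normed_vector \<Rightarrow> 'e" and K s :: real
  assumes F_lipschitz: "norm (F x - F y) \<le> K * norm (x - y)"
    and S_linear: "linear S" and S_bound: "norm (S b) \<le> s * norm b"
    and K_nonneg: "0 \<le> K" and s_nonneg: "0 \<le> s"
begin

lemma one_plus_power_le:
  assumes "0 \<le> \<tau>"
  shows "(1 + K * \<tau>) ^ m \<le> exp (K * (real m * \<tau>))"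
proof -
  have "(1 + K * \<tau>) ^ m \<le> exp (K * \<tau>) ^ m"
    using assms K_nonneg by (intro power_mono exp_ge_add_one_self) simp_all
  also have "\<dots> = exp (K * (real m * \<tau>))"
    by (simp add: exp_of_nat_mult[symmetric] mult_ac)
  finally show ?thesis .
qed

text \<open>Discrete Gronwall inequality: \<open>p\<close> obeys the recursion up to a defect of
  size \<open>\<tau> * \<eta>\<close> per step. It serves twice, for a finer chain sampled on a
  coarse grid and for an exact solution sampled on the grid.\<close>

lemma euler_chain_stable:
  assumes \<tau>: "0 \<le> \<tau>" and \<eta>: "0 \<le> \<eta>" and p0: "p 0 = z"
    and p: "\<And>k. k < m \<Longrightarrow> norm (p (Suc k) - p k - \<tau> *\<^sub>R F (p k) - S (\<xi> k)) \<le> \<tau> * \<eta>"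
  shows "norm (p m - euler_chain F S \<tau> \<xi> z m) \<le> exp (K * (real m * \<tau>)) * (real m * \<tau> * \<eta>)"
proof -
  let ?e = "\<lambda>k. euler_chain F S \<tau> \<xi> z k"
  have q: "1 \<le> (1 + K * \<tau>) ^ k" for k
    using \<tau> K_nonneg by (intro one_le_power) simp
  have "k \<le> m \<Longrightarrow> norm (p k - ?e k) \<le> (1 + K * \<tau>) ^ k * (real k * \<tau> * \<eta>)" for k
  proof (induction k)
    case (Suc k)
    have "p (Suc k) - ?e (Suc k) =
        (p (Suc k) - p k - \<tau> *\<^sub>R F (p k) - S (\<xi> k)) + (p k - ?e k) + \<tau> *\<^sub>R (F (p k) - F (?e k))"
      by (simp add: algebra_simps)
    moreover have "norm (a + b + c) \<le> norm a + norm b + norm c" for a b c :: 'e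
      using norm_triangle_ineq[of "a + b" c] norm_triangle_ineq[of a b] by linarith
    ultimately have "norm (p (Suc k) - ?e (Suc k)) \<le>
        norm (p (Suc k) - p k - \<tau> *\<^sub>R F (p k) - S (\<xi> k)) + norm (p k - ?e k)
          + norm (\<tau> *\<^sub>R (F (p k) - F (?e k)))"
      by presburger
    also have "norm (\<tau> *\<^sub>R (F (p k) - F (?e k))) \<le> \<tau> * (K * norm (p k - ?e k))"
      using \<tau> F_lipschitz by (simp add: mult_left_mono)
    also have "norm (p (Suc k) - p k - \<tau> *\<^sub>R F (p k) - S (\<xi> k)) \<le> \<tau> * \<eta>"
      using p Suc.prems by simp
    finally have "norm (p (Suc k) - ?e (Suc k)) \<le> \<tau> * \<eta> + (1 + K * \<tau>) * norm (p k - ?e k)"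
      by (simp add: algebra_simps)
    also have "\<dots> \<le> \<tau> * \<eta> + (1 + K * \<tau>) * ((1 + K * \<tau>) ^ k * (real k * \<tau> * \<eta>))"
      using Suc \<tau> K_nonneg by (intro add_left_mono mult_left_mono) simp_all
    also have "\<dots> \<le> (1 + K * \<tau>) ^ Suc k * (\<tau> * \<eta>) + (1 + K * \<tau>) ^ Suc k * (real k * \<tau> * \<eta>)"
      using mult_right_mono[OF q[of "Suc k"], of "\<tau> * \<eta>"] \<tau> \<eta> by (simp add: mult_ac)
    finally show ?case by (simp add: algebra_simps)
  qed (simp add: p0)
  then have "norm (p m - ?e m) \<le> (1 + K * \<tau>) ^ m * (real m * \<tau> * \<eta>)" by simp
  also have "\<dots> \<le> exp (K * (real m * \<tau>)) * (real m * \<tau> * \<eta>)"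
    using \<tau> \<eta> by (intro mult_right_mono one_plus_power_le) simp_all
  finally show ?thesis .
qed

text \<open>Both chains see the same noise, so it cancels in the difference and only the factor
  \<open>1 + K * \<tau>\<close> per step remains.\<close>

lemma euler_chain_lipschitz:
  assumes \<tau>: "0 \<le> \<tau>"
  shows "norm (euler_chain F S \<tau> \<xi> z m - euler_chain F S \<tau> \<xi> z' m) \<le> exp (K * (real m * \<tau>)) * norm (z - z')"
proof -
  let ?e = "euler_chain F S \<tau> \<xi>"
  have "norm (?e z m - ?e z' m) \<le> (1 + K * \<tau>) ^ m * norm (z - z')"
  proof (induction m)
    case (Suc k)
    have "?e z (Suc k) - ?e z' (Suc k) = (?e z k - ?e z' k) + \<tau> *\<^sub>R (F (?e z k) - F (?e z' k))"
      by (simp add: algebra_simps)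
    then have "norm (?e z (Suc k) - ?e z' (Suc k)) \<le> norm (?e z k - ?e z' k) + norm (\<tau> *\<^sub>R (F (?e z k) - F (?e z' k)))"
      by (metis norm_triangle_ineq)
    also have "\<dots> \<le> norm (?e z k - ?e z' k) + \<tau> * (K * norm (?e z k - ?e z' k))"
      using \<tau> F_lipschitz by (simp add: mult_left_mono)
    also have "\<dots> = (1 + K * \<tau>) * norm (?e z k - ?e z' k)" by (simp add: algebra_simps)
    also have "\<dots> \<le> (1 + K * \<tau>) * ((1 + K * \<tau>) ^ k * norm (z - z'))"
      using Suc \<tau> K_nonneg by (intro mult_left_mono) simp_all
    finally show ?case by (simp add: mult_ac)
  qed simp
  also have "\<dots> \<le> exp (K * (real m * \<tau>)) * norm (z - z')"
    using \<tau> by (intro mult_right_mono one_plus_power_le) simp_all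
  finally show ?thesis .
qed

lemma euler_chain_eq_sum:
  "euler_chain F S \<tau> \<xi> z k = z + \<tau> *\<^sub>R (\<Sum>i<k. F (euler_chain F S \<tau> \<xi> z i)) + S (\<Sum>i<k. \<xi> i)"
  by (induction k) (simp_all add: linear_add[OF S_linear] linear_0[OF S_linear] algebra_simps)

text \<open>Gronwall for the time integral of the displacement instead of its maximum. The noise
  then enters through its time average, whose moments are controlled by those at single grid
  times.\<close>

lemma euler_chain_increment_sum:
  assumes \<tau>: "0 \<le> \<tau>"
  shows "\<tau> * (\<Sum>i<m. norm (euler_chain F S \<tau> \<xi> z i - z)) \<le>
     exp (K * (real m * \<tau>)) * ((real m * \<tau>)\<^sup>2 * norm (F z) + s * (\<tau> * (\<Sum>j<m. norm (\<Sum>i<j. \<xi> i))))"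
proof -
  let ?e = "\<lambda>k. euler_chain F S \<tau> \<xi> z k"
  define I where "I k = \<tau> * (\<Sum>i<k. norm (?e i - z))" for k
  define a where "a k = \<tau> * (real k * \<tau> * norm (F z) + s * norm (\<Sum>i<k. \<xi> i))" for k
  have a0: "0 \<le> a k" for k using \<tau> s_nonneg by (simp add: a_def)
  have q: "1 \<le> (1 + K * \<tau>) ^ k" for k
    using \<tau> K_nonneg by (intro one_le_power) simp
  have g: "norm (?e k - z) \<le> K * I k + real k * \<tau> * norm (F z) + s * norm (\<Sum>i<k. \<xi> i)" for k
  proof -
    have "?e k - z = \<tau> *\<^sub>R (\<Sum>i<k. F (?e i)) + S (\<Sum>i<k. \<xi> i)"
      using euler_chain_eq_sum[of \<tau> \<xi> z k] by simp
    then have "norm (?e k - z) \<le> norm (\<tau> *\<^sub>R (\<Sum>i<k. F (?e i))) + s * norm (\<Sum>i<k. \<xi> i)"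
      using S_bound[of "\<Sum>i<k. \<xi> i"] by (auto intro!: norm_triangle_le)
    also have "norm (\<tau> *\<^sub>R (\<Sum>i<k. F (?e i))) \<le> \<tau> * (\<Sum>i<k. K * norm (?e i - z) + norm (F z))"
    proof -
      have "norm (F (?e i)) \<le> K * norm (?e i - z) + norm (F z)" for i
        using F_lipschitz[of "?e i" z] norm_triangle_ineq2[of "F (?e i)" "F z"] by linarith
      then have "norm (\<Sum>i<k. F (?e i)) \<le> (\<Sum>i<k. K * norm (?e i - z) + norm (F z))"
        by (intro sum_norm_le)
      then show ?thesis using \<tau> by (simp add: mult_left_mono)
    qed
    also have "\<dots> = K * I k + real k * \<tau> * norm (F z)"
      by (simp add: I_def sum.distrib sum_distrib_left algebra_simps)
    finally show ?thesis by simp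
  qed
  have "I k \<le> (1 + K * \<tau>) ^ k * (\<Sum>j<k. a j)" for k
  proof (induction k)
    case (Suc k)
    have "I (Suc k) = I k + \<tau> * norm (?e k - z)" by (simp add: I_def algebra_simps)
    also have "\<dots> \<le> I k + \<tau> * (K * I k + real k * \<tau> * norm (F z) + s * norm (\<Sum>i<k. \<xi> i))"
      using g \<tau> by (intro add_left_mono mult_left_mono)
    also have "\<dots> = (1 + K * \<tau>) * I k + a k" by (simp add: a_def algebra_simps)
    also have "\<dots> \<le> (1 + K * \<tau>) * ((1 + K * \<tau>) ^ k * (\<Sum>j<k. a j)) + (1 + K * \<tau>) ^ Suc k * a k"
      using Suc \<tau> K_nonneg mult_right_mono[OF q[of "Suc k"] a0[of k]]
      by (intro add_mono mult_left_mono) simp_all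
    finally show ?case by (simp add: algebra_simps)
  qed (simp add: I_def)
  then have "I m \<le> (1 + K * \<tau>) ^ m * (\<Sum>j<m. a j)" .
  also have "\<dots> \<le> exp (K * (real m * \<tau>)) * (\<Sum>j<m. a j)"
    using \<tau> a0 by (intro mult_right_mono one_plus_power_le sum_nonneg) simp_all
  also have "(\<Sum>j<m. a j) \<le> (real m * \<tau>)\<^sup>2 * norm (F z) + s * (\<tau> * (\<Sum>j<m. norm (\<Sum>i<j. \<xi> i)))"
  proof -
    have "(\<Sum>j<m. a j) = (\<Sum>j<m. \<tau> * (real j * \<tau> * norm (F z))) + s * (\<tau> * (\<Sum>j<m. norm (\<Sum>i<j. \<xi> i)))"
      by (simp add: a_def sum.distrib sum_distrib_left algebra_simps)
    also have "(\<Sum>j<m. \<tau> * (real j * \<tau> * norm (F z))) \<le> (\<Sum>j<m. \<tau> * (real m * \<tau> * norm (F z)))"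
      using \<tau> by (intro sum_mono mult_left_mono mult_right_mono) simp_all
    also have "\<dots> = (real m * \<tau>)\<^sup>2 * norm (F z)" by (simp add: power2_eq_square)
    finally show ?thesis by simp
  qed
  finally show ?thesis by (simp add: I_def mult_left_mono)
qed

text \<open>The error is the time integral of the change of \<open>F\<close> along the chain, hence
  \<open>K\<close> times the displacement just bounded. Over a time h it is of order
  \<open>h powr (3/2)\<close> for Brownian noise, since the average of the path is of order
  \<open>sqrt h\<close>.\<close>

lemma euler_chain_local_error:
  assumes \<tau>: "0 \<le> \<tau>"
  shows "norm (euler_chain F S \<tau> \<xi> z m - (z + (real m * \<tau>) *\<^sub>R F z + S (\<Sum>i<m. \<xi> i))) \<le>
     K * (exp (K * (real m * \<tau>)) * ((real m * \<tau>)\<^sup>2 * norm (F z) + s * (\<tau> * (\<Sum>j<m. norm (\<Sum>i<j. \<xi> i)))))"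
proof -
  let ?e = "\<lambda>k. euler_chain F S \<tau> \<xi> z k"
  have "?e m - (z + (real m * \<tau>) *\<^sub>R F z + S (\<Sum>i<m. \<xi> i)) = \<tau> *\<^sub>R (\<Sum>i<m. F (?e i) - F z)"
    by (subst euler_chain_eq_sum) (simp add: sum_subtractf sum_constant_scaleR scaleR_diff_right mult.commute)
  moreover have "norm (\<Sum>i<m. F (?e i) - F z) \<le> (\<Sum>i<m. K * norm (?e i - z))"
    using F_lipschitz by (intro sum_norm_le) simp
  ultimately have "norm (?e m - (z + (real m * \<tau>) *\<^sub>R F z + S (\<Sum>i<m. \<xi> i))) \<le> K * (\<tau> * (\<Sum>i<m. norm (?e i - z)))"
    using \<tau> mult_left_mono[of "norm (\<Sum>i<m. F (?e i) - F z)" "K * (\<Sum>i<m. norm (?e i - z))" \<tau>]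
    by (simp add: sum_distrib_left[symmetric] mult.left_commute)
  also have "\<dots> \<le> K * (exp (K * (real m * \<tau>)) * ((real m * \<tau>)\<^sup>2 * norm (F z) + s * (\<tau> * (\<Sum>j<m. norm (\<Sum>i<j. \<xi> i)))))"
    using K_nonneg \<tau> by (intro mult_left_mono euler_chain_increment_sum)
  finally show ?thesis .
qed


text \<open>Chains with m and with k steps are both close to the one with m k steps: the finer
  chain, sampled on the coarse grid, satisfies the coarse recursion up to a defect governed by the
  modulus of continuity of \<open>b\<close>.\<close>

lemma convergent_euler:
  assumes T: "0 \<le> T" and b: "continuous_on {0..T} b" and b0: "b 0 = 0"
  shows "convergent (\<lambda>m. euler F S T m b z)"
proof -
  define e where "e m k = euler_chain F S (T / real m) (increments (T / real m) b) z k" for m k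
  have in_T: "real k * (T / real m) \<in> {0..T}" if "k \<le> m" "0 < m" for k m
  proof -
    have "real k * T \<le> real m * T" using that T by (intro mult_right_mono) simp_all
    then show ?thesis using that T by (simp add: field_simps)
  qed
  have "bounded (b ` {0..T})" by (intro compact_imp_bounded compact_continuous_image b) simp
  then obtain B where B: "\<And>t. t \<in> {0..T} \<Longrightarrow> norm (b t) \<le> B"
    unfolding bounded_iff by blast
  have B0: "0 \<le> B" using B[of 0] T norm_ge_zero[of "b 0"] by (auto simp del: norm_ge_zero)
  \<comment> \<open>A bound on the displacement from \<open>z\<close>, uniform in the number of
    steps; \<open>Y\<close> is the resulting bound on the drift along every chain.\<close>
  define D where "D = K * (exp (K * T) * (T\<^sup>2 * norm (F z) + s * (T * B))) + T * norm (F z) + s * B"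
  define Y where "Y = K * D + norm (F z)"
  have D: "norm (e m k - z) \<le> D" if "k \<le> m" "0 < m" for m k
  proof -
    let ?\<tau> = "T / real m"
    have kT: "0 \<le> real k * ?\<tau>" "real k * ?\<tau> \<le> T" using in_T[OF that] by simp_all
    have sum_b: "(\<Sum>i<j. increments ?\<tau> b i) = b (real j * ?\<tau>)" for j
      by (simp add: sum_increments b0)
    have "?\<tau> * (\<Sum>j<k. norm (b (real j * ?\<tau>))) \<le> ?\<tau> * (\<Sum>j<k. B)"
      using that T by (intro mult_left_mono sum_mono B in_T) simp_all
    also have "\<dots> = real k * ?\<tau> * B" by simp
    also have "\<dots> \<le> T * B" using kT B0 by (intro mult_right_mono)
    finally have J: "?\<tau> * (\<Sum>j<k. norm (b (real j * ?\<tau>))) \<le> T * B" .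
    have "norm (e m k - (z + (real k * ?\<tau>) *\<^sub>R F z + S (b (real k * ?\<tau>)))) \<le>
        K * (exp (K * (real k * ?\<tau>)) * ((real k * ?\<tau>)\<^sup>2 * norm (F z) + s * (?\<tau> * (\<Sum>j<k. norm (b (real j * ?\<tau>))))))"
      using euler_chain_local_error[of ?\<tau> "increments ?\<tau> b" z k] T by (simp add: e_def sum_b)
    also have "\<dots> \<le> K * (exp (K * T) * (T\<^sup>2 * norm (F z) + s * (T * B)))"
    proof (intro mult_left_mono[OF _ K_nonneg] mult_mono[of "exp _"] mult_right_mono add_mono)
      show "exp (K * (real k * ?\<tau>)) \<le> exp (K * T)"
        using mult_left_mono[OF kT(2) K_nonneg] by simp
      show "0 \<le> (real k * ?\<tau>)\<^sup>2 * norm (F z) + s * (?\<tau> * (\<Sum>j<k. norm (b (real j * ?\<tau>))))"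
        using s_nonneg T by (intro add_nonneg_nonneg mult_nonneg_nonneg sum_nonneg) simp_all
      show "s * (?\<tau> * (\<Sum>j<k. norm (b (real j * ?\<tau>)))) \<le> s * (T * B)"
        using J s_nonneg by (rule mult_left_mono)
      show "(real k * ?\<tau>)\<^sup>2 \<le> T\<^sup>2" using kT by (rule power_mono[rotated])
    qed simp_all
    finally have "norm (e m k - (z + (real k * ?\<tau>) *\<^sub>R F z + S (b (real k * ?\<tau>)))) \<le> \<dots>" .
    moreover have "norm ((real k * ?\<tau>) *\<^sub>R F z) \<le> T * norm (F z)"
      using mult_right_mono[OF kT(2), of "norm (F z)"] by (simp only: norm_scaleR abs_of_nonneg[OF kT(1)] norm_ge_zero)
    moreover have "norm (S (b (real k * ?\<tau>))) \<le> s * B"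
      using S_bound[of "b (real k * ?\<tau>)"] mult_left_mono[OF B[OF in_T[OF that]] s_nonneg] by linarith
    moreover have "norm (e m k - z) \<le> norm (e m k - (z + (real k * ?\<tau>) *\<^sub>R F z + S (b (real k * ?\<tau>))))
        + norm ((real k * ?\<tau>) *\<^sub>R F z) + norm (S (b (real k * ?\<tau>)))"
    proof -
      have "e m k - z = (e m k - (z + (real k * ?\<tau>) *\<^sub>R F z + S (b (real k * ?\<tau>)))) + (real k * ?\<tau>) *\<^sub>R F z + S (b (real k * ?\<tau>))"
        by simp
      then show ?thesis by (metis add.commute norm_triangle_ineq norm_triangle_le add_mono order_refl)
    qed
    ultimately show ?thesis by (simp add: D_def)
  qed
  have Y: "norm (F (e m k)) \<le> Y" if "k \<le> m" "0 < m" for m k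
    using F_lipschitz[of "e m k" z] mult_left_mono[OF D[OF that] K_nonneg] norm_triangle_ineq2[of "F (e m k)" "F z"]
    by (simp add: Y_def)
  have Y0: "0 \<le> Y" using order_trans[OF norm_ge_zero Y[of 0 1]] by simp
  \<comment> \<open>Here \<omega> bounds the oscillation of \<open>b\<close> at scale
    \<open>T / real m\<close>; between two coarse grid points the fine chain moves at most
    \<open>T / real m * Y + s * \<omega>\<close>.\<close>
  have close: "norm (e (m * k) (m * k) - e m m) \<le> exp (K * T) * (T * (K * (T / real m * Y + s * \<omega>)))"
    if m: "0 < m" and k: "0 < k" and \<omega>0: "0 \<le> \<omega>"
      and \<omega>: "\<And>t t'. t \<in> {0..T} \<Longrightarrow> t' \<in> {0..T} \<Longrightarrow> \<bar>t - t'\<bar> \<le> T / real m \<Longrightarrow> norm (b t - b t') \<le> \<omega>"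
    for m k \<omega>
  proof -
    let ?\<tau> = "T / real m" and ?\<tau>' = "T / real (m * k)"
    have \<tau>': "real k * ?\<tau>' = ?\<tau>" "0 \<le> ?\<tau>'" "0 \<le> ?\<tau>" using m k T by (simp_all add: field_simps)
    define p where "p i = e (m * k) (i * k)" for i
    have "norm (p m - euler_chain F S ?\<tau> (increments ?\<tau> b) z m)
        \<le> exp (K * (real m * ?\<tau>)) * (real m * ?\<tau> * (K * (?\<tau> * Y + s * \<omega>)))"
    proof (rule euler_chain_stable)
      fix i assume i: "i < m"
      define \<xi> where "\<xi> = (\<lambda>j. increments ?\<tau>' b (i * k + j))"
      have le: "i * k + j \<le> m * k" if "j \<le> k" for j
      proof -
        have "i * k + j \<le> i * k + k" using that by simp
        also have "\<dots> = Suc i * k" by simp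
        also have "\<dots> \<le> m * k" using i by (intro mult_le_mono1) simp
        finally show ?thesis .
      qed
      have ch: "e (m * k) (i * k + j) = euler_chain F S ?\<tau>' \<xi> (p i) j" for j
        by (simp add: e_def p_def euler_chain_add \<xi>_def)
      have sum_\<xi>: "(\<Sum>l<j. \<xi> l) = b (real (i * k + j) * ?\<tau>') - b (real (i * k) * ?\<tau>')" for j
        by (induction j) (simp_all add: \<xi>_def increments_def)
      have dist: "norm (e (m * k) (i * k + j) - p i) \<le> ?\<tau> * Y + s * \<omega>" if j: "j < k" for j
      proof -
        have "e (m * k) (i * k + j) - p i = ?\<tau>' *\<^sub>R (\<Sum>l<j. F (e (m * k) (i * k + l))) + S (\<Sum>l<j. \<xi> l)"
          using euler_chain_eq_sum[of ?\<tau>' \<xi> "p i" j] by (simp add: ch)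
        then have "norm (e (m * k) (i * k + j) - p i) \<le> norm (?\<tau>' *\<^sub>R (\<Sum>l<j. F (e (m * k) (i * k + l)))) + norm (S (\<Sum>l<j. \<xi> l))"
          by (simp only: norm_triangle_ineq)
        moreover have "norm (\<Sum>l<j. F (e (m * k) (i * k + l))) \<le> (\<Sum>l<j. Y)"
          using j m k le by (intro sum_norm_le Y) simp_all
        then have "norm (?\<tau>' *\<^sub>R (\<Sum>l<j. F (e (m * k) (i * k + l)))) \<le> ?\<tau>' * (real j * Y)"
          using \<tau>'(2) by (simp only: norm_scaleR abs_of_nonneg sum_constant card_lessThan) (rule mult_left_mono)
        moreover have "?\<tau>' * (real j * Y) \<le> ?\<tau>' * (real k * Y)"
          using \<tau>'(2) Y0 j by (intro mult_left_mono mult_right_mono) simp_all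
        moreover have "norm (S (\<Sum>l<j. \<xi> l)) \<le> s * \<omega>"
        proof -
          have "norm (\<Sum>l<j. \<xi> l) \<le> \<omega>" unfolding sum_\<xi>
          proof (rule \<omega>)
            show "real (i * k + j) * ?\<tau>' \<in> {0..T}" "real (i * k) * ?\<tau>' \<in> {0..T}"
              using in_T[OF le, of j] in_T[OF le, of 0] j m k by simp_all
            have "real j * ?\<tau>' \<le> ?\<tau>" using \<tau>' j mult_right_mono[of "real j" "real k" ?\<tau>'] by simp
            moreover have "real (i * k + j) * ?\<tau>' - real (i * k) * ?\<tau>' = real j * ?\<tau>'" by (simp add: algebra_simps add_divide_distrib)
            moreover have "0 \<le> real j * ?\<tau>'" using \<tau>'(2) by (rule mult_nonneg_nonneg[OF of_nat_0_le_iff])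
            ultimately show "\<bar>real (i * k + j) * ?\<tau>' - real (i * k) * ?\<tau>'\<bar> \<le> ?\<tau>" by (simp only: abs_of_nonneg)
          qed
          then show ?thesis using S_bound[of "\<Sum>l<j. \<xi> l"] mult_left_mono[of _ \<omega> s] s_nonneg by (meson order_trans)
        qed
        moreover have "?\<tau>' * (real k * Y) = ?\<tau> * Y" unfolding \<tau>'(1)[symmetric] by (simp only: mult_ac)
        ultimately show ?thesis by linarith
      qed
      have S_eq: "(\<Sum>l<k. \<xi> l) = increments ?\<tau> b i"
      proof -
        have "real (i * k + k) * ?\<tau>' = real (Suc i) * ?\<tau>" "real (i * k) * ?\<tau>' = real i * ?\<tau>"
          using m k by (simp_all add: field_simps)
        then show ?thesis unfolding sum_\<xi> increments_def by simp
      qed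
      have "p (Suc i) = e (m * k) (i * k + k)" by (simp add: p_def add.commute)
      also have "\<dots> = p i + ?\<tau>' *\<^sub>R (\<Sum>l<k. F (e (m * k) (i * k + l))) + S (increments ?\<tau> b i)"
        using euler_chain_eq_sum[of ?\<tau>' \<xi> "p i" k] by (simp add: ch S_eq)
      finally have "p (Suc i) - p i - ?\<tau> *\<^sub>R F (p i) - S (increments ?\<tau> b i) = ?\<tau>' *\<^sub>R (\<Sum>l<k. F (e (m * k) (i * k + l))) - ?\<tau> *\<^sub>R F (p i)"
        by simp
      also have "\<dots> = ?\<tau>' *\<^sub>R (\<Sum>l<k. F (e (m * k) (i * k + l)) - F (p i))"
        by (simp add: \<tau>'(1)[symmetric] sum_subtractf sum_constant_scaleR scaleR_diff_right mult.commute del: of_nat_mult)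
      finally have "norm (p (Suc i) - p i - ?\<tau> *\<^sub>R F (p i) - S (increments ?\<tau> b i)) = ?\<tau>' * norm (\<Sum>l<k. F (e (m * k) (i * k + l)) - F (p i))"
        using \<tau>'(2) by (simp only: norm_scaleR abs_of_nonneg)
      also have "\<dots> \<le> ?\<tau>' * (\<Sum>l<k. K * (?\<tau> * Y + s * \<omega>))"
      proof (intro mult_left_mono \<tau>' sum_norm_le)
        fix l assume "l \<in> {..<k}"
        then have "norm (e (m * k) (i * k + l) - p i) \<le> ?\<tau> * Y + s * \<omega>" using dist by simp
        then show "norm (F (e (m * k) (i * k + l)) - F (p i)) \<le> K * (?\<tau> * Y + s * \<omega>)"
          by (meson F_lipschitz K_nonneg mult_left_mono order_trans)
      qed
      also have "\<dots> = (real k * ?\<tau>') * (K * (?\<tau> * Y + s * \<omega>))" by simp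
      finally show "norm (p (Suc i) - p i - ?\<tau> *\<^sub>R F (p i) - S (increments ?\<tau> b i)) \<le> ?\<tau> * (K * (?\<tau> * Y + s * \<omega>))"
        by (simp only: \<tau>')
    qed (use T Y0 K_nonneg s_nonneg \<omega>0 in \<open>simp_all add: p_def e_def\<close>)
    moreover have "real m * ?\<tau> = T" using m by simp
    moreover have "p m = e (m * k) (m * k)" "euler_chain F S ?\<tau> (increments ?\<tau> b) z m = e m m"
      by (simp_all add: p_def e_def)
    ultimately show ?thesis by simp
  qed
  have "Cauchy (\<lambda>m. e m m)"
  proof (rule metric_CauchyI)
    fix r :: real assume r: "0 < r"
    define C where "C = exp (K * T) * (T * K)"
    have C0: "0 \<le> C" using T K_nonneg by (simp add: C_def)
    \<comment> \<open>Chosen so that the noise part of the estimate is at most \<open>r / 4\<close>;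
      the added ones keep the denominator positive.\<close>
    define \<omega> where "\<omega> = r / (4 * (C + 1) * (s + 1))"
    have \<omega>: "0 < \<omega>" using r C0 s_nonneg by (simp add: \<omega>_def)
    have "uniformly_continuous_on {0..T} b" by (intro compact_uniformly_continuous b) simp
    then obtain d where d: "0 < d" "\<And>t t'. t \<in> {0..T} \<Longrightarrow> t' \<in> {0..T} \<Longrightarrow> dist t' t < d \<Longrightarrow> dist (b t') (b t) < \<omega>"
      using \<omega> unfolding uniformly_continuous_on_def by meson
    have lim1: "(\<lambda>m. C * (T * Y / real m)) \<longlonglongrightarrow> 0" and lim2: "(\<lambda>m. T / real m) \<longlonglongrightarrow> 0"
      using tendsto_mult_right_zero[OF lim_const_over_n, of C "T * Y"] lim_const_over_n[of T] by simp_all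
    have "\<forall>\<^sub>F m in sequentially. C * (T * Y / real m) < r / 4" "\<forall>\<^sub>F m in sequentially. T / real m < d"
      using r d(1) by (intro order_tendstoD(2)[OF lim1] order_tendstoD(2)[OF lim2]; simp)+
    then have "\<forall>\<^sub>F m in sequentially. C * (T * Y / real m) < r / 4 \<and> T / real m < d \<and> 0 < m"
      using eventually_gt_at_top[of "0::nat"] by eventually_elim simp
    then obtain N where N: "\<And>m. N \<le> m \<Longrightarrow> C * (T * Y / real m) < r / 4 \<and> T / real m < d \<and> 0 < m"
      by (auto simp: eventually_sequentially)
    have small: "norm (e (m * k) (m * k) - e m m) < r / 2" if "N \<le> m" "0 < k" for m k
    proof -
      have "norm (e (m * k) (m * k) - e m m) \<le> exp (K * T) * (T * (K * (T / real m * Y + s * \<omega>)))"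
      proof (rule close)
        fix t t' assume "t \<in> {0..T}" "t' \<in> {0..T}" "\<bar>t - t'\<bar> \<le> T / real m"
        then show "norm (b t - b t') \<le> \<omega>" using d(2)[of t' t] N[OF that(1)] by (simp add: dist_norm abs_minus_commute)
      qed (use N[OF that(1)] that \<omega> in auto)
      also have "\<dots> = C * (T * Y / real m) + C * (s * \<omega>)" by (simp add: C_def algebra_simps)
      also have "C * (s * \<omega>) \<le> (C + 1) * ((s + 1) * \<omega>)" using C0 s_nonneg \<omega> by (intro mult_mono mult_right_mono) simp_all
      also have "\<dots> = r / 4" using C0 s_nonneg by (simp add: \<omega>_def divide_simps)
      finally show ?thesis using conjunct1[OF N[OF that(1)]] r by linarith
    qed
    have "dist (e m m) (e k k) < r" if "N \<le> m" "N \<le> k" for m k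
    proof -
      have "norm (e (m * k) (m * k) - e m m) < r / 2" "norm (e (k * m) (k * m) - e k k) < r / 2"
        using small that N[of m] N[of k] by auto
      then have "dist (e m m) (e (m * k) (m * k)) < r / 2" "dist (e k k) (e (m * k) (m * k)) < r / 2"
        by (simp_all add: dist_norm norm_minus_commute mult.commute)
      then show ?thesis by (rule dist_triangle_half_l)
    qed
    then show "\<exists>M. \<forall>m\<ge>M. \<forall>n\<ge>M. dist (e m m) (e n n) < r" by blast
  qed
  then show ?thesis by (simp add: Cauchy_convergent_iff e_def euler_def)
qed

lemma euler_tendsto_flow:
  assumes "0 \<le> T" "continuous_on {0..T} b" "b 0 = 0"
  shows "(\<lambda>m. euler F S T m b z) \<longlonglongrightarrow> flow F S T b z"
  using convergent_euler[OF assms] by (simp add: flow_def convergent_LIMSEQ_iff)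

text \<open>Sampled on the grid, a solution of the integral equation satisfies the Euler recursion
  up to a defect given by its own modulus of continuity, so the chains converge to it. This gives
  uniqueness and turns any solution into a function of the driving path.\<close>

lemma flow_eq_solution:
  assumes T: "0 \<le> T" and b: "continuous_on {0..T} b" and b0: "b 0 = 0"
    and y: "continuous_on {0..T} y"
    and y_eq: "\<And>t. t \<in> {0..T} \<Longrightarrow> y t = y 0 + integral {0..t} (\<lambda>r. F (y r)) + S (b t)"
  shows "flow F S T b (y 0) = y T"
proof -
  have cF: "continuous_on UNIV F"
  proof (rule continuous_onI)
    fix x and r :: real assume "0 < r"
    then show "\<exists>d>0. \<forall>x'\<in>UNIV. dist x' x < d \<longrightarrow> dist (F x') (F x) \<le> r"
      using K_nonneg
    proof (intro exI[of _ "r / (K + 1)"] conjI ballI impI)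
      fix x' assume "dist x' x < r / (K + 1)"
      then have "(K + 1) * norm (x' - x) \<le> r" using K_nonneg by (simp add: dist_norm field_simps)
      then show "dist (F x') (F x) \<le> r" using F_lipschitz[of x' x] norm_ge_zero[of "x' - x"] unfolding dist_norm distrib_right by linarith
    qed simp
  qed
  have cFy: "continuous_on {0..T} (\<lambda>r. F (y r))"
    using continuous_on_compose2[OF cF y] by simp
  have int: "(\<lambda>r. F (y r)) integrable_on {a..c}" if "0 \<le> a" "c \<le> T" for a c
    using continuous_on_subset[OF cFy] that by (intro integrable_continuous_real) auto
  have step: "norm (y T - euler F S T m b (y 0)) \<le> exp (K * T) * (T * (K * \<omega>))"
    if m: "0 < m" and \<omega>0: "0 \<le> \<omega>"
      and \<omega>: "\<And>t t'. t \<in> {0..T} \<Longrightarrow> t' \<in> {0..T} \<Longrightarrow> \<bar>t - t'\<bar> \<le> T / real m \<Longrightarrow> norm (y t - y t') \<le> \<omega>"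
    for m \<omega>
  proof -
    let ?\<tau> = "T / real m"
    have \<tau>: "0 \<le> ?\<tau>" using T by simp
    have "norm (y (real m * ?\<tau>) - euler_chain F S ?\<tau> (increments ?\<tau> b) (y 0) m)
        \<le> exp (K * (real m * ?\<tau>)) * (real m * ?\<tau> * (K * \<omega>))"
    proof (rule euler_chain_stable[where p="\<lambda>k. y (real k * ?\<tau>)"])
      fix k assume k: "k < m"
      let ?t = "real k * ?\<tau>" and ?t' = "real (Suc k) * ?\<tau>"
      have t: "0 \<le> ?t" "?t \<le> ?t'" "?t' = ?t + ?\<tau>" using \<tau> T by (simp_all add: algebra_simps add_divide_distrib)
      have "?t' \<le> real m * ?\<tau>" using k \<tau> by (intro mult_right_mono) simp_all
      then have t'T: "?t' \<le> T" using m by simp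
      have I: "((\<lambda>r. F (y r) - F (y ?t)) has_integral (integral {?t..?t'} (\<lambda>r. F (y r)) - ?\<tau> *\<^sub>R F (y ?t))) {?t..?t'}"
        using has_integral_diff[OF integrable_integral[OF int[of ?t ?t']] has_integral_const_real[of "F (y ?t)" ?t ?t']] t t'T
        by simp
      have "integral {0..?t} (\<lambda>r. F (y r)) + integral {?t..?t'} (\<lambda>r. F (y r)) = integral {0..?t'} (\<lambda>r. F (y r))"
        using t t'T by (intro Henstock_Kurzweil_Integration.integral_combine int) auto
      moreover have "y ?t' = y 0 + integral {0..?t'} (\<lambda>r. F (y r)) + S (b ?t')"
        "y ?t = y 0 + integral {0..?t} (\<lambda>r. F (y r)) + S (b ?t)"
        using t t'T by (intro y_eq; simp)+
      ultimately have "y ?t' - y ?t - ?\<tau> *\<^sub>R F (y ?t) - S (increments ?\<tau> b k) = integral {?t..?t'} (\<lambda>r. F (y r)) - ?\<tau> *\<^sub>R F (y ?t)"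
        by (simp add: increments_def linear_diff[OF S_linear] algebra_simps)
      also have "norm \<dots> \<le> (K * \<omega>) * measure lborel (cbox ?t ?t')"
      proof (rule has_integral_bound[of "K * \<omega>" "\<lambda>r. F (y r) - F (y ?t)" _ ?t ?t'])
        show "((\<lambda>r. F (y r) - F (y ?t)) has_integral (integral {?t..?t'} (\<lambda>r. F (y r)) - ?\<tau> *\<^sub>R F (y ?t))) (cbox ?t ?t')"
          using I by (simp add: cbox_interval)
        fix r assume "r \<in> cbox ?t ?t'"
        then have r: "?t \<le> r" "r \<le> ?t'" by (simp_all add: cbox_interval)
        have "norm (y r - y ?t) \<le> \<omega>" using r t t'T by (intro \<omega>) auto
        then show "norm (F (y r) - F (y ?t)) \<le> K * \<omega>" by (meson F_lipschitz K_nonneg mult_left_mono order_trans)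
      qed (use K_nonneg \<omega>0 in simp)
      also have "measure lborel (cbox ?t ?t') = ?\<tau>" using t by (simp add: cbox_interval)
      finally show "norm (y ?t' - y ?t - ?\<tau> *\<^sub>R F (y ?t) - S (increments ?\<tau> b k)) \<le> ?\<tau> * (K * \<omega>)"
        by (simp add: mult_ac)
    qed (use \<tau> K_nonneg \<omega>0 in simp_all)
    moreover have "real m * ?\<tau> = T" using m by simp
    ultimately show ?thesis by (simp add: euler_def)
  qed
  have "(\<lambda>m. euler F S T m b (y 0)) \<longlonglongrightarrow> y T"
  proof (rule metric_LIMSEQ_I)
    fix r :: real assume r: "0 < r"
    define C where "C = exp (K * T) * (T * K)"
    have C0: "0 \<le> C" using T K_nonneg by (simp add: C_def)
    define \<omega> where "\<omega> = r / (2 * (C + 1))"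
    have \<omega>: "0 < \<omega>" using r C0 by (simp add: \<omega>_def)
    have "uniformly_continuous_on {0..T} y" by (intro compact_uniformly_continuous y) simp
    then obtain d where d: "0 < d" "\<And>t t'. t \<in> {0..T} \<Longrightarrow> t' \<in> {0..T} \<Longrightarrow> dist t' t < d \<Longrightarrow> dist (y t') (y t) < \<omega>"
      using \<omega> unfolding uniformly_continuous_on_def by meson
    have "\<forall>\<^sub>F m in sequentially. T / real m < d"
      using order_tendstoD(2)[OF lim_const_over_n d(1)] .
    then have "\<forall>\<^sub>F m in sequentially. T / real m < d \<and> 0 < m"
      using eventually_gt_at_top[of "0::nat"] by eventually_elim simp
    then obtain N where N: "\<And>m. N \<le> m \<Longrightarrow> T / real m < d \<and> 0 < m"
      by (auto simp: eventually_sequentially)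
    have "dist (euler F S T m b (y 0)) (y T) < r" if "N \<le> m" for m
    proof -
      have "norm (y T - euler F S T m b (y 0)) \<le> exp (K * T) * (T * (K * \<omega>))"
      proof (rule step)
        fix t t' assume "t \<in> {0..T}" "t' \<in> {0..T}" "\<bar>t - t'\<bar> \<le> T / real m"
        then show "norm (y t - y t') \<le> \<omega>" using d(2)[of t' t] N[OF that(1)] by (simp add: dist_norm abs_minus_commute)
      qed (use N[OF that] \<omega> in auto)
      also have "\<dots> = C * \<omega>" by (simp add: C_def)
      also have "\<dots> \<le> (C + 1) * \<omega>" using \<omega> by simp
      also have "\<dots> = r / 2" using C0 by (simp add: \<omega>_def divide_simps)
      finally show ?thesis using r by (simp add: dist_norm norm_minus_commute)
    qed
    then show "\<exists>N. \<forall>m\<ge>N. dist (euler F S T m b (y 0)) (y T) < r" by blast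
  qed
  then show ?thesis using euler_tendsto_flow[OF T b b0] LIMSEQ_unique by blast
qed

end

section \<open>Gaussian increments\<close>

text \<open>An orthogonal map sends balls to balls, so a Vitali covering of an open set by balls gives
  the inequality without determinants, for an arbitrary Euclidean space.\<close>

lemma emeasure_open_le_orthogonal_image:
  fixes Q :: "'a::euclidean_space \<Rightarrow> 'a"
  assumes Q: "orthogonal_transformation Q" and U: "open U"
  shows "emeasure lborel U \<le> emeasure lborel (Q ` U)"
proof -
  define K where "K = {(a, r). 0 < r \<and> cball a r \<subseteq> U}"
  have inj: "inj Q" using Q by (rule orthogonal_transformation_inj)
  have *: "\<exists>i. i \<in> K \<and> x \<in> cball (fst i) (snd i) \<and> snd i < d" if "x \<in> U" "0 < d" for x d
  proof -
    obtain e where e: "0 < e" "cball x e \<subseteq> U" using U \<open>x \<in> U\<close> open_contains_cball by metis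
    then have "cball x (min e (d / 2)) \<subseteq> U" by auto
    then show ?thesis using e \<open>0 < d\<close> by (intro exI[of _ "(x, min e (d / 2))"]) (auto simp: K_def)
  qed
  have pos: "0 < snd i" if "i \<in> K" for i using that by (auto simp: K_def)
  obtain C where C: "countable C" "C \<subseteq> K"
    "pairwise (\<lambda>i j. disjnt (cball (fst i) (snd i)) (cball (fst j) (snd j))) C"
    "negligible (U - (\<Union>i\<in>C. cball (fst i) (snd i)))"
    using Vitali_covering_theorem_cballs[of K snd U fst, OF pos *] by blast
  let ?B = "\<lambda>i. cball (fst i) (snd i)" and ?QB = "\<lambda>i. cball (Q (fst i)) (snd i)"
  have QB: "Q ` ?B i = ?QB i" for i
    by (rule image_orthogonal_transformation_cball[OF Q])
  have disj: "disjoint_family_on ?B C"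
    using C(3) by (auto simp: disjoint_family_on_def pairwise_def disjnt_def)
  have disjQ: "disjoint_family_on ?QB C"
    unfolding disjoint_family_on_def
  proof (intro ballI impI)
    fix i j assume "i \<in> C" "j \<in> C" "i \<noteq> j"
    then have "?B i \<inter> ?B j = {}" using disj by (auto simp: disjoint_family_on_def)
    then show "?QB i \<inter> ?QB j = {}" unfolding QB[symmetric] using inj by (simp add: image_Int[symmetric])
  qed
  have sub: "(\<Union>i\<in>C. ?B i) \<subseteq> U" using C(2) by (force simp: K_def)
  have borel: "U \<in> sets borel" using U by simp
  have UB: "(\<Union>i\<in>C. ?B i) \<in> sets borel" using C(1) by (intro sets.countable_UN') auto
  have "U - (\<Union>i\<in>C. ?B i) \<in> null_sets lborel"
    using C(4) UB borel by (simp add: negligible_iff_null_sets null_sets_completion_iff)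
  then have "emeasure lborel (U - (\<Union>i\<in>C. ?B i)) = 0" by auto
  then have "emeasure lborel U = emeasure lborel (\<Union>i\<in>C. ?B i)"
    using UB borel sub plus_emeasure[of "\<Union>i\<in>C. ?B i" lborel "U - (\<Union>i\<in>C. ?B i)"]
    by (simp add: Un_absorb1)
  also have "\<dots> = (\<integral>\<^sup>+i. emeasure lborel (?B i) \<partial>count_space C)"
    using C(1) disj by (intro emeasure_UN_countable) auto
  \<comment> \<open>The volume of a ball depends on its radius alone, and \<open>Q\<close> keeps the
    radii.\<close>
  also have "\<dots> = (\<integral>\<^sup>+i. emeasure lborel (?QB i) \<partial>count_space C)"
    using C(2) pos by (intro nn_integral_cong) (auto simp: emeasure_cball less_imp_le)
  also have "\<dots> = emeasure lborel (\<Union>i\<in>C. ?QB i)"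
    using C(1) disjQ by (intro emeasure_UN_countable[symmetric]) auto
  also have "\<dots> \<le> emeasure lborel (Q ` U)"
  proof (rule emeasure_mono)
    show "(\<Union>i\<in>C. ?QB i) \<subseteq> Q ` U" unfolding QB[symmetric] using sub by auto
    have "open (Q ` U)"
      using U Q inj by (metis linear_injective_imp_surjective open_surjective_linear_image orthogonal_transformation_linear)
    then show "Q ` U \<in> sets lborel" by simp
  qed
  finally show ?thesis .
qed

text \<open>The inequality for \<open>Q\<close> and for its inverse gives equality of volumes on
  open sets; boxes then determine Lebesgue measure.\<close>

lemma distr_lborel_orthogonal:
  fixes Q :: "'a::euclidean_space \<Rightarrow> 'a"
  assumes Q: "orthogonal_transformation Q"
  shows "distr lborel borel Q = lborel"
proof -
  have lin: "linear Q" using Q by (rule orthogonal_transformation_linear)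
  have bij: "bij Q" using Q by (rule orthogonal_transformation_bij)
  let ?P = "inv Q"
  have P: "orthogonal_transformation ?P" using Q by (rule orthogonal_transformation_inv)
  have meas: "Q \<in> borel_measurable borel"
    using lin by (intro borel_measurable_continuous_onI linear_continuous_on linear_conv_bounded_linear[THEN iffD1])
  have "emeasure lborel (?P ` U) = emeasure lborel U" if U: "open U" for U
  proof (rule antisym)
    have "open (?P ` U)"
      using U P by (metis linear_injective_imp_surjective open_surjective_linear_image orthogonal_transformation_inj orthogonal_transformation_linear)
    from emeasure_open_le_orthogonal_image[OF Q this]
    show "emeasure lborel (?P ` U) \<le> emeasure lborel U"
      using bij by (simp add: image_image surj_f_inv_f bij_is_surj)
  qed (rule emeasure_open_le_orthogonal_image[OF P U])
  from this[OF open_box] have "emeasure (distr lborel borel Q) (box l u) = emeasure lborel (box l u)" for l u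
    using meas bij by (simp add: emeasure_distr bij_vimage_eq_inv_image)
  then show ?thesis
    by (intro lborel_eqI[symmetric]) (simp_all add: emeasure_lborel_box)
qed

section \<open>Centred isotropic Gaussian measures and their moments\<close>

definition gauss :: "real \<Rightarrow> (real^'d) measure" where
  "gauss \<tau> = density lborel (\<lambda>x. ennreal ((2 * pi * \<tau>) powr (- real CARD('d) / 2) * exp (- (norm x)\<^sup>2 / (2 * \<tau>))))"

lemma sets_gauss [simp, measurable_cong]: "sets (gauss \<tau>) = sets borel"
  and space_gauss [simp]: "space (gauss \<tau>) = UNIV"
  by (simp_all add: gauss_def)

lemma distr_gauss_orthogonal:
  fixes Q :: "real^'d \<Rightarrow> real^'d"
  assumes Q: "orthogonal_transformation Q"
  shows "distr (gauss \<tau>) borel Q = gauss \<tau>"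
proof -
  have meas: "Q \<in> borel_measurable borel"
    using Q by (intro borel_measurable_continuous_onI linear_continuous_on linear_conv_bounded_linear[THEN iffD1] orthogonal_transformation_linear)
  let ?g = "\<lambda>x::real^'d. ennreal ((2 * pi * \<tau>) powr (- real CARD('d) / 2) * exp (- (norm x)\<^sup>2 / (2 * \<tau>)))"
  have "gauss \<tau> = density (distr lborel borel Q) ?g"
    by (simp add: gauss_def distr_lborel_orthogonal[OF Q])
  also have "\<dots> = distr (density lborel (\<lambda>x. ?g (Q x))) borel Q"
    using meas by (intro density_distr) simp_all
  also have "(\<lambda>x. ?g (Q x)) = ?g" using Q by (simp add: orthogonal_transformation_norm)
  finally show ?thesis by (simp add: gauss_def)
qed

lemma gauss_density_eq_prod:
  fixes x :: "real^'d"
  assumes "0 < \<tau>"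
  shows "(2 * pi * \<tau>) powr (- real CARD('d) / 2) * exp (- (norm x)\<^sup>2 / (2 * \<tau>))
     = (\<Prod>b\<in>Basis. normal_density 0 (sqrt \<tau>) (x \<bullet> b))"
proof -
  have "(\<Prod>b\<in>Basis. normal_density 0 (sqrt \<tau>) (x \<bullet> b))
      = (1 / sqrt (2 * pi * \<tau>)) ^ CARD('d) * exp (\<Sum>b\<in>Basis. - (x \<bullet> b)\<^sup>2 / (2 * \<tau>))"
    using assms by (simp add: normal_density_def prod_dividef exp_sum prod.distrib power_one_over)
  also have "(\<Sum>b\<in>Basis. - (x \<bullet> b)\<^sup>2 / (2 * \<tau>)) = - (norm x)\<^sup>2 / (2 * \<tau>)"
    by (simp add: sum_divide_distrib[symmetric] sum_negf norm_eq_sqrt_inner euclidean_inner[of x x] power2_eq_square sum_nonneg)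
  also have "(1 / sqrt (2 * pi * \<tau>)) ^ CARD('d) = (2 * pi * \<tau>) powr (- real CARD('d) / 2)"
    using assms by (simp add: powr_minus powr_half_sqrt[symmetric] powr_powr powr_realpow[symmetric] power_divide divide_simps powr_add[symmetric] mult.commute)
  finally show ?thesis by simp
qed

text \<open>The density is a product over the coordinates, so all factors except the one of
  \<open>j\<close> integrate to 1.\<close>

lemma nn_integral_gauss_coordinate:
  fixes j :: "real^'d"
  assumes \<tau>: "0 < \<tau>" and j: "j \<in> Basis" and h: "h \<in> borel_measurable borel"
  shows "(\<integral>\<^sup>+x. h (x \<bullet> j) \<partial>gauss \<tau>) = (\<integral>\<^sup>+y. h y * ennreal (normal_density 0 (sqrt \<tau>) y) \<partial>lborel)"
proof -
  let ?n = "\<lambda>y. ennreal (normal_density 0 (sqrt \<tau>) y)"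
  have n1: "(\<integral>\<^sup>+y. ?n y \<partial>lborel) = 1"
    using \<tau> by (subst nn_integral_eq_integral) (simp_all add: integral_normal_density)
  let ?f = "\<lambda>b y. if b = j then h y * ?n y else ?n y"
  have h': "(\<lambda>x. h (x \<bullet> j)) \<in> borel_measurable borel" using h by measurable
  have "(\<integral>\<^sup>+x. h (x \<bullet> j) \<partial>gauss \<tau>) = (\<integral>\<^sup>+x. (\<Prod>b\<in>Basis. ?n (x \<bullet> b)) * h (x \<bullet> j) \<partial>lborel)"
    using \<tau> h' unfolding gauss_def
    by (subst nn_integral_density) (simp_all only: gauss_density_eq_prod prod_ennreal normal_density_nonneg, simp_all)
  also have "\<dots> = (\<integral>\<^sup>+x. (\<Prod>b\<in>Basis. ?f b (x \<bullet> b)) \<partial>lborel)"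
  proof (rule nn_integral_cong)
    fix x :: "real^'d"
    have "(\<Prod>b\<in>Basis. ?f b (x \<bullet> b)) = h (x \<bullet> j) * ?n (x \<bullet> j) * (\<Prod>b\<in>Basis - {j}. ?n (x \<bullet> b))"
      using j by (subst prod.remove[of _ j]) (auto intro!: arg_cong2[where f="(*)"] prod.cong)
    also have "\<dots> = (\<Prod>b\<in>Basis. ?n (x \<bullet> b)) * h (x \<bullet> j)"
      using j by (subst (2) prod.remove[of _ j]) (simp_all add: mult_ac)
    finally show "(\<Prod>b\<in>Basis. ?n (x \<bullet> b)) * h (x \<bullet> j) = (\<Prod>b\<in>Basis. ?f b (x \<bullet> b))" by simp
  qed
  also have "\<dots> = (\<Prod>b\<in>Basis. \<integral>\<^sup>+y. ?f b y \<partial>lborel)"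
    using h by (intro nn_integral_lborel_prod) auto
  also have "\<dots> = (\<integral>\<^sup>+y. h y * ?n y \<partial>lborel)"
    using j n1 by (subst prod.remove[of _ j]) (auto intro!: prod.neutral)
  finally show ?thesis .
qed

lemma prob_space_gauss: "0 < \<tau> \<Longrightarrow> prob_space (gauss \<tau> :: (real^'d) measure)"
proof
  assume \<tau>: "0 < \<tau>"
  obtain j :: "real^'d" where j: "j \<in> Basis" using nonempty_Basis by blast
  have "emeasure (gauss \<tau> :: (real^'d) measure) (space (gauss \<tau>)) = (\<integral>\<^sup>+x. (\<lambda>_. 1) (x \<bullet> j) \<partial>gauss \<tau>)"
    by (simp del: space_gauss)
  also have "\<dots> = (\<integral>\<^sup>+y. ennreal (normal_density 0 (sqrt \<tau>) y) \<partial>lborel)"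
    using \<tau> j by (subst nn_integral_gauss_coordinate) simp_all
  also have "\<dots> = 1" using \<tau> by (subst nn_integral_eq_integral) simp_all
  finally show "emeasure (gauss \<tau> :: (real^'d) measure) (space (gauss \<tau>)) = 1" .
qed

text \<open>The even moments of a standard normal variable, equal to the product of the odd numbers
  below 2k.\<close>

definition gauss_moment :: "nat \<Rightarrow> real" where
  "gauss_moment k = fact (2 * k) / (2 ^ k * fact k)"

lemma gauss_coordinate_moment:
  fixes j :: "real^'d"
  assumes \<tau>: "0 < \<tau>" and j: "j \<in> Basis"
  shows "(\<integral>\<^sup>+x. ennreal ((x \<bullet> j) ^ (2 * k)) \<partial>gauss \<tau>) = ennreal (gauss_moment k * \<tau> ^ k)"
proof -
  have "(\<integral>\<^sup>+x. ennreal ((x \<bullet> j) ^ (2 * k)) \<partial>gauss \<tau>)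
      = (\<integral>\<^sup>+y. ennreal (y ^ (2 * k)) * ennreal (normal_density 0 (sqrt \<tau>) y) \<partial>lborel)"
    using \<tau> j by (rule nn_integral_gauss_coordinate) simp
  also have "\<dots> = (\<integral>\<^sup>+y. ennreal (normal_density 0 (sqrt \<tau>) y * (y - 0) ^ (2 * k)) \<partial>lborel)"
    by (simp add: ennreal_mult'[symmetric] mult.commute)
  also have "\<dots> = ennreal (fact (2 * k) / ((2 / (sqrt \<tau>)\<^sup>2) ^ k * fact k))"
    using \<tau> normal_moment_even[of "sqrt \<tau>" 0 k]
    by (subst nn_integral_eq_integral) (auto simp: has_bochner_integral_iff)
  also have "fact (2 * k) / ((2 / (sqrt \<tau>)\<^sup>2) ^ k * fact k) = gauss_moment k * \<tau> ^ k"
    using \<tau> by (simp add: gauss_moment_def power_divide)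
  finally show ?thesis .
qed

text \<open>Some coordinate carries at least the share \<open>1 / CARD('d)\<close> of the squared
  norm. This costs the k-th power of the dimension; the sum over all coordinates, which replaces the
  unknown one, costs one more factor.\<close>

lemma gauss_norm_moment:
  assumes \<tau>: "0 < \<tau>"
  shows "(\<integral>\<^sup>+x. ennreal (norm (x::real^'d) ^ (2 * k)) \<partial>gauss \<tau>)
     \<le> ennreal (real CARD('d) ^ Suc k * gauss_moment k * \<tau> ^ k)"
proof -
  have le: "norm x ^ (2 * k) \<le> real CARD('d) ^ k * (\<Sum>j\<in>Basis. (x \<bullet> j) ^ (2 * k))" for x :: "real^'d"
  proof -
    have "\<exists>j\<in>Basis. (norm x)\<^sup>2 \<le> real CARD('d) * (x \<bullet> j)\<^sup>2"
    proof (rule ccontr)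
      assume "\<not> ?thesis"
      then have "(\<Sum>j\<in>(Basis :: (real^'d) set). real CARD('d) * (x \<bullet> j)\<^sup>2) < (\<Sum>j\<in>(Basis :: (real^'d) set). (norm x)\<^sup>2)"
        by (intro sum_strict_mono) auto
      moreover have "(norm x)\<^sup>2 = (\<Sum>j\<in>Basis. (x \<bullet> j)\<^sup>2)"
        by (simp only: power2_norm_eq_inner) (simp only: euclidean_inner[of x x] power2_eq_square)
      ultimately show False by (simp add: sum_distrib_left[symmetric])
    qed
    then obtain j :: "real^'d" where j: "j \<in> Basis" "(norm x)\<^sup>2 \<le> real CARD('d) * (x \<bullet> j)\<^sup>2" by blast
    have "norm x ^ (2 * k) = ((norm x)\<^sup>2) ^ k" by (simp add: power_mult)
    also have "\<dots> \<le> (real CARD('d) * (x \<bullet> j)\<^sup>2) ^ k" using j by (intro power_mono) simp_all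
    also have "\<dots> = real CARD('d) ^ k * (x \<bullet> j) ^ (2 * k)" by (simp add: power_mult_distrib power_mult)
    also have "(x \<bullet> j) ^ (2 * k) \<le> (\<Sum>j\<in>Basis. (x \<bullet> j) ^ (2 * k))"
      using j(1) by (intro member_le_sum) (simp_all add: power_mult)
    finally show ?thesis by (simp add: mult_left_mono)
  qed
  have "(\<integral>\<^sup>+x. ennreal (norm (x::real^'d) ^ (2 * k)) \<partial>gauss \<tau>)
      \<le> (\<integral>\<^sup>+x. ennreal (real CARD('d) ^ k) * (\<Sum>j\<in>(Basis::(real^'d) set). ennreal ((x \<bullet> j) ^ (2 * k))) \<partial>gauss \<tau>)"
    using le by (intro nn_integral_mono) (simp add: sum_ennreal power_mult ennreal_mult'[symmetric] sum_nonneg)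
  also have "\<dots> = ennreal (real CARD('d) ^ k) * (\<Sum>j\<in>(Basis :: (real^'d) set). ennreal (gauss_moment k * \<tau> ^ k))"
    using \<tau> by (subst nn_integral_cmult)
      (auto simp: nn_integral_sum gauss_coordinate_moment simp del: sum_ennreal sum_constant)
  also have "\<dots> = ennreal (real CARD('d) ^ Suc k * gauss_moment k * \<tau> ^ k)"
    using \<tau> by (simp add: ennreal_mult'[symmetric] ennreal_of_nat_eq_real_of_nat gauss_moment_def mult_ac)
  finally show ?thesis .
qed

text \<open>Even powers come from \<open>gauss_norm_moment\<close>, and they dominate the others by
  \<open>2 * t ^ k \<le> 1 + t ^ (2 * k)\<close>.\<close>

lemma integrable_gauss_norm_power:
  assumes \<tau>: "0 < \<tau>"
  shows "integrable (gauss \<tau>) (\<lambda>x::real^'d. norm x ^ k)"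
proof -
  interpret prob_space "gauss \<tau> :: (real^'d) measure" using \<tau> by (rule prob_space_gauss)
  have "integrable (gauss \<tau>) (\<lambda>x::real^'d. norm x ^ (2 * k))"
  proof (rule integrableI_bounded)
    show "(\<integral>\<^sup>+x. ennreal (norm (norm (x::real^'d) ^ (2 * k))) \<partial>gauss \<tau>) < \<infinity>"
      using gauss_norm_moment[OF \<tau>, of k, where 'd='d] by (simp add: less_top order_le_less_trans)
  qed simp
  then have "integrable (gauss \<tau>) (\<lambda>x::real^'d. 1 + norm x ^ (2 * k))" by simp
  then show ?thesis
  proof (rule Bochner_Integration.integrable_bound)
    show "AE x in gauss \<tau>. norm (norm (x::real^'d) ^ k) \<le> norm (1 + norm x ^ (2 * k))"
    proof (rule AE_I2)
      fix x :: "real^'d"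
      have "0 \<le> (norm x ^ k - 1)\<^sup>2" by simp
      then have "2 * norm x ^ k \<le> 1 + norm x ^ (2 * k)"
        by (simp add: power2_diff power_even_eq)
      moreover have "0 \<le> norm x ^ k" by simp
      ultimately show "norm (norm x ^ k) \<le> norm (1 + norm x ^ (2 * k))"
        unfolding real_norm_def by (simp del: zero_le_power) linarith?
    qed
  qed simp
qed


lemma orthogonal_transformation_reflection:
  fixes e :: "'a::euclidean_space"
  assumes "norm e = 1"
  shows "orthogonal_transformation (\<lambda>x. x - (2 * (e \<bullet> x)) *\<^sub>R e)"
proof -
  have e: "e \<bullet> e = 1" using assms by (simp add: norm_eq_1)
  have "linear (\<lambda>x. x - (2 * (e \<bullet> x)) *\<^sub>R e)"
    by (intro linearI) (simp_all add: algebra_simps inner_add_right)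
  then show ?thesis
    by (simp add: orthogonal_transformation_def inner_diff_left inner_diff_right e inner_commute algebra_simps)
qed

section \<open>First and second Gaussian moments by symmetry\<close>

context
  fixes \<tau> :: real
  assumes \<tau>: "0 < \<tau>"
begin

lemma integrable_gauss_bound:
  fixes h :: "real^'d \<Rightarrow> real"
  assumes "h \<in> borel_measurable borel" and "\<And>x. \<bar>h x\<bar> \<le> C * norm x ^ k"
  shows "integrable (gauss \<tau>) h"
proof (rule Bochner_Integration.integrable_bound)
  show "integrable (gauss \<tau>) (\<lambda>x::real^'d. C * norm x ^ k)"
    using \<tau> by (intro integrable_mult_right integrable_gauss_norm_power)
  show "AE x in gauss \<tau>. norm (h x) \<le> norm (C * norm x ^ k)"
    using assms(2) by (intro AE_I2) (smt (verit) real_norm_def)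
qed (use assms in simp)

lemma integrable_gauss_inner: "integrable (gauss \<tau>) (\<lambda>x::real^'d. a \<bullet> x)"
  by (rule integrable_gauss_bound[of _ "norm a" 1]) (simp_all add: Cauchy_Schwarz_ineq2)

lemma integrable_gauss_inner_inner: "integrable (gauss \<tau>) (\<lambda>x::real^'d. (a \<bullet> x) * (b \<bullet> x))"
proof (rule integrable_gauss_bound[of _ "norm a * norm b" 2])
  fix x :: "real^'d"
  have "\<bar>a \<bullet> x\<bar> * \<bar>b \<bullet> x\<bar> \<le> (norm a * norm x) * (norm b * norm x)"
    by (intro mult_mono Cauchy_Schwarz_ineq2) simp_all
  then show "\<bar>(a \<bullet> x) * (b \<bullet> x)\<bar> \<le> norm a * norm b * norm x ^ 2"
    by (simp add: abs_mult power2_eq_square mult_ac)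
qed simp

lemma integral_gauss_orthogonal:
  fixes h :: "real^'d \<Rightarrow> real" and Q :: "real^'d \<Rightarrow> real^'d"
  assumes "orthogonal_transformation Q" "h \<in> borel_measurable borel"
  shows "(\<integral>x. h (Q x) \<partial>gauss \<tau>) = (\<integral>x. h x \<partial>gauss \<tau>)"
proof -
  have "Q \<in> borel_measurable borel"
    using assms(1) by (intro borel_measurable_continuous_onI linear_continuous_on linear_conv_bounded_linear[THEN iffD1] orthogonal_transformation_linear)
  then have "(\<integral>x. h x \<partial>distr (gauss \<tau>) borel Q) = (\<integral>x. h (Q x) \<partial>gauss \<tau>)"
    using assms(2) by (intro integral_distr) simp_all
  then show ?thesis using distr_gauss_orthogonal[OF assms(1), of \<tau>] by simp
qed

lemma integral_gauss_inner: "(\<integral>x. a \<bullet> x \<partial>(gauss \<tau> :: (real^'d) measure)) = 0"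
proof -
  have "orthogonal_transformation (uminus :: real^'d \<Rightarrow> real^'d)"
    by (simp add: orthogonal_transformation_def linear_uminus)
  from integral_gauss_orthogonal[OF this, of "\<lambda>x. a \<bullet> x"] show ?thesis by simp
qed

lemma integral_gauss_basis:
  fixes i j :: "real^'d"
  assumes i: "i \<in> Basis" and j: "j \<in> Basis"
  shows "(\<integral>x. (i \<bullet> x) * (j \<bullet> x) \<partial>gauss \<tau>) = (if i = j then \<tau> else 0)"
proof (cases "i = j")
  case True
  have "(\<integral>\<^sup>+x. ennreal ((x \<bullet> j) ^ (2 * 1)) \<partial>gauss \<tau>) = ennreal (gauss_moment 1 * \<tau> ^ 1)"
    using \<tau> j by (rule gauss_coordinate_moment)
  then have "(\<integral>\<^sup>+x. ennreal ((i \<bullet> x) * (j \<bullet> x)) \<partial>gauss \<tau>) = ennreal \<tau>"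
    using True by (simp add: gauss_moment_def power2_eq_square inner_commute)
  then show ?thesis
    using True \<tau> by (subst integral_eq_nn_integral) simp_all
next
  case False
  \<comment> \<open>The reflection along \<open>i\<close> preserves the Gaussian law and changes the
    sign of the product, so the integral equals its own negative.\<close>
  let ?Q = "\<lambda>x. x - (2 * (i \<bullet> x)) *\<^sub>R i"
  have "orthogonal_transformation ?Q" using i by (intro orthogonal_transformation_reflection) simp
  from integral_gauss_orthogonal[OF this, of "\<lambda>x. (i \<bullet> x) * (j \<bullet> x)"]
  have "(\<integral>x. (i \<bullet> ?Q x) * (j \<bullet> ?Q x) \<partial>gauss \<tau>) = (\<integral>x. (i \<bullet> x) * (j \<bullet> x) \<partial>gauss \<tau>)" by simp
  moreover have "(i \<bullet> ?Q x) * (j \<bullet> ?Q x) = - ((i \<bullet> x) * (j \<bullet> x))" for x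
    using False i j by (simp add: inner_diff_right inner_Basis)
  ultimately show ?thesis using False by simp
qed

lemma integral_gauss_inner_inner:
  fixes a b :: "real^'d"
  shows "(\<integral>x. (a \<bullet> x) * (b \<bullet> x) \<partial>gauss \<tau>) = \<tau> * (a \<bullet> b)"
proof -
  have "(a \<bullet> x) * (b \<bullet> x) = (\<Sum>i\<in>Basis. \<Sum>j\<in>Basis. (a \<bullet> i) * (b \<bullet> j) * ((i \<bullet> x) * (j \<bullet> x)))" for x
  proof -
    have "(a \<bullet> x) * (b \<bullet> x) = (\<Sum>i\<in>Basis. (a \<bullet> i) * (x \<bullet> i)) * (\<Sum>j\<in>Basis. (b \<bullet> j) * (x \<bullet> j))"
      by (simp only: euclidean_inner[of a x] euclidean_inner[of b x])
    then show ?thesis by (simp add: sum_product inner_commute mult_ac)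
  qed
  then have "(\<integral>x. (a \<bullet> x) * (b \<bullet> x) \<partial>gauss \<tau>)
      = (\<Sum>i\<in>Basis. \<Sum>j\<in>Basis. (a \<bullet> i) * (b \<bullet> j) * (\<integral>x. (i \<bullet> x) * (j \<bullet> x) \<partial>gauss \<tau>))"
    by (simp add: integrable_gauss_inner_inner)
  also have "\<dots> = (\<Sum>i\<in>Basis. (a \<bullet> i) * (b \<bullet> i) * \<tau>)"
    by (simp add: integral_gauss_basis if_distrib cong: if_cong)
  also have "\<dots> = \<tau> * (a \<bullet> b)" by (simp add: euclidean_inner[of a b] sum_distrib_left mult_ac)
  finally show ?thesis .
qed

lemma integral_gauss_norm_squared: "(\<integral>x. (norm x)\<^sup>2 \<partial>(gauss \<tau> :: (real^'d) measure)) = \<tau> * real CARD('d)"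
proof -
  have "(norm x)\<^sup>2 = (\<Sum>i\<in>Basis. (i \<bullet> x) * (i \<bullet> x))" for x :: "real^'d"
    by (simp add: power2_norm_eq_inner euclidean_inner[of x x] inner_commute)
  then show ?thesis by (simp add: integrable_gauss_inner_inner integral_gauss_basis)
qed

end

lemma euler_chain_measurable:
  fixes F :: "'e::euclidean_space \<Rightarrow> 'e"
  assumes [measurable]: "F \<in> borel_measurable borel" "S \<in> borel_measurable borel" "Z \<in> borel_measurable M"
    and X: "\<And>i. i < k \<Longrightarrow> X i \<in> borel_measurable M"
  shows "(\<lambda>\<omega>. euler_chain F S \<tau> (\<lambda>i. X i \<omega>) (Z \<omega>) k) \<in> borel_measurable M"
  using X
proof (induction k)
  case (Suc k)
  then have [measurable]: "(\<lambda>\<omega>. euler_chain F S \<tau> (\<lambda>i. X i \<omega>) (Z \<omega>) k) \<in> borel_measurable M" "X k \<in> borel_measurable M"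
    by simp_all
  show ?case by simp
qed simp

text \<open>The transition operator of one Euler step with Gaussian noise. It mentions no Brownian
  motion and therefore serves to compare flows driven by different ones.\<close>

definition euler_op :: "('e::euclidean_space \<Rightarrow> 'e) \<Rightarrow> (real^'d \<Rightarrow> 'e) \<Rightarrow> real \<Rightarrow> ('e \<Rightarrow> ennreal) \<Rightarrow> 'e \<Rightarrow> ennreal" where
  "euler_op F S \<tau> h z = (\<integral>\<^sup>+x. h (z + \<tau> *\<^sub>R F z + S x) \<partial>gauss \<tau>)"

lemma euler_op_measurable:
  assumes \<tau>: "0 < \<tau>" and [measurable]: "F \<in> borel_measurable borel" "S \<in> borel_measurable borel" "h \<in> borel_measurable borel"
  shows "euler_op F S \<tau> h \<in> borel_measurable borel"
proof -
  interpret prob_space "gauss \<tau> :: (real^'d) measure" using \<tau> by (rule prob_space_gauss)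
  have "(\<lambda>p. h (fst p + \<tau> *\<^sub>R F (fst p) + S (snd p))) \<in> borel_measurable (borel \<Otimes>\<^sub>M borel)"
    by measurable
  then have "(\<lambda>(z, x). h (z + \<tau> *\<^sub>R F z + S x)) \<in> borel_measurable (borel \<Otimes>\<^sub>M gauss \<tau>)"
    by (simp add: case_prod_beta' cong: measurable_cong_sets)
  then show ?thesis unfolding euler_op_def[abs_def] by (rule borel_measurable_nn_integral)
qed

text \<open>The last increment is integrated first; with the others fixed, it acts on the chain
  exactly as \<open>euler_op\<close>.\<close>

lemma nn_integral_PiM_euler_chain:
  fixes S :: "real^'d \<Rightarrow> 'e::euclidean_space"
  assumes \<tau>: "0 < \<tau>" and [measurable]: "F \<in> borel_measurable borel" "S \<in> borel_measurable borel"
    and h: "h \<in> borel_measurable borel"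
  shows "(\<integral>\<^sup>+\<xi>. h (euler_chain F S \<tau> \<xi> z k) \<partial>PiM {..<k} (\<lambda>_. gauss \<tau>)) = (euler_op F S \<tau> ^^ k) h z"
  using h
proof (induction k arbitrary: h)
  case 0
  show ?case by (simp add: PiM_empty nn_integral_count_space_finite)
next
  case (Suc k)
  note [measurable] = Suc.prems
  interpret prob_space "gauss \<tau> :: (real^'d) measure" using \<tau> by (rule prob_space_gauss)
  interpret product_sigma_finite "\<lambda>_::nat. gauss \<tau> :: (real^'d) measure" ..
  have [measurable]: "(\<lambda>\<xi>. euler_chain F S \<tau> \<xi> z (Suc k)) \<in> borel_measurable (PiM {..<Suc k} (\<lambda>_. gauss \<tau>))"
    by (rule euler_chain_measurable) simp_all
  have "(\<integral>\<^sup>+\<xi>. h (euler_chain F S \<tau> \<xi> z (Suc k)) \<partial>PiM {..<Suc k} (\<lambda>_. gauss \<tau>))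
      = (\<integral>\<^sup>+\<xi>. \<integral>\<^sup>+x. h (euler_chain F S \<tau> (\<xi>(k := x)) z (Suc k)) \<partial>gauss \<tau> \<partial>PiM {..<k} (\<lambda>_. gauss \<tau>))"
    unfolding lessThan_Suc
    by (subst product_nn_integral_insert) (simp_all add: lessThan_Suc[symmetric] del: euler_chain.simps)
  also have "\<dots> = (\<integral>\<^sup>+\<xi>. euler_op F S \<tau> h (euler_chain F S \<tau> \<xi> z k) \<partial>PiM {..<k} (\<lambda>_. gauss \<tau>))"
  proof (intro nn_integral_cong)
    fix \<xi>
    have "euler_chain F S \<tau> (\<xi>(k := x)) z k = euler_chain F S \<tau> \<xi> z k" for x
      by (rule euler_chain_cong) simp
    then show "(\<integral>\<^sup>+x. h (euler_chain F S \<tau> (\<xi>(k := x)) z (Suc k)) \<partial>gauss \<tau>) = euler_op F S \<tau> h (euler_chain F S \<tau> \<xi> z k)"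
      by (simp add: euler_op_def)
  qed
  also have "\<dots> = (euler_op F S \<tau> ^^ k) (euler_op F S \<tau> h) z"
    using \<tau> by (intro Suc.IH euler_op_measurable) simp_all
  finally show ?case by (simp add: funpow_swap1)
qed

text \<open>Rotation invariance of one Gaussian increment; iterated and passed to the limit, it
  shows that the reflected copy has the right law.\<close>

lemma euler_op_orthogonal:
  fixes S :: "real^'d \<Rightarrow> 'e::euclidean_space" and Q :: "real^'d \<Rightarrow> real^'d"
  assumes Q: "orthogonal_transformation Q" and [measurable]: "S \<in> borel_measurable borel" "h \<in> borel_measurable borel"
  shows "euler_op F (\<lambda>x. S (Q x)) \<tau> h = euler_op F S \<tau> h"
proof
  fix z
  have [measurable]: "Q \<in> borel_measurable borel"
    using Q by (intro borel_measurable_continuous_onI linear_continuous_on linear_conv_bounded_linear[THEN iffD1] orthogonal_transformation_linear)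
  have "euler_op F S \<tau> h z = (\<integral>\<^sup>+x. h (z + \<tau> *\<^sub>R F z + S x) \<partial>distr (gauss \<tau>) borel Q)"
    by (simp add: euler_op_def distr_gauss_orthogonal[OF Q])
  also have "\<dots> = euler_op F (\<lambda>x. S (Q x)) \<tau> h z"
    unfolding euler_op_def by (subst nn_integral_distr) simp_all
  finally show "euler_op F (\<lambda>x. S (Q x)) \<tau> h z = euler_op F S \<tau> h z" by simp
qed

section \<open>The concave profile\<close>

text \<open>Differentiability is asked only inside the interval: the formulas for the derivatives
  below hold for positive arguments, while 0 is a possible end point.\<close>

lemma mean_value_bound:
  fixes D D' :: "real \<Rightarrow> real"
  assumes ab: "a \<le> b" and cont: "continuous_on {a..b} D"
    and deriv: "\<And>x. a < x \<Longrightarrow> x < b \<Longrightarrow> (D has_real_derivative D' x) (at x)"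
    and bound: "\<And>x. a < x \<Longrightarrow> x < b \<Longrightarrow> \<bar>D' x\<bar> \<le> B"
  shows "\<bar>D b - D a\<bar> \<le> B * (b - a)"
proof (cases "a = b")
  case False
  then have "a < b" using ab by simp
  then obtain l z where z: "a < z" "z < b" "(D has_real_derivative l) (at z)" "D b - D a = (b - a) * l"
    using MVT[OF _ cont] deriv by (metis real_differentiable_def)
  have "l = D' z" using z deriv DERIV_unique by blast
  then show ?thesis using z bound[of z] \<open>a < b\<close> mult_left_mono[of "\<bar>l\<bar>" B "b - a"]
    by (simp add: abs_mult mult.commute)
qed simp

lemma has_real_derivative_integral:
  fixes h :: "real \<Rightarrow> real"
  assumes "continuous_on {a..b} h" "a < x" "x < b"
  shows "((\<lambda>y. integral {a..y} h) has_real_derivative h x) (at x)"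
  using integral_has_real_derivative[OF assms(1), of x] assms(2,3) at_within_Icc_at[of a x b] by simp

text \<open>The analysis of f is separated from the origin of the constants: later \<open>k\<close>
  becomes \<open>9 / 4 * c * \<gamma> / u\<close>. The condition \<open>g_R\<close> keeps the
  derivative of f between \<phi> / 2 and \<phi> up to \<open>R\<close>.\<close>

locale concave_profile =
  fixes \<kappa> k R :: real and \<phi> \<Phi> g f :: "real \<Rightarrow> real"
  assumes kappa: "0 \<le> \<kappa>" and k: "0 \<le> k" and R: "0 < R"
    and \<phi>_eq: "\<And>s. \<phi> s = exp (- \<kappa> * s\<^sup>2 / 2)"
    and \<Phi>_eq: "\<And>s. \<Phi> s = integral {0..s} \<phi>"
    and g_eq: "\<And>r. g r = 1 - k * integral {0..r} (\<lambda>s. \<Phi> s / \<phi> s)"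
    and f_eq: "\<And>r. f r = integral {0..min r R} (\<lambda>s. \<phi> s * g s)"
    and g_R: "1 / 2 \<le> g R"
begin

text \<open>\<psi> is the derivative of f below \<open>R\<close>, and \<psi>' that of \<psi>. The
  closed form follows from \<phi>' = -\<kappa> s \<phi> and \<phi> g' = -k \<Phi>; its first term
  will absorb drifts proportional to the distance, the second yields the decay.\<close>

definition "\<psi> s = \<phi> s * g s"
definition "\<psi>' s = - \<kappa> * s * \<psi> s - k * \<Phi> s"

lemma \<phi>_pos: "0 < \<phi> s" and \<phi>_le_1: "\<phi> s \<le> 1"
  using kappa by (simp_all add: \<phi>_eq)

lemma continuous_\<phi>: "continuous_on S \<phi>"
  unfolding \<phi>_eq by (intro continuous_intros) simp

lemma continuous_\<Phi>: "continuous_on {0..b} \<Phi>"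
  unfolding \<Phi>_eq by (intro indefinite_integral_continuous_1 integrable_continuous_interval continuous_\<phi>)

lemma continuous_ratio: "continuous_on {0..b} (\<lambda>s. \<Phi> s / \<phi> s)"
  using \<phi>_pos by (intro continuous_intros continuous_\<Phi> continuous_\<phi>) (auto simp: less_imp_neq[symmetric])

lemma continuous_g: "continuous_on {0..b} g"
  unfolding g_eq
  by (intro continuous_intros indefinite_integral_continuous_1 integrable_continuous_interval continuous_ratio)

lemma continuous_\<psi>: "continuous_on {0..b} \<psi>"
  unfolding \<psi>_def by (intro continuous_intros continuous_\<phi> continuous_g)

lemma \<Phi>_bounds:
  assumes "0 \<le> s"
  shows "0 \<le> \<Phi> s" "\<Phi> s \<le> s"
proof -
  have int: "\<phi> integrable_on {0..s}" by (intro integrable_continuous_interval continuous_\<phi>)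
  show "0 \<le> \<Phi> s" unfolding \<Phi>_eq using int \<phi>_pos by (intro integral_nonneg) (auto simp: less_imp_le)
  have "\<Phi> s \<le> integral {0..s} (\<lambda>_. 1)" unfolding \<Phi>_eq using int \<phi>_le_1 by (intro integral_le) auto
  then show "\<Phi> s \<le> s" using assms by simp
qed

lemma g_antimono:
  assumes "0 \<le> a" "a \<le> b"
  shows "g b \<le> g a"
proof -
  have "integral {0..a} (\<lambda>s. \<Phi> s / \<phi> s) \<le> integral {0..b} (\<lambda>s. \<Phi> s / \<phi> s)"
    using assms \<Phi>_bounds \<phi>_pos
    by (intro integral_subset_le integrable_continuous_interval continuous_ratio) (auto intro!: divide_nonneg_pos)
  then show ?thesis using k by (simp add: g_eq mult_left_mono)
qed

lemma g_bounds:
  assumes "0 \<le> s" "s \<le> R"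
  shows "1 / 2 \<le> g s" "g s \<le> 1"
  using g_antimono[of s R] g_antimono[of 0 s] g_R assms by (auto simp: g_eq[of 0])

lemma \<psi>_bounds:
  assumes "0 \<le> s" "s \<le> R"
  shows "\<phi> s / 2 \<le> \<psi> s" "\<psi> s \<le> \<phi> s" "0 < \<psi> s" "\<psi> s \<le> 1"
proof -
  show 1: "\<phi> s / 2 \<le> \<psi> s"
    using mult_left_mono[OF g_bounds(1)[OF assms], of "\<phi> s"] \<phi>_pos[of s] by (simp add: \<psi>_def)
  show 2: "\<psi> s \<le> \<phi> s"
    using mult_left_mono[OF g_bounds(2)[OF assms], of "\<phi> s"] \<phi>_pos[of s] by (simp add: \<psi>_def)
  show "0 < \<psi> s" "\<psi> s \<le> 1" using 1 2 \<phi>_pos[of s] \<phi>_le_1[of s] by linarith+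
qed

lemma \<psi>_lower: "0 \<le> s \<Longrightarrow> s \<le> R \<Longrightarrow> \<phi> R / 2 \<le> \<psi> s"
proof -
  assume s: "0 \<le> s" "s \<le> R"
  have "\<phi> R \<le> \<phi> s" using s kappa by (simp add: \<phi>_eq mult_left_mono power_mono)
  then show ?thesis using \<psi>_bounds(1)[OF s] by simp
qed

lemma \<Phi>_deriv: "0 < x \<Longrightarrow> (\<Phi> has_real_derivative \<phi> x) (at x)"
  unfolding \<Phi>_eq using has_real_derivative_integral[OF continuous_\<phi>, of 0 x "x + 1"] by simp

lemma \<psi>_deriv:
  assumes x: "0 < x"
  shows "(\<psi> has_real_derivative \<psi>' x) (at x)"
proof -
  have "(\<phi> has_real_derivative - \<kappa> * x * \<phi> x) (at x)"
    unfolding \<phi>_eq by (auto intro!: derivative_eq_intros)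
  moreover have "(g has_real_derivative - k * (\<Phi> x / \<phi> x)) (at x)"
    unfolding g_eq using has_real_derivative_integral[OF continuous_ratio, of x "x + 1"] x
    by (auto intro!: derivative_eq_intros)
  ultimately have "(\<psi> has_real_derivative (- \<kappa> * x * \<phi> x) * g x + (- k * (\<Phi> x / \<phi> x)) * \<phi> x) (at x)"
    unfolding \<psi>_def by (rule DERIV_mult)
  moreover have "(- \<kappa> * x * \<phi> x) * g x + (- k * (\<Phi> x / \<phi> x)) * \<phi> x = \<psi>' x"
    using \<phi>_pos[of x] by (simp add: \<psi>'_def \<psi>_def)
  ultimately show ?thesis by simp
qed

lemma \<psi>'_bounds:
  assumes "0 \<le> x" "x \<le> R"
  shows "\<psi>' x \<le> 0" "- (\<kappa> * R + k * R) \<le> \<psi>' x"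
proof -
  have "0 \<le> \<kappa> * x * \<psi> x" "0 \<le> k * \<Phi> x"
    using assms kappa k \<psi>_bounds[OF assms] \<Phi>_bounds by (simp_all add: less_imp_le)
  then show "\<psi>' x \<le> 0" by (simp add: \<psi>'_def)
  have "\<kappa> * x * \<psi> x \<le> \<kappa> * R * 1"
    using assms kappa \<psi>_bounds[OF assms] by (intro mult_mono mult_left_mono) (simp_all add: less_imp_le)
  moreover have "k * \<Phi> x \<le> k * R" using \<Phi>_bounds[of x] assms k by (intro mult_left_mono) auto
  ultimately show "- (\<kappa> * R + k * R) \<le> \<psi>' x" by (simp add: \<psi>'_def)
qed

lemma \<psi>_antimono:
  assumes "0 \<le> a" "a \<le> b" "b \<le> R"
  shows "\<psi> b \<le> \<psi> a"
proof (cases "a = b")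
  case False
  then have "a < b" using assms by simp
  moreover have "continuous_on {a..b} \<psi>" using continuous_\<psi>[of b] assms by (rule_tac continuous_on_subset) auto
  moreover have "\<psi> differentiable (at x)" if "a < x" "x < b" for x
    using \<psi>_deriv[of x] that assms unfolding real_differentiable_def by auto
  ultimately obtain l z where z: "a < z" "z < b" "(\<psi> has_real_derivative l) (at z)" "\<psi> b - \<psi> a = (b - a) * l"
    using MVT[of a b \<psi>] by blast
  then have "l = \<psi>' z" using \<psi>_deriv[of z] DERIV_unique assms by force
  then have "(b - a) * l \<le> 0" using \<psi>'_bounds(1)[of z] z assms by (intro mult_nonneg_nonpos) auto
  then show ?thesis using z by simp
qed simp

lemma \<psi>_lipschitz:
  assumes "0 \<le> a" "a \<le> b" "b \<le> R"
  shows "\<bar>\<psi> b - \<psi> a\<bar> \<le> (\<kappa> * R + k * R) * (b - a)"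
proof (rule mean_value_bound[of a b \<psi> \<psi>'])
  show "continuous_on {a..b} \<psi>" using continuous_\<psi>[of b] assms by (rule_tac continuous_on_subset) auto
  show "\<bar>\<psi>' x\<bar> \<le> \<kappa> * R + k * R" if "a < x" "x < b" for x
    using \<psi>'_bounds[of x] that assms by (simp add: abs_if)
qed (use assms \<psi>_deriv in auto)

text \<open>Lipschitz constant of \<psi>' on [0, R], and for this reason the constant in the cubic
  Taylor remainder of f.\<close>

definition "K3 = \<kappa> * (1 + R * (\<kappa> * R + k * R)) + k"

lemma K3_nonneg: "0 \<le> K3"
  using kappa k R by (simp add: K3_def)

lemma \<psi>'_lipschitz:
  assumes "0 \<le> a" "a \<le> b" "b \<le> R"
  shows "\<bar>\<psi>' b - \<psi>' a\<bar> \<le> K3 * (b - a)"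
proof -
  have "\<bar>\<Phi> b - \<Phi> a\<bar> \<le> 1 * (b - a)"
  proof (rule mean_value_bound[of a b \<Phi> \<phi>])
    show "continuous_on {a..b} \<Phi>" using continuous_\<Phi>[of b] assms by (rule_tac continuous_on_subset) auto
    show "\<bar>\<phi> x\<bar> \<le> 1" for x using \<phi>_pos[of x] \<phi>_le_1[of x] by simp
  qed (use assms \<Phi>_deriv in auto)
  then have 1: "k * \<bar>\<Phi> b - \<Phi> a\<bar> \<le> k * (b - a)" using k by (simp add: mult_left_mono)
  have "\<bar>b * \<psi> b - a * \<psi> a\<bar> = \<bar>(b - a) * \<psi> b + a * (\<psi> b - \<psi> a)\<bar>" by (simp add: algebra_simps)
  also have "\<dots> \<le> (b - a) * \<bar>\<psi> b\<bar> + a * \<bar>\<psi> b - \<psi> a\<bar>"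
    using assms by (intro abs_triangle_ineq[THEN order_trans]) (simp add: abs_mult)
  also have "\<dots> \<le> (b - a) * 1 + R * ((\<kappa> * R + k * R) * (b - a))"
    using assms \<psi>_bounds[of b] \<psi>_lipschitz[OF assms] by (intro add_mono mult_mono) auto
  finally have "\<kappa> * \<bar>b * \<psi> b - a * \<psi> a\<bar> \<le> \<kappa> * ((b - a) * 1 + R * ((\<kappa> * R + k * R) * (b - a)))"
    using kappa by (rule mult_left_mono)
  moreover have "\<psi>' b - \<psi>' a = - (\<kappa> * (b * \<psi> b - a * \<psi> a)) - k * (\<Phi> b - \<Phi> a)"
    by (simp add: \<psi>'_def algebra_simps)
  then have "\<bar>\<psi>' b - \<psi>' a\<bar> \<le> \<kappa> * \<bar>b * \<psi> b - a * \<psi> a\<bar> + k * \<bar>\<Phi> b - \<Phi> a\<bar>"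
    using kappa k abs_triangle_ineq4[of "- (\<kappa> * (b * \<psi> b - a * \<psi> a))" "k * (\<Phi> b - \<Phi> a)"]
    by (simp add: abs_mult)
  moreover have "\<kappa> * ((b - a) * 1 + R * ((\<kappa> * R + k * R) * (b - a))) + k * (b - a) = K3 * (b - a)"
    by (simp add: K3_def algebra_simps)
  ultimately show ?thesis using 1 by linarith
qed

lemma f_eq_\<psi>: "f r = integral {0..min r R} \<psi>"
  unfolding f_eq \<psi>_def[abs_def] ..

lemma f_diff:
  assumes "0 \<le> a" "a \<le> b" "b \<le> R"
  shows "f b - f a = integral {a..b} \<psi>"
proof -
  have "integral {0..a} \<psi> + integral {a..b} \<psi> = integral {0..b} \<psi>"
    using assms by (intro Henstock_Kurzweil_Integration.integral_combine integrable_continuous_interval continuous_\<psi>) auto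
  then show ?thesis using assms by (simp add: f_eq_\<psi> min_absorb1)
qed

lemma f_diff_bounds:
  assumes "0 \<le> a" "a \<le> b" "b \<le> R"
  shows "\<psi> b * (b - a) \<le> f b - f a" "f b - f a \<le> \<psi> a * (b - a)"
proof -
  have int: "\<psi> integrable_on {a..b}"
    using continuous_\<psi>[of b] assms by (intro integrable_continuous_interval) (rule_tac continuous_on_subset, auto)
  have "integral {a..b} (\<lambda>_. \<psi> b) \<le> integral {a..b} \<psi>"
    using assms by (intro integral_le int \<psi>_antimono) auto
  then show "\<psi> b * (b - a) \<le> f b - f a" using assms by (simp add: f_diff mult.commute)
  have "integral {a..b} \<psi> \<le> integral {a..b} (\<lambda>_. \<psi> a)"
    using assms by (intro integral_le int \<psi>_antimono) auto
  then show "f b - f a \<le> \<psi> a * (b - a)" using assms by (simp add: f_diff mult.commute)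
qed

lemma f_nonpos: "r \<le> 0 \<Longrightarrow> f r = 0"
  using R by (cases "r = 0") (simp_all add: f_eq_\<psi> min_def)

lemma f_ge_R: "R \<le> r \<Longrightarrow> f r = f R"
  by (simp add: f_eq_\<psi>)

lemma f_mono_lipschitz:
  assumes "a \<le> b"
  shows "f a \<le> f b" "f b \<le> f a + (b - a)"
proof -
  \<comment> \<open>f is constant on either side of [0, R]: the integral over an interval with
    negative right end is 0, and beyond \<open>R\<close> the minimum is \<open>R\<close>. Clamping
    the arguments reduces everything to [0, R].\<close>
  define c where "c x = max 0 (min x R)" for x
  have fc: "f x = f (c x)" for x
    using f_nonpos[of x] f_nonpos[of 0] f_ge_R[of x] R by (cases "x \<le> 0"; cases "R \<le> x") (simp_all add: c_def min_def max_def)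
  have c: "0 \<le> c a" "c a \<le> c b" "c b \<le> R" "c b - c a \<le> b - a"
    using assms R by (auto simp: c_def)
  have "0 \<le> \<psi> (c b) * (c b - c a)" using \<psi>_bounds[of "c b"] c by simp
  then show "f a \<le> f b" using f_diff_bounds(1)[OF c(1-3)] fc[of a] fc[of b] by linarith
  have "\<psi> (c a) * (c b - c a) \<le> 1 * (c b - c a)"
    using \<psi>_bounds[of "c a"] c by (intro mult_right_mono) auto
  then show "f b \<le> f a + (b - a)" using f_diff_bounds(2)[OF c(1-3)] fc[of a] fc[of b] c(4) unfolding mult_1 by linarith
qed

lemma f_mono: "a \<le> b \<Longrightarrow> f a \<le> f b"
  by (rule f_mono_lipschitz)

lemma f_lipschitz: "f b \<le> f a + \<bar>b - a\<bar>"
  using f_mono_lipschitz[of a b] f_mono_lipschitz[of b a] by linarith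

lemma f_nonneg: "0 \<le> f r"
  using f_mono[of 0 r] f_nonpos[of 0] f_nonpos[of r] by (cases "0 \<le> r") auto

lemma f_le_R: "f r \<le> R"
  using f_mono[of r "max r R"] f_ge_R[of "max r R"] f_lipschitz[of R 0] f_nonpos[of 0] R by simp

lemma f_le_\<Phi>:
  assumes "0 \<le> r" "r \<le> R"
  shows "f r \<le> \<Phi> r"
proof -
  have "integral {0..r} \<psi> \<le> integral {0..r} \<phi>"
    using assms \<psi>_bounds
    by (intro integral_le integrable_continuous_interval continuous_\<psi> continuous_\<phi>) auto
  then show ?thesis using assms by (simp add: f_eq_\<psi> \<Phi>_eq min_absorb1)
qed

text \<open>Concavity; it also covers \<open>r + s > R\<close>, where f stays constant while the
  tangent, whose slope is positive, keeps rising.\<close>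

lemma f_tangent:
  assumes r: "0 \<le> r" "r \<le> R" and s: "0 \<le> r + s"
  shows "f (r + s) \<le> f r + \<psi> r * s"
proof (cases "0 \<le> s")
  case True
  define b where "b = min (r + s) R"
  have b: "r \<le> b" "b \<le> R" "b - r \<le> s" using True r by (auto simp: b_def)
  have "f (r + s) = f b" by (simp add: f_eq_\<psi> b_def)
  also have "\<dots> \<le> f r + \<psi> r * (b - r)" using f_diff_bounds(2)[of r b] r b by simp
  also have "\<psi> r * (b - r) \<le> \<psi> r * s" using \<psi>_bounds[OF r] b by (intro mult_left_mono) auto
  finally show ?thesis by simp
next
  case False
  then show ?thesis using f_diff_bounds(1)[of "r + s" r] r s by simp
qed

lemma f_deriv:
  assumes "0 < x" "x < R"
  shows "(f has_real_derivative \<psi> x) (at x)"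
proof -
  have "((\<lambda>y. integral {0..y} \<psi>) has_real_derivative \<psi> x) (at x)"
    by (rule has_real_derivative_integral[OF continuous_\<psi> assms])
  moreover have "\<forall>\<^sub>F y in nhds x. integral {0..y} \<psi> = f y"
    using eventually_nhds_in_open[of "{..<R}" x] assms by (auto simp: f_eq_\<psi> min_absorb1 elim!: eventually_mono)
  ultimately show ?thesis by (subst (asm) DERIV_cong_ev[OF refl _ refl])
qed

lemma continuous_f: "continuous_on S f"
proof (rule continuous_onI)
  fix x and e :: real assume "0 < e"
  have le: "dist (f x') (f x) \<le> dist x' x" for x'
    using f_lipschitz[of x x'] f_lipschitz[of x' x] by (simp add: dist_real_def)
  show "\<exists>d>0. \<forall>x'\<in>S. dist x' x < d \<longrightarrow> dist (f x') (f x) \<le> e"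
  proof (intro exI[of _ e] conjI ballI impI)
    fix x' assume "dist x' x < e"
    with le[of x'] show "dist (f x') (f x) \<le> e" by linarith
  qed fact
qed

text \<open>The mean value theorem is applied to the remainder and to its derivative, since second
  derivatives are available inside (0, R) alone.\<close>

lemma f_taylor:
  assumes r: "0 \<le> r" "r \<le> R" and x: "0 \<le> x" "x \<le> R"
  shows "f x \<le> f r + \<psi> r * (x - r) + \<psi>' r / 2 * (x - r)\<^sup>2 + K3 * \<bar>x - r\<bar> ^ 3"
proof -
  define E where "E y = f y - f r - \<psi> r * (y - r) - \<psi>' r / 2 * (y - r)\<^sup>2" for y
  define E' where "E' y = \<psi> y - \<psi> r - \<psi>' r * (y - r)" for y
  have E: "(E has_real_derivative E' y) (at y)" if "0 < y" "y < R" for y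
    unfolding E_def E'_def using f_deriv[OF that] by (auto intro!: derivative_eq_intros)
  have E': "(E' has_real_derivative \<psi>' y - \<psi>' r) (at y)" if "0 < y" for y
    unfolding E'_def using \<psi>_deriv[OF that] by (auto intro!: derivative_eq_intros)
  have contE: "continuous_on S E" for S unfolding E_def by (intro continuous_intros continuous_f)
  have contE': "continuous_on {a..b} E'" if "0 \<le> a" for a b
    unfolding E'_def using that by (intro continuous_intros continuous_on_subset[OF continuous_\<psi>[of b]]) auto
  have E'_bound: "\<bar>E' y\<bar> \<le> K3 * (y - r)\<^sup>2" if y: "0 \<le> y" "y \<le> R" for y
  proof -
    have B: "\<bar>\<psi>' z - \<psi>' r\<bar> \<le> K3 * \<bar>y - r\<bar>" if "min r y \<le> z" "z \<le> max r y" for z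
    proof -
      have "\<bar>\<psi>' z - \<psi>' r\<bar> \<le> K3 * \<bar>z - r\<bar>"
        using \<psi>'_lipschitz[of z r] \<psi>'_lipschitz[of r z] that y r by (cases "z \<le> r") (auto simp: abs_minus_commute)
      also have "\<dots> \<le> K3 * \<bar>y - r\<bar>" using that K3_nonneg by (intro mult_left_mono) auto
      finally show ?thesis .
    qed
    have "\<bar>E' y - E' r\<bar> \<le> K3 * \<bar>y - r\<bar> * \<bar>y - r\<bar>"
    proof (cases "r \<le> y")
      case True
      then show ?thesis
        using mean_value_bound[of r y E' "\<lambda>z. \<psi>' z - \<psi>' r" "K3 * \<bar>y - r\<bar>"] contE' E' B r y by simp
    next
      case False
      then show ?thesis
        using mean_value_bound[of y r E' "\<lambda>z. \<psi>' z - \<psi>' r" "K3 * \<bar>y - r\<bar>"] contE' E' B r y by (simp add: abs_minus_commute)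
    qed
    then show ?thesis by (simp add: E'_def power2_eq_square mult.assoc)
  qed
  have B: "\<bar>E' z\<bar> \<le> K3 * (x - r)\<^sup>2" if "min r x \<le> z" "z \<le> max r x" for z
  proof -
    have "(z - r)\<^sup>2 \<le> (x - r)\<^sup>2" using that by (intro abs_le_square_iff[THEN iffD1]) auto
    then have "K3 * (z - r)\<^sup>2 \<le> K3 * (x - r)\<^sup>2" using K3_nonneg by (rule mult_left_mono)
    moreover have "0 \<le> z" "z \<le> R" using that r x by auto
    ultimately show ?thesis using E'_bound[of z] by linarith
  qed
  have "\<bar>E x - E r\<bar> \<le> K3 * (x - r)\<^sup>2 * \<bar>x - r\<bar>"
  proof (cases "r \<le> x")
    case True
    then show ?thesis
      using mean_value_bound[of r x E E' "K3 * (x - r)\<^sup>2"] contE E B r x by simp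
  next
    case False
    then show ?thesis
      using mean_value_bound[of x r E E' "K3 * (x - r)\<^sup>2"] contE E B r x by (simp add: abs_minus_commute)
  qed
  moreover have "(x - r)\<^sup>2 * \<bar>x - r\<bar> = \<bar>x - r\<bar> ^ 3" by (simp add: power3_eq_cube power2_eq_square)
  moreover have "E r = 0" by (simp add: E_def)
  ultimately have "E x \<le> K3 * \<bar>x - r\<bar> ^ 3" by (simp add: mult.assoc)
  then show ?thesis by (simp add: E_def)
qed

text \<open>A one-sided Taylor formula that survives the two kinks of f. If the new argument is
  negative, the step has length at least \<delta>, so lower powers of it are absorbed in the cubic
  term; beyond \<open>R\<close> the slope drops to 0, which only helps. \<open>C\<close> depends on
  \<delta>.\<close>

lemma f_cubic_bound:
  assumes \<delta>: "0 < \<delta>"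
  obtains C where "0 \<le> C"
    "\<And>r s. \<delta> \<le> r \<Longrightarrow> r \<le> R \<Longrightarrow> f (r + s) \<le> f r + \<psi> r * s + \<psi>' r / 2 * s\<^sup>2 + C * \<bar>s\<bar> ^ 3"
proof
  define P where "P = \<kappa> * R + k * R"
  define c where "c = \<phi> R / 2"
  define C where "C = K3 + P\<^sup>2 / c + 1 / \<delta>\<^sup>2 + P / (2 * \<delta>)"
  have P: "0 \<le> P" using kappa k R by (simp add: P_def)
  have c: "0 < c" using \<phi>_pos by (simp add: c_def)
  have terms: "0 \<le> K3" "0 \<le> P\<^sup>2 / c" "0 \<le> 1 / \<delta>\<^sup>2" "0 \<le> P / (2 * \<delta>)"
    using K3_nonneg P c \<delta> by simp_all
  then show "0 \<le> C" by (simp add: C_def)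
  fix r s :: real assume r: "\<delta> \<le> r" "r \<le> R"
  have r0: "0 \<le> r" using r \<delta> by simp
  define n :: real where "n = \<bar>s\<bar>"
  have n3: "0 \<le> n ^ 3" by (simp add: n_def)
  have \<psi>: "c \<le> \<psi> r" "\<psi> r \<le> 1" using \<psi>_bounds[OF r0 r(2)] \<psi>_lower[OF r0 r(2)] by (simp_all add: c_def)
  have \<psi>': "\<psi>' r \<le> 0" "- P \<le> \<psi>' r" using \<psi>'_bounds[OF r0 r(2)] by (simp_all add: P_def)
  have C_ge: "K3 * n ^ 3 + P\<^sup>2 / c * n ^ 3 \<le> C * n ^ 3" "1 / \<delta>\<^sup>2 * n ^ 3 + P / (2 * \<delta>) * n ^ 3 \<le> C * n ^ 3"
    using terms mult_right_mono[OF _ n3, of "K3 + P\<^sup>2 / c" C] mult_right_mono[OF _ n3, of "1 / \<delta>\<^sup>2 + P / (2 * \<delta>)" C]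
    by (simp_all add: C_def distrib_right)
  show "f (r + s) \<le> f r + \<psi> r * s + \<psi>' r / 2 * s\<^sup>2 + C * \<bar>s\<bar> ^ 3"
  proof (cases "r + s < 0")
    case True
    have n: "s = - n" "\<delta> \<le> n" using True r \<delta> by (auto simp: n_def)
    have "\<psi> r * n \<le> n" using \<psi> n \<delta> mult_right_mono[of "\<psi> r" 1 n] by simp
    also have "n \<le> 1 / \<delta>\<^sup>2 * n ^ 3"
    proof -
      have "\<delta>\<^sup>2 \<le> n\<^sup>2" using n \<delta> by (intro power_mono) simp_all
      then have "\<delta>\<^sup>2 * n \<le> n\<^sup>2 * n" using n \<delta> by (intro mult_right_mono) simp_all
      then show ?thesis using \<delta> by (simp add: field_simps power3_eq_cube power2_eq_square)
    qed
    finally have 1: "\<psi> r * n \<le> 1 / \<delta>\<^sup>2 * n ^ 3" .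
    have "- \<psi>' r / 2 * n\<^sup>2 \<le> P / 2 * n\<^sup>2" using \<psi>' by (intro mult_right_mono) simp_all
    also have "\<dots> \<le> P / (2 * \<delta>) * n ^ 3"
    proof -
      have "\<delta> * n\<^sup>2 \<le> n * n\<^sup>2" using n by (intro mult_right_mono) simp_all
      then have "n\<^sup>2 \<le> n ^ 3 / \<delta>" using \<delta> by (simp add: field_simps power3_eq_cube power2_eq_square)
      from mult_left_mono[OF this, of "P / 2"] P show ?thesis by simp
    qed
    finally have 2: "- \<psi>' r / 2 * n\<^sup>2 \<le> P / (2 * \<delta>) * n ^ 3" .
    have "f (r + s) = 0" using True by (simp add: f_nonpos)
    moreover have "s\<^sup>2 = n\<^sup>2" "\<psi> r * s = - (\<psi> r * n)" using n by simp_all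
    ultimately show ?thesis using 1 2 C_ge(2) f_nonneg[of r] n_def by simp
  next
    case False
    show ?thesis
    proof (cases "r + s \<le> R")
      case True
      have "C * n ^ 3 \<ge> K3 * n ^ 3" using C_ge(1) terms n3 by (smt (verit) mult_nonneg_nonneg)
      then show ?thesis using f_taylor[OF r0 r(2), of "r + s"] False True by (simp add: n_def)
    next
      case big: False
      define p where "p = R - r"
      have p: "0 \<le> p" "p < s" "n = s" using big r by (auto simp: p_def n_def)
      have "f (r + s) = f R" using big by (intro f_ge_R) simp
      also have "\<dots> \<le> f r + \<psi> r * p + \<psi>' r / 2 * p\<^sup>2 + K3 * p ^ 3"
        using f_taylor[OF r0 r(2), of R] R p by (simp add: p_def)
      \<comment> \<open>Stopping at \<open>R\<close> forgoes the negative second-order term over the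
        excess s - p, but saves at least c (s - p) in first order. If P s \<le> c the saving
        suffices; otherwise P s / c > 1 and the loss is itself cubic.\<close>
      also have "\<dots> \<le> f r + \<psi> r * s + \<psi>' r / 2 * s\<^sup>2 + K3 * s ^ 3 + P\<^sup>2 / c * s ^ 3"
      proof -
        have "p ^ 3 \<le> s ^ 3" using p by (intro power_mono) simp_all
        then have a: "K3 * p ^ 3 \<le> K3 * s ^ 3" using K3_nonneg by (rule mult_left_mono)
        have "- \<psi>' r / 2 * (s\<^sup>2 - p\<^sup>2) \<le> P / 2 * (s\<^sup>2 - p\<^sup>2)"
          using \<psi>' p by (intro mult_right_mono) (simp_all add: power_mono)
        also have sp: "s\<^sup>2 - p\<^sup>2 = (s - p) * (s + p)" by (simp add: power2_eq_square algebra_simps)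
        also have "P / 2 * ((s - p) * (s + p)) \<le> P / 2 * ((s - p) * (2 * s))"
          using p P by (intro mult_left_mono) simp_all
        also have "\<dots> = P * s * (s - p)" by simp
        finally have b: "- \<psi>' r / 2 * (s\<^sup>2 - p\<^sup>2) \<le> P * s * (s - p)" unfolding sp .
        have "P * s * (s - p) \<le> c * (s - p) + P\<^sup>2 / c * s ^ 3"
        proof (cases "P * s \<le> c")
          case True
          have "0 \<le> P\<^sup>2 / c * s ^ 3" using p c by simp
          then show ?thesis using mult_right_mono[OF True, of "s - p"] p by linarith
        next
          case False
          have "P * s * (s - p) \<le> P * s * s" using p P by (intro mult_left_mono) simp_all
          also have "\<dots> \<le> P * s * s * (P * s / c)"
            using False c p P mult_left_mono[of 1 "P * s / c" "P * s * s"] by simp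
          also have "\<dots> = P\<^sup>2 / c * s ^ 3" by (simp add: power2_eq_square power3_eq_cube)
          finally show ?thesis using c p by (smt (verit) mult_nonneg_nonneg)
        qed
        also have "c * (s - p) \<le> \<psi> r * (s - p)" using \<psi> p by (intro mult_right_mono) simp_all
        finally have d: "P * s * (s - p) \<le> \<psi> r * (s - p) + P\<^sup>2 / c * s ^ 3" by simp
        have "- \<psi>' r / 2 * (s\<^sup>2 - p\<^sup>2) = \<psi>' r / 2 * p\<^sup>2 - \<psi>' r / 2 * s\<^sup>2"
          by (simp add: right_diff_distrib)
        moreover have "\<psi> r * (s - p) = \<psi> r * s - \<psi> r * p" by (simp add: algebra_simps)
        ultimately show ?thesis using a b d by linarith
      qed
      also have "\<dots> \<le> f r + \<psi> r * s + \<psi>' r / 2 * s\<^sup>2 + C * \<bar>s\<bar> ^ 3"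
        using C_ge(1) p n_def by simp
      finally show ?thesis .
    qed
  qed
qed

end

section \<open>Brownian motion and the law of the flow\<close>

text \<open>Indicators of closed sets are limits of Lipschitz functions of the distance to the set.
  Lipschitz test functions are used because the Euler schemes preserve them uniformly in the number
  of steps.\<close>

lemma prob_measure_eqI_lipschitz:
  fixes \<mu> \<nu> :: "'e::metric_space measure"
  assumes \<mu>: "prob_space \<mu>" "sets \<mu> = sets borel" and \<nu>: "prob_space \<nu>" "sets \<nu> = sets borel"
    and eq: "\<And>(h :: 'e \<Rightarrow> real) L. (\<And>x. 0 \<le> h x) \<Longrightarrow> (\<And>x. h x \<le> 1) \<Longrightarrow> (\<And>x y. \<bar>h x - h y\<bar> \<le> L * dist x y) \<Longrightarrow>
        (\<integral>\<^sup>+x. ennreal (h x) \<partial>\<mu>) = (\<integral>\<^sup>+x. ennreal (h x) \<partial>\<nu>)"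
  shows "\<mu> = \<nu>"
proof (rule measure_eqI_generator_eq[where E="Collect closed" and \<Omega>=UNIV and A="\<lambda>_. UNIV"])
  show "Int_stable (Collect closed)" by (auto simp: Int_stable_def)
  show "sets \<mu> = sigma_sets UNIV (Collect closed)" "sets \<nu> = sigma_sets UNIV (Collect closed)"
    using \<mu> \<nu> by (simp_all add: borel_eq_closed)
  interpret \<mu>: prob_space \<mu> by fact
  interpret \<nu>: prob_space \<nu> by fact
  show "emeasure \<mu> UNIV \<noteq> \<infinity>" by simp
  fix C :: "'e set" assume "C \<in> Collect closed"
  then have C: "closed C" by simp
  show "emeasure \<mu> C = emeasure \<nu> C"
  proof (cases "C = {}")
    case False
    define h where "h n x = max 0 (1 - real n * infdist x C)" for n x
    have h01: "0 \<le> h n x" "h n x \<le> 1" for n x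
      by (simp_all add: h_def infdist_nonneg)
    have h_lip: "\<bar>h n x - h n y\<bar> \<le> real n * dist x y" for n x y
    proof -
      have "\<bar>h n x - h n y\<bar> \<le> \<bar>real n * infdist x C - real n * infdist y C\<bar>" by (simp add: h_def)
      also have "\<dots> = real n * \<bar>infdist x C - infdist y C\<bar>" by (simp add: right_diff_distrib[symmetric] abs_mult)
      also have "\<dots> \<le> real n * dist x y" by (intro mult_left_mono infdist_triangle_abs) simp
      finally show ?thesis .
    qed
    have meas: "(\<lambda>x. ennreal (h n x)) \<in> borel_measurable borel" for n
      unfolding h_def by (intro measurable_compose[OF borel_measurable_continuous_onI[of "\<lambda>x. max 0 (1 - real n * infdist x C)"] measurable_ennreal]
          continuous_intros)
    have lim: "(\<lambda>n. ennreal (h n x)) \<longlonglongrightarrow> indicator C x" for x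
    proof (cases "x \<in> C")
      case True
      then show ?thesis by (simp add: h_def)
    next
      case nx: False
      then have d: "0 < infdist x C" using C False by (simp add: infdist_pos_not_in_closed)
      then obtain N where N: "1 < real N * infdist x C" using reals_Archimedean3 by blast
      have "\<forall>\<^sub>F n in sequentially. ennreal (h n x) = indicator C x"
        using eventually_ge_at_top[of N]
      proof eventually_elim
        case (elim n)
        then have "real N * infdist x C \<le> real n * infdist x C" using d by simp
        then show ?case using N nx by (simp add: h_def)
      qed
      then show ?thesis by (rule tendsto_eventually)
    qed
    have conv: "(\<lambda>n. \<integral>\<^sup>+x. ennreal (h n x) \<partial>m) \<longlonglongrightarrow> emeasure m C" if "prob_space m" "sets m = sets borel" for m
    proof -
      interpret m: prob_space m by fact
      have "(\<lambda>n. \<integral>\<^sup>+x. ennreal (h n x) \<partial>m) \<longlonglongrightarrow> (\<integral>\<^sup>+x. indicator C x \<partial>m)"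
      proof (rule nn_integral_dominated_convergence[where w="\<lambda>_. 1"])
        show "(\<lambda>x. ennreal (h n x)) \<in> borel_measurable m" for n
          using meas that(2) by (simp cong: measurable_cong_sets)
        show "indicator C \<in> borel_measurable m"
          using C that(2) by (intro borel_measurable_indicator) simp
      qed (use h01 lim in \<open>simp_all add: m.emeasure_space_1\<close>)
      then show ?thesis using C that(2) by simp
    qed
    have "(\<lambda>n. \<integral>\<^sup>+x. ennreal (h n x) \<partial>\<mu>) = (\<lambda>n. \<integral>\<^sup>+x. ennreal (h n x) \<partial>\<nu>)"
      using h01 h_lip by (intro ext eq) auto
    then show ?thesis using conv[OF \<mu>] conv[OF \<nu>] LIMSEQ_unique by metis
  qed simp
qed auto

lemma brownian_motion_prob_space: "brownian_motion M B \<Longrightarrow> prob_space M"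
  and brownian_motion_measurable: "brownian_motion M B \<Longrightarrow> B t \<in> borel_measurable M"
  by (simp_all add: brownian_motion_def)

lemma brownian_motion_path:
  assumes "brownian_motion M B" "\<omega> \<in> space M"
  shows "B 0 \<omega> = 0" "continuous_on {0..T} (\<lambda>t. B t \<omega>)"
  using assms by (auto simp: brownian_motion_def intro: continuous_on_subset)

lemma distr_brownian_increment:
  fixes B :: "real \<Rightarrow> 'a \<Rightarrow> real^'d"
  assumes "brownian_motion M B" "0 \<le> r" "r < t"
  shows "distr M borel (\<lambda>\<omega>. B t \<omega> - B r \<omega>) = gauss (t - r)"
proof -
  have "distributed M lborel (\<lambda>\<omega>. B t \<omega> - B r \<omega>)
          (\<lambda>x. ennreal ((2 * pi * (t - r)) powr (- real CARD('d) / 2) * exp (- (norm x)\<^sup>2 / (2 * (t - r)))))"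
    using assms by (simp add: brownian_motion_def)
  from distributed_distr_eq_density[OF this] show ?thesis
    by (simp add: gauss_def cong: distr_cong)
qed

lemma distr_brownian:
  fixes B :: "real \<Rightarrow> 'a \<Rightarrow> real^'d"
  assumes "brownian_motion M B" "0 < t"
  shows "distr M borel (B t) = gauss t"
proof -
  have "distr M borel (B t) = distr M borel (\<lambda>\<omega>. B t \<omega> - B 0 \<omega>)"
    using assms(1) by (intro distr_cong) (simp_all add: brownian_motion_path)
  then show ?thesis using distr_brownian_increment[OF assms(1), of 0 t] assms(2) by simp
qed

lemma distr_brownian_increments:
  fixes B :: "real \<Rightarrow> 'a \<Rightarrow> real^'d"
  assumes B: "brownian_motion M B" and \<tau>: "0 < \<tau>" and m: "0 < m"
  shows "distr M (PiM {..<m} (\<lambda>_. borel)) (\<lambda>\<omega>. \<lambda>i\<in>{..<m}. increments \<tau> (\<lambda>t. B t \<omega>) i) = PiM {..<m} (\<lambda>_. gauss \<tau>)"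
proof -
  interpret prob_space M using B by (rule brownian_motion_prob_space)
  \<comment> \<open>\<open>m + 1\<close> times give \<open>m\<close> increments, matching the index
    set \<open>{..<length ts - 1}\<close> in \<open>brownian_motion\<close>.\<close>
  define ts where "ts = map (\<lambda>k. real k * \<tau>) [0..<Suc m]"
  have nth: "i \<le> m \<Longrightarrow> ts ! i = real i * \<tau>" for i
    unfolding ts_def by (subst nth_map) (simp_all del: upt_Suc)
  have len: "length ts - 1 = m" by (simp add: ts_def)
  have "sorted ts"
    unfolding sorted_iff_nth_mono_less using nth \<tau> len by (auto simp: ts_def mult_right_mono simp del: upt_Suc)
  moreover have "\<forall>t\<in>set ts. 0 \<le> t" using \<tau> by (auto simp: ts_def)
  ultimately have "indep_vars (\<lambda>_. borel) (\<lambda>i \<omega>. B (ts ! Suc i) \<omega> - B (ts ! i) \<omega>) {..<length ts - 1}"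
    using B by (simp add: brownian_motion_def)
  then have ind: "indep_vars (\<lambda>_. borel) (\<lambda>i \<omega>. increments \<tau> (\<lambda>t. B t \<omega>) i) {..<m}"
    unfolding len by (rule indep_vars_cong[THEN iffD1, rotated -1]) (auto simp: increments_def nth Suc_le_eq)
  have rv: "random_variable borel (\<lambda>\<omega>. increments \<tau> (\<lambda>t. B t \<omega>) i)" for i
    unfolding increments_def using brownian_motion_measurable[OF B] by simp
  have "distr M (PiM {..<m} (\<lambda>_. borel)) (\<lambda>\<omega>. \<lambda>i\<in>{..<m}. increments \<tau> (\<lambda>t. B t \<omega>) i)
      = PiM {..<m} (\<lambda>i. distr M borel (\<lambda>\<omega>. increments \<tau> (\<lambda>t. B t \<omega>) i))"
    using indep_vars_iff_distr_eq_PiM[where I="{..<m}" and M'="\<lambda>_. borel" and X="\<lambda>i \<omega>. increments \<tau> (\<lambda>t. B t \<omega>) i"] ind rv m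
    by auto
  also have "\<dots> = PiM {..<m} (\<lambda>_. gauss \<tau>)"
  proof (rule PiM_cong)
    fix i
    have "real i * \<tau> < real (Suc i) * \<tau>" "real (Suc i) * \<tau> - real i * \<tau> = \<tau>" using \<tau> by (simp_all add: algebra_simps)
    then show "distr M borel (\<lambda>\<omega>. increments \<tau> (\<lambda>t. B t \<omega>) i) = gauss \<tau>"
      using distr_brownian_increment[OF B, of "real i * \<tau>" "real (Suc i) * \<tau>"] \<tau> by (simp only: increments_def) simp
  qed simp
  finally show ?thesis .
qed

locale euler_noise = lipschitz_field F S K s
  for F :: "'e::euclidean_space \<Rightarrow> 'e" and S :: "real^'d \<Rightarrow> 'e" and K s
begin

lemma continuous_F: "continuous_on A F"
proof (rule continuous_onI)
  fix x and e :: real assume e: "0 < e"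
  show "\<exists>d>0. \<forall>x'\<in>A. dist x' x < d \<longrightarrow> dist (F x') (F x) \<le> e"
  proof (intro exI[of _ "e / (K + 1)"] conjI ballI impI)
    fix x' assume "dist x' x < e / (K + 1)"
    then have "(K + 1) * norm (x' - x) \<le> e" using K_nonneg by (simp add: dist_norm field_simps)
    then show "dist (F x') (F x) \<le> e"
      using F_lipschitz[of x' x] norm_ge_zero[of "x' - x"] unfolding dist_norm distrib_right by linarith
  qed (use e K_nonneg in simp)
qed

lemma F_measurable [measurable]: "F \<in> borel_measurable borel"
  by (intro borel_measurable_continuous_onI continuous_F)

lemma S_measurable [measurable]: "S \<in> borel_measurable borel"
  using S_linear by (intro borel_measurable_continuous_onI linear_continuous_on linear_conv_bounded_linear[THEN iffD1])

lemma euler_eq_chain: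
  assumes "0 < m"
  shows "euler F S T m b z = euler_chain F S (T / real m) (\<lambda>i\<in>{..<m}. increments (T / real m) b i) z m"
  unfolding euler_def by (rule euler_chain_cong) simp

lemma euler_measurable:
  assumes Z: "Z \<in> borel_measurable N" and b: "\<And>t. (\<lambda>\<omega>. b t \<omega>) \<in> borel_measurable N"
  shows "(\<lambda>\<omega>. euler F S T m (\<lambda>t. b t \<omega>) (Z \<omega>)) \<in> borel_measurable N"
  unfolding euler_def
proof (rule euler_chain_measurable)
  show "(\<lambda>\<omega>. increments (T / real m) (\<lambda>t. b t \<omega>) i) \<in> borel_measurable N" for i
    unfolding increments_def using b by simp
qed (use Z in simp_all)

lemma flow_measurable:
  assumes T: "0 \<le> T" and Z: "Z \<in> borel_measurable N" and b: "\<And>t. (\<lambda>\<omega>. b t \<omega>) \<in> borel_measurable N"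
    and path: "\<And>\<omega>. \<omega> \<in> space N \<Longrightarrow> continuous_on {0..T} (\<lambda>t. b t \<omega>) \<and> b 0 \<omega> = 0"
  shows "(\<lambda>\<omega>. flow F S T (\<lambda>t. b t \<omega>) (Z \<omega>)) \<in> borel_measurable N"
  by (rule borel_measurable_LIMSEQ_metric[OF euler_measurable[OF Z b]]) (use path T in \<open>auto intro!: euler_tendsto_flow\<close>)

lemma nn_integral_euler:
  fixes B :: "real \<Rightarrow> 'a \<Rightarrow> real^'d"
  assumes B: "brownian_motion M B" and T: "0 < T" and m: "0 < m" and h[measurable]: "h \<in> borel_measurable borel"
  shows "(\<integral>\<^sup>+\<omega>. h (euler F S T m (\<lambda>t. B t \<omega>) z) \<partial>M) = (euler_op F S (T / real m) ^^ m) h z"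
proof -
  let ?\<Xi> = "\<lambda>\<omega>. \<lambda>i\<in>{..<m}. increments (T / real m) (\<lambda>t. B t \<omega>) i"
  have \<tau>: "0 < T / real m" using T m by simp
  have [measurable]: "?\<Xi> \<in> measurable M (PiM {..<m} (\<lambda>_. borel))"
    unfolding increments_def using brownian_motion_measurable[OF B] by (intro measurable_restrict) simp
  have [measurable]: "(\<lambda>\<xi>. euler_chain F S (T / real m) \<xi> z m) \<in> borel_measurable (PiM {..<m} (\<lambda>_. borel))"
    by (rule euler_chain_measurable) simp_all
  have "(\<integral>\<^sup>+\<omega>. h (euler F S T m (\<lambda>t. B t \<omega>) z) \<partial>M)
      = (\<integral>\<^sup>+\<xi>. h (euler_chain F S (T / real m) \<xi> z m) \<partial>distr M (PiM {..<m} (\<lambda>_. borel)) ?\<Xi>)"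
    by (subst nn_integral_distr) (simp_all add: euler_eq_chain[OF m])
  also have "\<dots> = (euler_op F S (T / real m) ^^ m) h z"
    unfolding distr_brownian_increments[OF B \<tau> m] using \<tau> by (intro nn_integral_PiM_euler_chain) simp_all
  finally show ?thesis .
qed

text \<open>By independence the starting point forms a product measure with the vector of
  increments, so it can be integrated out last.\<close>

lemma nn_integral_euler_random:
  fixes B :: "real \<Rightarrow> 'a \<Rightarrow> real^'d"
  assumes B: "brownian_motion M B" and T: "0 < T" and m: "0 < m" and h[measurable]: "h \<in> borel_measurable borel"
    and Z[measurable]: "Z \<in> borel_measurable M"
    and ind: "prob_space.indep_set M (sigma_sets (space M) {Z -` A \<inter> space M | A. A \<in> sets borel})
        (sigma_sets (space M) {(\<lambda>\<omega>. B r \<omega>) -` A \<inter> space M | r A. A \<in> sets borel})"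
  shows "(\<integral>\<^sup>+\<omega>. h (euler F S T m (\<lambda>t. B t \<omega>) (Z \<omega>)) \<partial>M) = (\<integral>\<^sup>+z. (euler_op F S (T / real m) ^^ m) h z \<partial>distr M borel Z)"
proof -
  interpret prob_space M using B by (rule brownian_motion_prob_space)
  let ?\<Xi> = "\<lambda>\<omega>. \<lambda>i\<in>{..<m}. increments (T / real m) (\<lambda>t. B t \<omega>) i"
  let ?P = "PiM {..<m} (\<lambda>_. borel :: (real^'d) measure)"
  have \<tau>: "0 < T / real m" using T m by simp
  define G where "G = {(\<lambda>\<omega>. B r \<omega>) -` A \<inter> space M | r A. A \<in> sets (borel :: (real^'d) measure)}"
  have G: "G \<subseteq> Pow (space M)" by (auto simp: G_def)
  have BG: "B t \<in> measurable (sigma (space M) G) borel" for t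
  proof (rule measurableI)
    fix A :: "(real^'d) set" assume "A \<in> sets borel"
    then have "B t -` A \<inter> space M \<in> G" by (auto simp: G_def)
    then show "B t -` A \<inter> space (sigma (space M) G) \<in> sets (sigma (space M) G)" using G by (simp add: space_measure_of_conv)
  qed simp
  have \<Xi>G: "?\<Xi> \<in> measurable (sigma (space M) G) ?P"
    unfolding increments_def using BG by (intro measurable_restrict) simp
  have \<Xi>M[measurable]: "?\<Xi> \<in> measurable M ?P"
    unfolding increments_def using brownian_motion_measurable[OF B] by (intro measurable_restrict) simp
  \<comment> \<open>The increments are functions of the path, so events about them lie in the
    sigma-field that is assumed independent of \<open>Z\<close>.\<close>
  have sub: "{?\<Xi> -` A \<inter> space M | A. A \<in> sets ?P} \<subseteq> sigma_sets (space M) G"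
    using measurable_sets[OF \<Xi>G] G by (auto simp: space_measure_of_conv)
  have "prob_space (PiM {..<m} (\<lambda>_. gauss (T / real m) :: (real^'d) measure))"
    using \<tau> by (intro prob_space_PiM prob_space_gauss)
  then interpret P: prob_space "PiM {..<m} (\<lambda>_. gauss (T / real m) :: (real^'d) measure)" .
  interpret Z: prob_space "distr M borel Z" by (rule prob_space_distr) simp
  have setsP: "sets (PiM {..<m} (\<lambda>_. gauss (T / real m) :: (real^'d) measure)) = sets ?P" by (rule sets_PiM_cong) simp_all
  have joint: "distr M borel Z \<Otimes>\<^sub>M PiM {..<m} (\<lambda>_. gauss (T / real m)) = distr M (borel \<Otimes>\<^sub>M ?P) (\<lambda>\<omega>. (Z \<omega>, ?\<Xi> \<omega>))"
  proof (rule pair_measure_eqI)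
    fix A C assume "A \<in> sets (distr M borel Z)" "C \<in> sets (PiM {..<m} (\<lambda>_. gauss (T / real m) :: (real^'d) measure))"
    then have AC: "A \<in> sets borel" "C \<in> sets ?P" using setsP by simp_all
    have "?\<Xi> -` C \<inter> space M \<in> sigma_sets (space M) G" using sub AC by auto
    then have "prob ((Z -` A \<inter> space M) \<inter> (?\<Xi> -` C \<inter> space M)) = prob (Z -` A \<inter> space M) * prob (?\<Xi> -` C \<inter> space M)"
      using ind AC unfolding G_def[symmetric] by (intro indep_setD) auto
    moreover have "(\<lambda>\<omega>. (Z \<omega>, ?\<Xi> \<omega>)) -` (A \<times> C) \<inter> space M = (Z -` A \<inter> space M) \<inter> (?\<Xi> -` C \<inter> space M)" by auto
    moreover have "emeasure (PiM {..<m} (\<lambda>_. gauss (T / real m))) C = emeasure M (?\<Xi> -` C \<inter> space M)"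
      unfolding distr_brownian_increments[OF B \<tau> m, symmetric] using AC by (subst emeasure_distr) simp_all
    ultimately show "emeasure (distr M borel Z) A * emeasure (PiM {..<m} (\<lambda>_. gauss (T / real m))) C
        = emeasure (distr M (borel \<Otimes>\<^sub>M ?P) (\<lambda>\<omega>. (Z \<omega>, ?\<Xi> \<omega>))) (A \<times> C)"
      using AC by (simp add: emeasure_distr emeasure_eq_measure ennreal_mult)
  next
    show "sets (distr M borel Z \<Otimes>\<^sub>M PiM {..<m} (\<lambda>_. gauss (T / real m) :: (real^'d) measure)) = sets (distr M (borel \<Otimes>\<^sub>M ?P) (\<lambda>\<omega>. (Z \<omega>, ?\<Xi> \<omega>)))"
      using setsP by (simp cong: sets_pair_measure_cong)
  qed unfold_locales
  have mc: "(\<lambda>p. euler_chain F S (T / real m) (\<lambda>i. snd p i) (fst p) m) \<in> borel_measurable (borel \<Otimes>\<^sub>M ?P)"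
    by (rule euler_chain_measurable) simp_all
  then have hc: "(\<lambda>p. h (euler_chain F S (T / real m) (snd p) (fst p) m)) \<in> borel_measurable (borel \<Otimes>\<^sub>M ?P)"
    using measurable_compose[OF _ h] by simp
  have "(\<integral>\<^sup>+\<omega>. h (euler F S T m (\<lambda>t. B t \<omega>) (Z \<omega>)) \<partial>M)
      = (\<integral>\<^sup>+p. h (euler_chain F S (T / real m) (snd p) (fst p) m) \<partial>distr M (borel \<Otimes>\<^sub>M ?P) (\<lambda>\<omega>. (Z \<omega>, ?\<Xi> \<omega>)))"
    using hc by (subst nn_integral_distr) (simp_all add: euler_eq_chain[OF m])
  also have "\<dots> = (\<integral>\<^sup>+z. \<integral>\<^sup>+\<xi>. h (euler_chain F S (T / real m) \<xi> z m) \<partial>PiM {..<m} (\<lambda>_. gauss (T / real m)) \<partial>distr M borel Z)"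
    unfolding joint[symmetric]
    using hc setsP by (subst P.nn_integral_fst[symmetric]) (simp_all cong: measurable_cong_sets sets_pair_measure_cong)
  also have "\<dots> = (\<integral>\<^sup>+z. (euler_op F S (T / real m) ^^ m) h z \<partial>distr M borel Z)"
    using \<tau> by (intro nn_integral_cong nn_integral_PiM_euler_chain) simp_all
  finally show ?thesis .
qed

end

text \<open>The transition kernel of the diffusion at time \<open>T\<close>, realised on one fixed
  Brownian motion; \<open>distr_flow_eq_bind\<close> shows that it also describes solutions driven
  by any other one.\<close>

definition flow_law :: "('e::euclidean_space \<Rightarrow> 'e) \<Rightarrow> (real^'d \<Rightarrow> 'e) \<Rightarrow> 'a measure \<Rightarrow> (real \<Rightarrow> 'a \<Rightarrow> real^'d) \<Rightarrow> real \<Rightarrow> 'e \<Rightarrow> 'e measure" where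
  "flow_law F S M B T z = distr M borel (\<lambda>\<omega>. flow F S T (\<lambda>t. B t \<omega>) z)"

context euler_noise
begin

lemma flow_tendsto_brownian:
  assumes "brownian_motion M B" "0 \<le> T" "\<omega> \<in> space M"
  shows "(\<lambda>m. euler F S T m (\<lambda>t. B t \<omega>) z) \<longlonglongrightarrow> flow F S T (\<lambda>t. B t \<omega>) z"
  using assms by (intro euler_tendsto_flow brownian_motion_path) (auto simp: brownian_motion_path)

lemma flow_brownian_measurable:
  assumes "brownian_motion M B" "0 \<le> T" "Z \<in> borel_measurable M"
  shows "(\<lambda>\<omega>. flow F S T (\<lambda>t. B t \<omega>) (Z \<omega>)) \<in> borel_measurable M"
  using assms by (intro flow_measurable) (auto simp: brownian_motion_path brownian_motion_measurable)

lemma flow_brownian_measurable_pair: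
  assumes B: "brownian_motion M B" and T: "0 \<le> T"
  shows "(\<lambda>p. flow F S T (\<lambda>t. B t (snd p)) (fst p)) \<in> borel_measurable (borel \<Otimes>\<^sub>M M)"
proof (rule flow_measurable[OF T])
  show "(\<lambda>p. B t (snd p)) \<in> borel_measurable (borel \<Otimes>\<^sub>M M)" for t
    by (rule measurable_compose[OF measurable_snd brownian_motion_measurable[OF B]])
qed (auto simp: brownian_motion_path[OF B] space_pair_measure)

lemma flow_law_kernel:
  assumes B: "brownian_motion M B" and T: "0 \<le> T"
  shows "flow_law F S M B T \<in> borel \<rightarrow>\<^sub>M prob_algebra borel"
  unfolding flow_law_def
proof (rule measurable_distr_prob_space2[where M=M])
  have "prob_space M" using B by (rule brownian_motion_prob_space)
  then show "(\<lambda>x. M) \<in> borel \<rightarrow>\<^sub>M prob_algebra M" by (simp add: space_prob_algebra)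
qed (use flow_brownian_measurable_pair[OF B T] in \<open>simp add: case_prod_beta'\<close>)

lemma flow_law_prob_space:
  assumes B: "brownian_motion M B" and T: "0 \<le> T"
  shows "prob_space (flow_law F S M B T z)" "sets (flow_law F S M B T z) = sets borel"
proof -
  interpret prob_space M using B by (rule brownian_motion_prob_space)
  show "prob_space (flow_law F S M B T z)"
    unfolding flow_law_def using flow_brownian_measurable[OF B T, of "\<lambda>_. z"] by (intro prob_space_distr) simp
qed (simp add: flow_law_def)

lemma nn_integral_flow_law:
  assumes B: "brownian_motion M B" and T: "0 \<le> T" and h: "h \<in> borel_measurable borel"
  shows "(\<integral>\<^sup>+x. h x \<partial>flow_law F S M B T z) = (\<integral>\<^sup>+\<omega>. h (flow F S T (\<lambda>t. B t \<omega>) z) \<partial>M)"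
  unfolding flow_law_def using flow_brownian_measurable[OF B T, of "\<lambda>_. z"] h by (intro nn_integral_distr) simp_all

lemma nn_integral_euler_tendsto:
  fixes h :: "'e \<Rightarrow> real"
  assumes B: "brownian_motion M B" and T: "0 \<le> T" and Z: "Z \<in> borel_measurable M"
    and h: "continuous_on UNIV h" "\<And>x. h x \<le> 1"
  shows "(\<lambda>m. \<integral>\<^sup>+\<omega>. ennreal (h (euler F S T m (\<lambda>t. B t \<omega>) (Z \<omega>))) \<partial>M)
     \<longlonglongrightarrow> (\<integral>\<^sup>+\<omega>. ennreal (h (flow F S T (\<lambda>t. B t \<omega>) (Z \<omega>))) \<partial>M)"
proof -
  interpret prob_space M using B by (rule brownian_motion_prob_space)
  have hm: "h \<in> borel_measurable borel" using h(1) by (rule borel_measurable_continuous_onI)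
  show ?thesis
  proof (rule nn_integral_dominated_convergence[where w="\<lambda>_. 1"])
    show "(\<lambda>\<omega>. ennreal (h (euler F S T m (\<lambda>t. B t \<omega>) (Z \<omega>)))) \<in> borel_measurable M" for m
      using measurable_compose[OF euler_measurable[OF Z brownian_motion_measurable[OF B]] hm] by simp
    show "(\<lambda>\<omega>. ennreal (h (flow F S T (\<lambda>t. B t \<omega>) (Z \<omega>)))) \<in> borel_measurable M"
      using measurable_compose[OF flow_brownian_measurable[OF B T Z] hm] by simp
    show "AE \<omega> in M. (\<lambda>m. ennreal (h (euler F S T m (\<lambda>t. B t \<omega>) (Z \<omega>)))) \<longlonglongrightarrow> ennreal (h (flow F S T (\<lambda>t. B t \<omega>) (Z \<omega>)))"
    proof (rule AE_I2)
      fix \<omega> assume "\<omega> \<in> space M"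
      from flow_tendsto_brownian[OF B T this] h(1)
      show "(\<lambda>m. ennreal (h (euler F S T m (\<lambda>t. B t \<omega>) (Z \<omega>)))) \<longlonglongrightarrow> ennreal (h (flow F S T (\<lambda>t. B t \<omega>) (Z \<omega>)))"
        by (intro tendsto_ennrealI) (auto intro: continuous_on_tendsto_compose)
    qed
  qed (use h(2) in \<open>simp_all add: emeasure_space_1\<close>)
qed

lemma euler_op_tendsto_flow:
  fixes h :: "'e \<Rightarrow> real"
  assumes B: "brownian_motion M B" and T: "0 < T"
    and h: "continuous_on UNIV h" "\<And>x. h x \<le> 1"
  shows "(\<lambda>m. (euler_op F S (T / real m) ^^ m) (\<lambda>x. ennreal (h x)) z)
     \<longlonglongrightarrow> (\<integral>\<^sup>+\<omega>. ennreal (h (flow F S T (\<lambda>t. B t \<omega>) z)) \<partial>M)"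
proof (rule Lim_transform_eventually)
  show "(\<lambda>m. \<integral>\<^sup>+\<omega>. ennreal (h (euler F S T m (\<lambda>t. B t \<omega>) z)) \<partial>M)
     \<longlonglongrightarrow> (\<integral>\<^sup>+\<omega>. ennreal (h (flow F S T (\<lambda>t. B t \<omega>) z)) \<partial>M)"
    using nn_integral_euler_tendsto[OF B _ _ h, of T "\<lambda>_. z"] T by simp
  have hm: "h \<in> borel_measurable borel" using h(1) by (rule borel_measurable_continuous_onI)
  show "\<forall>\<^sub>F m in sequentially. (\<integral>\<^sup>+\<omega>. ennreal (h (euler F S T m (\<lambda>t. B t \<omega>) z)) \<partial>M) = (euler_op F S (T / real m) ^^ m) (\<lambda>x. ennreal (h x)) z"
    using eventually_gt_at_top[of "0::nat"]
  proof eventually_elim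
    case (elim m)
    then show ?case using hm by (intro nn_integral_euler[OF B T]) simp_all
  qed
qed

lemma lipschitz_continuous_on:
  fixes h :: "'e \<Rightarrow> real"
  assumes "\<And>x y. \<bar>h x - h y\<bar> \<le> L * dist x y"
  shows "continuous_on A h"
proof (rule continuous_onI)
  fix x and e :: real assume e: "0 < e"
  define L' where "L' = max L 0 + 1"
  have L': "0 < L'" "L \<le> L'" by (simp_all add: L'_def)
  show "\<exists>d>0. \<forall>x'\<in>A. dist x' x < d \<longrightarrow> dist (h x') (h x) \<le> e"
  proof (intro exI[of _ "e / L'"] conjI ballI impI)
    fix x' assume "dist x' x < e / L'"
    then have "L' * dist x' x \<le> e" using L' by (simp add: field_simps)
    moreover have "L * dist x' x \<le> L' * dist x' x" using L' by (intro mult_right_mono) simp_all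
    ultimately show "dist (h x') (h x) \<le> e" using assms[of x' x] by (simp add: dist_real_def)
  qed (use e L' in simp)
qed

text \<open>\<open>M\<close> carries the kernel and \<open>M'\<close> the solution; they are
  unrelated. Both sides are limits of integrals of the same iterated \<open>euler_op\<close>,
  evaluated at a random starting point on \<open>M'\<close> and at fixed ones on
  \<open>M\<close>.\<close>

lemma distr_flow_eq_bind:
  assumes B: "brownian_motion M B" and B': "brownian_motion M' B'" and T: "0 < T"
    and Z[measurable]: "Z \<in> borel_measurable M'" and Y[measurable]: "Y \<in> borel_measurable M'"
    and ind: "prob_space.indep_set M' (sigma_sets (space M') {Z -` A \<inter> space M' | A. A \<in> sets borel})
        (sigma_sets (space M') {(\<lambda>\<omega>. B' r \<omega>) -` A \<inter> space M' | r A. A \<in> sets borel})"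
    and eq: "\<And>\<omega>. \<omega> \<in> space M' \<Longrightarrow> Y \<omega> = flow F S T (\<lambda>t. B' t \<omega>) (Z \<omega>)"
  shows "distr M' borel Y = distr M' borel Z \<bind> flow_law F S M B T"
proof (rule prob_measure_eqI_lipschitz)
  interpret M': prob_space M' using B' by (rule brownian_motion_prob_space)
  interpret Z: prob_space "distr M' borel Z" by (rule M'.prob_space_distr) simp
  have ker: "flow_law F S M B T \<in> distr M' borel Z \<rightarrow>\<^sub>M prob_algebra borel"
    using flow_law_kernel[OF B, of T] T by simp
  then have ker': "flow_law F S M B T \<in> distr M' borel Z \<rightarrow>\<^sub>M subprob_algebra borel" by (rule measurable_prob_algebraD)
  show "prob_space (distr M' borel Y)" by (rule M'.prob_space_distr) simp
  show "prob_space (distr M' borel Z \<bind> flow_law F S M B T)"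
    using ker' flow_law_prob_space[OF B] T by (intro Z.prob_space_bind) auto
  show "sets (distr M' borel Z \<bind> flow_law F S M B T) = sets borel"
    using ker' by (subst sets_bind[where N=borel]) (auto simp: sets_kernel)
  fix h :: "'e \<Rightarrow> real" and L
  assume h: "\<And>x. 0 \<le> h x" "\<And>x. h x \<le> 1" "\<And>x y. \<bar>h x - h y\<bar> \<le> L * dist x y"
  have hc: "continuous_on UNIV h" using h(3) by (rule lipschitz_continuous_on)
  then have hm[measurable]: "h \<in> borel_measurable borel" by (rule borel_measurable_continuous_onI)
  let ?H = "\<lambda>x. ennreal (h x)"
  have "(\<lambda>m. \<integral>\<^sup>+\<omega>. ?H (euler F S T m (\<lambda>t. B' t \<omega>) (Z \<omega>)) \<partial>M') \<longlonglongrightarrow> (\<integral>\<^sup>+\<omega>. ?H (flow F S T (\<lambda>t. B' t \<omega>) (Z \<omega>)) \<partial>M')"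
    using T by (intro nn_integral_euler_tendsto[OF B' _ Z hc h(2)]) simp
  also have "(\<integral>\<^sup>+\<omega>. ?H (flow F S T (\<lambda>t. B' t \<omega>) (Z \<omega>)) \<partial>M') = (\<integral>\<^sup>+x. ?H x \<partial>distr M' borel Y)"
    by (subst nn_integral_distr) (auto simp: eq intro!: nn_integral_cong)
  finally have lim1: "(\<lambda>m. \<integral>\<^sup>+\<omega>. ?H (euler F S T m (\<lambda>t. B' t \<omega>) (Z \<omega>)) \<partial>M') \<longlonglongrightarrow> (\<integral>\<^sup>+x. ?H x \<partial>distr M' borel Y)" .
  have op_eq: "(euler_op F S (T / real m) ^^ m) ?H z = (\<integral>\<^sup>+\<omega>. ?H (euler F S T m (\<lambda>t. B t \<omega>) z) \<partial>M)" if "0 < m" for m z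
    using that by (intro nn_integral_euler[OF B T, symmetric]) simp_all
  have op_meas: "(euler_op F S (T / real m) ^^ k) ?H \<in> borel_measurable borel" if "0 < m" for m k
  proof (induction k)
    case (Suc k)
    then show ?case using T that by (auto intro!: euler_op_measurable)
  qed simp
  interpret M: prob_space M using B by (rule brownian_motion_prob_space)
  \<comment> \<open>The index 0 is set to 0 because measurability and the bound of the operator are
    known for positive \<open>m\<close>; the limit does not see it.\<close>
  have "(\<lambda>m. \<integral>\<^sup>+z. (if m = 0 then 0 else (euler_op F S (T / real m) ^^ m) ?H z) \<partial>distr M' borel Z) \<longlonglongrightarrow> (\<integral>\<^sup>+z. \<integral>\<^sup>+x. ?H x \<partial>flow_law F S M B T z \<partial>distr M' borel Z)"
  proof (rule nn_integral_dominated_convergence[where w="\<lambda>_. 1"])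
    show "(\<lambda>z. if m = 0 then 0 else (euler_op F S (T / real m) ^^ m) ?H z) \<in> borel_measurable (distr M' borel Z)" for m
      using op_meas[of m m] by (cases "m = 0") simp_all
    show "(\<lambda>z. \<integral>\<^sup>+x. ?H x \<partial>flow_law F S M B T z) \<in> borel_measurable (distr M' borel Z)"
      using ker' by (intro nn_integral_measurable_subprob_algebra2[where N=borel]) simp_all
    show "AE z in distr M' borel Z. (if m = 0 then 0 else (euler_op F S (T / real m) ^^ m) ?H z) \<le> 1" for m
    proof (rule AE_I2)
      fix z
      have "(\<integral>\<^sup>+\<omega>. ?H (euler F S T m (\<lambda>t. B t \<omega>) z) \<partial>M) \<le> (\<integral>\<^sup>+\<omega>. 1 \<partial>M)"
        using h(2) by (intro nn_integral_mono) simp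
      then show "(if m = 0 then 0 else (euler_op F S (T / real m) ^^ m) ?H z) \<le> 1"
        by (simp add: op_eq M.emeasure_space_1)
    qed
    show "AE z in distr M' borel Z. (\<lambda>m. if m = 0 then 0 else (euler_op F S (T / real m) ^^ m) ?H z) \<longlonglongrightarrow> (\<integral>\<^sup>+x. ?H x \<partial>flow_law F S M B T z)"
    proof (rule AE_I2)
      fix z
      have "(\<lambda>m. (euler_op F S (T / real m) ^^ m) ?H z) \<longlonglongrightarrow> (\<integral>\<^sup>+x. ?H x \<partial>flow_law F S M B T z)"
        using euler_op_tendsto_flow[OF B T hc h(2)] T by (simp add: nn_integral_flow_law[OF B])
      moreover have "\<forall>\<^sub>F m in sequentially. (euler_op F S (T / real m) ^^ m) ?H z = (if m = 0 then 0 else (euler_op F S (T / real m) ^^ m) ?H z)"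
        using eventually_gt_at_top[of "0::nat"] by eventually_elim simp
      ultimately show "(\<lambda>m. if m = 0 then 0 else (euler_op F S (T / real m) ^^ m) ?H z) \<longlonglongrightarrow> (\<integral>\<^sup>+x. ?H x \<partial>flow_law F S M B T z)"
        by (rule Lim_transform_eventually)
    qed
  qed (use Z.emeasure_space_1 in simp_all)
  moreover have "\<forall>\<^sub>F m in sequentially. (\<integral>\<^sup>+z. (if m = 0 then 0 else (euler_op F S (T / real m) ^^ m) ?H z) \<partial>distr M' borel Z)
      = (\<integral>\<^sup>+\<omega>. ?H (euler F S T m (\<lambda>t. B' t \<omega>) (Z \<omega>)) \<partial>M')"
    using eventually_gt_at_top[of "0::nat"]
  proof eventually_elim
    case (elim m)
    then show ?case using nn_integral_euler_random[OF B' T elim, of ?H Z] ind by simp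
  qed
  ultimately have "(\<lambda>m. \<integral>\<^sup>+\<omega>. ?H (euler F S T m (\<lambda>t. B' t \<omega>) (Z \<omega>)) \<partial>M') \<longlonglongrightarrow> (\<integral>\<^sup>+z. \<integral>\<^sup>+x. ?H x \<partial>flow_law F S M B T z \<partial>distr M' borel Z)"
    by (rule Lim_transform_eventually)
  with lim1 have "(\<integral>\<^sup>+x. ?H x \<partial>distr M' borel Y) = (\<integral>\<^sup>+z. \<integral>\<^sup>+x. ?H x \<partial>flow_law F S M B T z \<partial>distr M' borel Z)"
    by (rule LIMSEQ_unique)
  also have "\<dots> = (\<integral>\<^sup>+x. ?H x \<partial>(distr M' borel Z \<bind> flow_law F S M B T))"
    using ker' by (intro nn_integral_bind[symmetric, where B=borel]) simp_all
  finally show "(\<integral>\<^sup>+x. ?H x \<partial>distr M' borel Y) = (\<integral>\<^sup>+x. ?H x \<partial>(distr M' borel Z \<bind> flow_law F S M B T))" .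
qed simp

section \<open>Rotation invariance and semigroup property of the transition kernel\<close>

lemma euler_noise_orthogonal:
  fixes Q :: "real^'d \<Rightarrow> real^'d"
  assumes Q: "orthogonal_transformation Q"
  shows "euler_noise F (\<lambda>x. S (Q x)) K s"
proof -
  have "linear (\<lambda>x. S (Q x))"
    using linear_compose[OF orthogonal_transformation_linear[OF Q] S_linear] by (simp add: comp_def)
  moreover have "norm (S (Q b)) \<le> s * norm b" for b
    using S_bound[of "Q b"] orthogonal_transformation_norm[OF Q] by simp
  ultimately show ?thesis
    unfolding euler_noise_def lipschitz_field_def using F_lipschitz K_nonneg s_nonneg by blast
qed

text \<open>Equality holds exactly for every Euler chain, step by step, and is inherited by the
  limit. Applied to a reflection, it shows that the reflected flow follows the same kernel.\<close>

lemma flow_law_orthogonal: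
  fixes Q :: "real^'d \<Rightarrow> real^'d"
  assumes B: "brownian_motion M B" and T: "0 < T" and Q: "orthogonal_transformation Q"
  shows "flow_law F (\<lambda>x. S (Q x)) M B T z = flow_law F S M B T z"
proof (rule prob_measure_eqI_lipschitz)
  interpret Q: euler_noise F "\<lambda>x. S (Q x)" K s by (rule euler_noise_orthogonal[OF Q])
  show "prob_space (flow_law F (\<lambda>x. S (Q x)) M B T z)" "sets (flow_law F (\<lambda>x. S (Q x)) M B T z) = sets borel"
    "prob_space (flow_law F S M B T z)" "sets (flow_law F S M B T z) = sets borel"
    using Q.flow_law_prob_space[OF B] flow_law_prob_space[OF B] T by simp_all
  fix h :: "'e \<Rightarrow> real" and L
  assume h: "\<And>x. 0 \<le> h x" "\<And>x. h x \<le> 1" "\<And>x y. \<bar>h x - h y\<bar> \<le> L * dist x y"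
  have hc: "continuous_on UNIV h" using h(3) by (rule lipschitz_continuous_on)
  then have hm[measurable]: "h \<in> borel_measurable borel" by (rule borel_measurable_continuous_onI)
  let ?H = "\<lambda>x. ennreal (h x)"
  have op: "(euler_op F (\<lambda>x. S (Q x)) \<tau> ^^ k) ?H = (euler_op F S \<tau> ^^ k) ?H \<and> (euler_op F S \<tau> ^^ k) ?H \<in> borel_measurable borel" if "0 < \<tau>" for k \<tau>
  proof (induction k)
    case (Suc k)
    then show ?case using that euler_op_orthogonal[OF Q S_measurable] by (auto intro!: euler_op_measurable)
  qed simp
  have l1: "(\<lambda>m. (euler_op F S (T / real m) ^^ m) ?H z) \<longlonglongrightarrow> (\<integral>\<^sup>+x. ?H x \<partial>flow_law F S M B T z)"
    using euler_op_tendsto_flow[OF B T hc h(2)] T by (simp add: nn_integral_flow_law[OF B])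
  have l2: "(\<lambda>m. (euler_op F (\<lambda>x. S (Q x)) (T / real m) ^^ m) ?H z) \<longlonglongrightarrow> (\<integral>\<^sup>+x. ?H x \<partial>flow_law F (\<lambda>x. S (Q x)) M B T z)"
    using Q.euler_op_tendsto_flow[OF B T hc h(2)] T by (simp add: Q.nn_integral_flow_law[OF B])
  have ev: "\<forall>\<^sub>F m in sequentially. (euler_op F (\<lambda>x. S (Q x)) (T / real m) ^^ m) ?H z = (euler_op F S (T / real m) ^^ m) ?H z"
    using eventually_gt_at_top[of "0::nat"]
  proof eventually_elim
    case (elim m)
    then show ?case using op[of "T / real m" m] T by simp
  qed
  from l1 Lim_transform_eventually[OF l2 ev]
  show "(\<integral>\<^sup>+x. ?H x \<partial>flow_law F (\<lambda>x. S (Q x)) M B T z) = (\<integral>\<^sup>+x. ?H x \<partial>flow_law F S M B T z)"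
    by (rule LIMSEQ_unique[symmetric])
qed

lemma flow_zero:
  assumes "b 0 = 0"
  shows "flow F S 0 b z = z"
  using flow_eq_solution[of 0 b "\<lambda>_. z"] assms by (simp add: linear_0[OF S_linear])

text \<open>Chapman-Kolmogorov at multiples of \<open>T\<close>, obtained from
  \<open>euler_op\<close>: with a common step \<open>T / real m\<close>, N m steps followed by m
  steps are (N + 1) m steps. In the limit both the operator and its argument vary, which the uniform
  Lipschitz bound on \<Psi> handles.\<close>

lemma flow_law_semigroup:
  fixes B :: "real \<Rightarrow> 'a \<Rightarrow> real^'d"
  assumes B: "brownian_motion M B" and T: "0 < T" and N: "0 < N"
  shows "flow_law F S M B (real (Suc N) * T) z = flow_law F S M B (real N * T) z \<bind> flow_law F S M B T"
proof (rule prob_measure_eqI_lipschitz)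
  interpret M: prob_space M using B by (rule brownian_motion_prob_space)
  have T0: "0 \<le> T" "0 \<le> real N * T" "0 \<le> real (Suc N) * T" "0 < real N * T" "0 < real (Suc N) * T"
    using T N by simp_all
  interpret P: prob_space "flow_law F S M B (real N * T) z" using flow_law_prob_space[OF B] T0 by simp
  have sets: "sets (flow_law F S M B (real N * T) z) = sets borel" using flow_law_prob_space[OF B] T0 by simp
  have ker: "flow_law F S M B T \<in> flow_law F S M B (real N * T) z \<rightarrow>\<^sub>M subprob_algebra borel"
    using measurable_prob_algebraD[OF flow_law_kernel[OF B T0(1)]] sets by (simp cong: measurable_cong_sets)
  show "prob_space (flow_law F S M B (real (Suc N) * T) z)" "sets (flow_law F S M B (real (Suc N) * T) z) = sets borel"
    using flow_law_prob_space[OF B] T0 by blast+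
  show "prob_space (flow_law F S M B (real N * T) z \<bind> flow_law F S M B T)"
    using ker flow_law_prob_space[OF B] T0 by (intro P.prob_space_bind) auto
  show "sets (flow_law F S M B (real N * T) z \<bind> flow_law F S M B T) = sets borel"
    using ker P.not_empty by (subst sets_bind[where N=borel]) (auto simp: sets_kernel)
  fix \<phi> :: "'e \<Rightarrow> real" and L
  assume h: "\<And>x. 0 \<le> \<phi> x" "\<And>x. \<phi> x \<le> 1" "\<And>x y. \<bar>\<phi> x - \<phi> y\<bar> \<le> L * dist x y"
  have hc: "continuous_on UNIV \<phi>" using h(3) by (rule lipschitz_continuous_on)
  then have hm[measurable]: "\<phi> \<in> borel_measurable borel" by (rule borel_measurable_continuous_onI)
  have L: "0 \<le> L" using h(3)[of 0 "SOME b. b \<in> Basis"] by (smt (verit) SOME_Basis dist_0_norm mult_neg_pos norm_Basis zero_less_one)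
  let ?H = "\<lambda>x. ennreal (\<phi> x)"
  define \<Psi> where "\<Psi> m x = (\<integral>\<omega>. \<phi> (euler F S T m (\<lambda>t. B t \<omega>) x) \<partial>M)" for m x
  define \<Psi>' where "\<Psi>' x = (\<integral>\<omega>. \<phi> (flow F S T (\<lambda>t. B t \<omega>) x) \<partial>M)" for x
  have [measurable]: "(\<lambda>\<omega>. euler F S T m (\<lambda>t. B t \<omega>) x) \<in> borel_measurable M" for m x
    using euler_measurable[OF _ brownian_motion_measurable[OF B], of "\<lambda>_. x"] by simp
  have [measurable]: "(\<lambda>\<omega>. flow F S T (\<lambda>t. B t \<omega>) x) \<in> borel_measurable M" for x
    using flow_brownian_measurable[OF B T0(1), of "\<lambda>_. x"] by simp
  have int: "integrable M (\<lambda>\<omega>. \<phi> (euler F S T m (\<lambda>t. B t \<omega>) x))" for m x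
    using h by (intro M.integrable_const_bound[of _ 1]) auto
  have int': "integrable M (\<lambda>\<omega>. \<phi> (flow F S T (\<lambda>t. B t \<omega>) x))" for x
    using h by (intro M.integrable_const_bound[of _ 1]) auto
  have \<Psi>_op: "(\<lambda>x. ennreal (\<Psi> m x)) = (euler_op F S (T / real m) ^^ m) ?H" if "0 < m" for m
    using h(1) int that nn_integral_euler[OF B T that, of ?H]
    by (simp add: \<Psi>_def fun_eq_iff nn_integral_eq_integral)
  have \<Psi>_lim: "(\<lambda>m. \<Psi> m x) \<longlonglongrightarrow> \<Psi>' x" for x
    unfolding \<Psi>_def \<Psi>'_def
  proof (rule integral_dominated_convergence[where w="\<lambda>_. 1"])
    show "AE \<omega> in M. (\<lambda>m. \<phi> (euler F S T m (\<lambda>t. B t \<omega>) x)) \<longlonglongrightarrow> \<phi> (flow F S T (\<lambda>t. B t \<omega>) x)"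
    proof (rule AE_I2)
      fix \<omega> assume "\<omega> \<in> space M"
      from flow_tendsto_brownian[OF B T0(1) this] hc
      show "(\<lambda>m. \<phi> (euler F S T m (\<lambda>t. B t \<omega>) x)) \<longlonglongrightarrow> \<phi> (flow F S T (\<lambda>t. B t \<omega>) x)"
        by (auto intro: continuous_on_tendsto_compose)
    qed
  qed (use h in simp_all)
  \<comment> \<open>Euler chains are Lipschitz in the starting point with a constant independent of
    the number of steps, hence so are the functions \<open>\<Psi> m\<close> for positive
    \<open>m\<close>.\<close>
  define L' where "L' = L * exp (K * T)"
  have \<Psi>_le: "\<Psi> m x \<le> \<Psi> m y + L' * dist x y" if "0 < m" for m x y
  proof -
    have "\<Psi> m x \<le> (\<integral>\<omega>. \<phi> (euler F S T m (\<lambda>t. B t \<omega>) y) + L' * dist x y \<partial>M)"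
      unfolding \<Psi>_def
    proof (rule integral_mono[OF int])
      fix \<omega> assume "\<omega> \<in> space M"
      have "dist (euler F S T m (\<lambda>t. B t \<omega>) x) (euler F S T m (\<lambda>t. B t \<omega>) y) \<le> exp (K * T) * dist x y"
        using euler_chain_lipschitz[of "T / real m" "increments (T / real m) (\<lambda>t. B t \<omega>)" x m y] T0(1) that
        by (simp add: euler_def dist_norm)
      from mult_left_mono[OF this L] h(3)[of "euler F S T m (\<lambda>t. B t \<omega>) x" "euler F S T m (\<lambda>t. B t \<omega>) y"]
      show "\<phi> (euler F S T m (\<lambda>t. B t \<omega>) x) \<le> \<phi> (euler F S T m (\<lambda>t. B t \<omega>) y) + L' * dist x y"
        by (simp add: L'_def mult.assoc)
    qed (use int in simp)
    also have "\<dots> = \<Psi> m y + L' * dist x y" using int by (simp add: \<Psi>_def M.prob_space)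
    finally show ?thesis .
  qed
  have \<Psi>_lip: "\<bar>\<Psi> m x - \<Psi> m y\<bar> \<le> L' * dist x y" if "0 < m" for m x y
    using \<Psi>_le[OF that, of x y] \<Psi>_le[OF that, of y x] by (simp add: abs_le_iff dist_commute)
  have \<Psi>'_lip: "\<bar>\<Psi>' x - \<Psi>' y\<bar> \<le> L' * dist x y" for x y
  proof (rule tendsto_upperbound)
    show "(\<lambda>m. \<bar>\<Psi> m x - \<Psi> m y\<bar>) \<longlonglongrightarrow> \<bar>\<Psi>' x - \<Psi>' y\<bar>" by (intro tendsto_intros \<Psi>_lim)
    show "\<forall>\<^sub>F m in sequentially. \<bar>\<Psi> m x - \<Psi> m y\<bar> \<le> L' * dist x y"
      using eventually_gt_at_top[of "0::nat"] by eventually_elim (rule \<Psi>_lip)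
  qed simp
  have \<Psi>'m[measurable]: "\<Psi>' \<in> borel_measurable borel"
    by (intro borel_measurable_continuous_onI lipschitz_continuous_on[OF \<Psi>'_lip])
  have \<Psi>m: "\<Psi> m \<in> borel_measurable borel" if "0 < m" for m
    by (intro borel_measurable_continuous_onI lipschitz_continuous_on[OF \<Psi>_lip[OF that]])
  have \<Psi>01: "0 \<le> \<Psi> m x" "\<Psi> m x \<le> 1" for m x
    using h int unfolding \<Psi>_def by (auto intro!: integral_nonneg_AE M.integral_le_const)
  let ?e = "\<lambda>m \<omega>. euler F S (real N * T) (N * m) (\<lambda>t. B t \<omega>) z"
  let ?f = "\<lambda>\<omega>. flow F S (real N * T) (\<lambda>t. B t \<omega>) z"
  have em[measurable]: "(\<lambda>\<omega>. ?e m \<omega>) \<in> borel_measurable M" for m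
    using euler_measurable[OF _ brownian_motion_measurable[OF B], of "\<lambda>_. z"] by simp
  have fm[measurable]: "?f \<in> borel_measurable M"
    using flow_brownian_measurable[OF B T0(2), of "\<lambda>_. z"] by simp
  have sub: "strict_mono (\<lambda>m. k * m)" if "0 < k" for k :: nat using that by (simp add: strict_mono_def)
  have "(\<lambda>m. \<integral>\<^sup>+\<omega>. (if m = 0 then 0 else ennreal (\<Psi> m (?e m \<omega>))) \<partial>M) \<longlonglongrightarrow> (\<integral>\<^sup>+\<omega>. ennreal (\<Psi>' (?f \<omega>)) \<partial>M)"
  proof (rule nn_integral_dominated_convergence[where w="\<lambda>_. 1"])
    show "(\<lambda>\<omega>. if m = 0 then 0 else ennreal (\<Psi> m (?e m \<omega>))) \<in> borel_measurable M" for m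
      using \<Psi>m[of m] by (cases "m = 0") simp_all
    show "AE \<omega> in M. (\<lambda>m. if m = 0 then 0 else ennreal (\<Psi> m (?e m \<omega>))) \<longlonglongrightarrow> ennreal (\<Psi>' (?f \<omega>))"
    proof (rule AE_I2)
      fix \<omega> assume \<omega>: "\<omega> \<in> space M"
      have e: "(\<lambda>m. ?e m \<omega>) \<longlonglongrightarrow> ?f \<omega>"
        using LIMSEQ_subseq_LIMSEQ[OF flow_tendsto_brownian[OF B T0(2) \<omega>] sub[OF N]] by (simp add: comp_def)
      have "(\<lambda>m. L' * dist (?e m \<omega>) (?f \<omega>) + \<bar>\<Psi> m (?f \<omega>) - \<Psi>' (?f \<omega>)\<bar>) \<longlonglongrightarrow> L' * dist (?f \<omega>) (?f \<omega>) + \<bar>\<Psi>' (?f \<omega>) - \<Psi>' (?f \<omega>)\<bar>"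
        by (intro tendsto_intros e \<Psi>_lim)
      then have z: "(\<lambda>m. L' * dist (?e m \<omega>) (?f \<omega>) + \<bar>\<Psi> m (?f \<omega>) - \<Psi>' (?f \<omega>)\<bar>) \<longlonglongrightarrow> 0" by simp
      have "(\<lambda>m. \<Psi> m (?e m \<omega>)) \<longlonglongrightarrow> \<Psi>' (?f \<omega>)"
      proof (rule LIM_zero_cancel, rule Lim_null_comparison[OF _ z])
        show "\<forall>\<^sub>F m in sequentially. norm (\<Psi> m (?e m \<omega>) - \<Psi>' (?f \<omega>)) \<le> L' * dist (?e m \<omega>) (?f \<omega>) + \<bar>\<Psi> m (?f \<omega>) - \<Psi>' (?f \<omega>)\<bar>"
          using eventually_gt_at_top[of "0::nat"]
        proof eventually_elim
          case (elim m)
          show ?case using \<Psi>_lip[OF elim, of "?e m \<omega>" "?f \<omega>"] unfolding real_norm_def by linarith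
        qed
      qed
      then have "(\<lambda>m. ennreal (\<Psi> m (?e m \<omega>))) \<longlonglongrightarrow> ennreal (\<Psi>' (?f \<omega>))" by (rule tendsto_ennrealI)
      moreover have "\<forall>\<^sub>F m in sequentially. ennreal (\<Psi> m (?e m \<omega>)) = (if m = 0 then 0 else ennreal (\<Psi> m (?e m \<omega>)))"
        using eventually_gt_at_top[of "0::nat"] by eventually_elim simp
      ultimately show "(\<lambda>m. if m = 0 then 0 else ennreal (\<Psi> m (?e m \<omega>))) \<longlonglongrightarrow> ennreal (\<Psi>' (?f \<omega>))"
        by (rule Lim_transform_eventually)
    qed
  qed (use \<Psi>01 in \<open>simp_all add: M.emeasure_space_1\<close>)
  moreover have "\<forall>\<^sub>F m in sequentially. (\<integral>\<^sup>+\<omega>. (if m = 0 then 0 else ennreal (\<Psi> m (?e m \<omega>))) \<partial>M)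
      = (\<integral>\<^sup>+\<omega>. ?H (euler F S (real (Suc N) * T) (Suc N * m) (\<lambda>t. B t \<omega>) z) \<partial>M)"
    using eventually_gt_at_top[of "0::nat"]
  proof eventually_elim
    case (elim m)
    \<comment> \<open>The step sizes agree, so both sides become powers of one operator.\<close>
    have eqT: "real N * T / real (N * m) = T / real m" "real (Suc N) * T / real (Suc N * m) = T / real m"
      using N elim by (simp, subst of_nat_mult, simp del: of_nat_Suc)
    have "(\<integral>\<^sup>+\<omega>. ennreal (\<Psi> m (?e m \<omega>)) \<partial>M) = (euler_op F S (T / real m) ^^ (N * m)) (\<lambda>x. ennreal (\<Psi> m x)) z"
      using nn_integral_euler[OF B T0(4), of "N * m" "\<lambda>x. ennreal (\<Psi> m x)" z] \<Psi>m[OF elim] N elim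
      unfolding eqT by simp
    also have "\<dots> = (euler_op F S (T / real m) ^^ (Suc N * m)) ?H z"
      unfolding \<Psi>_op[OF elim] by (simp add: funpow_add add.commute[of m])
    also have "\<dots> = (\<integral>\<^sup>+\<omega>. ?H (euler F S (real (Suc N) * T) (Suc N * m) (\<lambda>t. B t \<omega>) z) \<partial>M)"
      using nn_integral_euler[OF B T0(5), of "Suc N * m" ?H z] elim unfolding eqT by simp
    finally show ?case using elim by simp
  qed
  ultimately have lim1: "(\<lambda>m. \<integral>\<^sup>+\<omega>. ?H (euler F S (real (Suc N) * T) (Suc N * m) (\<lambda>t. B t \<omega>) z) \<partial>M) \<longlonglongrightarrow> (\<integral>\<^sup>+\<omega>. ennreal (\<Psi>' (?f \<omega>)) \<partial>M)"
    by (rule Lim_transform_eventually)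
  have "(\<lambda>m. \<integral>\<^sup>+\<omega>. ?H (euler F S (real (Suc N) * T) (Suc N * m) (\<lambda>t. B t \<omega>) z) \<partial>M) \<longlonglongrightarrow> (\<integral>\<^sup>+\<omega>. ?H (flow F S (real (Suc N) * T) (\<lambda>t. B t \<omega>) z) \<partial>M)"
    using LIMSEQ_subseq_LIMSEQ[OF nn_integral_euler_tendsto[OF B T0(3) _ hc h(2), of "\<lambda>_. z"] sub[of "Suc N"]]
    by (simp add: comp_def)
  with lim1 have "(\<integral>\<^sup>+\<omega>. ?H (flow F S (real (Suc N) * T) (\<lambda>t. B t \<omega>) z) \<partial>M) = (\<integral>\<^sup>+\<omega>. ennreal (\<Psi>' (?f \<omega>)) \<partial>M)"
    using LIMSEQ_unique by blast
  moreover have "ennreal (\<Psi>' x) = (\<integral>\<^sup>+y. ?H y \<partial>flow_law F S M B T x)" for x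
    using T0 h(1) int' by (simp add: \<Psi>'_def nn_integral_flow_law[OF B] nn_integral_eq_integral)
  moreover have "(\<integral>\<^sup>+x. ?H x \<partial>(flow_law F S M B (real N * T) z \<bind> flow_law F S M B T))
      = (\<integral>\<^sup>+x. \<integral>\<^sup>+y. ?H y \<partial>flow_law F S M B T x \<partial>flow_law F S M B (real N * T) z)"
    using ker by (intro nn_integral_bind[where B=borel]) simp_all
  moreover have "\<dots> = (\<integral>\<^sup>+\<omega>. \<integral>\<^sup>+y. ?H y \<partial>flow_law F S M B T (?f \<omega>) \<partial>M)"
    using measurable_prob_algebraD[OF flow_law_kernel[OF B T0(1)]]
    by (intro nn_integral_flow_law[OF B T0(2)] nn_integral_measurable_subprob_algebra2[where N=borel]) simp_all
  ultimately show "(\<integral>\<^sup>+x. ?H x \<partial>flow_law F S M B (real (Suc N) * T) z) = (\<integral>\<^sup>+x. ?H x \<partial>(flow_law F S M B (real N * T) z \<bind> flow_law F S M B T))"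
    using T0(3) by (simp add: nn_integral_flow_law[OF B])
qed

end

section \<open>The Langevin system and its Lyapunov function\<close>

locale langevin =
  fixes U :: "real^'d \<Rightarrow> real" and gradU :: "real^'d \<Rightarrow> real^'d"
    and u \<gamma> L A lam \<eta> c :: real
  assumes u_pos: "u > 0" and gamma_pos: "\<gamma> > 0"
    and grad: "\<And>x. (U has_derivative (\<lambda>h. gradU x \<bullet> h)) (at x)"
    and L_pos: "L > 0" and A_pos: "A > 0" and lam: "0 < lam" "lam \<le> 1 / 4"
    and U_nonneg: "\<And>x. U x \<ge> 0"
    and lipschitz: "\<And>x y. norm (gradU x - gradU y) \<le> L * norm (x - y)"
    and drift: "\<And>x. (x \<bullet> gradU x) / 2 \<ge> lam * (U x + (1 / u) * \<gamma>\<^sup>2 * (norm x)\<^sup>2 / 4) - A"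
    and eta_pos: "\<eta> > 0"
    and c_pos: "c > 0"
    and c_bound:
      "let d = real CARD('d);
           \<alpha> = (1 + \<eta>) * L * u / \<gamma>\<^sup>2;
           \<epsilon> = 4 / \<gamma> * c / (d + A);
           R = R1 d A u \<gamma> lam \<alpha>;
           \<phi> = lphi L \<eta> \<gamma> u \<epsilon> \<alpha>;
           \<Phi> = lPhi L \<eta> \<gamma> u \<epsilon> \<alpha>
       in c \<le> \<gamma> * min (min (2 / 9 * u / \<gamma>\<^sup>2 / integral {0..R} (\<lambda>s. \<Phi> s / \<phi> s))
                             (1 / 18 * (\<eta> / (1 + \<eta>)) * (INF s\<in>{0<..R}. s * \<phi> s / \<Phi> s)))
                        (1 / 16 * lam)"
begin

section \<open>Constants of the statement and the three bounds on c\<close>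

definition "dd = real CARD('d)"
definition "\<alpha> = (1 + \<eta>) * L * u / \<gamma>\<^sup>2"
definition "\<epsilon> = 4 / \<gamma> * c / (dd + A)"
definition "R = R1 dd A u \<gamma> lam \<alpha>"
definition "\<phi> = lphi L \<eta> \<gamma> u \<epsilon> \<alpha>"
definition "\<Phi> = lPhi L \<eta> \<gamma> u \<epsilon> \<alpha>"
definition "g = lg L \<eta> \<gamma> u \<epsilon> \<alpha> c"
definition "f = lf L \<eta> \<gamma> u \<epsilon> \<alpha> c R"
definition "H = lH U u \<gamma> lam"
definition "\<rho> = lrho f H \<alpha> \<gamma> \<epsilon>"
definition "\<mu>max = max 1 (1 / (2 * \<alpha>))"
text \<open>Half the squared noise of the distance is \<open>4 * u / \<gamma>\<close>. Multiplied by
  it, the first summand equals \<open>\<alpha> * \<gamma>\<close>, the rate of the drift of the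
  distance, and the second pays for the covariation of the distance with the factor
  \<open>GG\<close>.\<close>

definition "\<kappa> = (1 + \<eta>) * L / 4 + \<gamma>\<^sup>2 / u * \<epsilon> * \<mu>max"

lemma dd_ge_1: "1 \<le> dd"
  unfolding dd_def by (simp add: Suc_leI)

lemma alpha_pos: "0 < \<alpha>"
  using u_pos gamma_pos L_pos eta_pos by (simp add: \<alpha>_def)

lemma eps_pos: "0 < \<epsilon>"
  using c_pos gamma_pos A_pos dd_ge_1 by (simp add: \<epsilon>_def)

text \<open>The constant part of the drift bound for the Lyapunov function is
  \<open>\<gamma> * (dd + A)\<close>, so each copy contributes 4c to the drift of
  \<open>GG\<close>.\<close>

lemma eps_eq: "\<epsilon> * \<gamma> * (dd + A) = 4 * c"
  using gamma_pos A_pos dd_ge_1 by (simp add: \<epsilon>_def)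

lemma R_pos: "0 < R"
proof -
  have "0 < lam - 2 * lam\<^sup>2" using lam by (simp add: power2_eq_square)
  moreover have "0 < 1 + 2 * \<alpha> + 2 * \<alpha>\<^sup>2" using alpha_pos by (simp add: add_pos_pos)
  ultimately show ?thesis
    using gamma_pos u_pos A_pos dd_ge_1 by (simp add: R_def R1_def)
qed

text \<open>The first bound gives \<open>g R \<ge> 1 / 2\<close>, the second contraction without
  reflection, the third the decay beyond \<open>R\<close> and the sign of
  \<open>1 - c * s\<^sup>2\<close> for short steps.\<close>

lemma c_bounds:
  shows "9 / 4 * c * \<gamma> / u * integral {0..R} (\<lambda>s. \<Phi> s / \<phi> s) \<le> 1 / 2"
    and "\<And>s. 0 < s \<Longrightarrow> s \<le> R \<Longrightarrow> 18 * c * \<Phi> s \<le> \<gamma> * (\<eta> / (1 + \<eta>)) * (s * \<phi> s)"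
    and "16 * c \<le> \<gamma> * lam"
proof -
  define I where "I = integral {0..R} (\<lambda>s. \<Phi> s / \<phi> s)"
  define m where "m = (INF s\<in>{0<..R}. s * \<phi> s / \<Phi> s)"
  have le: "c \<le> \<gamma> * min (min (2 / 9 * u / \<gamma>\<^sup>2 / I) (1 / 18 * (\<eta> / (1 + \<eta>)) * m)) (1 / 16 * lam)"
    using c_bound unfolding Let_def I_def m_def \<Phi>_def \<phi>_def R_def \<epsilon>_def \<alpha>_def dd_def .
  have mono: "c \<le> \<gamma> * x" if "min (min (2 / 9 * u / \<gamma>\<^sup>2 / I) (1 / 18 * (\<eta> / (1 + \<eta>)) * m)) (1 / 16 * lam) \<le> x" for x
    by (rule order_trans[OF le mult_left_mono[OF that less_imp_le[OF gamma_pos]]])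
  have 1: "c \<le> \<gamma> * (2 / 9 * u / \<gamma>\<^sup>2 / I)" by (rule mono, rule min.coboundedI1, rule min.cobounded1)
  have 2: "c \<le> \<gamma> * (1 / 18 * (\<eta> / (1 + \<eta>)) * m)" by (rule mono, rule min.coboundedI1, rule min.cobounded2)
  have 3: "c \<le> \<gamma> * (1 / 16 * lam)" by (rule mono, rule min.cobounded2)
  show "16 * c \<le> \<gamma> * lam" using 3 by simp
  \<comment> \<open>Positivity of the integral is forced by \<open>c > 0\<close>: otherwise the
    quotient would be nonpositive, division by 0 included.\<close>
  have Ipos: "0 < I"
  proof (rule ccontr)
    assume "\<not> 0 < I"
    then have "\<gamma> * (2 / 9 * u / \<gamma>\<^sup>2 / I) \<le> 0"
      using gamma_pos u_pos by (intro mult_nonneg_nonpos divide_nonneg_nonpos) simp_all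
    then show False using 1 c_pos by simp
  qed
  have "c * I \<le> \<gamma> * (2 / 9 * u / \<gamma>\<^sup>2 / I) * I" using 1 Ipos by (intro mult_right_mono) simp_all
  also have "\<dots> = \<gamma> * (2 / 9 * u / \<gamma>\<^sup>2)" using Ipos by simp
  finally have "c * I \<le> \<gamma> * (2 / 9 * u / \<gamma>\<^sup>2)" .
  then have "c * I * \<gamma> / u \<le> 2 / 9" using gamma_pos u_pos by (simp add: field_simps power2_eq_square)
  moreover have "9 / 4 * c * \<gamma> / u * I = 9 / 4 * (c * I * \<gamma> / u)" by simp
  ultimately show "9 / 4 * c * \<gamma> / u * integral {0..R} (\<lambda>s. \<Phi> s / \<phi> s) \<le> 1 / 2"
    unfolding I_def[symmetric] by linarith
  fix s assume s: "0 < s" "s \<le> R"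
  have \<phi>: "0 < \<phi> t" for t by (simp add: \<phi>_def lphi_def)
  have cont: "continuous_on X \<phi>" for X
    unfolding \<phi>_def lphi_def by (intro continuous_intros) simp_all
  have \<Phi>0: "0 \<le> \<Phi> t" for t
    unfolding \<Phi>_def lPhi_def \<phi>_def[symmetric] using \<phi> cont
    by (intro integral_nonneg integrable_continuous_interval) (auto simp: less_imp_le)
  have bdd: "bdd_below ((\<lambda>s. s * \<phi> s / \<Phi> s) ` {0<..R})"
    using \<phi> \<Phi>0 by (intro bdd_belowI2[of _ 0]) (simp add: less_imp_le)
  then have "m \<le> s * \<phi> s / \<Phi> s" unfolding m_def using s by (intro cINF_lower[OF bdd]) auto
  then have "\<gamma> * (1 / 18 * (\<eta> / (1 + \<eta>)) * m) \<le> \<gamma> * (1 / 18 * (\<eta> / (1 + \<eta>)) * (s * \<phi> s / \<Phi> s))"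
    using gamma_pos eta_pos by (intro mult_left_mono) simp_all
  with 2 have le: "c \<le> \<gamma> * (1 / 18 * (\<eta> / (1 + \<eta>)) * (s * \<phi> s / \<Phi> s))" by simp
  \<comment> \<open>Were it 0, the quotient would be 0 and c could not be positive.\<close>
  then have "\<Phi> s \<noteq> 0" using c_pos by auto
  then have "0 < \<Phi> s" using \<Phi>0[of s] by simp
  then have "c * \<Phi> s \<le> \<gamma> * (1 / 18 * (\<eta> / (1 + \<eta>)) * (s * \<phi> s / \<Phi> s)) * \<Phi> s"
    using le by (intro mult_right_mono) simp_all
  also have "\<gamma> * (1 / 18 * e * (x / p)) * p = \<gamma> * e * x / 18" if "0 < p" for e x p :: real
    using that by simp
  note this[OF \<open>0 < \<Phi> s\<close>]
  finally have le: "c * \<Phi> s \<le> \<gamma> * (\<eta> / (1 + \<eta>)) * (s * \<phi> s) / 18" .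
  have "18 * c * \<Phi> s \<le> x" if "c * \<Phi> s \<le> x / 18" for x using that by linarith
  then show "18 * c * \<Phi> s \<le> \<gamma> * (\<eta> / (1 + \<eta>)) * (s * \<phi> s)" using le .
qed

lemma kappa_nonneg: "0 \<le> \<kappa>"
  using L_pos eta_pos u_pos eps_pos by (simp add: \<kappa>_def \<mu>max_def)

sublocale concave_profile \<kappa> "9 / 4 * c * \<gamma> / u" R \<phi> \<Phi> g f
proof
  show "0 \<le> \<kappa>" by (rule kappa_nonneg)
  show "0 \<le> 9 / 4 * c * \<gamma> / u" using c_pos gamma_pos u_pos by simp
  show "0 < R" by (rule R_pos)
  show "\<phi> s = exp (- \<kappa> * s\<^sup>2 / 2)" for s
  proof -
    have "- (1 + \<eta>) * L * s\<^sup>2 / 8 - X * s\<^sup>2 / 2 = - ((1 + \<eta>) * L / 4 + X) * s\<^sup>2 / 2" for X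
      by (simp add: left_diff_distrib distrib_right add_divide_distrib diff_divide_distrib)
    then show ?thesis unfolding \<phi>_def lphi_def \<kappa>_def \<mu>max_def by (simp only:)
  qed
  show "\<Phi> s = integral {0..s} \<phi>" for s by (simp add: \<Phi>_def lPhi_def \<phi>_def)
  show "g r = 1 - 9 / 4 * c * \<gamma> / u * integral {0..r} (\<lambda>s. \<Phi> s / \<phi> s)" for r
    by (simp add: g_def lg_def \<Phi>_def \<phi>_def)
  then show "1 / 2 \<le> g R" using c_bounds(1) by simp
  show "f r = integral {0..min r R} (\<lambda>s. \<phi> s * g s)" for r
    by (simp add: f_def lf_def \<phi>_def g_def)
qed

section \<open>The Lyapunov function and its relation to the distance\<close>

definition "Qf x v = (norm (\<gamma> *\<^sub>R x + v))\<^sup>2 + (norm v)\<^sup>2 - lam * \<gamma>\<^sup>2 * (norm x)\<^sup>2" for x v :: "real^'d"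

lemma H_eq: "H (x, v) = U x + 1 / (4 * u) * Qf x v"
proof -
  have "\<gamma> *\<^sub>R (x + (1 / \<gamma>) *\<^sub>R v) = \<gamma> *\<^sub>R x + v" "\<gamma> *\<^sub>R ((1 / \<gamma>) *\<^sub>R v) = v"
    using gamma_pos by (simp_all add: algebra_simps)
  then have "(norm (\<gamma> *\<^sub>R x + v))\<^sup>2 = \<gamma>\<^sup>2 * (norm (x + (1 / \<gamma>) *\<^sub>R v))\<^sup>2" "(norm v)\<^sup>2 = \<gamma>\<^sup>2 * (norm ((1 / \<gamma>) *\<^sub>R v))\<^sup>2"
    by (metis norm_scaleR power_mult_distrib power2_abs)+
  then show ?thesis
    unfolding H_def lH_def Qf_def by (simp add: algebra_simps)
qed

text \<open>As |\<gamma> x + 2 v|^2 is nonnegative, the two squares in \<open>Qf\<close> are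
  together at least \<gamma>^2 |x|^2 / 2; \<open>lam \<le> 1 / 4\<close> leaves half of
  this.\<close>

lemma Qf_ge: "\<gamma>\<^sup>2 * (norm x)\<^sup>2 / 4 \<le> Qf x v"
proof -
  have "0 \<le> (norm (\<gamma> *\<^sub>R x + 2 *\<^sub>R v))\<^sup>2" by simp
  also have "\<dots> = 2 * (norm (\<gamma> *\<^sub>R x + v))\<^sup>2 + 2 * (norm v)\<^sup>2 - \<gamma>\<^sup>2 * (norm x)\<^sup>2"
    unfolding power2_norm_eq_inner by (simp add: inner_simps inner_commute power2_eq_square algebra_simps)
  finally have "\<gamma>\<^sup>2 * (norm x)\<^sup>2 / 2 \<le> (norm (\<gamma> *\<^sub>R x + v))\<^sup>2 + (norm v)\<^sup>2" by simp
  moreover have "lam * (\<gamma>\<^sup>2 * (norm x)\<^sup>2) \<le> 1 / 4 * (\<gamma>\<^sup>2 * (norm x)\<^sup>2)" using lam by (intro mult_right_mono) simp_all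
  ultimately show ?thesis by (simp add: Qf_def)
qed

lemma Qf_nonneg: "0 \<le> Qf x v"
  using Qf_ge[of x v] by (smt (verit) zero_le_power2 mult_nonneg_nonneg divide_nonneg_pos)

lemma H_nonneg: "0 \<le> H y"
  using Qf_nonneg u_pos U_nonneg by (cases y) (simp add: H_eq)

text \<open>The parallelogram identity for a nonnegative quadratic form; it converts a large
  difference into large values at the two points.\<close>

lemma Qf_parallelogram: "Qf (x - x') (v - v') \<le> 2 * (Qf x v + Qf x' v')"
proof -
  have "Qf (x - x') (v - v') + Qf (x + x') (v + v') = 2 * (Qf x v + Qf x' v')"
    unfolding Qf_def power2_norm_eq_inner by (simp add: inner_simps inner_commute algebra_simps)
  then show ?thesis using Qf_nonneg[of "x + x'" "v + v'"] by linarith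
qed

text \<open>In the difference of two copies \<open>zz\<close> has derivative \<gamma>
  (\<open>qq\<close> - \<open>zz\<close>) and no noise, whereas the drift of \<open>qq\<close>
  contains the gradients alone. This is why the distance \<open>rr\<close> is built from these two
  vectors.\<close>

definition "qq y y' = fst y - fst y' + (1 / \<gamma>) *\<^sub>R (snd y - snd y')" for y y' :: "(real^'d) \<times> (real^'d)"
definition "zz y y' = fst y - fst y'" for y y' :: "(real^'d) \<times> (real^'d)"
definition "rr y y' = \<alpha> * norm (zz y y') + norm (qq y y')" for y y' :: "(real^'d) \<times> (real^'d)"
definition "GG y y' = 1 + \<epsilon> * H y + \<epsilon> * H y'" for y y' :: "(real^'d) \<times> (real^'d)"

lemma rho_eq: "\<rho> y y' = f (rr y y') * GG y y'"
  by (cases y; cases y') (simp add: \<rho>_def lrho_def rr_def zz_def qq_def GG_def)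

lemma GG_ge_1: "1 \<le> GG y y'"
  using H_nonneg[of y] H_nonneg[of y'] eps_pos by (simp add: GG_def)

lemma rho_nonneg: "0 \<le> \<rho> y y'"
  using f_nonneg GG_ge_1[of y y'] by (simp add: rho_eq)

lemma rr_nonneg: "0 \<le> rr y y'"
  using alpha_pos by (simp add: rr_def)

text \<open>Cauchy-Schwarz for \<alpha> s + p = (1 + \<alpha>) p - \<alpha> (p - s): the squared
  coefficients sum to 1 + 2 \<alpha> + 2 \<alpha>^2. Passing to the form with \<open>lam\<close>
  costs the factor 1 - 2 lam. Both factors reappear in \<open>R1\<close>.\<close>

lemma rr_quadratic_bound:
  fixes s p :: real
  shows "(1 - 2 * lam) * (\<alpha> * s + p)\<^sup>2 \<le> (1 + 2 * \<alpha> + 2 * \<alpha>\<^sup>2) * (2 * p\<^sup>2 - 2 * p * s + (1 - lam) * s\<^sup>2)"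
proof -
  have "(1 + 2 * \<alpha> + 2 * \<alpha>\<^sup>2) * (2 * p\<^sup>2 - 2 * p * s + s\<^sup>2) - (\<alpha> * s + p)\<^sup>2 = ((1 + 2 * \<alpha>) * p - (1 + \<alpha>) * s)\<^sup>2"
    by (simp add: power2_eq_square algebra_simps)
  then have "(\<alpha> * s + p)\<^sup>2 \<le> (1 + 2 * \<alpha> + 2 * \<alpha>\<^sup>2) * (2 * p\<^sup>2 - 2 * p * s + s\<^sup>2)"
    by (smt (verit) zero_le_power2)
  then have "(1 - 2 * lam) * (\<alpha> * s + p)\<^sup>2 \<le> (1 - 2 * lam) * ((1 + 2 * \<alpha> + 2 * \<alpha>\<^sup>2) * (2 * p\<^sup>2 - 2 * p * s + s\<^sup>2))"
    using lam by (intro mult_left_mono) simp_all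
  also have "\<dots> = (1 + 2 * \<alpha> + 2 * \<alpha>\<^sup>2) * ((1 - 2 * lam) * (2 * p\<^sup>2 - 2 * p * s + s\<^sup>2))" by (simp only: mult_ac)
  also have "\<dots> \<le> (1 + 2 * \<alpha> + 2 * \<alpha>\<^sup>2) * (2 * p\<^sup>2 - 2 * p * s + (1 - lam) * s\<^sup>2)"
  proof (rule mult_left_mono)
    have "2 * p\<^sup>2 - 2 * p * s + (1 - lam) * s\<^sup>2 - (1 - 2 * lam) * (2 * p\<^sup>2 - 2 * p * s + s\<^sup>2) = lam * (2 * p - s)\<^sup>2"
      by (simp add: power2_eq_square algebra_simps)
    moreover have "0 \<le> lam * (2 * p - s)\<^sup>2" using lam by simp
    ultimately show "(1 - 2 * lam) * (2 * p\<^sup>2 - 2 * p * s + s\<^sup>2) \<le> 2 * p\<^sup>2 - 2 * p * s + (1 - lam) * s\<^sup>2" by linarith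
  qed (use alpha_pos in simp)
  finally show ?thesis .
qed

text \<open>\<open>R1\<close> is solved for exactly this: the distance bounds \<open>Qf\<close> of
  the difference from below, the parallelogram bound passes to the two points, and
  \<open>4 * u * H\<close> dominates \<open>Qf\<close>. The origin of 12 / 5 is seen in
  \<open>b1_far\<close>.\<close>

lemma H_lower_bound:
  assumes "R \<le> rr y y'"
  shows "12 / 5 * (dd + A) \<le> lam * (H y + H y')"
proof -
  obtain x v x' v' where y: "y = (x, v)" "y' = (x', v')" by (cases y; cases y')
  let ?z = "x - x'" and ?w = "v - v'"
  let ?q = "?z + (1 / \<gamma>) *\<^sub>R ?w"
  define k where "k = 1 + 2 * \<alpha> + 2 * \<alpha>\<^sup>2"
  have k: "0 < k" using alpha_pos by (simp add: k_def add_pos_pos)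
  have w: "?w = \<gamma> *\<^sub>R (?q - ?z)" using gamma_pos by simp
  have "Qf ?z ?w = \<gamma>\<^sup>2 * (2 * (norm ?q)\<^sup>2 - 2 * (?q \<bullet> ?z) + (1 - lam) * (norm ?z)\<^sup>2)"
  proof -
    have *: "Qf b (\<gamma> *\<^sub>R (a - b)) = \<gamma>\<^sup>2 * (2 * (norm a)\<^sup>2 - 2 * (a \<bullet> b) + (1 - lam) * (norm b)\<^sup>2)" for a b
      unfolding Qf_def power2_norm_eq_inner by (simp add: inner_simps inner_commute algebra_simps power2_eq_square)
    show ?thesis using *[of ?z ?q] w by metis
  qed
  also have "\<dots> \<ge> \<gamma>\<^sup>2 * (2 * (norm ?q)\<^sup>2 - 2 * norm ?q * norm ?z + (1 - lam) * (norm ?z)\<^sup>2)"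
    using norm_cauchy_schwarz[of ?q ?z] by (intro mult_left_mono) simp_all
  finally have Q: "\<gamma>\<^sup>2 * (2 * (norm ?q)\<^sup>2 - 2 * norm ?q * norm ?z + (1 - lam) * (norm ?z)\<^sup>2) \<le> Qf ?z ?w" .
  have lam2: "0 < 1 - 2 * lam" using lam by simp
  have RR: "R\<^sup>2 = 16 * (6 / 5) * k * (dd + A) * u / \<gamma>\<^sup>2 / (lam * (1 - 2 * lam))"
  proof -
    have "lam - 2 * lam\<^sup>2 = lam * (1 - 2 * lam)" by (simp add: power2_eq_square algebra_simps)
    then show ?thesis
      using u_pos A_pos dd_ge_1 k lam lam2 unfolding R_def R1_def k_def[symmetric]
      by (simp add: power_mult_distrib power_divide)
  qed
  have "16 * (6 / 5) * k * (dd + A) * u / lam = \<gamma>\<^sup>2 * ((1 - 2 * lam) * R\<^sup>2)"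
    unfolding RR using lam lam2 gamma_pos by simp
  also have "\<dots> \<le> \<gamma>\<^sup>2 * ((1 - 2 * lam) * (rr y y')\<^sup>2)"
    using assms R_pos lam2 by (intro mult_left_mono power_mono) simp_all
  also have "\<dots> \<le> \<gamma>\<^sup>2 * (k * (2 * (norm ?q)\<^sup>2 - 2 * norm ?q * norm ?z + (1 - lam) * (norm ?z)\<^sup>2))"
    using rr_quadratic_bound[of "norm ?z" "norm ?q"] by (intro mult_left_mono) (simp_all add: rr_def zz_def qq_def y k_def)
  also have "\<dots> \<le> k * Qf ?z ?w" using mult_left_mono[OF Q, of k] k by (simp add: mult_ac)
  also have "\<dots> \<le> k * (2 * (Qf x v + Qf x' v'))" using k by (intro mult_left_mono Qf_parallelogram) simp
  also have "\<dots> \<le> k * (8 * u * (H y + H y'))"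
    using k U_nonneg u_pos by (intro mult_left_mono) (simp_all add: y H_eq algebra_simps add_divide_distrib)
  finally have "k * (16 * (6 / 5) * (dd + A) * u / lam) \<le> k * (8 * u * (H y + H y'))"
    by (simp only: times_divide_eq_right mult_ac)
  then have "16 * (6 / 5) * (dd + A) * u / lam \<le> 8 * u * (H y + H y')"
    using k by (simp only: mult_le_cancel_left_pos)
  then have "16 * (6 / 5) * (dd + A) * u \<le> 8 * u * (H y + H y') * lam"
    using lam(1) by (simp only: pos_divide_le_eq)
  then have "u * (16 * (6 / 5) * (dd + A)) \<le> u * (8 * (lam * (H y + H y')))" by (simp only: mult_ac)
  then have "16 * (6 / 5) * (dd + A) \<le> 8 * (lam * (H y + H y'))" using u_pos by (simp only: mult_le_cancel_left_pos)
  then show ?thesis by linarith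
qed

section \<open>The generator and the drift of the Lyapunov factor\<close>

definition "\<sigma>0 = sqrt (2 * \<gamma> * u)"

lemma sigma0: "0 < \<sigma>0" "\<sigma>0\<^sup>2 = 2 * \<gamma> * u"
  using gamma_pos u_pos by (simp_all add: \<sigma>0_def)

definition FF :: "(real^'d) \<times> (real^'d) \<Rightarrow> (real^'d) \<times> (real^'d)" where
  "FF y = (snd y, - (\<gamma> *\<^sub>R snd y + u *\<^sub>R gradU (fst y)))"

definition SS :: "real^'d \<Rightarrow> (real^'d) \<times> (real^'d)" where
  "SS b = (0, \<sigma>0 *\<^sub>R b)"

text \<open>The differential of \<open>H\<close> at \<open>y\<close> in direction \<open>e\<close>.
  The second-order part of the generator is the constant \<open>\<gamma> * dd\<close>, because
  \<open>H\<close> is quadratic in the velocity with Hessian 1 / u and half the squared noise is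
  \<open>\<gamma> * u\<close>.\<close>

definition "DH y e = gradU (fst y) \<bullet> fst e + 1 / (4 * u) * (2 * ((\<gamma> *\<^sub>R fst y + snd y) \<bullet> (\<gamma> *\<^sub>R fst e + snd e))
    + 2 * (snd y \<bullet> snd e) - 2 * lam * \<gamma>\<^sup>2 * (fst y \<bullet> fst e))" for y e :: "(real^'d) \<times> (real^'d)"

lemma DH_linear: "DH y (h *\<^sub>R a + e) = h * DH y a + DH y e"
  by (simp add: DH_def inner_simps algebra_simps add_divide_distrib)

text \<open>On the left stands the generator applied to \<open>H\<close>. After the drift condition,
  what separates it from the bound is \<gamma> times a sum of two squares with nonnegative
  coefficients.\<close>

lemma generator_bound: "DH y (FF y) + \<gamma> * dd \<le> \<gamma> * (dd + A - lam * H y)"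
proof -
  obtain x v where y: "y = (x, v)" by (cases y)
  have gen: "DH y (FF y) = - (\<gamma> / 2) * (x \<bullet> gradU x) - \<gamma> / (2 * u) * (norm v)\<^sup>2 - lam * \<gamma>\<^sup>2 / (2 * u) * (x \<bullet> v)"
    using u_pos unfolding y DH_def FF_def power2_norm_eq_inner
    by (simp add: inner_simps inner_commute field_simps power2_eq_square)
  have lamH: "lam * H y = lam * U x + lam / (4 * u) * (\<gamma>\<^sup>2 * (1 - lam) * (norm x)\<^sup>2 + 2 * \<gamma> * (x \<bullet> v) + 2 * (norm v)\<^sup>2)"
    unfolding y H_eq Qf_def power2_norm_eq_inner
    by (simp add: inner_simps inner_commute algebra_simps power2_eq_square add_divide_distrib diff_divide_distrib)
  have dr: "- (\<gamma> / 2) * (x \<bullet> gradU x) \<le> \<gamma> * (A - lam * (U x + (1 / u) * \<gamma>\<^sup>2 * (norm x)\<^sup>2 / 4))"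
    using mult_left_mono[OF drift[of x], of \<gamma>] gamma_pos by (simp add: algebra_simps)
  have "0 \<le> lam * lam * \<gamma>\<^sup>2 * (norm x)\<^sup>2 / (4 * u)" "0 \<le> (1 - lam) / (2 * u) * (norm v)\<^sup>2"
    using lam u_pos by simp_all
  then have nn: "0 \<le> \<gamma> * (lam * lam * \<gamma>\<^sup>2 * (norm x)\<^sup>2 / (4 * u) + (1 - lam) / (2 * u) * (norm v)\<^sup>2)"
    using gamma_pos by simp
  have "\<gamma> * (A - lam * (U x + (1 / u) * \<gamma>\<^sup>2 * (norm x)\<^sup>2 / 4)) - \<gamma> / (2 * u) * (norm v)\<^sup>2 - lam * \<gamma>\<^sup>2 / (2 * u) * (x \<bullet> v)
      = \<gamma> * (A - lam * H y) - \<gamma> * (lam * lam * \<gamma>\<^sup>2 * (norm x)\<^sup>2 / (4 * u) + (1 - lam) / (2 * u) * (norm v)\<^sup>2)"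
    unfolding lamH using u_pos by (simp add: field_simps power2_eq_square)
  then have "DH y (FF y) \<le> \<gamma> * (A - lam * H y)" using gen dr nn by linarith
  then show ?thesis by (simp add: algebra_simps)
qed

definition "b1 y y' = \<epsilon> * (DH y (FF y) + DH y' (FF y')) + 2 * \<epsilon> * \<gamma> * dd"

lemma b1_bound: "b1 y y' \<le> 8 * c - \<epsilon> * \<gamma> * (lam * (H y + H y'))"
proof -
  have "\<epsilon> * ((DH y (FF y) + \<gamma> * dd) + (DH y' (FF y') + \<gamma> * dd)) \<le> \<epsilon> * (\<gamma> * (dd + A - lam * H y) + \<gamma> * (dd + A - lam * H y'))"
    using eps_pos by (intro mult_left_mono add_mono generator_bound) simp
  also have "\<dots> = 2 * (\<epsilon> * \<gamma> * (dd + A)) - \<epsilon> * \<gamma> * (lam * (H y + H y'))" by (simp add: algebra_simps)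
  finally show ?thesis unfolding eps_eq b1_def by (simp add: algebra_simps)
qed

lemma b1_le: "b1 y y' \<le> 8 * c"
proof -
  have "0 \<le> \<epsilon> * \<gamma> * (lam * (H y + H y'))"
    using eps_pos gamma_pos lam H_nonneg[of y] H_nonneg[of y'] by simp
  then show ?thesis using b1_bound[of y y'] by linarith
qed

text \<open>With X = \<open>\<epsilon> * \<gamma> * (lam * (H y + H y'))\<close>,
  \<open>H_lower_bound\<close> gives X \<ge> 48 c / 5, and the third bound on c gives X / 16 \<ge> c
  \<epsilon> (H y + H y'). What remains, 15 X / 16 \<ge> 9 c, pays for 8c + c; here 12 / 5 and 1 /
  16 fit together.\<close>

lemma b1_far:
  assumes "R \<le> rr y y'"
  shows "b1 y y' \<le> - c * GG y y'"
proof -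
  define h where "h = H y + H y'"
  have h0: "0 \<le> h" using H_nonneg by (simp add: h_def)
  have eg: "0 < \<epsilon> * \<gamma>" using eps_pos gamma_pos by simp
  have "\<epsilon> * \<gamma> * (12 / 5 * (dd + A)) \<le> \<epsilon> * \<gamma> * (lam * h)"
    using H_lower_bound[OF assms] eg unfolding h_def by (intro mult_left_mono) simp_all
  moreover have "\<epsilon> * \<gamma> * (12 / 5 * (dd + A)) = 12 / 5 * (\<epsilon> * \<gamma> * (dd + A))" by simp
  ultimately have 1: "48 / 5 * c \<le> \<epsilon> * \<gamma> * (lam * h)" unfolding eps_eq by linarith
  have "\<epsilon> * h * (16 * c) \<le> \<epsilon> * h * (\<gamma> * lam)"
    using c_bounds(3) eps_pos h0 by (intro mult_left_mono) simp_all
  then have 2: "16 * (c * (\<epsilon> * h)) \<le> \<epsilon> * \<gamma> * (lam * h)" by (simp add: mult_ac)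
  have "b1 y y' \<le> 8 * c - \<epsilon> * \<gamma> * (lam * h)" using b1_bound unfolding h_def .
  then have "b1 y y' \<le> - c - c * (\<epsilon> * h)" using 1 2 c_pos by linarith
  then show ?thesis by (simp add: GG_def h_def algebra_simps)
qed

text \<open>Here \<open>\<beta>\<close> bounds the drift of the distance \<open>rr\<close>, \<open>\<sigma>\<close> is the
  intensity of its noise under reflection, and \<open>b1\<close> is the drift of the factor \<open>GG\<close> including the
  second-order term of its noise.\<close>

definition "\<beta> y y' = \<alpha> * \<gamma> * (norm (qq y y') - norm (zz y y')) + u * L / \<gamma> * norm (zz y y')"

lemma uL_eq: "u * L / \<gamma> = \<alpha> * \<gamma> / (1 + \<eta>)"
proof -
  have "1 + \<eta> \<noteq> 0" using eta_pos by simp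
  then show ?thesis using gamma_pos by (simp add: \<alpha>_def power2_eq_square)
qed

definition "\<sigma> = 2 * \<sigma>0 / \<gamma>"

lemma sigma_squared: "\<sigma>\<^sup>2 = 8 * u / \<gamma>" "0 < \<sigma>"
  using sigma0 gamma_pos by (simp_all add: \<sigma>_def power_divide power_mult_distrib power2_eq_square field_simps)

text \<open>The velocity gradient of \<open>H\<close> is (\<gamma> x + 2 v) / (2 u), so up to this
  factor \<open>nn\<close> is the difference of the gradients at the two points. A difference
  appears because reflection reverses the noise of the second copy along \<open>qq\<close>.\<close>

definition "nn y y' = (\<gamma> *\<^sub>R fst y + 2 *\<^sub>R snd y) - (\<gamma> *\<^sub>R fst y' + 2 *\<^sub>R snd y')" for y y' :: "(real^'d) \<times> (real^'d)"

lemma norm_nn_le: "norm (nn y y') \<le> 2 * \<gamma> * \<mu>max * rr y y'"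
proof -
  have "nn y y' = (2 * \<gamma>) *\<^sub>R qq y y' - \<gamma> *\<^sub>R zz y y'"
    using gamma_pos by (simp add: nn_def qq_def zz_def vec_eq_iff field_simps)
  then have "norm (nn y y') \<le> 2 * \<gamma> * norm (qq y y') + \<gamma> * norm (zz y y')"
    using gamma_pos norm_triangle_ineq4[of "(2 * \<gamma>) *\<^sub>R qq y y'" "\<gamma> *\<^sub>R zz y y'"] by simp
  also have "\<gamma> * norm (zz y y') = 2 * \<gamma> * (1 / (2 * \<alpha>) * (\<alpha> * norm (zz y y')))"
    using alpha_pos by simp
  also have "2 * \<gamma> * norm (qq y y') + 2 * \<gamma> * (1 / (2 * \<alpha>) * (\<alpha> * norm (zz y y')))
      \<le> 2 * \<gamma> * (\<mu>max * norm (qq y y')) + 2 * \<gamma> * (\<mu>max * (\<alpha> * norm (zz y y')))"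
    using gamma_pos alpha_pos mult_right_mono[of 1 \<mu>max "norm (qq y y')"]
    by (intro add_mono mult_left_mono mult_right_mono) (simp_all add: \<mu>max_def)
  finally show ?thesis by (simp add: rr_def algebra_simps)
qed

text \<open>The concave profile \<open>f\<close> is built so that the reflection noise in the direction of \<open>qq\<close>
  compensates both the drift of the distance and the covariation with the Lyapunov factor.\<close>

lemma contraction_reflection:
  assumes r: "rr y y' \<le> R" and e: "norm e \<le> 1"
  shows "\<psi> (rr y y') * \<beta> y y' * GG y y' + \<psi>' (rr y y') / 2 * \<sigma>\<^sup>2 * GG y y' + f (rr y y') * b1 y y'
      + \<psi> (rr y y') * \<sigma> * (\<epsilon> * \<sigma>0 / (2 * u) * (e \<bullet> nn y y')) \<le> - c * (f (rr y y') * GG y y')"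
proof -
  define r where "r = rr y y'"
  define G where "G = GG y y'"
  have r0: "0 \<le> r" "r \<le> R" using rr_nonneg r by (simp_all add: r_def)
  have G1: "1 \<le> G" using GG_ge_1 by (simp add: G_def)
  have \<psi>0: "0 < \<psi> r" using \<psi>_bounds[OF r0] by simp
  have "\<alpha> * \<gamma> * norm (zz y y') / (1 + \<eta>) \<le> \<alpha> * \<gamma> * norm (zz y y')"
    using alpha_pos gamma_pos eta_pos mult_left_mono[of 1 "1 + \<eta>" "\<alpha> * \<gamma> * norm (zz y y')"]
    by (simp add: divide_le_eq)
  then have "\<beta> y y' \<le> \<alpha> * \<gamma> * norm (qq y y')" unfolding \<beta>_def uL_eq by (simp add: algebra_simps)
  also have "\<dots> \<le> \<alpha> * \<gamma> * r" using alpha_pos gamma_pos by (intro mult_left_mono) (simp_all add: r_def rr_def)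
  finally have "\<psi> r * \<beta> y y' * G \<le> \<psi> r * (\<alpha> * \<gamma> * r) * G"
    using \<psi>0 G1 by (intro mult_right_mono mult_left_mono) simp_all
  \<comment> \<open>The closed form of \<psi>' with
    \<open>\<sigma>\<^sup>2 / 2 = 4 * u / \<gamma>\<close>: the terms from \<kappa> cancel the drift
    and the covariation, and the coefficient 9 / 4 in g is chosen so that
    \<open>9 * c * \<Phi> r\<close> is left.\<close>
  moreover have "\<psi>' r / 2 * \<sigma>\<^sup>2 * G = - (\<psi> r * (\<alpha> * \<gamma> * r) * G) - 4 * \<gamma> * \<epsilon> * \<mu>max * r * \<psi> r * G - 9 * c * \<Phi> r * G"
  proof -
    have k: "\<kappa> * (4 * u / \<gamma>) = \<alpha> * \<gamma> + 4 * \<gamma> * \<epsilon> * \<mu>max"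
    proof -
      have "(a / 4 + \<gamma>\<^sup>2 / u * b) * (4 * u / \<gamma>) = a * u / \<gamma>\<^sup>2 * \<gamma> + 4 * \<gamma> * b" for a b
        using gamma_pos u_pos by (simp add: field_simps power2_eq_square)
      from this[of "(1 + \<eta>) * L" "\<epsilon> * \<mu>max"] show ?thesis by (simp only: \<kappa>_def \<alpha>_def mult.assoc)
    qed
    have "\<psi>' r / 2 * \<sigma>\<^sup>2 = (- \<kappa> * r * \<psi> r - 9 / 4 * c * \<gamma> / u * \<Phi> r) * (4 * u / \<gamma>)"
      unfolding sigma_squared \<psi>'_def by simp
    also have "\<dots> = - (\<kappa> * (4 * u / \<gamma>)) * (r * \<psi> r) - 9 * c * \<Phi> r"
    proof -
      have "(- a * r * b - 9 / 4 * c * \<gamma> / u * p) * (4 * u / \<gamma>) = - (a * (4 * u / \<gamma>)) * (r * b) - 9 * c * p" for a b p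
        using gamma_pos u_pos by (simp add: field_simps)
      then show ?thesis .
    qed
    finally have "\<psi>' r / 2 * \<sigma>\<^sup>2 * G = (- (\<alpha> * \<gamma> + 4 * \<gamma> * \<epsilon> * \<mu>max) * (r * \<psi> r) - 9 * c * \<Phi> r) * G"
      unfolding k by (simp only:)
    also have "\<dots> = - (\<psi> r * (\<alpha> * \<gamma> * r) * G) - 4 * \<gamma> * \<epsilon> * \<mu>max * r * \<psi> r * G - 9 * c * \<Phi> r * G"
      by (simp add: algebra_simps)
    finally show ?thesis .
  qed
  moreover have "f r * b1 y y' \<le> 8 * c * \<Phi> r * G"
  proof -
    have "f r * b1 y y' \<le> f r * (8 * c)" using b1_le f_nonneg by (intro mult_left_mono)
    also have "\<dots> \<le> \<Phi> r * (8 * c)" using f_le_\<Phi>[OF r0] c_pos by (intro mult_right_mono) simp_all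
    also have "\<dots> \<le> \<Phi> r * (8 * c) * G" using mult_left_mono[OF G1, of "\<Phi> r * (8 * c)"] c_pos \<Phi>_bounds[OF r0(1)] by simp
    finally show ?thesis by (simp add: mult_ac)
  qed
  moreover have "\<psi> r * \<sigma> * (\<epsilon> * \<sigma>0 / (2 * u) * (e \<bullet> nn y y')) \<le> 4 * \<gamma> * \<epsilon> * \<mu>max * r * \<psi> r * G"
  proof -
    have "e \<bullet> nn y y' \<le> norm e * norm (nn y y')" by (rule norm_cauchy_schwarz)
    also have "\<dots> \<le> 1 * norm (nn y y')" using e by (intro mult_right_mono) simp_all
    also have "\<dots> \<le> 2 * \<gamma> * \<mu>max * r" using norm_nn_le by (simp add: r_def)
    finally have le: "e \<bullet> nn y y' \<le> 2 * \<gamma> * \<mu>max * r" .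
    have "\<psi> r * \<sigma> * (\<epsilon> * \<sigma>0 / (2 * u) * (e \<bullet> nn y y')) \<le> \<psi> r * \<sigma> * (\<epsilon> * \<sigma>0 / (2 * u) * (2 * \<gamma> * \<mu>max * r))"
      using \<psi>0 sigma_squared sigma0 eps_pos u_pos le by (intro mult_left_mono) simp_all
    also have "\<dots> = \<psi> r * (\<sigma> * \<sigma>0) * (\<epsilon> / (2 * u) * (2 * \<gamma> * \<mu>max * r))" by simp
    also have "\<sigma> * \<sigma>0 = 2 * \<sigma>0\<^sup>2 / \<gamma>" by (simp add: \<sigma>_def power2_eq_square)
    also have "\<dots> = 4 * u" using gamma_pos unfolding sigma0 by simp
    also have "\<psi> r * (4 * u) * (\<epsilon> / (2 * u) * (2 * \<gamma> * \<mu>max * r)) = 4 * \<gamma> * \<epsilon> * \<mu>max * r * \<psi> r" using u_pos by simp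
    also have "\<dots> \<le> 4 * \<gamma> * \<epsilon> * \<mu>max * r * \<psi> r * G"
    proof -
      have "0 \<le> 4 * \<gamma> * \<epsilon> * \<mu>max * r * \<psi> r" using gamma_pos eps_pos r0 \<psi>0 by (simp add: \<mu>max_def)
      from mult_left_mono[OF G1 this] show ?thesis by simp
    qed
    finally show ?thesis .
  qed
  \<comment> \<open>Of the 9c, eight are consumed by the drift of \<open>GG\<close> and one remains
    as the rate.\<close>
  ultimately have "\<psi> r * \<beta> y y' * G + \<psi>' r / 2 * \<sigma>\<^sup>2 * G + f r * b1 y y' + \<psi> r * \<sigma> * (\<epsilon> * \<sigma>0 / (2 * u) * (e \<bullet> nn y y'))
      \<le> - (c * \<Phi> r * G)" by linarith
  also have "\<dots> \<le> - (c * f r * G)"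
    using f_le_\<Phi>[OF r0] c_pos G1 by (intro le_imp_neg_le mult_right_mono mult_left_mono) simp_all
  finally show ?thesis by (simp add: r_def G_def mult.assoc)
qed

text \<open>Without noise in the distance the decay must come from the drift. Since
  \<open>u * L / \<gamma>\<close> is smaller than \<open>\<alpha> * \<gamma>\<close> by the factor 1
  + \<eta>, \<beta> is at most a multiple of \<delta> minus
  \<open>\<gamma> * (\<eta> / (1 + \<eta>)) * r\<close>, and the second bound on c compares this
  linear decay with 9c times f.\<close>

lemma contraction_synchronous:
  assumes r: "rr y y' \<le> R" and q: "norm (qq y y') \<le> \<delta>"
  shows "\<psi> (rr y y') * \<beta> y y' * GG y y' + f (rr y y') * b1 y y'
      \<le> - c * (f (rr y y') * GG y y') + (\<alpha> + 1) * \<gamma> * \<delta> * GG y y'"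
proof -
  define r where "r = rr y y'"
  define G where "G = GG y y'"
  define n where "n = norm (qq y y')"
  have r0: "0 \<le> r" "r \<le> R" using rr_nonneg r by (simp_all add: r_def)
  have G1: "1 \<le> G" using GG_ge_1 by (simp add: G_def)
  have \<psi>0: "0 < \<psi> r" "\<psi> r \<le> 1" "\<phi> r / 2 \<le> \<psi> r" using \<psi>_bounds[OF r0] by simp_all
  define k where "k = \<gamma> * (\<eta> / (1 + \<eta>))"
  have k0: "0 \<le> k" "k \<le> \<gamma>" using gamma_pos eta_pos by (simp_all add: k_def divide_le_eq)
  have \<beta>: "\<beta> y y' = \<alpha> * \<gamma> * n + k * n - k * r"
  proof -
    have "\<beta> y y' = \<alpha> * \<gamma> * n - \<alpha> * norm (zz y y') * (\<gamma> - \<gamma> / (1 + \<eta>))"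
      unfolding \<beta>_def uL_eq n_def by (simp add: algebra_simps)
    also have "\<gamma> - \<gamma> / (1 + \<eta>) = k" using eta_pos by (simp add: k_def field_simps)
    finally show ?thesis by (simp add: r_def rr_def n_def algebra_simps)
  qed
  have n: "0 \<le> n" "n \<le> \<delta>" using q by (simp_all add: n_def)
  have "k * n \<le> \<gamma> * n" using k0 n by (intro mult_right_mono)
  moreover have "(\<alpha> + 1) * \<gamma> * n \<le> (\<alpha> + 1) * \<gamma> * \<delta>" using n alpha_pos gamma_pos by (intro mult_left_mono) simp_all
  ultimately have "\<beta> y y' \<le> (\<alpha> + 1) * \<gamma> * \<delta> - k * r" unfolding \<beta> by (simp add: algebra_simps)
  then have "\<psi> r * \<beta> y y' \<le> \<psi> r * ((\<alpha> + 1) * \<gamma> * \<delta>) - \<psi> r * (k * r)"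
    using mult_left_mono[of "\<beta> y y'" "(\<alpha> + 1) * \<gamma> * \<delta> - k * r" "\<psi> r"] \<psi>0(1)
    by (simp only: right_diff_distrib less_imp_le)
  moreover have "\<psi> r * ((\<alpha> + 1) * \<gamma> * \<delta>) \<le> 1 * ((\<alpha> + 1) * \<gamma> * \<delta>)"
    using \<psi>0 n alpha_pos gamma_pos by (intro mult_right_mono) simp_all
  moreover have "9 * c * f r \<le> \<psi> r * (k * r)"
  proof (cases "r = 0")
    case True
    then show ?thesis using f_nonpos[of 0] by simp
  next
    case False
    then have "18 * c * \<Phi> r \<le> k * (r * \<phi> r)" using c_bounds(2)[of r] r0 by (simp add: k_def)
    moreover have "\<phi> r / 2 * (k * r) \<le> \<psi> r * (k * r)" using \<psi>0 k0 r0 by (intro mult_right_mono) simp_all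
    moreover have "9 * c * f r \<le> 9 * c * \<Phi> r" using f_le_\<Phi>[OF r0] c_pos by simp
    ultimately show ?thesis by (simp add: algebra_simps)
  qed
  ultimately have "\<psi> r * \<beta> y y' \<le> (\<alpha> + 1) * \<gamma> * \<delta> - 9 * c * f r" by linarith
  then have "\<psi> r * \<beta> y y' * G \<le> ((\<alpha> + 1) * \<gamma> * \<delta> - 9 * c * f r) * G" using G1 by (intro mult_right_mono) simp_all
  moreover have "f r * b1 y y' \<le> 8 * c * f r * G"
  proof -
    have "f r * b1 y y' \<le> f r * (8 * c)" using b1_le f_nonneg by (intro mult_left_mono)
    also have "\<dots> \<le> f r * (8 * c) * G" using mult_left_mono[OF G1, of "f r * (8 * c)"] c_pos f_nonneg[of r] by simp
    finally show ?thesis by (simp add: mult_ac)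
  qed
  ultimately have "\<psi> r * \<beta> y y' * G + f r * b1 y y' \<le> - c * (f r * G) + (\<alpha> + 1) * \<gamma> * \<delta> * G"
    by (simp add: algebra_simps)
  then show ?thesis by (simp add: r_def G_def)
qed

end

section \<open>Pathwise expansion over a short time\<close>

lemma norm_fst_le_norm: "norm (fst p) \<le> norm p" and norm_snd_le_norm: "norm (snd p) \<le> norm p"
  for p :: "'a::real_normed_vector \<times> 'b::real_normed_vector"
  using norm_fst_le[of "fst p" "snd p"] norm_snd_le[of "snd p" "fst p"] by simp_all

text \<open>Here \<open>n\<close> is the size of the noise increment, \<zeta> its component along
  the reflection and \<open>nb\<close> its product with the gradient of \<open>GG\<close>. The terms
  of order s^2 are kept, in particular the covariation \<open>\<zeta> * nb\<close>; the products of
  order s^3 are at worst of size W^3 \<Xi>^5.\<close>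

lemma product_expansion:
  fixes s W \<Xi> n \<zeta> :: real
  assumes s: "0 < s" "s \<le> 1" and W: "1 \<le> W" and \<Xi>: "1 \<le> \<Xi>"
    and n: "0 \<le> n" "n \<le> s * \<Xi>" and \<zeta>: "\<bar>\<zeta>\<bar> \<le> n"
    and a: "\<bar>A1\<bar> \<le> a" "\<bar>A2\<bar> \<le> a" "\<bar>A3\<bar> \<le> a"
    and F: "0 \<le> F" "F \<le> R" and G: "0 \<le> G" "G \<le> g * W\<^sup>2"
    and b0: "\<bar>b0\<bar> \<le> g * W\<^sup>2" and nb: "\<bar>nb\<bar> \<le> g * W * n" and k: "0 \<le> k"
    and C: "0 \<le> C1" "0 \<le> C2"
    and f1: "0 \<le> f1" "f1 \<le> F + s\<^sup>2 * A1 + A2 * \<zeta> + A3 * \<zeta>\<^sup>2 + C1 * W * (s ^ 3 * \<Xi> ^ 3)"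
    and G1: "0 \<le> G1" "G1 \<le> G + s\<^sup>2 * b0 + nb + k * n\<^sup>2 + C2 * W\<^sup>2 * (s ^ 3 * \<Xi>\<^sup>2)"
  shows "f1 * G1 \<le> F * G + s\<^sup>2 * (A1 * G + F * b0) + A2 * G * \<zeta> + A3 * G * \<zeta>\<^sup>2 + F * nb + k * F * n\<^sup>2 + A2 * (\<zeta> * nb)
     + (2 * a * (2 * g + k) + a * (g + k) + C1 * (3 * g + k) + (R + 3 * a + C1) * C2) * (W ^ 3 * (s ^ 3 * \<Xi> ^ 5))"
proof -
  have a0: "0 \<le> a" using a(1) by linarith
  have g0: "0 \<le> g"
  proof -
    have "0 \<le> g * W\<^sup>2" using G by linarith
    moreover have "0 < W\<^sup>2" using W by simp
    ultimately show ?thesis by (simp add: zero_le_mult_iff)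
  qed
  have R0: "0 \<le> R" using F by linarith
  \<comment> \<open>All error terms are monomials; with s \<le> 1 \<le> W, \<Xi> they grow when the
    power of s is lowered or the other powers are raised.\<close>
  have le: "s ^ j * (W ^ i * \<Xi> ^ l) \<le> s ^ j' * (W ^ i' * \<Xi> ^ l')" if "j' \<le> j" "i \<le> i'" "l \<le> l'" for i j l i' j' l'
    using that s W \<Xi> by (intro mult_mono power_decreasing power_increasing) simp_all
  have n2: "n\<^sup>2 \<le> s\<^sup>2 * \<Xi>\<^sup>2" using n power_mono[of n "s * \<Xi>" 2] by (simp add: power_mult_distrib)
  have \<zeta>2: "\<zeta>\<^sup>2 \<le> s\<^sup>2 * \<Xi>\<^sup>2" using power_mono[OF \<zeta>, of 2] n2 by simp
  define D1 where "D1 = s\<^sup>2 * A1 + A2 * \<zeta> + A3 * \<zeta>\<^sup>2"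
  define D2 where "D2 = s\<^sup>2 * b0 + nb + k * n\<^sup>2"
  define E1 where "E1 = C1 * W * (s ^ 3 * \<Xi> ^ 3)"
  define E2 where "E2 = C2 * W\<^sup>2 * (s ^ 3 * \<Xi>\<^sup>2)"
  have E1: "0 \<le> E1" and E2: "0 \<le> E2" using C s W \<Xi> by (simp_all add: E1_def E2_def)
  have s2b0: "\<bar>s\<^sup>2 * b0\<bar> \<le> g * (s\<^sup>2 * W\<^sup>2)"
    using mult_left_mono[OF b0, of "s\<^sup>2"] by (simp add: abs_mult mult_ac)
  have nb': "\<bar>nb\<bar> \<le> g * (s * (W * \<Xi>))"
  proof -
    have "g * W * n \<le> g * W * (s * \<Xi>)" using n g0 W by (intro mult_left_mono) simp_all
    then show ?thesis using nb by (simp add: mult_ac)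
  qed
  have kn2: "0 \<le> k * n\<^sup>2" "k * n\<^sup>2 \<le> k * (s\<^sup>2 * \<Xi>\<^sup>2)" using k n2 by (simp_all add: mult_left_mono)
  have D2: "\<bar>D2\<bar> \<le> (2 * g + k) * (s * (W\<^sup>2 * \<Xi>\<^sup>2))"
  proof -
    have "g * (s\<^sup>2 * W\<^sup>2) \<le> g * (s * (W\<^sup>2 * \<Xi>\<^sup>2))" using le[of 1 2 2 2 0 2] g0 by - (rule mult_left_mono, simp_all)
    moreover have "g * (s * (W * \<Xi>)) \<le> g * (s * (W\<^sup>2 * \<Xi>\<^sup>2))" using le[of 1 1 1 2 1 2] g0 by - (rule mult_left_mono, simp_all)
    moreover have "k * (s\<^sup>2 * \<Xi>\<^sup>2) \<le> k * (s * (W\<^sup>2 * \<Xi>\<^sup>2))" using le[of 1 2 0 2 2 2] k by - (rule mult_left_mono, simp_all)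
    ultimately show ?thesis using s2b0 nb' kn2 unfolding D2_def by (simp add: distrib_right)
  qed
  have A13: "\<bar>s\<^sup>2 * A1 + A3 * \<zeta>\<^sup>2\<bar> \<le> 2 * a * (s\<^sup>2 * \<Xi>\<^sup>2)"
  proof -
    have "\<bar>s\<^sup>2 * A1\<bar> \<le> s\<^sup>2 * a" using a(1) by (simp add: abs_mult mult_left_mono)
    also have "\<dots> \<le> a * (s\<^sup>2 * \<Xi>\<^sup>2)" using mult_left_mono[OF le[of 2 2 0 0 0 2], of a] a0 by (simp add: mult.commute)
    finally have 1: "\<bar>s\<^sup>2 * A1\<bar> \<le> a * (s\<^sup>2 * \<Xi>\<^sup>2)" .
    have "\<bar>A3 * \<zeta>\<^sup>2\<bar> \<le> a * (s\<^sup>2 * \<Xi>\<^sup>2)" using mult_mono[OF a(3) \<zeta>2 a0] by (simp add: abs_mult)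
    then show ?thesis using 1 by linarith
  qed
  have rest1: "(s\<^sup>2 * A1 + A3 * \<zeta>\<^sup>2) * D2 \<le> 2 * a * (2 * g + k) * (W ^ 3 * (s ^ 3 * \<Xi> ^ 5))"
  proof -
    have "(s\<^sup>2 * A1 + A3 * \<zeta>\<^sup>2) * D2 \<le> \<bar>s\<^sup>2 * A1 + A3 * \<zeta>\<^sup>2\<bar> * \<bar>D2\<bar>" by (metis abs_ge_self abs_mult)
    also have "\<dots> \<le> (2 * a * (s\<^sup>2 * \<Xi>\<^sup>2)) * ((2 * g + k) * (s * (W\<^sup>2 * \<Xi>\<^sup>2)))"
      using A13 D2 a0 by (intro mult_mono) simp_all
    also have "\<dots> = 2 * a * (2 * g + k) * (s ^ 3 * (W\<^sup>2 * \<Xi> ^ 4))" by (simp add: power2_eq_square power3_eq_cube power4_eq_xxxx)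
    also have "\<dots> \<le> 2 * a * (2 * g + k) * (s ^ 3 * (W ^ 3 * \<Xi> ^ 5))" using a0 g0 k by (intro mult_left_mono le) simp_all
    finally show ?thesis by (simp add: mult.left_commute[of "s ^ 3"])
  qed
  have rest2: "A2 * \<zeta> * (s\<^sup>2 * b0 + k * n\<^sup>2) \<le> a * (g + k) * (W ^ 3 * (s ^ 3 * \<Xi> ^ 5))"
  proof -
    have "A2 * \<zeta> * (s\<^sup>2 * b0 + k * n\<^sup>2) \<le> \<bar>A2\<bar> * \<bar>\<zeta>\<bar> * \<bar>s\<^sup>2 * b0 + k * n\<^sup>2\<bar>" by (metis abs_ge_self abs_mult)
    also have "\<dots> \<le> (a * (s * \<Xi>)) * ((g + k) * (s\<^sup>2 * (W\<^sup>2 * \<Xi>\<^sup>2)))"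
    proof (rule mult_mono)
      show "\<bar>A2\<bar> * \<bar>\<zeta>\<bar> \<le> a * (s * \<Xi>)" using a(2) \<zeta> n a0 by (intro mult_mono) simp_all
      have "g * (s\<^sup>2 * W\<^sup>2) \<le> g * (s\<^sup>2 * (W\<^sup>2 * \<Xi>\<^sup>2))" using le[of 2 2 2 2 0 2] g0 by - (rule mult_left_mono, simp_all)
      moreover have "k * (s\<^sup>2 * \<Xi>\<^sup>2) \<le> k * (s\<^sup>2 * (W\<^sup>2 * \<Xi>\<^sup>2))" using le[of 2 2 0 2 2 2] k by - (rule mult_left_mono, simp_all)
      ultimately show "\<bar>s\<^sup>2 * b0 + k * n\<^sup>2\<bar> \<le> (g + k) * (s\<^sup>2 * (W\<^sup>2 * \<Xi>\<^sup>2))"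
        using s2b0 kn2 by (simp add: distrib_right)
    qed (use a0 s \<Xi> in simp_all)
    also have "\<dots> = a * (g + k) * (s ^ 3 * (W\<^sup>2 * \<Xi> ^ 3))" by (simp add: power2_eq_square power3_eq_cube)
    also have "\<dots> \<le> a * (g + k) * (s ^ 3 * (W ^ 3 * \<Xi> ^ 5))" using a0 g0 k by (intro mult_left_mono le) simp_all
    finally show ?thesis by (simp add: mult.left_commute[of "s ^ 3"])
  qed
  have rest3: "E1 * (G + D2) \<le> C1 * (3 * g + k) * (W ^ 3 * (s ^ 3 * \<Xi> ^ 5))"
  proof -
    have "G \<le> g * (W\<^sup>2 * \<Xi>\<^sup>2)"
      using G(2) mult_left_mono[OF le[of 0 0 2 2 0 2], of g] g0 by simp
    moreover have "(2 * g + k) * (s * (W\<^sup>2 * \<Xi>\<^sup>2)) \<le> (2 * g + k) * (W\<^sup>2 * \<Xi>\<^sup>2)"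
      using le[of 0 1 2 2 2 2] g0 k by - (rule mult_left_mono, simp_all)
    ultimately have "G + D2 \<le> (3 * g + k) * (W\<^sup>2 * \<Xi>\<^sup>2)" using D2 by (simp add: distrib_right)
    then have "E1 * (G + D2) \<le> E1 * ((3 * g + k) * (W\<^sup>2 * \<Xi>\<^sup>2))" using E1 by (rule mult_left_mono)
    also have "\<dots> = C1 * (3 * g + k) * (W ^ 3 * (s ^ 3 * \<Xi> ^ 5))"
      by (simp add: E1_def power2_eq_square power3_eq_cube power_numeral_reduce)
    finally show ?thesis .
  qed
  have rest4: "(F + D1 + E1) * E2 \<le> (R + 3 * a + C1) * C2 * (W ^ 3 * (s ^ 3 * \<Xi> ^ 5))"
  proof -
    have one: "1 \<le> W * \<Xi> ^ 3" using le[of 0 0 0 1 0 3] by simp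
    have "2 * a * (s\<^sup>2 * \<Xi>\<^sup>2) \<le> 2 * a * (W * \<Xi> ^ 3)" using le[of 0 2 0 1 2 3] a0 by - (rule mult_left_mono, simp_all)
    moreover have "A2 * \<zeta> \<le> a * (W * \<Xi> ^ 3)"
    proof -
      have "A2 * \<zeta> \<le> \<bar>A2\<bar> * \<bar>\<zeta>\<bar>" by (metis abs_ge_self abs_mult)
      also have "\<dots> \<le> a * (s * \<Xi>)" using a(2) \<zeta> n a0 by (intro mult_mono) simp_all
      also have "\<dots> \<le> a * (W * \<Xi> ^ 3)" using le[of 0 1 0 1 1 3] a0 by - (rule mult_left_mono, simp_all)
      finally show ?thesis .
    qed
    moreover have "F \<le> R * (W * \<Xi> ^ 3)" using F mult_left_mono[OF one R0] by simp
    moreover have "E1 \<le> C1 * (W * \<Xi> ^ 3)"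
    proof -
      have "C1 * (s ^ 3 * (W * \<Xi> ^ 3)) \<le> C1 * (W * \<Xi> ^ 3)" using le[of 0 3 1 1 3 3] C by - (rule mult_left_mono, simp_all)
      then show ?thesis by (simp add: E1_def mult_ac)
    qed
    ultimately have "F + D1 + E1 \<le> (R + 3 * a + C1) * (W * \<Xi> ^ 3)"
      using A13 unfolding D1_def by (simp add: distrib_right)
    then have "(F + D1 + E1) * E2 \<le> (R + 3 * a + C1) * (W * \<Xi> ^ 3) * E2" using E2 by (rule mult_right_mono)
    also have "\<dots> = (R + 3 * a + C1) * C2 * (W ^ 3 * (s ^ 3 * \<Xi> ^ 5))"
      by (simp add: E2_def power2_eq_square power3_eq_cube power_numeral_reduce)
    finally show ?thesis .
  qed
  have "f1 * G1 \<le> (F + D1 + E1) * G1" using f1 G1 by (intro mult_right_mono) (simp_all add: D1_def E1_def algebra_simps)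
  also have "\<dots> \<le> (F + D1 + E1) * (G + D2 + E2)"
  proof (rule mult_left_mono)
    show "0 \<le> F + D1 + E1" using f1 by (simp add: D1_def E1_def algebra_simps)
  qed (use G1 in \<open>simp add: D2_def E2_def algebra_simps\<close>)
  also have "\<dots> = F * G + F * D2 + D1 * G + A2 * (\<zeta> * nb)
      + (s\<^sup>2 * A1 + A3 * \<zeta>\<^sup>2) * D2 + A2 * \<zeta> * (s\<^sup>2 * b0 + k * n\<^sup>2) + E1 * (G + D2) + (F + D1 + E1) * E2"
    by (simp add: D1_def D2_def algebra_simps)
  also have "F * G + F * D2 + D1 * G + A2 * (\<zeta> * nb) = F * G + s\<^sup>2 * (A1 * G + F * b0) + A2 * G * \<zeta> + A3 * G * \<zeta>\<^sup>2 + F * nb + k * F * n\<^sup>2 + A2 * (\<zeta> * nb)"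
    by (simp add: D1_def D2_def algebra_simps)
  finally show ?thesis using rest1 rest2 rest3 rest4 unfolding distrib_right by linarith
qed

context langevin
begin

section \<open>Growth bounds and the one-step expansion of the Lyapunov function\<close>

definition "Kc = 1 + \<gamma> + u * L"

lemma Kc_nonneg: "0 \<le> Kc"
  using gamma_pos u_pos L_pos by (simp add: Kc_def)

lemma FF_lipschitz: "norm (FF y - FF y') \<le> Kc * norm (y - y')"
proof -
  have "FF y - FF y' = (snd (y - y'), - (\<gamma> *\<^sub>R snd (y - y') + u *\<^sub>R (gradU (fst y) - gradU (fst y'))))"
    by (simp add: FF_def algebra_simps)
  then have "norm (FF y - FF y') \<le> norm (snd (y - y')) + norm (\<gamma> *\<^sub>R snd (y - y') + u *\<^sub>R (gradU (fst y) - gradU (fst y')))"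
    by (metis norm_Pair_le norm_minus_cancel)
  also have "\<dots> \<le> norm (snd (y - y')) + (\<gamma> * norm (snd (y - y')) + u * norm (gradU (fst y) - gradU (fst y')))"
    using gamma_pos u_pos norm_triangle_ineq[of "\<gamma> *\<^sub>R snd (y - y')" "u *\<^sub>R (gradU (fst y) - gradU (fst y'))"] by simp
  also have "\<dots> \<le> norm (y - y') + (\<gamma> * norm (y - y') + u * (L * norm (y - y')))"
  proof -
    have "norm (snd (y - y')) \<le> norm (y - y')" by (rule norm_snd_le_norm)
    moreover have "norm (fst y - fst y') \<le> norm (y - y')" using norm_fst_le_norm[of "y - y'"] by simp
    then have "norm (gradU (fst y) - gradU (fst y')) \<le> L * norm (y - y')"
      using lipschitz[of "fst y" "fst y'"] L_pos by (meson less_imp_le mult_left_mono order_trans)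
    ultimately show ?thesis using gamma_pos u_pos by (intro add_mono mult_left_mono) simp_all
  qed
  finally show ?thesis by (simp add: Kc_def algebra_simps)
qed

sublocale noise: euler_noise FF SS Kc \<sigma>0
proof (unfold euler_noise_def lipschitz_field_def, intro conjI allI)
  show "linear SS" by (intro linearI) (simp_all add: SS_def algebra_simps)
  show "norm (SS b) \<le> \<sigma>0 * norm b" for b using sigma0 by (simp add: SS_def norm_Pair)
  show "norm (FF y - FF y') \<le> Kc * norm (y - y')" for y y' by (rule FF_lipschitz)
qed (use Kc_nonneg sigma0 in simp_all)

definition "K1 = norm (FF 0) + Kc"

lemma K1_nonneg: "0 \<le> K1" using Kc_nonneg by (simp add: K1_def)

lemma FF_growth: "norm (FF y) \<le> K1 * (1 + norm y)"
proof -
  have "norm (FF y) \<le> norm (FF 0) + Kc * norm y"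
    using FF_lipschitz[of y 0] norm_triangle_ineq2[of "FF y" "FF 0"] by simp
  also have "\<dots> \<le> K1 * (1 + norm y)" using Kc_nonneg by (simp add: K1_def algebra_simps)
  finally show ?thesis .
qed

definition "K2 = norm (gradU 0) + L + 1 / (4 * u) * (2 * (\<gamma> + 1)\<^sup>2 + 2 + 2 * \<gamma>\<^sup>2)"

lemma K2_nonneg: "0 \<le> K2" using L_pos u_pos by (simp add: K2_def)

lemma norm_combination_le: "norm (\<gamma> *\<^sub>R fst e + snd e) \<le> (\<gamma> + 1) * norm e"
proof -
  have "norm (\<gamma> *\<^sub>R fst e + snd e) \<le> \<gamma> * norm (fst e) + norm (snd e)"
    using gamma_pos norm_triangle_ineq[of "\<gamma> *\<^sub>R fst e" "snd e"] by simp
  also have "\<dots> \<le> \<gamma> * norm e + norm e"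
    using gamma_pos norm_fst_le_norm[of e] norm_snd_le_norm[of e] by (intro add_mono mult_left_mono) simp_all
  finally show ?thesis by (simp add: algebra_simps)
qed

lemma DH_bound: "\<bar>DH y e\<bar> \<le> K2 * (1 + norm y) * norm e"
proof -
  have in_le: "\<bar>a \<bullet> b\<bar> \<le> A * B" if "norm a \<le> A" "norm b \<le> B" for a b :: "real^'d" and A B
  proof -
    have "\<bar>a \<bullet> b\<bar> \<le> norm a * norm b" by (rule Cauchy_Schwarz_ineq2)
    also have "\<dots> \<le> A * B" using that norm_ge_zero[of a] norm_ge_zero[of b] by (intro mult_mono) linarith+
    finally show ?thesis .
  qed
  have "norm (gradU (fst y)) \<le> (norm (gradU 0) + L) * (1 + norm y)"
  proof -
    have "norm (gradU (fst y)) \<le> norm (gradU 0) + L * norm (fst y)"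
      using lipschitz[of "fst y" 0] norm_triangle_ineq2[of "gradU (fst y)" "gradU 0"] by simp
    also have "\<dots> \<le> norm (gradU 0) + L * norm y" using L_pos norm_fst_le_norm[of y] by simp
    also have "\<dots> \<le> (norm (gradU 0) + L) * (1 + norm y)" using L_pos by (simp add: algebra_simps)
    finally show ?thesis .
  qed
  then have 1: "\<bar>gradU (fst y) \<bullet> fst e\<bar> \<le> (norm (gradU 0) + L) * (1 + norm y) * norm e"
    by (rule in_le) (rule norm_fst_le_norm)
  have 2: "\<bar>(\<gamma> *\<^sub>R fst y + snd y) \<bullet> (\<gamma> *\<^sub>R fst e + snd e)\<bar> \<le> ((\<gamma> + 1) * norm y) * ((\<gamma> + 1) * norm e)"
    by (intro in_le norm_combination_le)
  have 3: "\<bar>snd y \<bullet> snd e\<bar> \<le> norm y * norm e" by (intro in_le norm_snd_le_norm)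
  have "\<bar>fst y \<bullet> fst e\<bar> \<le> norm y * norm e" by (intro in_le norm_fst_le_norm)
  then have "lam * (\<gamma>\<^sup>2 * \<bar>fst y \<bullet> fst e\<bar>) \<le> 1 * (\<gamma>\<^sup>2 * (norm y * norm e))"
    using lam by (intro mult_mono mult_left_mono) simp_all
  then have 4: "\<bar>lam * \<gamma>\<^sup>2 * (fst y \<bullet> fst e)\<bar> \<le> \<gamma>\<^sup>2 * (norm y * norm e)" using lam by (simp add: abs_mult mult.assoc)
  define X where "X = 2 * ((\<gamma> *\<^sub>R fst y + snd y) \<bullet> (\<gamma> *\<^sub>R fst e + snd e)) + 2 * (snd y \<bullet> snd e) - 2 * lam * \<gamma>\<^sup>2 * (fst y \<bullet> fst e)"
  have "\<bar>X\<bar> \<le> 2 * (((\<gamma> + 1) * norm y) * ((\<gamma> + 1) * norm e)) + 2 * (norm y * norm e) + 2 * (\<gamma>\<^sup>2 * (norm y * norm e))"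
    using 2 3 4 unfolding X_def by (simp add: mult.assoc)
  also have "\<dots> = (2 * (\<gamma> + 1)\<^sup>2 + 2 + 2 * \<gamma>\<^sup>2) * (norm y * norm e)" by (simp add: power2_eq_square algebra_simps)
  also have "\<dots> \<le> (2 * (\<gamma> + 1)\<^sup>2 + 2 + 2 * \<gamma>\<^sup>2) * ((1 + norm y) * norm e)"
    by (intro mult_left_mono mult_right_mono) simp_all
  finally have "1 / (4 * u) * \<bar>X\<bar> \<le> 1 / (4 * u) * ((2 * (\<gamma> + 1)\<^sup>2 + 2 + 2 * \<gamma>\<^sup>2) * ((1 + norm y) * norm e))"
    using u_pos by (intro mult_left_mono) simp_all
  moreover have "DH y e = gradU (fst y) \<bullet> fst e + 1 / (4 * u) * X" by (simp add: DH_def X_def)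
  then have "\<bar>DH y e\<bar> \<le> \<bar>gradU (fst y) \<bullet> fst e\<bar> + 1 / (4 * u) * \<bar>X\<bar>"
    using u_pos abs_triangle_ineq[of "gradU (fst y) \<bullet> fst e" "1 / (4 * u) * X"] by (simp add: abs_mult)
  ultimately show ?thesis using 1 unfolding K2_def distrib_right mult.assoc by linarith
qed

text \<open>The mean value theorem along the segment; the Lipschitz bound on the gradient controls
  the rest.\<close>

lemma U_taylor: "U (x + p) \<le> U x + gradU x \<bullet> p + L * (norm p)\<^sup>2"
proof -
  have deriv: "((\<lambda>t. U (x + t *\<^sub>R p)) has_real_derivative gradU (x + t *\<^sub>R p) \<bullet> p) (at t)" for t
  proof -
    have "((\<lambda>t. x + t *\<^sub>R p) has_derivative (\<lambda>t. t *\<^sub>R p)) (at t)" by (auto intro!: derivative_eq_intros)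
    from has_derivative_compose[OF this grad] show ?thesis
      by (simp add: has_field_derivative_def mult_commute_abs)
  qed
  have "\<exists>t::real. 0 < t \<and> t < 1 \<and> U (x + 1 *\<^sub>R p) - U (x + 0 *\<^sub>R p) = (1 - 0) * (gradU (x + t *\<^sub>R p) \<bullet> p)"
    using MVT2[of 0 1 "\<lambda>t. U (x + t *\<^sub>R p)" "\<lambda>t. gradU (x + t *\<^sub>R p) \<bullet> p"] deriv by simp
  then obtain t :: real where t: "0 < t" "t < 1" "U (x + p) - U x = gradU (x + t *\<^sub>R p) \<bullet> p" by auto
  have "(gradU (x + t *\<^sub>R p) - gradU x) \<bullet> p \<le> norm (gradU (x + t *\<^sub>R p) - gradU x) * norm p" by (rule norm_cauchy_schwarz)
  also have "\<dots> \<le> (L * norm (t *\<^sub>R p)) * norm p" using lipschitz[of "x + t *\<^sub>R p" x] by (intro mult_right_mono) simp_all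
  also have "\<dots> \<le> L * norm p * norm p" using t L_pos by (intro mult_right_mono mult_left_mono) (simp_all add: mult_left_le_one_le)
  finally show ?thesis using t by (simp add: inner_diff_left power2_eq_square mult.assoc)
qed

definition "K4 = 1 / (4 * u) * (2 * \<sigma>0 * (\<gamma> + 2) + (\<gamma> + 1)\<^sup>2 + 1) + L"

lemma K4_nonneg: "0 \<le> K4" using sigma0 gamma_pos u_pos L_pos by (simp add: K4_def)

text \<open>The noise moves the velocity only, where \<open>H\<close> is quadratic, so the expansion
  in the noise is exact and \<open>U\<close> is expanded in the displacement \<open>a\<close> alone.
  In expectation the term with \<open>(norm b)\<^sup>2\<close> becomes the second-order part of the
  generator.\<close>

lemma H_increment:
  "H (y + a + SS b) \<le> H y + DH y a + \<sigma>0 / (2 * u) * ((\<gamma> *\<^sub>R fst y + 2 *\<^sub>R snd y) \<bullet> b) + \<gamma> * (norm b)\<^sup>2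
     + K4 * (norm b * norm a + (norm a)\<^sup>2)"
proof -
  obtain x v p w where y: "y = (x, v)" "a = (p, w)" by (cases y; cases a)
  define m where "m = norm a"
  have m: "0 \<le> m" "norm p \<le> m" "norm w \<le> m" "norm (\<gamma> *\<^sub>R p + w) \<le> (\<gamma> + 1) * m"
    using norm_fst_le_norm[of a] norm_snd_le_norm[of a] norm_combination_le[of a] by (simp_all add: m_def y)
  have Q: "Qf (x + p) (v + w + \<sigma>0 *\<^sub>R b) = Qf x v
      + (2 * ((\<gamma> *\<^sub>R x + v) \<bullet> (\<gamma> *\<^sub>R p + w)) + 2 * (v \<bullet> w) - 2 * lam * \<gamma>\<^sup>2 * (x \<bullet> p))
      + 2 * \<sigma>0 * ((\<gamma> *\<^sub>R x + 2 *\<^sub>R v) \<bullet> b) + 2 * \<sigma>0\<^sup>2 * (norm b)\<^sup>2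
      + (2 * \<sigma>0 * ((\<gamma> *\<^sub>R p + w) \<bullet> b + w \<bullet> b) + (norm (\<gamma> *\<^sub>R p + w))\<^sup>2 + (norm w)\<^sup>2 - lam * \<gamma>\<^sup>2 * (norm p)\<^sup>2)"
    unfolding Qf_def power2_norm_eq_inner by (simp add: inner_simps inner_commute algebra_simps power2_eq_square)
  have "(\<gamma> *\<^sub>R p + w) \<bullet> b + w \<bullet> b \<le> ((\<gamma> + 1) * m) * norm b + m * norm b"
  proof (rule add_mono)
    have "(\<gamma> *\<^sub>R p + w) \<bullet> b \<le> norm (\<gamma> *\<^sub>R p + w) * norm b" by (rule norm_cauchy_schwarz)
    also have "\<dots> \<le> ((\<gamma> + 1) * m) * norm b" using m by (intro mult_right_mono) simp_all
    finally show "(\<gamma> *\<^sub>R p + w) \<bullet> b \<le> ((\<gamma> + 1) * m) * norm b" .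
    have "w \<bullet> b \<le> norm w * norm b" by (rule norm_cauchy_schwarz)
    also have "\<dots> \<le> m * norm b" using m by (intro mult_right_mono) simp_all
    finally show "w \<bullet> b \<le> m * norm b" .
  qed
  then have "2 * \<sigma>0 * ((\<gamma> *\<^sub>R p + w) \<bullet> b + w \<bullet> b) \<le> 2 * \<sigma>0 * (((\<gamma> + 1) * m) * norm b + m * norm b)"
    using sigma0 by (intro mult_left_mono) simp_all
  also have "\<dots> = 2 * \<sigma>0 * (\<gamma> + 2) * (norm b * m)" by (simp add: algebra_simps)
  finally have q1: "2 * \<sigma>0 * ((\<gamma> *\<^sub>R p + w) \<bullet> b + w \<bullet> b) \<le> 2 * \<sigma>0 * (\<gamma> + 2) * (norm b * m)" .
  have q2: "(norm (\<gamma> *\<^sub>R p + w))\<^sup>2 \<le> (\<gamma> + 1)\<^sup>2 * m\<^sup>2" using power_mono[OF m(4), of 2] by (simp add: power_mult_distrib)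
  have q3: "(norm w)\<^sup>2 \<le> m\<^sup>2" "(norm p)\<^sup>2 \<le> m\<^sup>2" using m by (simp_all add: power_mono)
  have q4: "0 \<le> lam * \<gamma>\<^sup>2 * (norm p)\<^sup>2" using lam by simp
  define Z where "Z = 2 * \<sigma>0 * (\<gamma> + 2) + (\<gamma> + 1)\<^sup>2 + 1"
  have "2 * \<sigma>0 * ((\<gamma> *\<^sub>R p + w) \<bullet> b + w \<bullet> b) + (norm (\<gamma> *\<^sub>R p + w))\<^sup>2 + (norm w)\<^sup>2 - lam * \<gamma>\<^sup>2 * (norm p)\<^sup>2
      \<le> 2 * \<sigma>0 * (\<gamma> + 2) * (norm b * m) + ((\<gamma> + 1)\<^sup>2 + 1) * m\<^sup>2"
    using q1 q2 q3(1) q4 unfolding distrib_right mult_1 by linarith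
  also have "\<dots> \<le> Z * (norm b * m + m\<^sup>2)"
  proof -
    have "0 \<le> ((\<gamma> + 1)\<^sup>2 + 1) * (norm b * m)" "0 \<le> 2 * \<sigma>0 * (\<gamma> + 2) * m\<^sup>2" using m sigma0 gamma_pos by simp_all
    then show ?thesis unfolding Z_def by (simp add: distrib_left distrib_right)
  qed
  finally have rem: "2 * \<sigma>0 * ((\<gamma> *\<^sub>R p + w) \<bullet> b + w \<bullet> b) + (norm (\<gamma> *\<^sub>R p + w))\<^sup>2 + (norm w)\<^sup>2 - lam * \<gamma>\<^sup>2 * (norm p)\<^sup>2
      \<le> Z * (norm b * m + m\<^sup>2)" .
  define i where "i = 1 / (4 * u)"
  define lin where "lin = 2 * ((\<gamma> *\<^sub>R x + v) \<bullet> (\<gamma> *\<^sub>R p + w)) + 2 * (v \<bullet> w) - 2 * lam * \<gamma>\<^sup>2 * (x \<bullet> p)"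
  define vb where "vb = (\<gamma> *\<^sub>R x + 2 *\<^sub>R v) \<bullet> b"
  define re where "re = 2 * \<sigma>0 * ((\<gamma> *\<^sub>R p + w) \<bullet> b + w \<bullet> b) + (norm (\<gamma> *\<^sub>R p + w))\<^sup>2 + (norm w)\<^sup>2 - lam * \<gamma>\<^sup>2 * (norm p)\<^sup>2"
  define N where "N = norm b * m + m\<^sup>2"
  have "H (y + a + SS b) = U (x + p) + i * Qf (x + p) (v + w + \<sigma>0 *\<^sub>R b)" by (simp add: y SS_def H_eq i_def)
  then have F1: "H (y + a + SS b) = U (x + p) + (i * Qf x v + i * lin + i * (2 * \<sigma>0 * vb) + i * (2 * \<sigma>0\<^sup>2 * (norm b)\<^sup>2) + i * re)"
    unfolding Q lin_def[symmetric] vb_def[symmetric] re_def[symmetric] by (simp only: distrib_left)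
  have F2: "H y = U x + i * Qf x v" by (simp add: y H_eq i_def)
  have F3: "DH y a = gradU x \<bullet> p + i * lin" by (simp add: DH_def y i_def lin_def)
  have F4: "i * (2 * \<sigma>0\<^sup>2 * (norm b)\<^sup>2) = \<gamma> * (norm b)\<^sup>2" using u_pos unfolding sigma0(2) i_def by simp
  have F5: "i * (2 * \<sigma>0 * vb) = \<sigma>0 / (2 * u) * vb" by (simp add: i_def)
  have F6: "i * re \<le> i * (Z * N)" using rem u_pos unfolding re_def N_def i_def by (intro mult_left_mono) simp_all
  have F7: "L * (norm p)\<^sup>2 \<le> L * N" using q3 L_pos m unfolding N_def by (intro mult_left_mono) (simp_all add: add_increasing)
  have F8: "K4 * N = i * (Z * N) + L * N" by (simp add: K4_def Z_def i_def distrib_right)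
  have "(\<gamma> *\<^sub>R fst y + 2 *\<^sub>R snd y) \<bullet> b = vb" "norm b * norm a + (norm a)\<^sup>2 = N" by (simp_all add: vb_def y N_def m_def)
  then show ?thesis using U_taylor[of x p] F1 F2 F3 F4 F5 F6 F7 F8 by (simp only:)
qed

text \<open>\<open>a\<close> is the drift over time s^2 plus the Euler error \<open>e\<close>;
  everything beyond first order in \<open>a\<close>, and all of \<open>e\<close>, falls into the
  remainder.\<close>

lemma H_step:
  assumes C0: "0 \<le> C0"
  obtains C where "0 \<le> C" "\<And>s \<Xi> y b e. 0 < s \<Longrightarrow> s \<le> 1 \<Longrightarrow> 1 \<le> \<Xi> \<Longrightarrow> norm b \<le> s * \<Xi> \<Longrightarrow> norm e \<le> C0 * (1 + norm y) * (s ^ 3 * \<Xi>) \<Longrightarrow>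
      H (y + s\<^sup>2 *\<^sub>R FF y + SS b + e) \<le> H y + s\<^sup>2 * DH y (FF y) + \<sigma>0 / (2 * u) * ((\<gamma> *\<^sub>R fst y + 2 *\<^sub>R snd y) \<bullet> b) + \<gamma> * (norm b)\<^sup>2
        + C * (1 + norm y)\<^sup>2 * (s ^ 3 * \<Xi>\<^sup>2)"
proof
  define C where "C = K2 * C0 + K4 * ((K1 + C0) + (K1 + C0)\<^sup>2)"
  show "0 \<le> C" using K1_nonneg K2_nonneg K4_nonneg C0 by (simp add: C_def)
  fix s \<Xi> :: real and y e :: "(real^'d) \<times> (real^'d)" and b :: "real^'d"
  assume s: "0 < s" "s \<le> 1" and \<Xi>: "1 \<le> \<Xi>" and b: "norm b \<le> s * \<Xi>" and e: "norm e \<le> C0 * (1 + norm y) * (s ^ 3 * \<Xi>)"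
  define W where "W = 1 + norm y"
  have W: "1 \<le> W" by (simp add: W_def)
  have le: "s ^ j * (W ^ i * \<Xi> ^ l) \<le> s ^ j' * (W ^ i' * \<Xi> ^ l')" if "j' \<le> j" "i \<le> i'" "l \<le> l'" for i j l i' j' l'
    using that s W \<Xi> by (intro mult_mono power_decreasing power_increasing) simp_all
  define a where "a = s\<^sup>2 *\<^sub>R FF y + e"
  define K where "K = K1 + C0"
  have K0: "0 \<le> K" using K1_nonneg C0 by (simp add: K_def)
  have e': "norm e \<le> C0 * (s ^ 3 * (W * \<Xi>))" using e by (simp add: W_def mult_ac)
  have m: "norm a \<le> K * (s\<^sup>2 * (W * \<Xi>))"
  proof -
    have "norm a \<le> s\<^sup>2 * norm (FF y) + norm e" unfolding a_def by (intro norm_triangle_le) simp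
    also have "s\<^sup>2 * norm (FF y) \<le> s\<^sup>2 * (K1 * W)" using FF_growth by (intro mult_left_mono) (simp_all add: W_def)
    also have "s\<^sup>2 * (K1 * W) = K1 * (s\<^sup>2 * W)" by simp
    also have "\<dots> \<le> K1 * (s\<^sup>2 * (W * \<Xi>))" using le[of 2 2 1 1 0 1] K1_nonneg by - (rule mult_left_mono, simp_all)
    also have "norm e \<le> C0 * (s\<^sup>2 * (W * \<Xi>))"
      using e' mult_left_mono[OF le[of 2 3 1 1 1 1] C0] by simp
    finally show ?thesis by (simp add: K_def distrib_right)
  qed
  have bm: "norm b * norm a \<le> K * (s ^ 3 * (W\<^sup>2 * \<Xi>\<^sup>2))"
  proof -
    have "norm b * norm a \<le> (s * \<Xi>) * (K * (s\<^sup>2 * (W * \<Xi>)))" using b m s \<Xi> by (intro mult_mono) simp_all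
    also have "\<dots> = K * (s ^ 3 * (W * \<Xi>\<^sup>2))" by (simp add: power2_eq_square power3_eq_cube)
    also have "\<dots> \<le> K * (s ^ 3 * (W\<^sup>2 * \<Xi>\<^sup>2))" using le[of 3 3 1 2 2 2] K0 by - (rule mult_left_mono, simp_all)
    finally show ?thesis .
  qed
  have mm: "(norm a)\<^sup>2 \<le> K\<^sup>2 * (s ^ 3 * (W\<^sup>2 * \<Xi>\<^sup>2))"
  proof -
    have "(norm a)\<^sup>2 \<le> (K * (s\<^sup>2 * (W * \<Xi>)))\<^sup>2" using m by (intro power_mono) simp_all
    also have "\<dots> = K\<^sup>2 * (s ^ 4 * (W\<^sup>2 * \<Xi>\<^sup>2))" by (simp add: power_mult_distrib power_mult[symmetric])
    also have "\<dots> \<le> K\<^sup>2 * (s ^ 3 * (W\<^sup>2 * \<Xi>\<^sup>2))" using le[of 3 4 2 2 2 2] by - (rule mult_left_mono, simp_all)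
    finally show ?thesis .
  qed
  have De: "DH y e \<le> K2 * C0 * (s ^ 3 * (W\<^sup>2 * \<Xi>\<^sup>2))"
  proof -
    have "DH y e \<le> K2 * W * norm e" using DH_bound[of y e] by (simp add: W_def)
    also have "\<dots> \<le> K2 * W * (C0 * (s ^ 3 * (W * \<Xi>)))" using e' K2_nonneg W by (intro mult_left_mono) simp_all
    also have "\<dots> = K2 * C0 * (s ^ 3 * (W\<^sup>2 * \<Xi>))" by (simp add: power2_eq_square)
    also have "\<dots> \<le> K2 * C0 * (s ^ 3 * (W\<^sup>2 * \<Xi>\<^sup>2))" using le[of 3 3 2 2 1 2] K2_nonneg C0 by - (rule mult_left_mono, simp_all)
    finally show ?thesis .
  qed
  have fin: "K4 * (norm b * norm a + (norm a)\<^sup>2) \<le> K4 * ((K + K\<^sup>2) * (s ^ 3 * (W\<^sup>2 * \<Xi>\<^sup>2)))"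
    using bm mm K4_nonneg by (intro mult_left_mono) (simp_all add: distrib_right)
  have eq: "y + s\<^sup>2 *\<^sub>R FF y + SS b + e = y + a + SS b" by (simp add: a_def)
  have DHa: "DH y a = s\<^sup>2 * DH y (FF y) + DH y e" unfolding a_def by (rule DH_linear)
  have Ceq: "C * W\<^sup>2 * (s ^ 3 * \<Xi>\<^sup>2) = K2 * C0 * (s ^ 3 * (W\<^sup>2 * \<Xi>\<^sup>2)) + K4 * ((K + K\<^sup>2) * (s ^ 3 * (W\<^sup>2 * \<Xi>\<^sup>2)))"
    by (simp add: C_def K_def algebra_simps)
  show "H (y + s\<^sup>2 *\<^sub>R FF y + SS b + e) \<le> H y + s\<^sup>2 * DH y (FF y) + \<sigma>0 / (2 * u) * ((\<gamma> *\<^sub>R fst y + 2 *\<^sub>R snd y) \<bullet> b) + \<gamma> * (norm b)\<^sup>2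
        + C * (1 + norm y)\<^sup>2 * (s ^ 3 * \<Xi>\<^sup>2)"
    unfolding W_def[symmetric] eq Ceq using H_increment[of y a b] De fin DHa by linarith
qed

end

text \<open>The absolute value acts linearly unless \<open>n + x\<close> is negative, and then |x|
  \<ge> \<delta>, so the defect is at most cubic in x.\<close>

lemma abs_add_le_cubic:
  fixes n x \<delta> :: real
  assumes "0 < \<delta>" "\<delta> \<le> n"
  shows "\<bar>n + x\<bar> \<le> n + x + 2 * \<bar>x\<bar> ^ 3 / \<delta>\<^sup>2"
proof (cases "0 \<le> n + x")
  case True
  then show ?thesis using assms by simp
next
  case False
  then have x: "\<delta> \<le> \<bar>x\<bar>" "x = - \<bar>x\<bar>" using assms by simp_all
  have "\<delta>\<^sup>2 * \<bar>x\<bar> \<le> \<bar>x\<bar>\<^sup>2 * \<bar>x\<bar>" using x assms by (intro mult_right_mono power_mono) simp_all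
  then have "\<bar>x\<bar> \<le> \<bar>x\<bar> ^ 3 / \<delta>\<^sup>2" using assms by (simp add: field_simps power2_eq_square power3_eq_cube)
  then show ?thesis using False x assms by linarith
qed

section \<open>One-step expansion of the distance and of the semimetric\<close>

context langevin
begin

text \<open>The condition \<open>h * \<gamma> \<le> 1\<close> makes the new \<open>zz\<close> a
  convex combination of \<open>zz\<close> and \<open>qq\<close>, up to errors, so the triangle
  inequality keeps its decay. The noise stays inside the norm of \<open>qq\<close>, to be treated
  according to the coupling.\<close>

lemma rr_step:
  assumes h: "0 \<le> h" "h * \<gamma> \<le> 1"
  shows "rr (y + h *\<^sub>R FF y + SS b + e) (y' + h *\<^sub>R FF y' + SS b' + e')
    \<le> \<alpha> * norm (zz y y') + h * \<beta> y y' + norm (qq y y' + (\<sigma>0 / \<gamma>) *\<^sub>R (b - b')) + (\<alpha> + 1 + 1 / \<gamma>) * (norm e + norm e')"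
proof -
  define z where "z = zz y y'"
  define q where "q = qq y y'"
  define y1 where "y1 = y + h *\<^sub>R FF y + SS b + e"
  define y1' where "y1' = y' + h *\<^sub>R FF y' + SS b' + e'"
  define dg where "dg = gradU (fst y) - gradU (fst y')"
  have zz1: "zz y1 y1' = (1 - h * \<gamma>) *\<^sub>R z + (h * \<gamma>) *\<^sub>R q + (fst e - fst e')"
    using gamma_pos by (simp add: y1_def y1'_def z_def q_def zz_def qq_def FF_def SS_def vec_eq_iff field_simps)
  have qq1: "qq y1 y1' = (q + (\<sigma>0 / \<gamma>) *\<^sub>R (b - b')) - (h * u / \<gamma>) *\<^sub>R dg + ((fst e - fst e') + (1 / \<gamma>) *\<^sub>R (snd e - snd e'))"
    using gamma_pos by (simp add: y1_def y1'_def q_def qq_def dg_def FF_def SS_def vec_eq_iff field_simps)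
  have fe: "norm (fst e - fst e') \<le> norm e + norm e'"
    using norm_triangle_ineq4[of "fst e" "fst e'"] norm_fst_le_norm[of e] norm_fst_le_norm[of e'] by linarith
  have se: "norm (snd e - snd e') \<le> norm e + norm e'"
    using norm_triangle_ineq4[of "snd e" "snd e'"] norm_snd_le_norm[of e] norm_snd_le_norm[of e'] by linarith
  have "norm (zz y1 y1') \<le> norm ((1 - h * \<gamma>) *\<^sub>R z) + norm ((h * \<gamma>) *\<^sub>R q) + norm (fst e - fst e')"
    unfolding zz1 by (intro norm_triangle_le add_mono norm_triangle_ineq order_refl)
  also have "\<dots> \<le> (1 - h * \<gamma>) * norm z + h * \<gamma> * norm q + (norm e + norm e')"
    using h gamma_pos fe by simp
  finally have "\<alpha> * norm (zz y1 y1') \<le> \<alpha> * ((1 - h * \<gamma>) * norm z + h * \<gamma> * norm q + (norm e + norm e'))"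
    using alpha_pos by (intro mult_left_mono) simp_all
  also have "\<dots> = \<alpha> * norm z + h * (\<alpha> * \<gamma> * (norm q - norm z)) + \<alpha> * (norm e + norm e')" by (simp add: algebra_simps)
  finally have Z: "\<alpha> * norm (zz y1 y1') \<le> \<alpha> * norm z + h * (\<alpha> * \<gamma> * (norm q - norm z)) + \<alpha> * (norm e + norm e')" .
  have "norm (qq y1 y1') \<le> norm (q + (\<sigma>0 / \<gamma>) *\<^sub>R (b - b')) + norm ((h * u / \<gamma>) *\<^sub>R dg) + (norm (fst e - fst e') + norm ((1 / \<gamma>) *\<^sub>R (snd e - snd e')))"
    unfolding qq1 by (intro norm_triangle_le add_mono norm_triangle_ineq norm_triangle_ineq4)
  also have "norm ((h * u / \<gamma>) *\<^sub>R dg) \<le> h * (u * L / \<gamma> * norm z)"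
  proof -
    have "h * u / \<gamma> * norm dg \<le> h * u / \<gamma> * (L * norm z)"
      unfolding dg_def z_def zz_def using h gamma_pos u_pos by (intro mult_left_mono lipschitz) simp_all
    then show ?thesis using h gamma_pos u_pos by (simp add: abs_mult mult_ac)
  qed
  also have "norm (fst e - fst e') + norm ((1 / \<gamma>) *\<^sub>R (snd e - snd e')) \<le> (norm e + norm e') + 1 / \<gamma> * (norm e + norm e')"
    unfolding norm_scaleR using fe se gamma_pos by (intro add_mono mult_mono) simp_all
  finally have "norm (qq y1 y1') \<le> norm (q + (\<sigma>0 / \<gamma>) *\<^sub>R (b - b')) + h * (u * L / \<gamma> * norm z) + ((norm e + norm e') + 1 / \<gamma> * (norm e + norm e'))"
    by simp
  then show ?thesis
    using Z unfolding y1_def[symmetric] y1'_def[symmetric] rr_def[of y1 y1'] \<beta>_def z_def[symmetric] q_def[symmetric]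
    by (simp add: algebra_simps)
qed

text \<open>The time step is \<open>s\<^sup>2\<close>, so that noise increments \<open>b\<close> are of order \<open>s\<close>. In the expansions below,
  \<open>A1\<close>, \<open>A2\<close>, \<open>A3\<close> are the coefficients of \<open>s\<^sup>2\<close>, \<open>ee \<bullet> b\<close> and \<open>(ee \<bullet> b)\<^sup>2\<close> in \<open>f (rr y y')\<close>; they vanish beyond
  \<open>R\<close>, where \<open>f\<close> is constant. For \<open>GG\<close> the gradient along the coupled noise is \<open>nv\<close> and the first-order
  drift is \<open>bb\<close>. Since \<open>ee = 0\<close> when the reflection direction is too short, \<open>QQ\<close> is then the identity.\<close>

definition "ee \<delta> y y' = (if \<delta> \<le> norm (qq y y') then (1 / norm (qq y y')) *\<^sub>R qq y y' else 0)"
definition "QQ \<delta> y y' b = b - (2 * (ee \<delta> y y' \<bullet> b)) *\<^sub>R ee \<delta> y y'"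
definition "A1 y y' = (if rr y y' < R then \<psi> (rr y y') * \<beta> y y' else 0)"
definition "A2 \<delta> y y' = (if rr y y' < R \<and> \<delta> \<le> norm (qq y y') then \<psi> (rr y y') * \<sigma> else 0)"
definition "A3 \<delta> y y' = (if rr y y' < R \<and> \<delta> \<le> norm (qq y y') then \<psi>' (rr y y') / 2 * \<sigma>\<^sup>2 else 0)"
definition "vv y = \<gamma> *\<^sub>R fst y + 2 *\<^sub>R snd y" for y :: "(real^'d) \<times> (real^'d)"
definition "nv \<delta> y y' = (\<epsilon> * \<sigma>0 / (2 * u)) *\<^sub>R (vv y + QQ \<delta> y y' (vv y'))"
definition "bb y y' = \<epsilon> * (DH y (FF y) + DH y' (FF y'))"

lemma norm_ee:
  assumes "0 < \<delta>"
  shows "norm (ee \<delta> y y') = (if \<delta> \<le> norm (qq y y') then 1 else 0)" "norm (ee \<delta> y y') \<le> 1"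
  using assms by (auto simp: ee_def)

lemma QQ_orthogonal:
  assumes "0 < \<delta>"
  shows "orthogonal_transformation (QQ \<delta> y y')"
proof (cases "\<delta> \<le> norm (qq y y')")
  case True
  then show ?thesis
    unfolding QQ_def using norm_ee(1)[OF assms, of y y'] by (intro orthogonal_transformation_reflection) simp
next
  case False
  then have "QQ \<delta> y y' = (\<lambda>b. b)" by (simp add: QQ_def ee_def fun_eq_iff)
  then show ?thesis by (simp add: orthogonal_transformation_def linear_id[unfolded id_def])
qed

lemma norm_QQ: "0 < \<delta> \<Longrightarrow> norm (QQ \<delta> y y' b) = norm b"
  using QQ_orthogonal by (rule orthogonal_transformation_norm)

lemma inner_QQ: "a \<bullet> QQ \<delta> y y' b = QQ \<delta> y y' a \<bullet> b"
  by (simp add: QQ_def inner_simps inner_commute)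

text \<open>Along \<open>ee\<close>, reflection turns the sum of gradients in \<open>nv\<close> into
  their difference; without reflection both sides vanish.\<close>

lemma ee_inner_nv:
  assumes "0 < \<delta>"
  shows "ee \<delta> y y' \<bullet> nv \<delta> y y' = \<epsilon> * \<sigma>0 / (2 * u) * (ee \<delta> y y' \<bullet> nn y y')"
proof (cases "\<delta> \<le> norm (qq y y')")
  case True
  then have "ee \<delta> y y' \<bullet> ee \<delta> y y' = 1" using norm_ee(1)[OF assms, of y y'] by (simp add: norm_eq_1)
  then have "ee \<delta> y y' \<bullet> QQ \<delta> y y' a = - (ee \<delta> y y' \<bullet> a)" for a by (simp add: QQ_def inner_simps)
  then show ?thesis by (simp add: nv_def nn_def vv_def inner_simps)
next
  case False
  then show ?thesis by (simp add: ee_def)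
qed

text \<open>Collects the three regimes: decay of \<open>GG\<close> alone beyond \<open>R\<close>,
  reflection, and the synchronous case, which is the source of the error in \<delta>. The factor
  \<open>ee \<delta> y y' \<bullet> ee \<delta> y y'\<close> is 1 or 0 and comes from the variance
  of the noise along \<open>ee\<close>.\<close>

lemma step_contraction:
  assumes \<delta>: "0 < \<delta>"
  shows "(A1 y y' + A3 \<delta> y y' * (ee \<delta> y y' \<bullet> ee \<delta> y y')) * GG y y' + f (rr y y') * b1 y y' + A2 \<delta> y y' * (ee \<delta> y y' \<bullet> nv \<delta> y y')
     \<le> - c * (f (rr y y') * GG y y') + (\<alpha> + 1) * \<gamma> * \<delta> * GG y y'"
proof -
  have pos: "0 \<le> (\<alpha> + 1) * \<gamma> * \<delta> * GG y y'"
    using alpha_pos gamma_pos \<delta> GG_ge_1[of y y'] by simp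
  consider "R \<le> rr y y'" | "rr y y' < R" "\<delta> \<le> norm (qq y y')" | "rr y y' < R" "norm (qq y y') < \<delta>" by linarith
  then show ?thesis
  proof cases
    case 1
    have "f (rr y y') * b1 y y' \<le> f (rr y y') * (- c * GG y y')" using b1_far[OF 1] f_nonneg by (intro mult_left_mono)
    then show ?thesis using 1 pos by (simp add: A1_def A2_def A3_def mult_ac)
  next
    case 2
    then have "ee \<delta> y y' \<bullet> ee \<delta> y y' = 1" using norm_ee(1)[OF \<delta>, of y y'] by (simp add: norm_eq_1)
    then show ?thesis
      using 2 contraction_reflection[of y y' "ee \<delta> y y'"] norm_ee(2)[OF \<delta>] pos
      unfolding ee_inner_nv[OF \<delta>] by (simp add: A1_def A2_def A3_def distrib_right)
  next
    case 3
    then show ?thesis using contraction_synchronous[of y y' \<delta>] by (simp add: A1_def A2_def A3_def)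
  qed
qed

definition "\<beta>m = \<alpha> * \<gamma> * (R + R / \<alpha>) + u * L / \<gamma> * (R / \<alpha>)"

lemma beta_bound:
  assumes "rr y y' \<le> R"
  shows "\<bar>\<beta> y y'\<bar> \<le> \<beta>m"
proof -
  have q: "norm (qq y y') \<le> R" using assms alpha_pos by (smt (verit) rr_def mult_nonneg_nonneg norm_ge_zero)
  have "\<alpha> * norm (zz y y') \<le> R" using assms by (smt (verit) rr_def norm_ge_zero)
  then have z: "norm (zz y y') \<le> R / \<alpha>" using alpha_pos by (simp add: field_simps)
  have "\<bar>norm (qq y y') - norm (zz y y')\<bar> \<le> R + R / \<alpha>"
    using q z norm_ge_zero[of "qq y y'"] norm_ge_zero[of "zz y y'"] by (simp only: abs_le_iff) linarith
  then have 1: "\<bar>\<alpha> * \<gamma> * (norm (qq y y') - norm (zz y y'))\<bar> \<le> \<alpha> * \<gamma> * (R + R / \<alpha>)"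
    using alpha_pos gamma_pos by (simp add: abs_mult)
  have "\<bar>u * L / \<gamma> * norm (zz y y')\<bar> = u * L / \<gamma> * norm (zz y y')" using u_pos L_pos gamma_pos by simp
  also have "\<dots> \<le> u * L / \<gamma> * (R / \<alpha>)" using z u_pos L_pos gamma_pos by (intro mult_left_mono) simp_all
  finally show ?thesis using 1 unfolding \<beta>_def \<beta>m_def by linarith
qed

lemma beta_m_nonneg: "0 \<le> \<beta>m"
  using alpha_pos gamma_pos u_pos L_pos R_pos by (simp add: \<beta>m_def)

text \<open>Constancy of f, \<open>f_cubic_bound\<close> or \<open>f_tangent\<close> applies,
  according to the regime. \<open>W\<close> serves for both Euler errors, and \<open>C\<close>
  depends on \<delta> but not on the points, the step or the noise.\<close>

lemma f_step:
  assumes \<delta>: "0 < \<delta>" and C0: "0 \<le> C0"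
  obtains C where "0 \<le> C" "\<And>s \<Xi> W y y' b e e'. 0 < s \<Longrightarrow> s \<le> 1 \<Longrightarrow> s\<^sup>2 * \<gamma> \<le> 1 \<Longrightarrow> 1 \<le> \<Xi> \<Longrightarrow> 1 \<le> W \<Longrightarrow> norm b \<le> s * \<Xi> \<Longrightarrow>
      norm e \<le> C0 * W * (s ^ 3 * \<Xi>) \<Longrightarrow> norm e' \<le> C0 * W * (s ^ 3 * \<Xi>) \<Longrightarrow>
      f (rr (y + s\<^sup>2 *\<^sub>R FF y + SS b + e) (y' + s\<^sup>2 *\<^sub>R FF y' + SS (QQ \<delta> y y' b) + e'))
      \<le> f (rr y y') + s\<^sup>2 * A1 y y' + A2 \<delta> y y' * (ee \<delta> y y' \<bullet> b) + A3 \<delta> y y' * (ee \<delta> y y' \<bullet> b)\<^sup>2 + C * W * (s ^ 3 * \<Xi> ^ 3)"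
proof -
  define P where "P = \<kappa> * R + 9 / 4 * c * \<gamma> / u * R"
  have P0: "0 \<le> P" using kappa_nonneg R_pos c_pos gamma_pos u_pos by (simp add: P_def)
  obtain Cf where Cf: "0 \<le> Cf" "\<And>r s. \<delta> \<le> r \<Longrightarrow> r \<le> R \<Longrightarrow> f (r + s) \<le> f r + \<psi> r * s + \<psi>' r / 2 * s\<^sup>2 + Cf * \<bar>s\<bar> ^ 3"
    using f_cubic_bound[OF \<delta>] by blast
  define Ce where "Ce = 2 * C0 * (\<alpha> + 1 + 1 / \<gamma>)"
  define C where "C = P * \<beta>m * \<sigma> + Cf * (\<beta>m + \<sigma>) ^ 3 + 2 * \<sigma> ^ 3 / \<delta>\<^sup>2 + Ce"
  have Ce0: "0 \<le> Ce" using C0 alpha_pos gamma_pos by (simp add: Ce_def)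
  have parts: "0 \<le> P * \<beta>m * \<sigma>" "0 \<le> Cf * (\<beta>m + \<sigma>) ^ 3" "0 \<le> 2 * \<sigma> ^ 3 / \<delta>\<^sup>2"
    using P0 beta_m_nonneg sigma_squared(2) Cf(1) by simp_all
  show thesis
  proof (rule that)
    show C0: "0 \<le> C" using parts Ce0 by (simp add: C_def)
    fix s \<Xi> W :: real and y y' e e' :: "(real^'d) \<times> (real^'d)" and b :: "real^'d"
    assume s: "0 < s" "s \<le> 1" "s\<^sup>2 * \<gamma> \<le> 1" and \<Xi>: "1 \<le> \<Xi>" and W: "1 \<le> W" and b: "norm b \<le> s * \<Xi>"
      and e: "norm e \<le> C0 * W * (s ^ 3 * \<Xi>)" "norm e' \<le> C0 * W * (s ^ 3 * \<Xi>)"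
    have le: "s ^ j * (W ^ i * \<Xi> ^ l) \<le> s ^ j' * (W ^ i' * \<Xi> ^ l')" if "j' \<le> j" "i \<le> i'" "l \<le> l'" for i j l i' j' l'
      using that s W \<Xi> by (intro mult_mono power_decreasing power_increasing) simp_all
    define T where "T = s ^ 3 * (W * \<Xi> ^ 3)"
    have T0: "0 \<le> T" using s W \<Xi> by (simp add: T_def)
    define r where "r = rr y y'"
    define r1 where "r1 = rr (y + s\<^sup>2 *\<^sub>R FF y + SS b + e) (y' + s\<^sup>2 *\<^sub>R FF y' + SS (QQ \<delta> y y' b) + e')"
    define \<zeta> where "\<zeta> = ee \<delta> y y' \<bullet> b"
    have r0: "0 \<le> r" by (simp add: r_def rr_nonneg)
    define E where "E = (\<alpha> + 1 + 1 / \<gamma>) * (norm e + norm e')"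
    have E: "0 \<le> E" "E \<le> Ce * T"
    proof -
      show "0 \<le> E" using alpha_pos gamma_pos by (simp add: E_def)
      have "E \<le> (\<alpha> + 1 + 1 / \<gamma>) * (2 * (C0 * W * (s ^ 3 * \<Xi>)))"
        unfolding E_def using e alpha_pos gamma_pos by (intro mult_left_mono) simp_all
      also have "\<dots> = Ce * (s ^ 3 * (W * \<Xi>))" by (simp add: Ce_def)
      also have "\<dots> \<le> Ce * T" unfolding T_def using le[of 3 3 1 1 1 3] Ce0 by - (rule mult_left_mono, simp_all)
      finally show "E \<le> Ce * T" .
    qed
    have r1: "r1 \<le> \<alpha> * norm (zz y y') + s\<^sup>2 * \<beta> y y' + norm (qq y y' + (\<sigma>0 / \<gamma>) *\<^sub>R (b - QQ \<delta> y y' b)) + E"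
      unfolding r1_def E_def using s by (intro rr_step) simp_all
    have \<zeta>: "\<bar>\<zeta>\<bar> \<le> s * \<Xi>"
    proof -
      have "\<bar>\<zeta>\<bar> \<le> norm (ee \<delta> y y') * norm b" unfolding \<zeta>_def by (rule Cauchy_Schwarz_ineq2)
      also have "\<dots> \<le> 1 * (s * \<Xi>)" using norm_ee(2)[OF \<delta>] b by (intro mult_mono) simp_all
      finally show ?thesis by simp
    qed
    have goal: "f r1 \<le> f r + s\<^sup>2 * A1 y y' + A2 \<delta> y y' * \<zeta> + A3 \<delta> y y' * \<zeta>\<^sup>2 + C * T"
    proof -
      consider "R \<le> r" | "r < R" "\<delta> \<le> norm (qq y y')" | "r < R" "norm (qq y y') < \<delta>" by linarith
      then show ?thesis
      proof cases
        case 1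
        have "f r1 \<le> f (max r1 R)" by (intro f_mono) simp
        also have "\<dots> = f R" by (intro f_ge_R) simp
        also have "\<dots> = f r" using 1 by (intro f_ge_R[symmetric])
        finally show ?thesis using 1 mult_nonneg_nonneg[OF C0 T0] unfolding A1_def A2_def A3_def r_def[symmetric] by simp
      next
        case 2
        define q where "q = norm (qq y y')"
        have q: "\<delta> \<le> q" "0 < q" using 2 \<delta> unfolding q_def by linarith+
        have r\<delta>: "\<delta> \<le> r" "r \<le> R" using q 2 alpha_pos by (simp_all add: r_def rr_def q_def add_increasing)
        \<comment> \<open>The difference of the two noises is parallel to \<open>qq\<close>, so the
          new norm is the absolute value of a real number.\<close>
        have "qq y y' = q *\<^sub>R ee \<delta> y y'" using 2 q by (auto simp: ee_def q_def)
        moreover have "(\<sigma>0 / \<gamma>) *\<^sub>R (b - QQ \<delta> y y' b) = (\<sigma> * \<zeta>) *\<^sub>R ee \<delta> y y'"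
          by (simp add: QQ_def \<zeta>_def \<sigma>_def mult_ac)
        ultimately have "qq y y' + (\<sigma>0 / \<gamma>) *\<^sub>R (b - QQ \<delta> y y' b) = (q + \<sigma> * \<zeta>) *\<^sub>R ee \<delta> y y'"
          by (simp add: scaleR_add_left)
        then have "norm (qq y y' + (\<sigma>0 / \<gamma>) *\<^sub>R (b - QQ \<delta> y y' b)) = \<bar>q + \<sigma> * \<zeta>\<bar>"
          using norm_ee(1)[OF \<delta>, of y y'] 2 by simp
        also have "\<dots> \<le> q + \<sigma> * \<zeta> + 2 * \<bar>\<sigma> * \<zeta>\<bar> ^ 3 / \<delta>\<^sup>2" by (rule abs_add_le_cubic[OF \<delta> q(1)])
        finally have nq: "norm (qq y y' + (\<sigma>0 / \<gamma>) *\<^sub>R (b - QQ \<delta> y y' b)) \<le> q + \<sigma> * \<zeta> + 2 * \<bar>\<sigma> * \<zeta>\<bar> ^ 3 / \<delta>\<^sup>2" .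
        define s0 where "s0 = s\<^sup>2 * \<beta> y y' + \<sigma> * \<zeta>"
        have \<beta>: "\<bar>\<beta> y y'\<bar> \<le> \<beta>m" using 2 by (intro beta_bound) (simp add: r_def)
        have \<tau>: "2 * \<bar>\<sigma> * \<zeta>\<bar> ^ 3 / \<delta>\<^sup>2 \<le> 2 * \<sigma> ^ 3 / \<delta>\<^sup>2 * T"
        proof -
          have "\<bar>\<sigma> * \<zeta>\<bar> \<le> \<sigma> * (s * \<Xi>)" using \<zeta> sigma_squared(2) by (simp add: abs_mult)
          then have "\<bar>\<sigma> * \<zeta>\<bar> ^ 3 \<le> (\<sigma> * (s * \<Xi>)) ^ 3" by (intro power_mono) simp_all
          also have "\<dots> = \<sigma> ^ 3 * (s ^ 3 * \<Xi> ^ 3)" by (simp add: power_mult_distrib)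
          also have "\<dots> \<le> \<sigma> ^ 3 * T" unfolding T_def using le[of 3 3 0 1 3 3] sigma_squared(2) by - (rule mult_left_mono, simp_all)
          finally have "2 / \<delta>\<^sup>2 * \<bar>\<sigma> * \<zeta>\<bar> ^ 3 \<le> 2 / \<delta>\<^sup>2 * (\<sigma> ^ 3 * T)" by (intro mult_left_mono) simp_all
          then show ?thesis by simp
        qed
        have "f r1 \<le> f ((r + s0) + (2 * \<bar>\<sigma> * \<zeta>\<bar> ^ 3 / \<delta>\<^sup>2 + E))"
          using r1 nq by (intro f_mono) (simp add: s0_def r_def rr_def q_def)
        also have "\<dots> \<le> f (r + s0) + (2 * \<bar>\<sigma> * \<zeta>\<bar> ^ 3 / \<delta>\<^sup>2 + E)"
        proof -
          have "0 \<le> 2 * \<bar>\<sigma> * \<zeta>\<bar> ^ 3 / \<delta>\<^sup>2 + E" using E by simp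
          then show ?thesis using f_mono_lipschitz(2)[of "r + s0" "(r + s0) + (2 * \<bar>\<sigma> * \<zeta>\<bar> ^ 3 / \<delta>\<^sup>2 + E)"] by simp
        qed
        also have "f (r + s0) \<le> f r + \<psi> r * s0 + \<psi>' r / 2 * s0\<^sup>2 + Cf * \<bar>s0\<bar> ^ 3" by (rule Cf(2)[OF r\<delta>])
        \<comment> \<open>Only the noise part of the square is kept: the square of the drift has the
          favourable sign, and the mixed term is of order s^3.\<close>
        also have "\<psi>' r / 2 * s0\<^sup>2 \<le> \<psi>' r / 2 * (\<sigma>\<^sup>2 * \<zeta>\<^sup>2) + P * \<beta>m * \<sigma> * T"
        proof -
          have p: "\<psi>' r \<le> 0" "- P \<le> \<psi>' r" using \<psi>'_bounds[OF r0 r\<delta>(2)] by (simp_all add: P_def)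
          have "\<psi>' r / 2 * s0\<^sup>2 = \<psi>' r / 2 * (\<sigma>\<^sup>2 * \<zeta>\<^sup>2) + \<psi>' r / 2 * (s\<^sup>2 * \<beta> y y')\<^sup>2 + \<psi>' r * (s\<^sup>2 * \<beta> y y' * \<sigma> * \<zeta>)"
            by (simp add: s0_def power2_eq_square algebra_simps)
          moreover have "\<psi>' r / 2 * (s\<^sup>2 * \<beta> y y')\<^sup>2 \<le> 0" using p by (intro mult_nonpos_nonneg) simp_all
          moreover have "\<psi>' r * (s\<^sup>2 * \<beta> y y' * \<sigma> * \<zeta>) \<le> P * \<beta>m * \<sigma> * T"
          proof -
            have "\<psi>' r * (s\<^sup>2 * \<beta> y y' * \<sigma> * \<zeta>) \<le> \<bar>\<psi>' r\<bar> * (s\<^sup>2 * \<bar>\<beta> y y'\<bar> * \<sigma> * \<bar>\<zeta>\<bar>)"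
              using sigma_squared(2) abs_ge_self[of "\<psi>' r * (s\<^sup>2 * \<beta> y y' * \<sigma> * \<zeta>)"] by (simp add: abs_mult)
            also have "\<dots> \<le> P * (s\<^sup>2 * \<beta>m * \<sigma> * (s * \<Xi>))"
              using p \<beta> \<zeta> sigma_squared(2) P0 beta_m_nonneg by (intro mult_mono mult_left_mono mult_right_mono mult_nonneg_nonneg) auto
            also have "\<dots> = P * \<beta>m * \<sigma> * (s ^ 3 * \<Xi>)" by (simp add: power2_eq_square power3_eq_cube)
            also have "\<dots> \<le> P * \<beta>m * \<sigma> * T" unfolding T_def using le[of 3 3 0 1 1 3] parts(1) by - (rule mult_left_mono, simp_all)
            finally show ?thesis .
          qed
          ultimately show ?thesis by linarith
        qed
        also have "Cf * \<bar>s0\<bar> ^ 3 \<le> Cf * (\<beta>m + \<sigma>) ^ 3 * T"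
        proof -
          have "\<bar>s0\<bar> \<le> s\<^sup>2 * \<bar>\<beta> y y'\<bar> + \<sigma> * \<bar>\<zeta>\<bar>"
            unfolding s0_def using sigma_squared(2) by (intro abs_triangle_ineq[THEN order_trans]) (simp add: abs_mult)
          also have "\<dots> \<le> s\<^sup>2 * \<beta>m + \<sigma> * (s * \<Xi>)" using \<beta> \<zeta> sigma_squared(2) by (intro add_mono mult_left_mono) simp_all
          also have "s\<^sup>2 * \<beta>m \<le> \<beta>m * (s * \<Xi>)" using mult_left_mono[OF le[of 1 2 0 0 0 1] beta_m_nonneg] by (simp add: mult.commute)
          finally have "\<bar>s0\<bar> \<le> (\<beta>m + \<sigma>) * (s * \<Xi>)" by (simp add: distrib_right)
          then have "\<bar>s0\<bar> ^ 3 \<le> ((\<beta>m + \<sigma>) * (s * \<Xi>)) ^ 3" by (intro power_mono) simp_all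
          also have "\<dots> = (\<beta>m + \<sigma>) ^ 3 * (s ^ 3 * \<Xi> ^ 3)" by (simp add: power_mult_distrib)
          also have "\<dots> \<le> (\<beta>m + \<sigma>) ^ 3 * T" unfolding T_def using le[of 3 3 0 1 3 3] beta_m_nonneg sigma_squared(2) by - (rule mult_left_mono, simp_all)
          finally show ?thesis using Cf(1) by (simp add: mult_left_mono mult.assoc)
        qed
        finally have "f r1 \<le> f r + \<psi> r * s0 + (\<psi>' r / 2 * (\<sigma>\<^sup>2 * \<zeta>\<^sup>2) + P * \<beta>m * \<sigma> * T) + Cf * (\<beta>m + \<sigma>) ^ 3 * T + (2 * \<bar>\<sigma> * \<zeta>\<bar> ^ 3 / \<delta>\<^sup>2 + E)"
          by simp
        also have "\<dots> \<le> f r + \<psi> r * s0 + \<psi>' r / 2 * (\<sigma>\<^sup>2 * \<zeta>\<^sup>2) + C * T"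
          using \<tau> E(2) unfolding C_def distrib_right by linarith
        also have "\<dots> = f r + s\<^sup>2 * A1 y y' + A2 \<delta> y y' * \<zeta> + A3 \<delta> y y' * \<zeta>\<^sup>2 + C * T"
          using 2 unfolding A1_def A2_def A3_def r_def[symmetric] by (simp add: s0_def algebra_simps)
        finally show ?thesis .
      next
        case 3
        then have QQ: "QQ \<delta> y y' b = b" by (simp add: QQ_def ee_def)
        have "f r1 \<le> f ((r + s\<^sup>2 * \<beta> y y') + E)" using r1 unfolding QQ by (intro f_mono) (simp add: r_def rr_def)
        also have "\<dots> \<le> f (r + s\<^sup>2 * \<beta> y y') + E"
          using f_mono_lipschitz(2)[of "r + s\<^sup>2 * \<beta> y y'" "(r + s\<^sup>2 * \<beta> y y') + E"] E by simp
        also have "f (r + s\<^sup>2 * \<beta> y y') \<le> f r + \<psi> r * (s\<^sup>2 * \<beta> y y')"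
        \<comment> \<open>The tangent bound asks for a nonnegative new argument, which
          \<open>s\<^sup>2 * \<gamma> \<le> 1\<close> guarantees.\<close>
        proof (rule f_tangent[OF r0])
          have "r + s\<^sup>2 * \<beta> y y' = \<alpha> * ((1 - s\<^sup>2 * \<gamma>) * norm (zz y y')) + s\<^sup>2 * (\<alpha> * \<gamma> * norm (qq y y')) + s\<^sup>2 * (u * L / \<gamma> * norm (zz y y')) + norm (qq y y')"
            by (simp add: r_def rr_def \<beta>_def algebra_simps)
          also have "0 \<le> \<dots>" using s alpha_pos gamma_pos u_pos L_pos by (intro add_nonneg_nonneg mult_nonneg_nonneg) simp_all
          finally show "0 \<le> r + s\<^sup>2 * \<beta> y y'" .
        qed (use 3 in simp)
        finally have "f r1 \<le> f r + \<psi> r * (s\<^sup>2 * \<beta> y y') + E" by simp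
        also have "\<dots> \<le> f r + \<psi> r * (s\<^sup>2 * \<beta> y y') + C * T"
        proof -
          have "Ce * T \<le> C * T" using parts T0 by (intro mult_right_mono) (simp_all add: C_def)
          then show ?thesis using E(2) by linarith
        qed
        finally show ?thesis using 3 unfolding A1_def A2_def A3_def r_def[symmetric] by (simp add: mult_ac)
      qed
    qed
    then show "f (rr (y + s\<^sup>2 *\<^sub>R FF y + SS b + e) (y' + s\<^sup>2 *\<^sub>R FF y' + SS (QQ \<delta> y y' b) + e'))
      \<le> f (rr y y') + s\<^sup>2 * A1 y y' + A2 \<delta> y y' * (ee \<delta> y y' \<bullet> b) + A3 \<delta> y y' * (ee \<delta> y y' \<bullet> b)\<^sup>2 + C * W * (s ^ 3 * \<Xi> ^ 3)"
      unfolding r1_def[symmetric] r_def[symmetric] \<zeta>_def[symmetric] by (simp add: T_def mult_ac)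
  qed
qed

definition "KH = U 0 + norm (gradU 0) + L + ((\<gamma> + 1)\<^sup>2 + 1) / (4 * u)"

lemma KH_nonneg: "0 \<le> KH"
  using U_nonneg[of 0] L_pos u_pos by (simp add: KH_def)

lemma H_growth: "H y \<le> KH * (1 + norm y)\<^sup>2"
proof -
  obtain x v where y: "y = (x, v)" by (cases y)
  define n where "n = norm y"
  have x: "norm x \<le> n" "norm v \<le> n" "norm (\<gamma> *\<^sub>R x + v) \<le> (\<gamma> + 1) * n" "0 \<le> n"
    using norm_fst_le_norm[of y] norm_snd_le_norm[of y] norm_combination_le[of y] by (simp_all add: n_def y)
  have "U x \<le> U 0 + gradU 0 \<bullet> x + L * (norm x)\<^sup>2" using U_taylor[of 0 x] by simp
  also have "gradU 0 \<bullet> x \<le> norm (gradU 0) * n"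
    using norm_cauchy_schwarz[of "gradU 0" x] mult_left_mono[OF x(1), of "norm (gradU 0)"] by simp
  also have "L * (norm x)\<^sup>2 \<le> L * n\<^sup>2" using x L_pos by (intro mult_left_mono power_mono) simp_all
  finally have U: "U x \<le> U 0 + norm (gradU 0) * n + L * n\<^sup>2" by simp
  have "Qf x v \<le> (norm (\<gamma> *\<^sub>R x + v))\<^sup>2 + (norm v)\<^sup>2" using lam by (simp add: Qf_def)
  also have "\<dots> \<le> ((\<gamma> + 1) * n)\<^sup>2 + n\<^sup>2" using x by (intro add_mono power_mono) simp_all
  finally have "Qf x v \<le> ((\<gamma> + 1)\<^sup>2 + 1) * n\<^sup>2" by (simp add: power2_eq_square algebra_simps)
  then have "1 / (4 * u) * Qf x v \<le> 1 / (4 * u) * (((\<gamma> + 1)\<^sup>2 + 1) * n\<^sup>2)"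
    using u_pos by (intro mult_left_mono) simp_all
  then have H: "H y \<le> U 0 + norm (gradU 0) * n + L * n\<^sup>2 + ((\<gamma> + 1)\<^sup>2 + 1) / (4 * u) * n\<^sup>2"
    using U by (simp add: y H_eq)
  have n1: "1 \<le> (1 + n)\<^sup>2" "n \<le> (1 + n)\<^sup>2" "n\<^sup>2 \<le> (1 + n)\<^sup>2"
    using x(4) by (simp_all add: power2_eq_square algebra_simps)
  have "U 0 \<le> U 0 * (1 + n)\<^sup>2" using mult_left_mono[OF n1(1) U_nonneg[of 0]] by simp
  moreover have "norm (gradU 0) * n \<le> norm (gradU 0) * (1 + n)\<^sup>2" using n1 by (intro mult_left_mono) simp_all
  moreover have "L * n\<^sup>2 \<le> L * (1 + n)\<^sup>2" using n1 L_pos by (intro mult_left_mono) simp_all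
  moreover have "((\<gamma> + 1)\<^sup>2 + 1) / (4 * u) * n\<^sup>2 \<le> ((\<gamma> + 1)\<^sup>2 + 1) / (4 * u) * (1 + n)\<^sup>2"
    using n1 u_pos by (intro mult_left_mono) simp_all
  ultimately show ?thesis using H unfolding KH_def n_def[symmetric] distrib_right by linarith
qed

text \<open>One constant for the growth of \<open>GG\<close>, \<open>bb\<close> and
  \<open>nv\<close>, so that \<open>product_expansion\<close> can be used with a single
  \<open>g\<close>.\<close>

definition "Kg = 1 + 2 * \<epsilon> * KH + 2 * \<epsilon> * (K1 * K2) + \<epsilon> * \<sigma>0 / (2 * u) * (\<gamma> + 2)"

lemma Kg_bounds:
  defines "W y y' \<equiv> 1 + norm y + norm y'"
  shows "GG y y' \<le> Kg * (W y y')\<^sup>2" "\<bar>bb y y'\<bar> \<le> Kg * (W y y')\<^sup>2" "0 < \<delta> \<Longrightarrow> norm (nv \<delta> y y') \<le> Kg * W y y'"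
proof -
  have W: "1 \<le> W y y'" "1 \<le> (W y y')\<^sup>2" by (simp_all add: W_def one_le_power)
  have le: "(1 + norm y)\<^sup>2 \<le> (W y y')\<^sup>2" "(1 + norm y')\<^sup>2 \<le> (W y y')\<^sup>2" by (simp_all add: W_def power_mono)
  have parts: "0 \<le> 2 * \<epsilon> * KH" "0 \<le> 2 * \<epsilon> * (K1 * K2)" "0 \<le> \<epsilon> * \<sigma>0 / (2 * u) * (\<gamma> + 2)"
    using eps_pos KH_nonneg K1_nonneg K2_nonneg sigma0 gamma_pos u_pos by simp_all
  have "\<epsilon> * H y \<le> \<epsilon> * (KH * (W y y')\<^sup>2)" "\<epsilon> * H y' \<le> \<epsilon> * (KH * (W y y')\<^sup>2)"
    using eps_pos H_growth[of y] H_growth[of y'] mult_left_mono[OF le(1) KH_nonneg] mult_left_mono[OF le(2) KH_nonneg]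
    by (simp_all add: mult_left_mono)
  then have "GG y y' \<le> (1 + 2 * \<epsilon> * KH) * (W y y')\<^sup>2" using W(2) unfolding GG_def distrib_right mult.assoc mult_1 by linarith
  also have "\<dots> \<le> Kg * (W y y')\<^sup>2" using parts by (intro mult_right_mono) (simp_all add: Kg_def)
  finally show "GG y y' \<le> Kg * (W y y')\<^sup>2" .
  have DHF: "\<bar>DH a (FF a)\<bar> \<le> K1 * K2 * (1 + norm a)\<^sup>2" for a
  proof -
    have "\<bar>DH a (FF a)\<bar> \<le> K2 * (1 + norm a) * norm (FF a)" by (rule DH_bound)
    also have "\<dots> \<le> K2 * (1 + norm a) * (K1 * (1 + norm a))" using K2_nonneg by (intro mult_left_mono FF_growth) simp
    finally show ?thesis by (simp add: power2_eq_square mult_ac)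
  qed
  have "\<bar>DH y (FF y)\<bar> \<le> K1 * K2 * (W y y')\<^sup>2" "\<bar>DH y' (FF y')\<bar> \<le> K1 * K2 * (W y y')\<^sup>2"
    using DHF[of y] DHF[of y'] le K1_nonneg K2_nonneg mult_left_mono[OF le(1), of "K1 * K2"] mult_left_mono[OF le(2), of "K1 * K2"] by auto
  then have "\<bar>DH y (FF y) + DH y' (FF y')\<bar> \<le> 2 * (K1 * K2 * (W y y')\<^sup>2)" by linarith
  then have "\<bar>bb y y'\<bar> \<le> \<epsilon> * (2 * (K1 * K2 * (W y y')\<^sup>2))" using eps_pos by (simp add: bb_def abs_mult)
  also have "\<dots> = 2 * \<epsilon> * (K1 * K2) * (W y y')\<^sup>2" by simp
  also have "\<dots> \<le> Kg * (W y y')\<^sup>2" using parts by (intro mult_right_mono) (simp_all add: Kg_def)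
  finally show "\<bar>bb y y'\<bar> \<le> Kg * (W y y')\<^sup>2" .
  assume \<delta>: "0 < \<delta>"
  have vv: "norm (vv a) \<le> (\<gamma> + 2) * norm a" for a
  proof -
    have "norm (vv a) \<le> \<gamma> * norm (fst a) + 2 * norm (snd a)"
      using gamma_pos norm_triangle_ineq[of "\<gamma> *\<^sub>R fst a" "2 *\<^sub>R snd a"] by (simp add: vv_def)
    also have "\<dots> \<le> \<gamma> * norm a + 2 * norm a"
      using gamma_pos norm_fst_le_norm[of a] norm_snd_le_norm[of a] by (intro add_mono mult_left_mono) simp_all
    finally show ?thesis by (simp add: distrib_right)
  qed
  have "norm (vv y + QQ \<delta> y y' (vv y')) \<le> norm (vv y) + norm (vv y')"
    using norm_triangle_ineq[of "vv y" "QQ \<delta> y y' (vv y')"] norm_QQ[OF \<delta>] by simp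
  also have "\<dots> \<le> (\<gamma> + 2) * norm y + (\<gamma> + 2) * norm y'" by (intro add_mono vv)
  also have "\<dots> \<le> (\<gamma> + 2) * W y y'" using gamma_pos by (simp add: W_def algebra_simps)
  finally have "norm (nv \<delta> y y') \<le> \<epsilon> * \<sigma>0 / (2 * u) * ((\<gamma> + 2) * W y y')"
    using eps_pos sigma0 u_pos by (simp add: nv_def mult_left_mono divide_right_mono)
  also have "\<dots> = \<epsilon> * \<sigma>0 / (2 * u) * (\<gamma> + 2) * W y y'" by simp
  also have "\<dots> \<le> Kg * W y y'" using parts W by (intro mult_right_mono) (simp_all add: Kg_def)
  finally show "norm (nv \<delta> y y') \<le> Kg * W y y'" .
qed

lemma A_bounds:
  obtains a where "0 \<le> a" "\<And>\<delta> y y'. \<bar>A1 y y'\<bar> \<le> a" "\<And>\<delta> y y'. \<bar>A2 \<delta> y y'\<bar> \<le> a" "\<And>\<delta> y y'. \<bar>A3 \<delta> y y'\<bar> \<le> a"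
proof
  define P where "P = \<kappa> * R + 9 / 4 * c * \<gamma> / u * R"
  define a where "a = \<beta>m + \<sigma> + P * \<sigma>\<^sup>2"
  have P0: "0 \<le> P" using kappa_nonneg R_pos c_pos gamma_pos u_pos by (simp add: P_def)
  have parts: "0 \<le> \<beta>m" "0 \<le> \<sigma>" "0 \<le> P * \<sigma>\<^sup>2" using beta_m_nonneg sigma_squared(2) P0 by simp_all
  show "0 \<le> a" using parts by (simp add: a_def)
  fix \<delta> y y'
  have \<psi>: "\<bar>\<psi> (rr y y')\<bar> \<le> 1" if "rr y y' < R" using \<psi>_bounds[OF rr_nonneg less_imp_le[OF that]] by simp
  have \<psi>': "\<bar>\<psi>' (rr y y') / 2\<bar> \<le> P" if "rr y y' < R"
    using \<psi>'_bounds[OF rr_nonneg less_imp_le[OF that]] P0 by (simp add: P_def abs_le_iff)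
  show "\<bar>A1 y y'\<bar> \<le> a"
  proof (cases "rr y y' < R")
    case True
    have "\<bar>\<psi> (rr y y')\<bar> * \<bar>\<beta> y y'\<bar> \<le> 1 * \<beta>m"
      using \<psi>[OF True] beta_bound[of y y'] True by (intro mult_mono) simp_all
    then show ?thesis using parts True by (simp add: A1_def a_def abs_mult)
  qed (use parts in \<open>simp add: A1_def a_def\<close>)
  show "\<bar>A2 \<delta> y y'\<bar> \<le> a"
  proof (cases "rr y y' < R \<and> \<delta> \<le> norm (qq y y')")
    case True
    have "\<bar>\<psi> (rr y y')\<bar> * \<sigma> \<le> 1 * \<sigma>" using \<psi> True parts by (intro mult_right_mono) simp_all
    then show ?thesis using parts True by (simp add: A2_def a_def abs_mult)
  qed (use parts in \<open>auto simp: A2_def a_def\<close>)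
  show "\<bar>A3 \<delta> y y'\<bar> \<le> a"
  proof (cases "rr y y' < R \<and> \<delta> \<le> norm (qq y y')")
    case True
    have "\<bar>\<psi>' (rr y y') / 2\<bar> * \<sigma>\<^sup>2 \<le> P * \<sigma>\<^sup>2" using \<psi>' True by (intro mult_right_mono) simp_all
    then show ?thesis using parts True by (simp add: A3_def a_def abs_mult)
  qed (use parts in \<open>auto simp: A3_def a_def\<close>)
qed

text \<open>The expansions of f and \<open>GG\<close> multiplied together. Up to the remainder the
  bound is a polynomial of degree two in \<open>b\<close>, so its expectation is given by first and
  second Gaussian moments.\<close>

lemma rho_step:
  assumes \<delta>: "0 < \<delta>" and C0: "0 \<le> C0"
  obtains C where "0 \<le> C" "\<And>s \<Xi> y y' b e e'. 0 < s \<Longrightarrow> s \<le> 1 \<Longrightarrow> s\<^sup>2 * \<gamma> \<le> 1 \<Longrightarrow> 1 \<le> \<Xi> \<Longrightarrow> norm b \<le> s * \<Xi> \<Longrightarrow>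
      norm e \<le> C0 * (1 + norm y) * (s ^ 3 * \<Xi>) \<Longrightarrow> norm e' \<le> C0 * (1 + norm y') * (s ^ 3 * \<Xi>) \<Longrightarrow>
      \<rho> (y + s\<^sup>2 *\<^sub>R FF y + SS b + e) (y' + s\<^sup>2 *\<^sub>R FF y' + SS (QQ \<delta> y y' b) + e')
      \<le> f (rr y y') * GG y y' + s\<^sup>2 * (A1 y y' * GG y y' + f (rr y y') * bb y y') + A2 \<delta> y y' * GG y y' * (ee \<delta> y y' \<bullet> b)
        + A3 \<delta> y y' * GG y y' * (ee \<delta> y y' \<bullet> b)\<^sup>2 + f (rr y y') * (nv \<delta> y y' \<bullet> b) + 2 * \<epsilon> * \<gamma> * f (rr y y') * (norm b)\<^sup>2
        + A2 \<delta> y y' * ((ee \<delta> y y' \<bullet> b) * (nv \<delta> y y' \<bullet> b)) + C * ((1 + norm y + norm y') ^ 3 * (s ^ 3 * \<Xi> ^ 5))"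
proof -
  obtain a where a: "0 \<le> a" "\<And>y y'. \<bar>A1 y y'\<bar> \<le> a" "\<And>\<delta> y y'. \<bar>A2 \<delta> y y'\<bar> \<le> a" "\<And>\<delta> y y'. \<bar>A3 \<delta> y y'\<bar> \<le> a"
    using A_bounds by metis
  obtain C1 where C1: "0 \<le> C1" "\<And>s \<Xi> W y y' b e e'. 0 < s \<Longrightarrow> s \<le> 1 \<Longrightarrow> s\<^sup>2 * \<gamma> \<le> 1 \<Longrightarrow> 1 \<le> \<Xi> \<Longrightarrow> 1 \<le> W \<Longrightarrow> norm b \<le> s * \<Xi> \<Longrightarrow>
      norm e \<le> C0 * W * (s ^ 3 * \<Xi>) \<Longrightarrow> norm e' \<le> C0 * W * (s ^ 3 * \<Xi>) \<Longrightarrow>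
      f (rr (y + s\<^sup>2 *\<^sub>R FF y + SS b + e) (y' + s\<^sup>2 *\<^sub>R FF y' + SS (QQ \<delta> y y' b) + e'))
      \<le> f (rr y y') + s\<^sup>2 * A1 y y' + A2 \<delta> y y' * (ee \<delta> y y' \<bullet> b) + A3 \<delta> y y' * (ee \<delta> y y' \<bullet> b)\<^sup>2 + C1 * W * (s ^ 3 * \<Xi> ^ 3)"
    using f_step[OF \<delta> C0] by blast
  obtain CH where CH: "0 \<le> CH" "\<And>s \<Xi> y b e. 0 < s \<Longrightarrow> s \<le> 1 \<Longrightarrow> 1 \<le> \<Xi> \<Longrightarrow> norm b \<le> s * \<Xi> \<Longrightarrow> norm e \<le> C0 * (1 + norm y) * (s ^ 3 * \<Xi>) \<Longrightarrow>
      H (y + s\<^sup>2 *\<^sub>R FF y + SS b + e) \<le> H y + s\<^sup>2 * DH y (FF y) + \<sigma>0 / (2 * u) * ((\<gamma> *\<^sub>R fst y + 2 *\<^sub>R snd y) \<bullet> b) + \<gamma> * (norm b)\<^sup>2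
        + CH * (1 + norm y)\<^sup>2 * (s ^ 3 * \<Xi>\<^sup>2)"
    using H_step[OF C0] by blast
  define C2 where "C2 = 2 * \<epsilon> * CH"
  define k where "k = 2 * \<epsilon> * \<gamma>"
  have C2: "0 \<le> C2" and k: "0 \<le> k" using eps_pos CH gamma_pos by (simp_all add: C2_def k_def)
  define C where "C = 2 * a * (2 * Kg + k) + a * (Kg + k) + C1 * (3 * Kg + k) + (R + 3 * a + C1) * C2"
  have Kg: "0 \<le> Kg" using eps_pos KH_nonneg K1_nonneg K2_nonneg sigma0 gamma_pos u_pos by (simp add: Kg_def)
  show thesis
  proof (rule that)
    show "0 \<le> C" using a(1) Kg k C1(1) C2 R_pos by (simp add: C_def)
    fix s \<Xi> :: real and y y' e e' :: "(real^'d) \<times> (real^'d)" and b :: "real^'d"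
    assume s: "0 < s" "s \<le> 1" "s\<^sup>2 * \<gamma> \<le> 1" and \<Xi>: "1 \<le> \<Xi>" and b: "norm b \<le> s * \<Xi>"
      and e: "norm e \<le> C0 * (1 + norm y) * (s ^ 3 * \<Xi>)" and e': "norm e' \<le> C0 * (1 + norm y') * (s ^ 3 * \<Xi>)"
    define W where "W = 1 + norm y + norm y'"
    have W: "1 \<le> W" "1 + norm y \<le> W" "1 + norm y' \<le> W" by (simp_all add: W_def)
    define y1 where "y1 = y + s\<^sup>2 *\<^sub>R FF y + SS b + e"
    define y1' where "y1' = y' + s\<^sup>2 *\<^sub>R FF y' + SS (QQ \<delta> y y' b) + e'"
    have t0: "0 \<le> s ^ 3 * \<Xi>" "0 \<le> s ^ 3 * \<Xi>\<^sup>2" using s \<Xi> by simp_all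
    have eW: "norm e \<le> C0 * W * (s ^ 3 * \<Xi>)" "norm e' \<le> C0 * W * (s ^ 3 * \<Xi>)"
      using order_trans[OF e mult_right_mono[OF mult_left_mono[OF W(2) C0] t0(1)]]
        order_trans[OF e' mult_right_mono[OF mult_left_mono[OF W(3) C0] t0(1)]] by simp_all
    define \<zeta> where "\<zeta> = ee \<delta> y y' \<bullet> b"
    define nb where "nb = nv \<delta> y y' \<bullet> b"
    have Q: "norm (QQ \<delta> y y' b) = norm b" by (rule norm_QQ[OF \<delta>])
    have \<zeta>: "\<bar>\<zeta>\<bar> \<le> norm b"
      using Cauchy_Schwarz_ineq2[of "ee \<delta> y y'" b] mult_right_mono[OF norm_ee(2)[OF \<delta>, of y y'], of "norm b"]
      unfolding \<zeta>_def by simp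
    have nb: "\<bar>nb\<bar> \<le> Kg * W * norm b"
      using Cauchy_Schwarz_ineq2[of "nv \<delta> y y'" b] mult_right_mono[OF Kg_bounds(3)[OF \<delta>, of y y'], of "norm b"]
      unfolding nb_def W_def by simp
    have f1: "f (rr y1 y1') \<le> f (rr y y') + s\<^sup>2 * A1 y y' + A2 \<delta> y y' * \<zeta> + A3 \<delta> y y' * \<zeta>\<^sup>2 + C1 * W * (s ^ 3 * \<Xi> ^ 3)"
      unfolding y1_def y1'_def \<zeta>_def using s \<Xi> W b eW by (intro C1(2))
    have G1: "GG y1 y1' \<le> GG y y' + s\<^sup>2 * bb y y' + nb + k * (norm b)\<^sup>2 + C2 * W\<^sup>2 * (s ^ 3 * \<Xi>\<^sup>2)"
    proof -
      have p: "CH * (1 + norm y)\<^sup>2 * (s ^ 3 * \<Xi>\<^sup>2) \<le> CH * W\<^sup>2 * (s ^ 3 * \<Xi>\<^sup>2)" "CH * (1 + norm y')\<^sup>2 * (s ^ 3 * \<Xi>\<^sup>2) \<le> CH * W\<^sup>2 * (s ^ 3 * \<Xi>\<^sup>2)"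
        using CH(1) t0 W by (intro mult_right_mono mult_left_mono power_mono; simp)+
      have "H y1 \<le> H y + s\<^sup>2 * DH y (FF y) + \<sigma>0 / (2 * u) * (vv y \<bullet> b) + \<gamma> * (norm b)\<^sup>2 + CH * W\<^sup>2 * (s ^ 3 * \<Xi>\<^sup>2)"
        using CH(2)[OF s(1,2) \<Xi> b e] p(1) unfolding y1_def vv_def by linarith
      moreover have "H y1' \<le> H y' + s\<^sup>2 * DH y' (FF y') + \<sigma>0 / (2 * u) * (vv y' \<bullet> QQ \<delta> y y' b) + \<gamma> * (norm b)\<^sup>2 + CH * W\<^sup>2 * (s ^ 3 * \<Xi>\<^sup>2)"
        using CH(2)[OF s(1,2) \<Xi> _ e', of "QQ \<delta> y y' b"] b p(2) unfolding y1'_def vv_def Q by linarith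
      ultimately have "\<epsilon> * (H y1 + H y1') \<le> \<epsilon> * ((H y + s\<^sup>2 * DH y (FF y) + \<sigma>0 / (2 * u) * (vv y \<bullet> b) + \<gamma> * (norm b)\<^sup>2 + CH * W\<^sup>2 * (s ^ 3 * \<Xi>\<^sup>2))
          + (H y' + s\<^sup>2 * DH y' (FF y') + \<sigma>0 / (2 * u) * (QQ \<delta> y y' (vv y') \<bullet> b) + \<gamma> * (norm b)\<^sup>2 + CH * W\<^sup>2 * (s ^ 3 * \<Xi>\<^sup>2)))"
        using eps_pos unfolding inner_QQ by (intro mult_left_mono add_mono) simp_all
      also have "\<dots> = \<epsilon> * H y + \<epsilon> * H y' + s\<^sup>2 * bb y y' + nb + k * (norm b)\<^sup>2 + C2 * W\<^sup>2 * (s ^ 3 * \<Xi>\<^sup>2)"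
        by (simp add: bb_def nb_def nv_def k_def C2_def inner_add_left algebra_simps add_divide_distrib)
      finally show ?thesis by (simp add: GG_def distrib_left)
    qed
    have "f (rr y1 y1') * GG y1 y1' \<le> f (rr y y') * GG y y' + s\<^sup>2 * (A1 y y' * GG y y' + f (rr y y') * bb y y') + A2 \<delta> y y' * GG y y' * \<zeta> + A3 \<delta> y y' * GG y y' * \<zeta>\<^sup>2 + f (rr y y') * nb + k * f (rr y y') * (norm b)\<^sup>2 + A2 \<delta> y y' * (\<zeta> * nb)
       + (2 * a * (2 * Kg + k) + a * (Kg + k) + C1 * (3 * Kg + k) + (R + 3 * a + C1) * C2) * (W ^ 3 * (s ^ 3 * \<Xi> ^ 5))"
    proof (rule product_expansion[where g=Kg])
      show "GG y y' \<le> Kg * W\<^sup>2" "\<bar>bb y y'\<bar> \<le> Kg * W\<^sup>2" using Kg_bounds unfolding W_def by simp_all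
      show "0 \<le> GG y y'" "0 \<le> GG y1 y1'" using GG_ge_1[of y y'] GG_ge_1[of y1 y1'] by simp_all
    qed (fact s(1) s(2) W(1) \<Xi> norm_ge_zero b \<zeta> a(2) a(3) a(4) f_nonneg f_le_R nb k C1(1) C2 f1 G1)+
    then show "\<rho> (y + s\<^sup>2 *\<^sub>R FF y + SS b + e) (y' + s\<^sup>2 *\<^sub>R FF y' + SS (QQ \<delta> y y' b) + e')
      \<le> f (rr y y') * GG y y' + s\<^sup>2 * (A1 y y' * GG y y' + f (rr y y') * bb y y') + A2 \<delta> y y' * GG y y' * (ee \<delta> y y' \<bullet> b)
        + A3 \<delta> y y' * GG y y' * (ee \<delta> y y' \<bullet> b)\<^sup>2 + f (rr y y') * (nv \<delta> y y' \<bullet> b) + 2 * \<epsilon> * \<gamma> * f (rr y y') * (norm b)\<^sup>2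
        + A2 \<delta> y y' * ((ee \<delta> y y' \<bullet> b) * (nv \<delta> y y' \<bullet> b)) + C * ((1 + norm y + norm y') ^ 3 * (s ^ 3 * \<Xi> ^ 5))"
      unfolding rho_eq y1_def[symmetric] y1'_def[symmetric] C_def W_def[symmetric] \<zeta>_def[symmetric] nb_def[symmetric] k_def[symmetric] .
  qed
qed

end

section \<open>Expectations over a short time\<close>

text \<open>Jensen's inequality for the sixth power, by comparison with the tangent at the
  mean.\<close>

lemma power_mean_six:
  fixes x :: "nat \<Rightarrow> real"
  assumes "0 < m" "\<And>j. j < m \<Longrightarrow> 0 \<le> x j"
  shows "((\<Sum>j<m. x j) / real m) ^ 6 \<le> (\<Sum>j<m. x j ^ 6) / real m"
proof -
  define a where "a = (\<Sum>j<m. x j) / real m"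
  have a0: "0 \<le> a" unfolding a_def using assms(2) by (intro divide_nonneg_nonneg sum_nonneg) simp_all
  have tangent: "a ^ 6 + 6 * a ^ 5 * (t - a) \<le> t ^ 6" if "0 \<le> t" for t
  proof -
    \<comment> \<open>The quartic factor has positive coefficients, which puts t^6 above its tangent
      when t and a are nonnegative.\<close>
    have "t ^ 6 - (a ^ 6 + 6 * a ^ 5 * (t - a)) = (t - a)\<^sup>2 * (t ^ 4 + 2 * t ^ 3 * a + 3 * t\<^sup>2 * a\<^sup>2 + 4 * t * a ^ 3 + 5 * a ^ 4)"
      by algebra
    moreover have "0 \<le> \<dots>" using that a0 by simp
    ultimately show ?thesis by linarith
  qed
  have "(\<Sum>j<m. a ^ 6 + 6 * a ^ 5 * (x j - a)) \<le> (\<Sum>j<m. x j ^ 6)"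
    using assms by (intro sum_mono tangent) simp
  moreover have "(\<Sum>j<m. a ^ 6 + 6 * a ^ 5 * (x j - a)) = real m * a ^ 6 + 6 * a ^ 5 * ((\<Sum>j<m. x j) - real m * a)"
    by (simp add: sum.distrib sum_distrib_left[symmetric] sum_subtractf)
  moreover have "(\<Sum>j<m. x j) - real m * a = 0" using assms by (simp add: a_def)
  ultimately have "real m * a ^ 6 \<le> (\<Sum>j<m. x j ^ 6)" by simp
  then show ?thesis using assms by (simp add: a_def[symmetric] pos_le_divide_eq mult.commute)
qed

text \<open>Dominates the rescaled path over one time step and has moments bounded uniformly in the number
  \<open>m\<close> of Euler steps; it plays the role of \<open>\<Xi>\<close> in the pathwise expansions.\<close>

definition path_size :: "(real \<Rightarrow> 'a \<Rightarrow> 'b::real_normed_vector) \<Rightarrow> real \<Rightarrow> nat \<Rightarrow> 'a \<Rightarrow> real" where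
  "path_size B h m \<omega> = 1 + norm (B h \<omega>) / sqrt h + (\<Sum>j<m. norm (B (real j * (h / real m)) \<omega>) / sqrt h) / real m"

lemma path_size_bounds:
  assumes "0 < h" "0 < m"
  shows "1 \<le> path_size B h m \<omega>" "norm (B h \<omega>) \<le> sqrt h * path_size B h m \<omega>"
    "(h / real m) * (\<Sum>j<m. norm (B (real j * (h / real m)) \<omega>)) \<le> h * (sqrt h * path_size B h m \<omega>)"
proof -
  define a where "a = norm (B h \<omega>) / sqrt h"
  define b where "b = (\<Sum>j<m. norm (B (real j * (h / real m)) \<omega>) / sqrt h) / real m"
  have ab: "0 \<le> a" "0 \<le> b" using assms by (simp_all add: a_def b_def sum_nonneg)
  have P: "path_size B h m \<omega> = 1 + a + b" by (simp add: path_size_def a_def b_def)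
  show "1 \<le> path_size B h m \<omega>" using ab by (simp add: P)
  have "norm (B h \<omega>) = sqrt h * a" using assms by (simp add: a_def)
  also have "\<dots> \<le> sqrt h * path_size B h m \<omega>" using ab assms by (intro mult_left_mono) (simp_all add: P)
  finally show "norm (B h \<omega>) \<le> sqrt h * path_size B h m \<omega>" .
  have "(h / real m) * (\<Sum>j<m. norm (B (real j * (h / real m)) \<omega>)) = h * (sqrt h * b)"
    using assms by (simp add: b_def sum_divide_distrib[symmetric])
  also have "\<dots> \<le> h * (sqrt h * path_size B h m \<omega>)" using ab assms by (intro mult_left_mono) (simp_all add: P)
  finally show "(h / real m) * (\<Sum>j<m. norm (B (real j * (h / real m)) \<omega>)) \<le> h * (sqrt h * path_size B h m \<omega>)" .
qed

text \<open>\<open>sixth_const\<close> bounds the sixth moment of the norm of Brownian motion at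
  time 1. The factor 3^6 comes from (1 + a + b)^6 \<le> 3^6 (1 + a^6 + b^6), and each of the two
  random parts of \<open>path_size\<close> contributes one \<open>sixth_const\<close>.\<close>

definition "sixth_const d = d ^ 4 * gauss_moment 3"
definition "path_const d = 3 ^ 6 * (1 + 2 * sixth_const d)"

lemma brownian_integral:
  fixes B :: "real \<Rightarrow> 'a \<Rightarrow> real^'d" and h :: "real^'d \<Rightarrow> real"
  assumes B: "brownian_motion M B" and t: "0 < t" and h: "h \<in> borel_measurable borel"
  shows "(\<integral>\<omega>. h (B t \<omega>) \<partial>M) = (\<integral>x. h x \<partial>gauss t)" "integrable M (\<lambda>\<omega>. h (B t \<omega>)) \<longleftrightarrow> integrable (gauss t) h"
  using distr_brownian[OF B t] integral_distr[OF brownian_motion_measurable[OF B, of t] h]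
    integrable_distr_eq[OF brownian_motion_measurable[OF B, of t] h] by simp_all

lemma brownian_sixth_moment:
  fixes B :: "real \<Rightarrow> 'a \<Rightarrow> real^'d"
  assumes B: "brownian_motion M B" and t: "0 \<le> t"
  shows "integrable M (\<lambda>\<omega>. norm (B t \<omega>) ^ 6)" "(\<integral>\<omega>. norm (B t \<omega>) ^ 6 \<partial>M) \<le> sixth_const (real CARD('d)) * t ^ 3"
proof -
  interpret prob_space M using B by (rule brownian_motion_prob_space)
  have "integrable M (\<lambda>\<omega>. norm (B t \<omega>) ^ 6) \<and> (\<integral>\<omega>. norm (B t \<omega>) ^ 6 \<partial>M) \<le> sixth_const (real CARD('d)) * t ^ 3"
  proof (cases "t = 0")
    case True
    have "integrable M (\<lambda>\<omega>. norm (B 0 \<omega>) ^ 6) \<longleftrightarrow> integrable M (\<lambda>\<omega>. 0 :: real)"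
      by (rule Bochner_Integration.integrable_cong) (simp_all add: brownian_motion_path(1)[OF B])
    moreover have "(\<integral>\<omega>. norm (B 0 \<omega>) ^ 6 \<partial>M) = (\<integral>\<omega>. 0 \<partial>M)"
      by (rule Bochner_Integration.integral_cong) (simp_all add: brownian_motion_path(1)[OF B])
    ultimately show ?thesis using True by simp
  next
    case False
    then have t: "0 < t" using t by simp
    have int: "integrable (gauss t) (\<lambda>x::real^'d. norm x ^ 6)" by (rule integrable_gauss_norm_power[OF t])
    have "ennreal (\<integral>x. norm x ^ 6 \<partial>(gauss t :: (real^'d) measure)) = (\<integral>\<^sup>+x. ennreal (norm (x::real^'d) ^ (2 * 3)) \<partial>gauss t)"
      using nn_integral_eq_integral[OF int] by simp
    also have "\<dots> \<le> ennreal (real CARD('d) ^ Suc 3 * gauss_moment 3 * t ^ 3)" by (rule gauss_norm_moment[OF t])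
    finally have "(\<integral>x. norm x ^ 6 \<partial>(gauss t :: (real^'d) measure)) \<le> sixth_const (real CARD('d)) * t ^ 3"
      using t by (subst (asm) ennreal_le_iff) (simp_all add: sixth_const_def gauss_moment_def eval_nat_numeral)
    then show ?thesis using brownian_integral[OF B t, of "\<lambda>x. norm x ^ 6"] int by simp
  qed
  then show "integrable M (\<lambda>\<omega>. norm (B t \<omega>) ^ 6)" "(\<integral>\<omega>. norm (B t \<omega>) ^ 6 \<partial>M) \<le> sixth_const (real CARD('d)) * t ^ 3" by simp_all
qed

lemma path_size_measurable:
  fixes B :: "real \<Rightarrow> 'a \<Rightarrow> real^'d"
  assumes B: "brownian_motion M B"
  shows "path_size B h m \<in> borel_measurable M"
proof -
  note [measurable] = brownian_motion_measurable[OF B]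
  show ?thesis unfolding path_size_def[abs_def] by measurable
qed

text \<open>The grid times do not exceed \<open>h\<close>, so after division by
  \<open>sqrt h\<close> every sixth moment is at most \<open>sixth_const\<close>, whatever
  \<open>h\<close> and \<open>m\<close>.\<close>

lemma path_size_moment:
  fixes B :: "real \<Rightarrow> 'a \<Rightarrow> real^'d"
  assumes B: "brownian_motion M B" and h: "0 < h" and m: "0 < m"
  shows "integrable M (\<lambda>\<omega>. path_size B h m \<omega> ^ 6)" "(\<integral>\<omega>. path_size B h m \<omega> ^ 6 \<partial>M) \<le> path_const (real CARD('d))"
proof -
  interpret prob_space M using B by (rule brownian_motion_prob_space)
  let ?t = "\<lambda>j. real j * (h / real m)"
  let ?c = "sixth_const (real CARD('d))"
  define X where "X \<omega> = norm (B h \<omega>) ^ 6 / h ^ 3" for \<omega>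
  define Y where "Y \<omega> = (\<Sum>j<m. norm (B (?t j) \<omega>) ^ 6 / h ^ 3) / real m" for \<omega>
  have sq: "sqrt h ^ 6 = h ^ 3" using h power_mult[of "sqrt h" 2 3] by simp
  have t: "0 \<le> ?t j" "j < m \<Longrightarrow> ?t j \<le> h" for j
    using h m mult_right_mono[of "real j" "real m" h] by (simp_all add: field_simps)
  have six: "(1 + a + b) ^ 6 \<le> 3 ^ 6 * (1 + a ^ 6 + b ^ 6)" if "0 \<le> a" "0 \<le> b" for a b :: real
  proof -
    define n where "n = max 1 (max a b)"
    have "(1 + a + b) ^ 6 \<le> (3 * n) ^ 6" using that by (intro power_mono) (auto simp: n_def)
    also have "\<dots> = 3 ^ 6 * n ^ 6" by (rule power_mult_distrib)
    also have "n ^ 6 \<le> 1 + a ^ 6 + b ^ 6" unfolding n_def max_def using that by auto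
    finally show ?thesis by simp
  qed
  have bound: "path_size B h m \<omega> ^ 6 \<le> 3 ^ 6 * (1 + X \<omega> + Y \<omega>)" for \<omega>
  proof -
    have "path_size B h m \<omega> ^ 6 \<le> 3 ^ 6 * (1 + (norm (B h \<omega>) / sqrt h) ^ 6 + ((\<Sum>j<m. norm (B (?t j) \<omega>) / sqrt h) / real m) ^ 6)"
      unfolding path_size_def using h by (intro six) (simp_all add: sum_nonneg)
    also have "((\<Sum>j<m. norm (B (?t j) \<omega>) / sqrt h) / real m) ^ 6 \<le> (\<Sum>j<m. (norm (B (?t j) \<omega>) / sqrt h) ^ 6) / real m"
      using h by (intro power_mean_six[OF m]) simp
    also have "\<dots> = Y \<omega>" unfolding Y_def power_divide sq ..
    also have "(norm (B h \<omega>) / sqrt h) ^ 6 = X \<omega>" unfolding X_def power_divide sq ..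
    finally show ?thesis by simp
  qed
  have intX: "integrable M X" unfolding X_def using h by (intro integrable_divide brownian_sixth_moment(1)[OF B]) simp
  have intY: "integrable M Y" unfolding Y_def using t by (intro integrable_divide Bochner_Integration.integrable_sum brownian_sixth_moment(1)[OF B]) simp
  have EX: "(\<integral>\<omega>. X \<omega> \<partial>M) \<le> ?c"
    using brownian_sixth_moment(2)[OF B, of h] h by (simp add: X_def field_simps)
  have "(\<integral>\<omega>. Y \<omega> \<partial>M) = (\<Sum>j<m. (\<integral>\<omega>. norm (B (?t j) \<omega>) ^ 6 \<partial>M) / h ^ 3) / real m"
    unfolding Y_def using t by (simp add: brownian_sixth_moment(1)[OF B])
  also have "\<dots> \<le> (\<Sum>j<m. ?c) / real m"
  proof (intro divide_right_mono sum_mono)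
    fix j assume "j \<in> {..<m}"
    then have "?t j ^ 3 \<le> h ^ 3" using t by (intro power_mono) simp_all
    moreover have "0 \<le> ?c" by (simp add: sixth_const_def gauss_moment_def)
    ultimately have "?c * ?t j ^ 3 \<le> ?c * h ^ 3" by (intro mult_left_mono)
    then have "(\<integral>\<omega>. norm (B (?t j) \<omega>) ^ 6 \<partial>M) \<le> ?c * h ^ 3" using brownian_sixth_moment(2)[OF B t(1), of j] by linarith
    then show "(\<integral>\<omega>. norm (B (?t j) \<omega>) ^ 6 \<partial>M) / h ^ 3 \<le> ?c" using h by (simp add: pos_divide_le_eq)
  qed simp
  also have "\<dots> = ?c" using m by simp
  finally have EY: "(\<integral>\<omega>. Y \<omega> \<partial>M) \<le> ?c" .
  have int: "integrable M (\<lambda>\<omega>. 3 ^ 6 * (1 + X \<omega> + Y \<omega>))" using intX intY by simp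
  show int6: "integrable M (\<lambda>\<omega>. path_size B h m \<omega> ^ 6)"
  proof (rule Bochner_Integration.integrable_bound[OF int])
    show "(\<lambda>\<omega>. path_size B h m \<omega> ^ 6) \<in> borel_measurable M"
      using path_size_measurable[OF B, of h m] by simp
    show "AE \<omega> in M. norm (path_size B h m \<omega> ^ 6) \<le> norm (3 ^ 6 * (1 + X \<omega> + Y \<omega>))"
    proof (rule AE_I2)
      fix \<omega>
      have "0 \<le> path_size B h m \<omega> ^ 6" by simp
      then show "norm (path_size B h m \<omega> ^ 6) \<le> norm (3 ^ 6 * (1 + X \<omega> + Y \<omega>))" using bound[of \<omega>] unfolding real_norm_def by linarith
    qed
  qed
  have "(\<integral>\<omega>. path_size B h m \<omega> ^ 6 \<partial>M) \<le> (\<integral>\<omega>. 3 ^ 6 * (1 + X \<omega> + Y \<omega>) \<partial>M)"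
    using bound by (intro integral_mono int6 int)
  also have "\<dots> = 3 ^ 6 * (1 + (\<integral>\<omega>. X \<omega> \<partial>M) + (\<integral>\<omega>. Y \<omega> \<partial>M))" using intX intY by (simp add: prob_space)
  also have "\<dots> \<le> path_const (real CARD('d))" unfolding path_const_def using EX EY by (intro mult_left_mono) simp_all
  finally show "(\<integral>\<omega>. path_size B h m \<omega> ^ 6 \<partial>M) \<le> path_const (real CARD('d))" .
qed

section \<open>One coupled step in expectation\<close>

context langevin
begin

definition "W3 y y' = (1 + norm y + norm y') ^ 3" for y y' :: "(real^'d) \<times> (real^'d)"

lemma continuous_H: "continuous_on X H"
proof -
  have "continuous_on UNIV U"
    using grad by (intro continuous_at_imp_continuous_on) (auto intro: has_derivative_continuous)
  then have "continuous_on X (\<lambda>y. U (fst y))"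
    by (rule continuous_on_compose2) (auto intro!: continuous_intros)
  then have "continuous_on X (\<lambda>y. U (fst y) + 1 / (4 * u) * Qf (fst y) (snd y))"
    unfolding Qf_def by (intro continuous_intros)
  moreover have "H = (\<lambda>y. U (fst y) + 1 / (4 * u) * Qf (fst y) (snd y))"
    using H_eq by (auto simp: fun_eq_iff)
  ultimately show ?thesis by simp
qed

lemma continuous_rho: "continuous_on UNIV (\<lambda>p. \<rho> (fst p) (snd p))"
proof -
  have rr: "continuous_on UNIV (\<lambda>p. rr (fst p) (snd p))"
    unfolding rr_def zz_def qq_def by (intro continuous_intros)
  have GG: "continuous_on UNIV (\<lambda>p. GG (fst p) (snd p))"
    unfolding GG_def by (intro continuous_intros continuous_on_compose2[OF continuous_H[of UNIV]]) auto
  show ?thesis unfolding rho_eq by (intro continuous_on_mult GG continuous_on_compose2[OF continuous_f[of UNIV] rr]) simp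
qed

lemma rho_tendsto:
  assumes "a \<longlonglongrightarrow> y" "b \<longlonglongrightarrow> y'"
  shows "(\<lambda>n. \<rho> (a n) (b n)) \<longlonglongrightarrow> \<rho> y y'"
  using continuous_on_tendsto_compose[OF continuous_rho tendsto_Pair[OF assms]] by simp

lemma rho_measurable [measurable]: "(\<lambda>p. \<rho> (fst p) (snd p)) \<in> borel_measurable borel"
  by (rule borel_measurable_continuous_onI[OF continuous_rho])

definition "C0 = Kc * (exp Kc * (K1 + \<sigma>0))"

lemma C0_nonneg: "0 \<le> C0"
  using Kc_nonneg K1_nonneg sigma0 by (simp add: C0_def)

lemma euler_error:
  fixes Q :: "real^'d \<Rightarrow> real^'d"
  assumes B: "B 0 \<omega> = 0" and m: "0 < m" and h: "0 < h" and Q: "orthogonal_transformation Q"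
  shows "norm (euler FF (\<lambda>x. SS (Q x)) h m (\<lambda>t. B t \<omega>) y - (y + h *\<^sub>R FF y + SS (Q (B h \<omega>))))
    \<le> Kc * (exp (Kc * h) * (h\<^sup>2 * (K1 * (1 + norm y)) + \<sigma>0 * (h * (sqrt h * path_size B h m \<omega>))))"
proof -
  interpret Q: euler_noise FF "\<lambda>x. SS (Q x)" Kc \<sigma>0 by (rule noise.euler_noise_orthogonal[OF Q])
  let ?\<xi> = "increments (h / real m) (\<lambda>t. B t \<omega>)"
  have sum: "(\<Sum>i<j. ?\<xi> i) = B (real j * (h / real m)) \<omega>" for j
    using sum_increments[of "h / real m" "\<lambda>t. B t \<omega>" j] B by simp
  have hm: "real m * (h / real m) = h" using m by simp
  have "norm (euler FF (\<lambda>x. SS (Q x)) h m (\<lambda>t. B t \<omega>) y - (y + h *\<^sub>R FF y + SS (Q (B h \<omega>))))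
    \<le> Kc * (exp (Kc * h) * (h\<^sup>2 * norm (FF y) + \<sigma>0 * ((h / real m) * (\<Sum>j<m. norm (B (real j * (h / real m)) \<omega>)))))"
    using Q.euler_chain_local_error[of "h / real m" ?\<xi> y m] h unfolding euler_def sum hm by simp
  also have "\<dots> \<le> Kc * (exp (Kc * h) * (h\<^sup>2 * (K1 * (1 + norm y)) + \<sigma>0 * (h * (sqrt h * path_size B h m \<omega>))))"
    using FF_growth[of y] path_size_bounds(3)[OF h m, of B \<omega>] Kc_nonneg sigma0
    by (intro mult_left_mono add_mono) simp_all
  finally show ?thesis .
qed

text \<open>With time step s^2 \<le> 1 the exponential is at most \<open>exp Kc\<close>; the drift
  contributes order s^4 and the noise order s^3, so s^3 serves for both.\<close>

lemma euler_local_error: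
  fixes Q :: "real^'d \<Rightarrow> real^'d"
  assumes B: "B 0 \<omega> = 0" and m: "0 < m" and s: "0 < s" "s \<le> 1" and Q: "orthogonal_transformation Q"
  shows "norm (euler FF (\<lambda>x. SS (Q x)) (s\<^sup>2) m (\<lambda>t. B t \<omega>) y - (y + s\<^sup>2 *\<^sub>R FF y + SS (Q (B (s\<^sup>2) \<omega>))))
    \<le> C0 * (1 + norm y) * (s ^ 3 * path_size B (s\<^sup>2) m \<omega>)"
proof -
  define \<Xi> where "\<Xi> = path_size B (s\<^sup>2) m \<omega>"
  have \<Xi>: "1 \<le> \<Xi>" using path_size_bounds(1)[of "s\<^sup>2" m B \<omega>] s m by (simp add: \<Xi>_def)
  have "norm (euler FF (\<lambda>x. SS (Q x)) (s\<^sup>2) m (\<lambda>t. B t \<omega>) y - (y + s\<^sup>2 *\<^sub>R FF y + SS (Q (B (s\<^sup>2) \<omega>))))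
    \<le> Kc * (exp (Kc * s\<^sup>2) * ((s\<^sup>2)\<^sup>2 * (K1 * (1 + norm y)) + \<sigma>0 * (s\<^sup>2 * (s * \<Xi>))))"
    using euler_error[of B \<omega> m "s\<^sup>2" Q y] B m s Q by (simp add: \<Xi>_def)
  also have "\<dots> \<le> Kc * (exp Kc * (K1 * ((1 + norm y) * (s ^ 3 * \<Xi>)) + \<sigma>0 * ((1 + norm y) * (s ^ 3 * \<Xi>))))"
  proof (rule mult_left_mono[OF mult_mono Kc_nonneg])
    have "Kc * s\<^sup>2 \<le> Kc * 1" using s Kc_nonneg by (intro mult_left_mono) (simp_all add: power_le_one)
    then show "exp (Kc * s\<^sup>2) \<le> exp Kc" by simp
    have s4: "(s\<^sup>2)\<^sup>2 \<le> s ^ 3 * \<Xi>"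
    proof -
      have "s ^ 4 \<le> s ^ 3" using s by (intro power_decreasing) simp_all
      also have "\<dots> \<le> s ^ 3 * \<Xi>" using \<Xi> s by simp
      finally show ?thesis by simp
    qed
    have "(s\<^sup>2)\<^sup>2 * (K1 * (1 + norm y)) \<le> (s ^ 3 * \<Xi>) * (K1 * (1 + norm y))"
      using K1_nonneg by (intro mult_right_mono s4) simp
    then have 1: "(s\<^sup>2)\<^sup>2 * (K1 * (1 + norm y)) \<le> K1 * ((1 + norm y) * (s ^ 3 * \<Xi>))" by (simp add: mult_ac)
    have "1 * (s ^ 3 * \<Xi>) \<le> (1 + norm y) * (s ^ 3 * \<Xi>)" using s \<Xi> by (intro mult_right_mono) simp_all
    then have "s\<^sup>2 * (s * \<Xi>) \<le> (1 + norm y) * (s ^ 3 * \<Xi>)" by (simp add: power2_eq_square power3_eq_cube mult_ac)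
    then have "\<sigma>0 * (s\<^sup>2 * (s * \<Xi>)) \<le> \<sigma>0 * ((1 + norm y) * (s ^ 3 * \<Xi>))" using sigma0 by (intro mult_left_mono) simp_all
    then show "(s\<^sup>2)\<^sup>2 * (K1 * (1 + norm y)) + \<sigma>0 * (s\<^sup>2 * (s * \<Xi>)) \<le> K1 * ((1 + norm y) * (s ^ 3 * \<Xi>)) + \<sigma>0 * ((1 + norm y) * (s ^ 3 * \<Xi>))"
      using 1 by (rule add_mono[rotated])
    show "0 \<le> (s\<^sup>2)\<^sup>2 * (K1 * (1 + norm y)) + \<sigma>0 * (s\<^sup>2 * (s * \<Xi>))" using s \<Xi> sigma0 K1_nonneg by simp
  qed simp
  also have "\<dots> = C0 * (1 + norm y) * (s ^ 3 * \<Xi>)" by (simp add: C0_def algebra_simps)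
  finally show ?thesis by (simp add: \<Xi>_def)
qed

text \<open>Taking expectations in \<open>rho_step\<close> kills the linear noise terms and turns
  the quadratic ones into inner products times s^2, which form the left-hand side of
  \<open>step_contraction\<close>. \<open>C\<close> depends on \<delta>, but not on the Brownian
  motion, the starting points or the number \<open>m\<close> of Euler steps.\<close>

lemma one_step_euler:
  assumes \<delta>: "0 < \<delta>"
  obtains C where "0 \<le> C" "\<And>(M :: 'a measure) B s m y y'. brownian_motion M B \<Longrightarrow> 0 < s \<Longrightarrow> s \<le> 1 \<Longrightarrow> s\<^sup>2 * \<gamma> \<le> 1 \<Longrightarrow> 0 < m \<Longrightarrow>
      (\<integral>\<^sup>+\<omega>. ennreal (\<rho> (euler FF SS (s\<^sup>2) m (\<lambda>t. B t \<omega>) y) (euler FF (\<lambda>x. SS (QQ \<delta> y y' x)) (s\<^sup>2) m (\<lambda>t. B t \<omega>) y')) \<partial>M)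
      \<le> ennreal ((1 - c * s\<^sup>2) * \<rho> y y' + ((\<alpha> + 1) * \<gamma> * Kg * \<delta> * s\<^sup>2 + C * s ^ 3) * W3 y y')"
proof -
  obtain C where C: "0 \<le> C" "\<And>s \<Xi> y y' b e e'. 0 < s \<Longrightarrow> s \<le> 1 \<Longrightarrow> s\<^sup>2 * \<gamma> \<le> 1 \<Longrightarrow> 1 \<le> \<Xi> \<Longrightarrow> norm b \<le> s * \<Xi> \<Longrightarrow>
      norm e \<le> C0 * (1 + norm y) * (s ^ 3 * \<Xi>) \<Longrightarrow> norm e' \<le> C0 * (1 + norm y') * (s ^ 3 * \<Xi>) \<Longrightarrow>
      \<rho> (y + s\<^sup>2 *\<^sub>R FF y + SS b + e) (y' + s\<^sup>2 *\<^sub>R FF y' + SS (QQ \<delta> y y' b) + e')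
      \<le> f (rr y y') * GG y y' + s\<^sup>2 * (A1 y y' * GG y y' + f (rr y y') * bb y y') + A2 \<delta> y y' * GG y y' * (ee \<delta> y y' \<bullet> b)
        + A3 \<delta> y y' * GG y y' * (ee \<delta> y y' \<bullet> b)\<^sup>2 + f (rr y y') * (nv \<delta> y y' \<bullet> b) + 2 * \<epsilon> * \<gamma> * f (rr y y') * (norm b)\<^sup>2
        + A2 \<delta> y y' * ((ee \<delta> y y' \<bullet> b) * (nv \<delta> y y' \<bullet> b)) + C * ((1 + norm y + norm y') ^ 3 * (s ^ 3 * \<Xi> ^ 5))"
    using rho_step[OF \<delta> C0_nonneg] by blast
  define D where "D = C * path_const dd"
  have pc: "0 \<le> path_const dd" by (simp add: path_const_def sixth_const_def gauss_moment_def dd_def)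
  show thesis
  proof (rule that)
    show "0 \<le> D" using C(1) pc by (simp add: D_def)
    fix M :: "'a measure" and B :: "real \<Rightarrow> 'a \<Rightarrow> real^'d" and s :: real and m :: nat and y y' :: "(real^'d) \<times> (real^'d)"
    assume B: "brownian_motion M B" and s: "0 < s" "s \<le> 1" "s\<^sup>2 * \<gamma> \<le> 1" and m: "0 < m"
    interpret prob_space M using B by (rule brownian_motion_prob_space)
    define h where "h = s\<^sup>2"
    have h: "0 < h" using s by (simp add: h_def)
    have sh: "sqrt h = s" using s by (simp add: h_def)
    define \<Xi> where "\<Xi> = path_size B h m"
    define F where "F = f (rr y y')"
    define G where "G = GG y y'"
    define E where "E = ee \<delta> y y'"
    define N where "N = nv \<delta> y y'"
    define a1 where "a1 = A1 y y'"
    define a2 where "a2 = A2 \<delta> y y'"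
    define a3 where "a3 = A3 \<delta> y y'"
    define W where "W = W3 y y'"
    have W: "0 \<le> W" by (simp add: W_def W3_def)
    \<comment> \<open>The bound of \<open>rho_step\<close> without its remainder, as a function of
      the increment; the square is written as a product to match the lemma on second
      moments.\<close>
    define poly where "poly b = F * G + h * (a1 * G + F * bb y y') + a2 * G * (E \<bullet> b) + a3 * G * ((E \<bullet> b) * (E \<bullet> b)) + F * (N \<bullet> b)
       + 2 * \<epsilon> * \<gamma> * F * (norm b)\<^sup>2 + a2 * ((E \<bullet> b) * (N \<bullet> b))" for b
    define pth where "pth \<omega> = poly (B h \<omega>) + C * (W * s ^ 3) * \<Xi> \<omega> ^ 6" for \<omega>
    have bound: "\<rho> (euler FF SS h m (\<lambda>t. B t \<omega>) y) (euler FF (\<lambda>x. SS (QQ \<delta> y y' x)) h m (\<lambda>t. B t \<omega>) y') \<le> pth \<omega>" if \<omega>: "\<omega> \<in> space M" for \<omega>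
    proof -
      have B0: "B 0 \<omega> = 0" using B \<omega> by (rule brownian_motion_path)
      define e where "e = euler FF SS h m (\<lambda>t. B t \<omega>) y - (y + h *\<^sub>R FF y + SS (B h \<omega>))"
      define e' where "e' = euler FF (\<lambda>x. SS (QQ \<delta> y y' x)) h m (\<lambda>t. B t \<omega>) y' - (y' + h *\<^sub>R FF y' + SS (QQ \<delta> y y' (B h \<omega>)))"
      have oid: "orthogonal_transformation (\<lambda>x::real^'d. x)" by (simp add: orthogonal_transformation_def linear_id[unfolded id_def])
      have e: "norm e \<le> C0 * (1 + norm y) * (s ^ 3 * \<Xi> \<omega>)"
        using euler_local_error[where B=B and \<omega>=\<omega> and Q="\<lambda>x. x" and y=y, OF B0 m s(1,2) oid] by (simp add: e_def h_def \<Xi>_def)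
      have e': "norm e' \<le> C0 * (1 + norm y') * (s ^ 3 * \<Xi> \<omega>)"
        using euler_local_error[where B=B and \<omega>=\<omega> and Q="QQ \<delta> y y'" and y=y', OF B0 m s(1,2) QQ_orthogonal[OF \<delta>]] by (simp add: e'_def h_def \<Xi>_def)
      have \<Xi>: "1 \<le> \<Xi> \<omega>" "norm (B h \<omega>) \<le> s * \<Xi> \<omega>"
        using path_size_bounds(1,2)[OF h m, of B \<omega>] by (simp_all add: \<Xi>_def sh)
      have "\<rho> (y + s\<^sup>2 *\<^sub>R FF y + SS (B h \<omega>) + e) (y' + s\<^sup>2 *\<^sub>R FF y' + SS (QQ \<delta> y y' (B h \<omega>)) + e') \<le> poly (B h \<omega>) + C * (W * (s ^ 3 * \<Xi> \<omega> ^ 5))"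
        using C(2)[OF s \<Xi> e e'] unfolding poly_def F_def G_def E_def N_def a1_def a2_def a3_def W_def W3_def h_def power2_eq_square[of "_ \<bullet> _"] .
      also have "\<dots> \<le> pth \<omega>"
      proof -
        \<comment> \<open>The fifth power is raised to the sixth, whose moment is known.\<close>
        have "\<Xi> \<omega> ^ 5 \<le> \<Xi> \<omega> ^ 6" using \<Xi>(1) by (intro power_increasing) simp_all
        then have "C * (W * s ^ 3) * \<Xi> \<omega> ^ 5 \<le> C * (W * s ^ 3) * \<Xi> \<omega> ^ 6" using C(1) W s by (intro mult_left_mono) simp_all
        then show ?thesis by (simp add: pth_def mult_ac)
      qed
      finally show ?thesis by (simp add: e_def e'_def h_def)
    qed
    have int_poly: "integrable (gauss h) poly" "(\<integral>b. poly b \<partial>gauss h) = F * G + h * ((a1 + a3 * (E \<bullet> E)) * G + F * b1 y y' + a2 * (E \<bullet> N))"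
    proof -
      interpret g: prob_space "gauss h :: (real^'d) measure" by (rule prob_space_gauss[OF h])
      note i = integrable_gauss_inner[OF h] integrable_gauss_inner_inner[OF h] integrable_gauss_norm_power[OF h]
      show "integrable (gauss h) poly" unfolding poly_def by (simp add: i)
      have "(\<integral>b. poly b \<partial>gauss h) = F * G + h * (a1 * G + F * bb y y') + a3 * G * (h * (E \<bullet> E)) + 2 * \<epsilon> * \<gamma> * F * (h * dd) + a2 * (h * (E \<bullet> N))"
        unfolding poly_def by (simp add: i integral_gauss_inner[OF h] integral_gauss_inner_inner[OF h] integral_gauss_norm_squared[OF h] g.prob_space[unfolded space_gauss] dd_def)
      then show "(\<integral>b. poly b \<partial>gauss h) = F * G + h * ((a1 + a3 * (E \<bullet> E)) * G + F * b1 y y' + a2 * (E \<bullet> N))"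
        by (simp add: b1_def bb_def algebra_simps)
    qed
    have poly_meas: "poly \<in> borel_measurable borel" unfolding poly_def by simp
    have int_pth: "integrable M pth" "(\<integral>\<omega>. pth \<omega> \<partial>M) = (\<integral>b. poly b \<partial>gauss h) + C * (W * s ^ 3) * (\<integral>\<omega>. \<Xi> \<omega> ^ 6 \<partial>M)"
      using brownian_integral[OF B h poly_meas] int_poly(1) path_size_moment(1)[OF B h m]
      unfolding pth_def \<Xi>_def by simp_all
    have "(\<integral>\<^sup>+\<omega>. ennreal (\<rho> (euler FF SS h m (\<lambda>t. B t \<omega>) y) (euler FF (\<lambda>x. SS (QQ \<delta> y y' x)) h m (\<lambda>t. B t \<omega>) y')) \<partial>M) \<le> (\<integral>\<^sup>+\<omega>. ennreal (pth \<omega>) \<partial>M)"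
      using bound by (intro nn_integral_mono ennreal_leI)
    also have "\<dots> = ennreal (\<integral>\<omega>. pth \<omega> \<partial>M)"
      using bound rho_nonneg order_trans by (intro nn_integral_eq_integral int_pth(1) AE_I2) blast
    also have "(\<integral>\<omega>. pth \<omega> \<partial>M) \<le> (1 - c * s\<^sup>2) * \<rho> y y' + ((\<alpha> + 1) * \<gamma> * Kg * \<delta> * s\<^sup>2 + D * s ^ 3) * W3 y y'"
    proof -
      have "(a1 + a3 * (E \<bullet> E)) * G + F * b1 y y' + a2 * (E \<bullet> N) \<le> - c * (F * G) + (\<alpha> + 1) * \<gamma> * \<delta> * G"
        using step_contraction[OF \<delta>, of y y'] unfolding F_def G_def E_def N_def a1_def a2_def a3_def .
      also have "(\<alpha> + 1) * \<gamma> * \<delta> * G \<le> (\<alpha> + 1) * \<gamma> * \<delta> * (Kg * W)"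
      proof (rule mult_left_mono)
        have Kg: "0 \<le> Kg" using eps_pos KH_nonneg K1_nonneg K2_nonneg sigma0 gamma_pos u_pos by (simp add: Kg_def)
        have "G \<le> Kg * (1 + norm y + norm y')\<^sup>2" unfolding G_def by (rule Kg_bounds(1))
        also have "\<dots> \<le> Kg * W" unfolding W_def W3_def using Kg by (intro mult_left_mono power_increasing) simp_all
        finally show "G \<le> Kg * W" .
      qed (use alpha_pos gamma_pos \<delta> in simp)
      finally have "h * ((a1 + a3 * (E \<bullet> E)) * G + F * b1 y y' + a2 * (E \<bullet> N)) \<le> h * (- c * (F * G) + (\<alpha> + 1) * \<gamma> * \<delta> * (Kg * W))"
        using h by (intro mult_left_mono) simp_all
      moreover have "C * (W * s ^ 3) * (\<integral>\<omega>. \<Xi> \<omega> ^ 6 \<partial>M) \<le> C * (W * s ^ 3) * path_const dd"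
        using path_size_moment(2)[OF B h m] C(1) W s unfolding \<Xi>_def dd_def by (intro mult_left_mono) simp_all
      ultimately have "(\<integral>\<omega>. pth \<omega> \<partial>M) \<le> F * G + h * (- c * (F * G) + (\<alpha> + 1) * \<gamma> * \<delta> * (Kg * W)) + C * (W * s ^ 3) * path_const dd"
        unfolding int_pth int_poly by linarith
      also have "\<dots> = (1 - c * s\<^sup>2) * (F * G) + ((\<alpha> + 1) * \<gamma> * Kg * \<delta> * s\<^sup>2 + D * s ^ 3) * W"
        by (simp add: D_def h_def algebra_simps)
      finally show ?thesis by (simp add: rho_eq F_def G_def W_def)
    qed
    finally show "(\<integral>\<^sup>+\<omega>. ennreal (\<rho> (euler FF SS (s\<^sup>2) m (\<lambda>t. B t \<omega>) y) (euler FF (\<lambda>x. SS (QQ \<delta> y y' x)) (s\<^sup>2) m (\<lambda>t. B t \<omega>) y')) \<partial>M)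
      \<le> ennreal ((1 - c * s\<^sup>2) * \<rho> y y' + ((\<alpha> + 1) * \<gamma> * Kg * \<delta> * s\<^sup>2 + D * s ^ 3) * W3 y y')"
      by (simp add: h_def ennreal_leI)
  qed
qed

text \<open>Fatou's lemma along \<open>Suc m\<close>, since the bound is available for positive
  indices.\<close>

lemma fatou_limit:
  fixes X :: "nat \<Rightarrow> 'a \<Rightarrow> real"
  assumes meas: "\<And>m. X m \<in> borel_measurable M"
    and lim: "\<And>\<omega>. \<omega> \<in> space M \<Longrightarrow> (\<lambda>m. X m \<omega>) \<longlonglongrightarrow> Y \<omega>"
    and bound: "\<And>m. 0 < m \<Longrightarrow> (\<integral>\<^sup>+\<omega>. ennreal (X m \<omega>) \<partial>M) \<le> K"
  shows "(\<integral>\<^sup>+\<omega>. ennreal (Y \<omega>) \<partial>M) \<le> K"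
proof -
  have "(\<integral>\<^sup>+\<omega>. ennreal (Y \<omega>) \<partial>M) = (\<integral>\<^sup>+\<omega>. liminf (\<lambda>m. ennreal (X (Suc m) \<omega>)) \<partial>M)"
  proof (rule nn_integral_cong)
    fix \<omega> assume "\<omega> \<in> space M"
    then have "(\<lambda>m. ennreal (X (Suc m) \<omega>)) \<longlonglongrightarrow> ennreal (Y \<omega>)" by (intro tendsto_ennrealI LIMSEQ_Suc lim)
    then show "ennreal (Y \<omega>) = liminf (\<lambda>m. ennreal (X (Suc m) \<omega>))" by (intro lim_imp_Liminf[symmetric]) simp_all
  qed
  also have "\<dots> \<le> liminf (\<lambda>m. \<integral>\<^sup>+\<omega>. ennreal (X (Suc m) \<omega>) \<partial>M)"
    using meas by (intro nn_integral_liminf) simp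
  also have "\<dots> \<le> liminf (\<lambda>m. K)" using bound by (intro Liminf_mono always_eventually) simp
  also have "\<dots> = K" by (simp add: Liminf_const)
  finally show ?thesis .
qed

lemma one_step_flow:
  assumes \<delta>: "0 < \<delta>"
  obtains C where "0 \<le> C" "\<And>(M :: 'a measure) B s y y'. brownian_motion M B \<Longrightarrow> 0 < s \<Longrightarrow> s \<le> 1 \<Longrightarrow> s\<^sup>2 * \<gamma> \<le> 1 \<Longrightarrow>
      (\<integral>\<^sup>+\<omega>. ennreal (\<rho> (flow FF SS (s\<^sup>2) (\<lambda>t. B t \<omega>) y) (flow FF (\<lambda>x. SS (QQ \<delta> y y' x)) (s\<^sup>2) (\<lambda>t. B t \<omega>) y')) \<partial>M)
      \<le> ennreal ((1 - c * s\<^sup>2) * \<rho> y y' + ((\<alpha> + 1) * \<gamma> * Kg * \<delta> * s\<^sup>2 + C * s ^ 3) * W3 y y')"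
proof -
  obtain C where C: "0 \<le> C" "\<And>(M :: 'a measure) B s m y y'. brownian_motion M B \<Longrightarrow> 0 < s \<Longrightarrow> s \<le> 1 \<Longrightarrow> s\<^sup>2 * \<gamma> \<le> 1 \<Longrightarrow> 0 < m \<Longrightarrow>
      (\<integral>\<^sup>+\<omega>. ennreal (\<rho> (euler FF SS (s\<^sup>2) m (\<lambda>t. B t \<omega>) y) (euler FF (\<lambda>x. SS (QQ \<delta> y y' x)) (s\<^sup>2) m (\<lambda>t. B t \<omega>) y')) \<partial>M)
      \<le> ennreal ((1 - c * s\<^sup>2) * \<rho> y y' + ((\<alpha> + 1) * \<gamma> * Kg * \<delta> * s\<^sup>2 + C * s ^ 3) * W3 y y')"
    using one_step_euler[OF \<delta>] by blast
  show thesis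
  proof (rule that[OF C(1)])
    fix M :: "'a measure" and B :: "real \<Rightarrow> 'a \<Rightarrow> real^'d" and s :: real and y y' :: "(real^'d) \<times> (real^'d)"
    assume B: "brownian_motion M B" and s: "0 < s" "s \<le> 1" "s\<^sup>2 * \<gamma> \<le> 1"
    interpret Q: euler_noise FF "\<lambda>x. SS (QQ \<delta> y y' x)" Kc \<sigma>0 by (rule noise.euler_noise_orthogonal[OF QQ_orthogonal[OF \<delta>]])
    show "(\<integral>\<^sup>+\<omega>. ennreal (\<rho> (flow FF SS (s\<^sup>2) (\<lambda>t. B t \<omega>) y) (flow FF (\<lambda>x. SS (QQ \<delta> y y' x)) (s\<^sup>2) (\<lambda>t. B t \<omega>) y')) \<partial>M)
      \<le> ennreal ((1 - c * s\<^sup>2) * \<rho> y y' + ((\<alpha> + 1) * \<gamma> * Kg * \<delta> * s\<^sup>2 + C * s ^ 3) * W3 y y')"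
    proof (rule fatou_limit)
      show "(\<lambda>\<omega>. \<rho> (euler FF SS (s\<^sup>2) m (\<lambda>t. B t \<omega>) y) (euler FF (\<lambda>x. SS (QQ \<delta> y y' x)) (s\<^sup>2) m (\<lambda>t. B t \<omega>) y')) \<in> borel_measurable M" for m
      proof -
        have "(\<lambda>\<omega>. (euler FF SS (s\<^sup>2) m (\<lambda>t. B t \<omega>) y, euler FF (\<lambda>x. SS (QQ \<delta> y y' x)) (s\<^sup>2) m (\<lambda>t. B t \<omega>) y')) \<in> borel_measurable M"
          using noise.euler_measurable[OF _ brownian_motion_measurable[OF B], of "\<lambda>_. y"] Q.euler_measurable[OF _ brownian_motion_measurable[OF B], of "\<lambda>_. y'"]
          by (intro borel_measurable_Pair) simp_all
        from measurable_compose[OF this rho_measurable] show ?thesis by simp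
      qed
      fix \<omega> assume \<omega>: "\<omega> \<in> space M"
      show "(\<lambda>m. \<rho> (euler FF SS (s\<^sup>2) m (\<lambda>t. B t \<omega>) y) (euler FF (\<lambda>x. SS (QQ \<delta> y y' x)) (s\<^sup>2) m (\<lambda>t. B t \<omega>) y'))
          \<longlonglongrightarrow> \<rho> (flow FF SS (s\<^sup>2) (\<lambda>t. B t \<omega>) y) (flow FF (\<lambda>x. SS (QQ \<delta> y y' x)) (s\<^sup>2) (\<lambda>t. B t \<omega>) y')"
        by (intro rho_tendsto noise.flow_tendsto_brownian[OF B _ \<omega>] Q.flow_tendsto_brownian[OF B _ \<omega>]) simp_all
    next
      fix m :: nat assume "0 < m"
      then show "(\<integral>\<^sup>+\<omega>. ennreal (\<rho> (euler FF SS (s\<^sup>2) m (\<lambda>t. B t \<omega>) y) (euler FF (\<lambda>x. SS (QQ \<delta> y y' x)) (s\<^sup>2) m (\<lambda>t. B t \<omega>) y')) \<partial>M)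
      \<le> ennreal ((1 - c * s\<^sup>2) * \<rho> y y' + ((\<alpha> + 1) * \<gamma> * Kg * \<delta> * s\<^sup>2 + C * s ^ 3) * W3 y y')"
        by (intro C(2) B s)
    qed
  qed
qed

text \<open>The error of a step is weighted by \<open>W3\<close> at its starting pair, so cubic
  moments are needed at all intermediate times. The expansion of a single step, used over a time
  that is not small, already bounds them uniformly up to \<open>T\<close>.\<close>

lemma moment_flow:
  assumes T: "0 < T"
  obtains C where "0 \<le> C" "\<And>(M :: 'a measure) B t y. brownian_motion M B \<Longrightarrow> 0 < t \<Longrightarrow> t \<le> T \<Longrightarrow>
      (\<integral>\<^sup>+\<omega>. ennreal ((1 + norm (flow FF SS t (\<lambda>t. B t \<omega>) y)) ^ 3) \<partial>M) \<le> ennreal (C * (1 + norm y) ^ 3)"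
proof -
  \<comment> \<open>The summands bound, in this order, the starting point, the drift, the noise and
    the Euler error, each as a multiple of \<open>1 + norm y\<close> times the path size.\<close>
  define D where "D = 1 + T * K1 + \<sigma>0 * sqrt T + Kc * (exp (Kc * T) * (T\<^sup>2 * K1 + \<sigma>0 * (T * sqrt T)))"
  have D0: "0 \<le> D" using T K1_nonneg sigma0 Kc_nonneg by (simp add: D_def)
  have pc: "0 \<le> path_const dd" by (simp add: path_const_def sixth_const_def gauss_moment_def dd_def)
  show thesis
  proof (rule that)
    show "0 \<le> D ^ 3 * path_const dd" using D0 pc by simp
    fix M :: "'a measure" and B :: "real \<Rightarrow> 'a \<Rightarrow> real^'d" and t :: real and y :: "(real^'d) \<times> (real^'d)"
    assume B: "brownian_motion M B" and t: "0 < t" "t \<le> T"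
    show "(\<integral>\<^sup>+\<omega>. ennreal ((1 + norm (flow FF SS t (\<lambda>t. B t \<omega>) y)) ^ 3) \<partial>M) \<le> ennreal (D ^ 3 * path_const dd * (1 + norm y) ^ 3)"
    proof (rule fatou_limit)
      show "(\<lambda>\<omega>. (1 + norm (euler FF SS t m (\<lambda>t. B t \<omega>) y)) ^ 3) \<in> borel_measurable M" for m
        using noise.euler_measurable[OF _ brownian_motion_measurable[OF B], of "\<lambda>_. y" t m] by simp
      show "(\<lambda>m. (1 + norm (euler FF SS t m (\<lambda>t. B t \<omega>) y)) ^ 3) \<longlonglongrightarrow> (1 + norm (flow FF SS t (\<lambda>t. B t \<omega>) y)) ^ 3"
        if "\<omega> \<in> space M" for \<omega>
        using noise.flow_tendsto_brownian[OF B less_imp_le[OF t(1)] that] by (intro tendsto_intros)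
      fix m :: nat assume m: "0 < m"
      have bound: "(1 + norm (euler FF SS t m (\<lambda>t. B t \<omega>) y)) ^ 3 \<le> (D * (1 + norm y)) ^ 3 * path_size B t m \<omega> ^ 6" if \<omega>: "\<omega> \<in> space M" for \<omega>
      proof -
        define \<Xi> where "\<Xi> = path_size B t m \<omega>"
        define Y where "Y = 1 + norm y"
        have \<Xi>: "1 \<le> \<Xi>" "norm (B t \<omega>) \<le> sqrt t * \<Xi>" using path_size_bounds[OF t(1) m, of B \<omega>] by (simp_all add: \<Xi>_def)
        have Y: "1 \<le> Y" by (simp add: Y_def)
        have Y\<Xi>: "Y \<le> Y * \<Xi>" "\<Xi> \<le> Y * \<Xi>" using \<Xi>(1) Y by simp_all
        have oid: "orthogonal_transformation (\<lambda>x::real^'d. x)" by (simp add: orthogonal_transformation_def linear_id[unfolded id_def])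
        define e where "e = euler FF SS t m (\<lambda>t. B t \<omega>) y - (y + t *\<^sub>R FF y + SS (B t \<omega>))"
        have "norm e \<le> Kc * (exp (Kc * t) * (t\<^sup>2 * (K1 * Y) + \<sigma>0 * (t * (sqrt t * \<Xi>))))"
          using euler_error[where B=B and \<omega>=\<omega> and Q="\<lambda>x. x" and y=y, OF brownian_motion_path(1)[OF B \<omega>] m t(1) oid] by (simp add: e_def \<Xi>_def Y_def)
        also have "\<dots> \<le> Kc * (exp (Kc * T) * (T\<^sup>2 * (K1 * (Y * \<Xi>)) + \<sigma>0 * (T * (sqrt T * (Y * \<Xi>)))))"
          using t Kc_nonneg K1_nonneg sigma0 \<Xi>(1) Y Y\<Xi>
          by (intro mult_left_mono[OF _ Kc_nonneg] mult_mono add_mono mult_left_mono power_mono mult_nonneg_nonneg add_nonneg_nonneg)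
             (auto intro: mult_left_mono)
        finally have e: "norm e \<le> Kc * (exp (Kc * T) * (T\<^sup>2 * K1 + \<sigma>0 * (T * sqrt T))) * (Y * \<Xi>)" by (simp add: algebra_simps)
        have "t * norm (FF y) \<le> T * (K1 * (Y * \<Xi>))"
        proof (rule mult_mono)
          have "K1 * Y \<le> K1 * (Y * \<Xi>)" using Y\<Xi> K1_nonneg by (intro mult_left_mono)
          then show "norm (FF y) \<le> K1 * (Y * \<Xi>)" using FF_growth[of y] by (simp add: Y_def)
        qed (use t in simp_all)
        then have F: "norm (t *\<^sub>R FF y) \<le> T * K1 * (Y * \<Xi>)" using t by (simp add: mult.assoc)
        have "norm (SS (B t \<omega>)) \<le> \<sigma>0 * norm (B t \<omega>)" by (rule noise.S_bound)
        also have "\<dots> \<le> \<sigma>0 * (sqrt T * (Y * \<Xi>))"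
        proof (rule mult_left_mono)
          have "sqrt t * \<Xi> \<le> sqrt T * (Y * \<Xi>)" using t \<Xi>(1) Y\<Xi> by (intro mult_mono) simp_all
          then show "norm (B t \<omega>) \<le> sqrt T * (Y * \<Xi>)" using \<Xi>(2) by linarith
        qed (use sigma0 in simp)
        finally have S: "norm (SS (B t \<omega>)) \<le> \<sigma>0 * sqrt T * (Y * \<Xi>)" by (simp add: mult.assoc)
        have "euler FF SS t m (\<lambda>t. B t \<omega>) y = y + t *\<^sub>R FF y + SS (B t \<omega>) + e" by (simp add: e_def)
        then have "norm (euler FF SS t m (\<lambda>t. B t \<omega>) y) \<le> norm y + norm (t *\<^sub>R FF y) + norm (SS (B t \<omega>)) + norm e"
          by (simp only:) (intro norm_triangle_le add_mono norm_triangle_ineq order_refl)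
        then have "1 + norm (euler FF SS t m (\<lambda>t. B t \<omega>) y) \<le> D * (Y * \<Xi>)"
          using e F S Y\<Xi>(1) unfolding D_def distrib_right by (simp add: Y_def)
        then have "(1 + norm (euler FF SS t m (\<lambda>t. B t \<omega>) y)) ^ 3 \<le> (D * (Y * \<Xi>)) ^ 3" by (intro power_mono) simp_all
        also have "\<dots> = (D * Y) ^ 3 * \<Xi> ^ 3" by (simp add: power_mult_distrib)
        also have "\<dots> \<le> (D * Y) ^ 3 * \<Xi> ^ 6" using \<Xi>(1) D0 Y by (intro mult_left_mono power_increasing) simp_all
        finally show ?thesis by (simp add: \<Xi>_def Y_def)
      qed
      have "(\<integral>\<^sup>+\<omega>. ennreal ((1 + norm (euler FF SS t m (\<lambda>t. B t \<omega>) y)) ^ 3) \<partial>M) \<le> (\<integral>\<^sup>+\<omega>. ennreal ((D * (1 + norm y)) ^ 3 * path_size B t m \<omega> ^ 6) \<partial>M)"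
        using bound by (intro nn_integral_mono ennreal_leI)
      also have "\<dots> = ennreal (\<integral>\<omega>. (D * (1 + norm y)) ^ 3 * path_size B t m \<omega> ^ 6 \<partial>M)"
        using path_size_moment(1)[OF B t(1) m] D0 by (intro nn_integral_eq_integral AE_I2) simp_all
      also have "(\<integral>\<omega>. (D * (1 + norm y)) ^ 3 * path_size B t m \<omega> ^ 6 \<partial>M) = (D * (1 + norm y)) ^ 3 * (\<integral>\<omega>. path_size B t m \<omega> ^ 6 \<partial>M)" by simp
      also have "\<dots> \<le> (D * (1 + norm y)) ^ 3 * path_const dd"
        using path_size_moment(2)[OF B t(1) m] D0 unfolding dd_def by (intro mult_left_mono) simp_all
      also have "\<dots> = D ^ 3 * path_const dd * (1 + norm y) ^ 3" by (simp add: power_mult_distrib)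
      finally show "(\<integral>\<^sup>+\<omega>. ennreal ((1 + norm (euler FF SS t m (\<lambda>t. B t \<omega>) y)) ^ 3) \<partial>M) \<le> ennreal (D ^ 3 * path_const dd * (1 + norm y) ^ 3)"
        by (simp add: ennreal_leI)
    qed
  qed
qed

end

section \<open>Iterated couplings\<close>

text \<open>Moves the noise map into the driving sequence. In the coupling this map depends on the
  starting pair, so joint measurability is obtained by treating its values as increments.\<close>

lemma euler_chain_comp:
  "euler_chain F S \<tau> \<xi> z k = euler_chain F (\<lambda>x. x) \<tau> (\<lambda>i. S (\<xi> i)) z k"
  by (induction k) simp_all

context langevin
begin

text \<open>The reflection is determined by the pair at the beginning of the step and kept until its
  end. Hence the second component is a flow with a fixed orthogonal map in front of the noise, and
  its law is exactly that of the kernel.\<close>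

definition coupling_step :: "'a measure \<Rightarrow> (real \<Rightarrow> 'a \<Rightarrow> real^'d) \<Rightarrow> real \<Rightarrow> real \<Rightarrow> ((real^'d) \<times> (real^'d)) \<times> ((real^'d) \<times> (real^'d)) \<Rightarrow> (((real^'d) \<times> (real^'d)) \<times> ((real^'d) \<times> (real^'d))) measure" where
  "coupling_step M B \<delta> h p = distr M borel (\<lambda>\<omega>. (flow FF SS h (\<lambda>t. B t \<omega>) (fst p), flow FF (\<lambda>x. SS (QQ \<delta> (fst p) (snd p) x)) h (\<lambda>t. B t \<omega>) (snd p)))"

text \<open>A Markov chain of coupled steps: binding kernels gives every step fresh noise, although
  all of them are built on the same space \<open>M\<close>.\<close>

primrec coupling_iter :: "'a measure \<Rightarrow> (real \<Rightarrow> 'a \<Rightarrow> real^'d) \<Rightarrow> real \<Rightarrow> real \<Rightarrow> nat \<Rightarrow> ((real^'d) \<times> (real^'d)) \<times> ((real^'d) \<times> (real^'d)) \<Rightarrow> (((real^'d) \<times> (real^'d)) \<times> ((real^'d) \<times> (real^'d))) measure" where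
  "coupling_iter M B \<delta> h 0 p = return borel p"
| "coupling_iter M B \<delta> h (Suc n) p = coupling_iter M B \<delta> h n p \<bind> coupling_step M B \<delta> h"

lemma QQ_measurable:
  fixes y y' :: "'a \<Rightarrow> (real^'d) \<times> (real^'d)"
  assumes [measurable]: "y \<in> borel_measurable N" "y' \<in> borel_measurable N" "b \<in> borel_measurable N"
  shows "(\<lambda>p. QQ \<delta> (y p) (y' p) (b p)) \<in> borel_measurable N"
proof -
  have fs: "fst \<in> borel_measurable (borel :: ((real^'d) \<times> (real^'d)) measure)" "snd \<in> borel_measurable (borel :: ((real^'d) \<times> (real^'d)) measure)"
    by (intro borel_measurable_continuous_onI continuous_intros)+
  have [measurable]: "(\<lambda>p. fst (y p)) \<in> borel_measurable N" "(\<lambda>p. snd (y p)) \<in> borel_measurable N"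
    "(\<lambda>p. fst (y' p)) \<in> borel_measurable N" "(\<lambda>p. snd (y' p)) \<in> borel_measurable N"
    using measurable_compose[OF assms(1) fs(1)] measurable_compose[OF assms(1) fs(2)]
      measurable_compose[OF assms(2) fs(1)] measurable_compose[OF assms(2) fs(2)] by simp_all
  have [measurable]: "(\<lambda>p. qq (y p) (y' p)) \<in> borel_measurable N" unfolding qq_def by simp
  have [measurable]: "(\<lambda>p. ee \<delta> (y p) (y' p)) \<in> borel_measurable N" unfolding ee_def by measurable
  show ?thesis unfolding QQ_def by simp
qed

context
  fixes M :: "'a measure" and B :: "real \<Rightarrow> 'a \<Rightarrow> real^'d"
  assumes B: "brownian_motion M B"
begin

lemma coupling_pair_measurable:
  assumes \<delta>: "0 < \<delta>" and h: "0 \<le> h"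
  shows "(\<lambda>q. (flow FF SS h (\<lambda>t. B t (snd q)) (fst (fst q)), flow FF (\<lambda>x. SS (QQ \<delta> (fst (fst q)) (snd (fst q)) x)) h (\<lambda>t. B t (snd q)) (snd (fst q))))
    \<in> borel_measurable (borel \<Otimes>\<^sub>M M)"
proof (rule borel_measurable_Pair)
  let ?N = "borel \<Otimes>\<^sub>M M :: ((((real^'d) \<times> (real^'d)) \<times> ((real^'d) \<times> (real^'d))) \<times> 'a) measure"
  have fs: "fst \<in> borel_measurable (borel :: (((real^'d) \<times> (real^'d)) \<times> ((real^'d) \<times> (real^'d))) measure)" "snd \<in> borel_measurable (borel :: (((real^'d) \<times> (real^'d)) \<times> ((real^'d) \<times> (real^'d))) measure)"
    by (intro borel_measurable_continuous_onI continuous_intros)+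
  have y: "(\<lambda>q. fst (fst q)) \<in> borel_measurable ?N" "(\<lambda>q. snd (fst q)) \<in> borel_measurable ?N"
    by (rule measurable_compose[OF measurable_fst fs(1)]) (rule measurable_compose[OF measurable_fst fs(2)])
  have b: "(\<lambda>q. B t (snd q)) \<in> borel_measurable ?N" for t
    by (rule measurable_compose[OF measurable_snd brownian_motion_measurable[OF B]])
  show "(\<lambda>q. flow FF SS h (\<lambda>t. B t (snd q)) (fst (fst q))) \<in> borel_measurable ?N"
    by (rule noise.flow_measurable[OF h y(1) b]) (auto simp: brownian_motion_path[OF B] space_pair_measure)
  show "(\<lambda>q. flow FF (\<lambda>x. SS (QQ \<delta> (fst (fst q)) (snd (fst q)) x)) h (\<lambda>t. B t (snd q)) (snd (fst q))) \<in> borel_measurable ?N"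
  \<comment> \<open>The noise map of the second component varies with the starting pair, so its
    measurability is derived from the Euler chains directly.\<close>
  proof (rule borel_measurable_LIMSEQ_metric)
    fix m
    have inc: "(\<lambda>q. SS (QQ \<delta> (fst (fst q)) (snd (fst q)) (increments (h / real m) (\<lambda>t. B t (snd q)) i))) \<in> borel_measurable ?N" for i
      using b unfolding increments_def by (intro measurable_compose[OF QQ_measurable[OF y] noise.S_measurable]) simp
    show "(\<lambda>q. euler FF (\<lambda>x. SS (QQ \<delta> (fst (fst q)) (snd (fst q)) x)) h m (\<lambda>t. B t (snd q)) (snd (fst q))) \<in> borel_measurable ?N"
      unfolding euler_def
      by (subst euler_chain_comp) (rule euler_chain_measurable[OF noise.F_measurable _ y(2) inc], simp)
  next
    fix q assume "q \<in> space ?N"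
    then have \<omega>: "snd q \<in> space M" by (auto simp: space_pair_measure)
    interpret Q: euler_noise FF "\<lambda>x. SS (QQ \<delta> (fst (fst q)) (snd (fst q)) x)" Kc \<sigma>0
      by (rule noise.euler_noise_orthogonal[OF QQ_orthogonal[OF \<delta>]])
    show "(\<lambda>m. euler FF (\<lambda>x. SS (QQ \<delta> (fst (fst q)) (snd (fst q)) x)) h m (\<lambda>t. B t (snd q)) (snd (fst q)))
        \<longlonglongrightarrow> flow FF (\<lambda>x. SS (QQ \<delta> (fst (fst q)) (snd (fst q)) x)) h (\<lambda>t. B t (snd q)) (snd (fst q))"
      by (rule Q.flow_tendsto_brownian[OF B h \<omega>])
  qed
qed

lemma coupling_pair_measurable':
  assumes \<delta>: "0 < \<delta>" and h: "0 \<le> h"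
  shows "(\<lambda>\<omega>. (flow FF SS h (\<lambda>t. B t \<omega>) y, flow FF (\<lambda>x. SS (QQ \<delta> y y' x)) h (\<lambda>t. B t \<omega>) y')) \<in> borel_measurable M"
proof -
  have "(\<lambda>\<omega>. ((y, y'), \<omega>)) \<in> measurable M (borel \<Otimes>\<^sub>M M)" by simp
  from measurable_compose[OF this coupling_pair_measurable[OF assms]] show ?thesis by simp
qed

lemma coupling_step_kernel:
  assumes "0 < \<delta>" "0 \<le> h"
  shows "coupling_step M B \<delta> h \<in> borel \<rightarrow>\<^sub>M prob_algebra borel"
  unfolding coupling_step_def
proof (rule measurable_distr_prob_space2[where M=M])
  have "prob_space M" using B by (rule brownian_motion_prob_space)
  then show "(\<lambda>x. M) \<in> borel \<rightarrow>\<^sub>M prob_algebra M" by (simp add: space_prob_algebra)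
qed (use coupling_pair_measurable[OF assms] in \<open>simp add: case_prod_beta'\<close>)

lemma coupling_iter_kernel:
  assumes "0 < \<delta>" "0 \<le> h"
  shows "coupling_iter M B \<delta> h n \<in> borel \<rightarrow>\<^sub>M prob_algebra borel"
proof (induction n)
  case 0
  have "coupling_iter M B \<delta> h 0 = return borel" by (simp add: fun_eq_iff)
  then show ?case using measurable_return_prob_space by metis
next
  case (Suc n)
  have "coupling_iter M B \<delta> h (Suc n) = (\<lambda>p. coupling_iter M B \<delta> h n p \<bind> coupling_step M B \<delta> h)" by (simp add: fun_eq_iff)
  then show ?case using measurable_bind_prob_space[OF Suc coupling_step_kernel[OF assms]] by simp
qed

lemma coupling_step_marginals:
  assumes \<delta>: "0 < \<delta>" and h: "0 < h"
  shows "distr (coupling_step M B \<delta> h p) borel fst = flow_law FF SS M B h (fst p)"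
    "distr (coupling_step M B \<delta> h p) borel snd = flow_law FF SS M B h (snd p)"
proof -
  have fs: "fst \<in> borel_measurable (borel :: (((real^'d) \<times> (real^'d)) \<times> ((real^'d) \<times> (real^'d))) measure)" "snd \<in> borel_measurable (borel :: (((real^'d) \<times> (real^'d)) \<times> ((real^'d) \<times> (real^'d))) measure)"
    by (intro borel_measurable_continuous_onI continuous_intros)+
  note m = coupling_pair_measurable'[OF \<delta> less_imp_le[OF h], of "fst p" "snd p"]
  show "distr (coupling_step M B \<delta> h p) borel fst = flow_law FF SS M B h (fst p)"
    unfolding coupling_step_def flow_law_def by (subst distr_distr[OF fs(1) m]) (simp add: comp_def)
  have "distr (coupling_step M B \<delta> h p) borel snd = flow_law FF (\<lambda>x. SS (QQ \<delta> (fst p) (snd p) x)) M B h (snd p)"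
    unfolding coupling_step_def flow_law_def by (subst distr_distr[OF fs(2) m]) (simp add: comp_def)
  then show "distr (coupling_step M B \<delta> h p) borel snd = flow_law FF SS M B h (snd p)"
    using noise.flow_law_orthogonal[OF B h QQ_orthogonal[OF \<delta>]] by simp
qed

lemma flow_law_zero: "flow_law FF SS M B 0 z = return borel z"
proof -
  interpret prob_space M using B by (rule brownian_motion_prob_space)
  have "flow_law FF SS M B 0 z = distr M borel (\<lambda>_. z)"
    unfolding flow_law_def by (rule distr_cong) (simp_all add: noise.flow_zero brownian_motion_path[OF B])
  also have "\<dots> = return borel z" by simp
  finally show ?thesis .
qed

text \<open>Adds to the semigroup property the case \<open>n = 0\<close>, where the kernel is a
  point mass.\<close>

lemma flow_law_Suc:
  assumes h: "0 < h"
  shows "flow_law FF SS M B (real (Suc n) * h) z = flow_law FF SS M B (real n * h) z \<bind> flow_law FF SS M B h"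
proof (cases "n = 0")
  case True
  then show ?thesis
    using bind_return[OF measurable_prob_algebraD[OF noise.flow_law_kernel[OF B less_imp_le[OF h]]], of z]
    by (simp add: flow_law_zero)
next
  case False
  then show ?thesis by (intro noise.flow_law_semigroup[OF B h]) simp
qed

lemma coupling_iter_prob:
  assumes "0 < \<delta>" "0 \<le> h"
  shows "prob_space (coupling_iter M B \<delta> h n p)" "sets (coupling_iter M B \<delta> h n p) = sets borel" "space (coupling_iter M B \<delta> h n p) = UNIV"
proof -
  have "coupling_iter M B \<delta> h n p \<in> space (prob_algebra borel)"
    using measurable_space[OF coupling_iter_kernel[OF assms], of p] by simp
  then show p: "prob_space (coupling_iter M B \<delta> h n p)" "sets (coupling_iter M B \<delta> h n p) = sets borel"
    by (simp_all add: space_prob_algebra)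
  from sets_eq_imp_space_eq[OF p(2)] show "space (coupling_iter M B \<delta> h n p) = UNIV" by simp
qed

text \<open>Each step has the kernel as marginal whatever pair it starts from, so the marginals of
  the chain follow the semigroup. The argument is the same for both projections and is carried out
  for a general \<open>pr\<close>.\<close>

lemma coupling_iter_marginals:
  assumes \<delta>: "0 < \<delta>" and h: "0 < h"
  shows "distr (coupling_iter M B \<delta> h n p) borel fst = flow_law FF SS M B (real n * h) (fst p)"
    "distr (coupling_iter M B \<delta> h n p) borel snd = flow_law FF SS M B (real n * h) (snd p)"
proof -
  have fs: "fst \<in> borel_measurable (borel :: (((real^'d) \<times> (real^'d)) \<times> ((real^'d) \<times> (real^'d))) measure)" "snd \<in> borel_measurable (borel :: (((real^'d) \<times> (real^'d)) \<times> ((real^'d) \<times> (real^'d))) measure)"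
    by (intro borel_measurable_continuous_onI continuous_intros)+
  have h0: "0 \<le> h" using h by simp
  have gen: "distr (coupling_iter M B \<delta> h n p) borel pr = flow_law FF SS M B (real n * h) (pr p)"
    if pr: "pr \<in> borel_measurable borel" and step: "\<And>q. distr (coupling_step M B \<delta> h q) borel pr = flow_law FF SS M B h (pr q)" for pr
  proof (induction n)
    case 0
    then show ?case using pr by (simp add: distr_return flow_law_zero)
  next
    case (Suc n)
    note it = coupling_iter_prob[OF \<delta> h0, of n p]
    have ker: "coupling_step M B \<delta> h \<in> coupling_iter M B \<delta> h n p \<rightarrow>\<^sub>M subprob_algebra borel"
      using measurable_prob_algebraD[OF coupling_step_kernel[OF \<delta> h0]] it(2) by (simp cong: measurable_cong_sets)
    have pr': "pr \<in> coupling_iter M B \<delta> h n p \<rightarrow>\<^sub>M borel" using pr it(2) by (simp cong: measurable_cong_sets)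
    have "distr (coupling_iter M B \<delta> h (Suc n) p) borel pr = coupling_iter M B \<delta> h n p \<bind> (\<lambda>q. flow_law FF SS M B h (pr q))"
      using distr_bind[OF ker _ pr] it(3) by (simp add: step)
    also have "\<dots> = distr (coupling_iter M B \<delta> h n p) borel pr \<bind> flow_law FF SS M B h"
      using bind_distr[OF pr' measurable_prob_algebraD[OF noise.flow_law_kernel[OF B h0]]] it(3) by (simp add: comp_def)
    finally show ?case using flow_law_Suc[OF h] Suc by simp
  qed
  show "distr (coupling_iter M B \<delta> h n p) borel fst = flow_law FF SS M B (real n * h) (fst p)"
    by (rule gen[OF fs(1) coupling_step_marginals(1)[OF \<delta> h]])
  show "distr (coupling_iter M B \<delta> h n p) borel snd = flow_law FF SS M B (real n * h) (snd p)"
    by (rule gen[OF fs(2) coupling_step_marginals(2)[OF \<delta> h]])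
qed

lemma W3_measurable: "(\<lambda>p. W3 (fst p) (snd p)) \<in> borel_measurable borel"
  unfolding W3_def by (intro borel_measurable_continuous_onI continuous_intros)

lemma W3_nonneg: "0 \<le> W3 y y'"
  by (simp add: W3_def)

text \<open>\<open>W3\<close> is dominated by the cubes of the two components, so only the marginals
  matter and the constant is the same for all \<delta> and \<open>h\<close>. This independence later
  allows \<delta> to be chosen in terms of it.\<close>

lemma coupling_iter_moment:
  assumes T: "0 < T"
  obtains C where "0 \<le> C" "\<And>\<delta> h n p. 0 < \<delta> \<Longrightarrow> 0 < h \<Longrightarrow> real n * h \<le> T \<Longrightarrow>
     (\<integral>\<^sup>+q. ennreal (W3 (fst q) (snd q)) \<partial>coupling_iter M B \<delta> h n p) \<le> ennreal (C * W3 (fst p) (snd p))"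
proof -
  obtain C where C: "0 \<le> C" "\<And>(M :: 'a measure) B t y. brownian_motion M B \<Longrightarrow> 0 < t \<Longrightarrow> t \<le> T \<Longrightarrow>
      (\<integral>\<^sup>+\<omega>. ennreal ((1 + norm (flow FF SS t (\<lambda>t. B t \<omega>) y)) ^ 3) \<partial>M) \<le> ennreal (C * (1 + norm y) ^ 3)"
    using moment_flow[OF T] by blast
  \<comment> \<open>The maximum with 1 covers time 0.\<close>
  define D where "D = max C 1"
  have cube_meas: "(\<lambda>z. ennreal ((1 + norm (z :: (real^'d) \<times> (real^'d))) ^ 3)) \<in> borel_measurable borel" by simp
  have mom: "(\<integral>\<^sup>+z. ennreal ((1 + norm z) ^ 3) \<partial>flow_law FF SS M B t y) \<le> ennreal (D * (1 + norm y) ^ 3)" if "0 \<le> t" "t \<le> T" for t y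
  proof (cases "t = 0")
    case True
    have "1 * (1 + norm y) ^ 3 \<le> D * (1 + norm y) ^ 3" by (intro mult_right_mono) (simp_all add: D_def)
    then show ?thesis using True cube_meas by (simp add: flow_law_zero nn_integral_return ennreal_leI)
  next
    case False
    have "C * (1 + norm y) ^ 3 \<le> D * (1 + norm y) ^ 3" by (intro mult_right_mono) (simp_all add: D_def)
    then show ?thesis
      using C(2)[OF B, of t y] that False noise.nn_integral_flow_law[OF B that(1) cube_meas]
      by (simp add: order_trans[OF _ ennreal_leI])
  qed
  show thesis
  proof (rule that)
    show "0 \<le> 8 * D" by (simp add: D_def)
    fix \<delta> h :: real and n :: nat and p :: "((real^'d) \<times> (real^'d)) \<times> ((real^'d) \<times> (real^'d))"
    assume \<delta>: "0 < \<delta>" and h: "0 < h" and nh: "real n * h \<le> T"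
    have fs: "fst \<in> borel_measurable (borel :: (((real^'d) \<times> (real^'d)) \<times> ((real^'d) \<times> (real^'d))) measure)" "snd \<in> borel_measurable (borel :: (((real^'d) \<times> (real^'d)) \<times> ((real^'d) \<times> (real^'d))) measure)"
      by (intro borel_measurable_continuous_onI continuous_intros)+
    let ?K = "coupling_iter M B \<delta> h n p"
    note it = coupling_iter_prob[OF \<delta> less_imp_le[OF h], of n p]
    have fsK: "fst \<in> borel_measurable ?K" "snd \<in> borel_measurable ?K" using fs it(2) by (simp_all cong: measurable_cong_sets)
    have cube: "W3 a b \<le> 4 * (1 + norm a) ^ 3 + 4 * (1 + norm b) ^ 3" for a b
    proof -
      define x where "x = 1 + norm a"
      define z where "z = 1 + norm b"
      have xz: "0 \<le> x" "0 \<le> z" by (simp_all add: x_def z_def)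
      have "W3 a b \<le> (x + z) ^ 3" unfolding W3_def x_def z_def by (intro power_mono) simp_all
      also have "\<dots> = 4 * x ^ 3 + 4 * z ^ 3 - 3 * ((x + z) * (x - z)\<^sup>2)" by algebra
      also have "\<dots> \<le> 4 * x ^ 3 + 4 * z ^ 3" using xz by simp
      finally show ?thesis by (simp add: x_def z_def)
    qed
    have single: "(1 + norm a) ^ 3 \<le> W3 a b" "(1 + norm b) ^ 3 \<le> W3 a b" for a b
      unfolding W3_def by (intro power_mono; simp)+
    have m: "(\<integral>\<^sup>+q. ennreal ((1 + norm (fst q)) ^ 3) \<partial>?K) \<le> ennreal (D * W3 (fst p) (snd p))"
      "(\<integral>\<^sup>+q. ennreal ((1 + norm (snd q)) ^ 3) \<partial>?K) \<le> ennreal (D * W3 (fst p) (snd p))"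
    proof -
      have D1: "0 \<le> D" by (simp add: D_def)
      have "(\<integral>\<^sup>+q. ennreal ((1 + norm (fst q)) ^ 3) \<partial>?K) = (\<integral>\<^sup>+z. ennreal ((1 + norm z) ^ 3) \<partial>flow_law FF SS M B (real n * h) (fst p))"
        unfolding coupling_iter_marginals(1)[OF \<delta> h, symmetric] using fsK(1) cube_meas by (subst nn_integral_distr) simp_all
      also have "\<dots> \<le> ennreal (D * (1 + norm (fst p)) ^ 3)" using nh h by (intro mom) simp_all
      also have "\<dots> \<le> ennreal (D * W3 (fst p) (snd p))" by (intro ennreal_leI mult_left_mono single D1)
      finally show "(\<integral>\<^sup>+q. ennreal ((1 + norm (fst q)) ^ 3) \<partial>?K) \<le> ennreal (D * W3 (fst p) (snd p))" .
      have "(\<integral>\<^sup>+q. ennreal ((1 + norm (snd q)) ^ 3) \<partial>?K) = (\<integral>\<^sup>+z. ennreal ((1 + norm z) ^ 3) \<partial>flow_law FF SS M B (real n * h) (snd p))"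
        unfolding coupling_iter_marginals(2)[OF \<delta> h, symmetric] using fsK(2) cube_meas by (subst nn_integral_distr) simp_all
      also have "\<dots> \<le> ennreal (D * (1 + norm (snd p)) ^ 3)" using nh h by (intro mom) simp_all
      also have "\<dots> \<le> ennreal (D * W3 (fst p) (snd p))" by (intro ennreal_leI mult_left_mono single D1)
      finally show "(\<integral>\<^sup>+q. ennreal ((1 + norm (snd q)) ^ 3) \<partial>?K) \<le> ennreal (D * W3 (fst p) (snd p))" .
    qed
    have "(\<integral>\<^sup>+q. ennreal (W3 (fst q) (snd q)) \<partial>?K) \<le> (\<integral>\<^sup>+q. 4 * ennreal ((1 + norm (fst q)) ^ 3) + 4 * ennreal ((1 + norm (snd q)) ^ 3) \<partial>?K)"
    proof (rule nn_integral_mono)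
      fix q
      have "ennreal (W3 (fst q) (snd q)) \<le> ennreal (4 * (1 + norm (fst q)) ^ 3 + 4 * (1 + norm (snd q)) ^ 3)" by (intro ennreal_leI cube)
      then show "ennreal (W3 (fst q) (snd q)) \<le> 4 * ennreal ((1 + norm (fst q)) ^ 3) + 4 * ennreal ((1 + norm (snd q)) ^ 3)"
        by (simp add: ennreal_plus ennreal_mult ennreal_numeral)
    qed
    also have "\<dots> = 4 * (\<integral>\<^sup>+q. ennreal ((1 + norm (fst q)) ^ 3) \<partial>?K) + 4 * (\<integral>\<^sup>+q. ennreal ((1 + norm (snd q)) ^ 3) \<partial>?K)"
      using fsK by (subst nn_integral_add) (simp_all add: nn_integral_cmult)
    also have "\<dots> \<le> 4 * ennreal (D * W3 (fst p) (snd p)) + 4 * ennreal (D * W3 (fst p) (snd p))"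
      using m by (intro add_mono mult_left_mono) simp_all
    also have "\<dots> = ennreal (8 * D * W3 (fst p) (snd p))"
    proof -
      have "0 \<le> D * W3 (fst p) (snd p)" using W3_nonneg by (simp add: D_def)
      then have "ennreal (8 * (D * W3 (fst p) (snd p))) = 8 * ennreal (D * W3 (fst p) (snd p))"
        by (subst ennreal_mult) simp_all
      then show ?thesis by (simp add: distrib_right[symmetric] mult.assoc)
    qed
    finally show "(\<integral>\<^sup>+q. ennreal (W3 (fst q) (snd q)) \<partial>?K) \<le> ennreal (8 * D * W3 (fst p) (snd p))" .
  qed
qed

text \<open>Induction on the number of steps. The factor \<open>1 - c * s\<^sup>2\<close> lies in
  [0, 1], so earlier errors do not grow and the total is at most n times the bound for one of
  them.\<close>

lemma coupling_iter_cost: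
  assumes \<delta>: "0 < \<delta>" and s: "0 < s" "s \<le> 1" "s\<^sup>2 * \<gamma> \<le> 1" and E: "0 \<le> E" and C: "0 \<le> C"
    and step: "\<And>p. (\<integral>\<^sup>+q. ennreal (\<rho> (fst q) (snd q)) \<partial>coupling_step M B \<delta> (s\<^sup>2) p) \<le> ennreal ((1 - c * s\<^sup>2) * \<rho> (fst p) (snd p) + E * W3 (fst p) (snd p))"
    and mom: "\<And>k p. k < n \<Longrightarrow> (\<integral>\<^sup>+q. ennreal (W3 (fst q) (snd q)) \<partial>coupling_iter M B \<delta> (s\<^sup>2) k p) \<le> ennreal (C * W3 (fst p) (snd p))"
  shows "(\<integral>\<^sup>+q. ennreal (\<rho> (fst q) (snd q)) \<partial>coupling_iter M B \<delta> (s\<^sup>2) n p) \<le> ennreal ((1 - c * s\<^sup>2) ^ n * \<rho> (fst p) (snd p) + real n * (E * (C * W3 (fst p) (snd p))))"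
  using mom
proof (induction n)
  case 0
  then show ?case using rho_measurable by (simp add: nn_integral_return)
next
  case (Suc n)
  let ?K = "coupling_iter M B \<delta> (s\<^sup>2) n p"
  define a where "a = 1 - c * s\<^sup>2"
  have a: "0 \<le> a" "a \<le> 1"
  proof -
    have "16 * c * s\<^sup>2 \<le> \<gamma> * lam * s\<^sup>2" using c_bounds(3) by (intro mult_right_mono) simp_all
    also have "\<dots> = lam * (s\<^sup>2 * \<gamma>)" by simp
    also have "\<dots> \<le> 1 * 1" using lam s gamma_pos by (intro mult_mono) simp_all
    finally show "0 \<le> a" by (simp add: a_def)
    show "a \<le> 1" using c_pos by (simp add: a_def)
  qed
  note it = coupling_iter_prob[OF \<delta> zero_le_power2[of s], of n p]
  have ker: "coupling_step M B \<delta> (s\<^sup>2) \<in> ?K \<rightarrow>\<^sub>M subprob_algebra borel"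
    using measurable_prob_algebraD[OF coupling_step_kernel[OF \<delta> zero_le_power2[of s]]] it(2) by (simp cong: measurable_cong_sets)
  have mK: "(\<lambda>q. ennreal (\<rho> (fst q) (snd q))) \<in> borel_measurable ?K" "(\<lambda>q. ennreal (W3 (fst q) (snd q))) \<in> borel_measurable ?K"
    using rho_measurable W3_measurable it(2) by (simp_all cong: measurable_cong_sets)
  have "(\<integral>\<^sup>+q. ennreal (\<rho> (fst q) (snd q)) \<partial>coupling_iter M B \<delta> (s\<^sup>2) (Suc n) p)
      = (\<integral>\<^sup>+q. \<integral>\<^sup>+r. ennreal (\<rho> (fst r) (snd r)) \<partial>coupling_step M B \<delta> (s\<^sup>2) q \<partial>?K)"
    using rho_measurable by (simp add: nn_integral_bind[OF _ ker])
  also have "\<dots> \<le> (\<integral>\<^sup>+q. ennreal a * ennreal (\<rho> (fst q) (snd q)) + ennreal E * ennreal (W3 (fst q) (snd q)) \<partial>?K)"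
  proof (rule nn_integral_mono)
    fix q
    show "(\<integral>\<^sup>+r. ennreal (\<rho> (fst r) (snd r)) \<partial>coupling_step M B \<delta> (s\<^sup>2) q) \<le> ennreal a * ennreal (\<rho> (fst q) (snd q)) + ennreal E * ennreal (W3 (fst q) (snd q))"
      using step[of q] a E rho_nonneg[of "fst q" "snd q"] W3_nonneg[of "fst q" "snd q"] by (simp add: ennreal_mult ennreal_plus a_def[symmetric])
  qed
  also have "\<dots> = ennreal a * (\<integral>\<^sup>+q. ennreal (\<rho> (fst q) (snd q)) \<partial>?K) + ennreal E * (\<integral>\<^sup>+q. ennreal (W3 (fst q) (snd q)) \<partial>?K)"
    using mK by (simp add: nn_integral_add nn_integral_cmult)
  also have "\<dots> \<le> ennreal a * ennreal (a ^ n * \<rho> (fst p) (snd p) + real n * (E * (C * W3 (fst p) (snd p)))) + ennreal E * ennreal (C * W3 (fst p) (snd p))"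
    using Suc by (intro add_mono mult_left_mono) (simp_all add: a_def)
  also have "\<dots> = ennreal (a * (a ^ n * \<rho> (fst p) (snd p) + real n * (E * (C * W3 (fst p) (snd p)))) + E * (C * W3 (fst p) (snd p)))"
    using a E C rho_nonneg[of "fst p" "snd p"] W3_nonneg[of "fst p" "snd p"] by (simp add: ennreal_mult ennreal_plus)
  also have "\<dots> \<le> ennreal (a ^ Suc n * \<rho> (fst p) (snd p) + real (Suc n) * (E * (C * W3 (fst p) (snd p))))"
  proof (rule ennreal_leI)
    define Z where "Z = E * (C * W3 (fst p) (snd p))"
    have "0 \<le> Z" using E C W3_nonneg by (simp add: Z_def)
    then have "a * (real n * Z) \<le> 1 * (real n * Z)" using a by (intro mult_right_mono) simp_all
    then show "a * (a ^ n * \<rho> (fst p) (snd p) + real n * (E * (C * W3 (fst p) (snd p)))) + E * (C * W3 (fst p) (snd p)) \<le> a ^ Suc n * \<rho> (fst p) (snd p) + real (Suc n) * (E * (C * W3 (fst p) (snd p)))"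
      unfolding Z_def[symmetric] by (simp add: algebra_simps)
  qed
  finally show ?case by (simp add: a_def)
qed

text \<open>For starting pairs with \<open>W3\<close> at most \<open>j\<close>, \<delta> is chosen
  first, since the moment constant \<open>D\<close> is known independently of it, and then the
  number of steps, since the constant \<open>C\<close> of the remainder depends on \<delta>. The
  error \<open>r\<close> is split into halves.\<close>

lemma coupling_kernel_exists:
  assumes t: "0 < t" and r: "0 < r"
  obtains \<delta> n where "\<And>j. 0 < \<delta> j" "\<And>j. 0 < n j"
    "\<And>(j::nat) p. W3 (fst p) (snd p) \<le> real j \<Longrightarrow>
      (\<integral>\<^sup>+q. ennreal (\<rho> (fst q) (snd q)) \<partial>coupling_iter M B (\<delta> j) (t / real (n j)) (n j) p) \<le> ennreal (exp (- c * t) * \<rho> (fst p) (snd p) + r)"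
proof -
  obtain D where D: "0 \<le> D" "\<And>\<delta> h n p. 0 < \<delta> \<Longrightarrow> 0 < h \<Longrightarrow> real n * h \<le> t \<Longrightarrow>
     (\<integral>\<^sup>+q. ennreal (W3 (fst q) (snd q)) \<partial>coupling_iter M B \<delta> h n p) \<le> ennreal (D * W3 (fst p) (snd p))"
    using coupling_iter_moment[OF t] by blast
  define K where "K = (\<alpha> + 1) * \<gamma> * Kg"
  have Kg: "0 \<le> Kg" using eps_pos KH_nonneg K1_nonneg K2_nonneg sigma0 gamma_pos u_pos by (simp add: Kg_def)
  have K: "0 \<le> K" using alpha_pos gamma_pos Kg by (simp add: K_def)
  have ex: "\<exists>\<delta> n. 0 < \<delta> \<and> 0 < n \<and> (\<forall>p. W3 (fst p) (snd p) \<le> real j \<longrightarrow>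
      (\<integral>\<^sup>+q. ennreal (\<rho> (fst q) (snd q)) \<partial>coupling_iter M B \<delta> (t / real n) n p) \<le> ennreal (exp (- c * t) * \<rho> (fst p) (snd p) + r))" for j :: nat
  proof -
    \<comment> \<open>Makes the total synchronous error, at most t K \<delta> D j, no larger than r
      / 2; adding 1 keeps the denominator positive.\<close>
    define \<delta> where "\<delta> = r / (2 * (t * K * D * real j + 1))"
    have den: "0 < t * K * D * real j + 1" using t K D by (simp add: add_nonneg_pos)
    have \<delta>: "0 < \<delta>" using r den by (simp add: \<delta>_def)
    have \<delta>_le: "t * (K * \<delta>) * (D * real j) \<le> r / 2"
    proof -
      have "t * (K * \<delta>) * (D * real j) = (t * K * D * real j) * \<delta>" by simp
      also have "\<dots> \<le> (t * K * D * real j + 1) * \<delta>" using \<delta> by simp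
      also have "\<dots> = r / 2"
        unfolding \<delta>_def using den by (metis less_irrefl mult.commute nonzero_mult_divide_mult_cancel_left times_divide_eq_right)
      finally show ?thesis .
    qed
    obtain C where C: "0 \<le> C" "\<And>(M :: 'a measure) B s y y'. brownian_motion M B \<Longrightarrow> 0 < s \<Longrightarrow> s \<le> 1 \<Longrightarrow> s\<^sup>2 * \<gamma> \<le> 1 \<Longrightarrow>
      (\<integral>\<^sup>+\<omega>. ennreal (\<rho> (flow FF SS (s\<^sup>2) (\<lambda>t. B t \<omega>) y) (flow FF (\<lambda>x. SS (QQ \<delta> y y' x)) (s\<^sup>2) (\<lambda>t. B t \<omega>) y')) \<partial>M)
      \<le> ennreal ((1 - c * s\<^sup>2) * \<rho> y y' + ((\<alpha> + 1) * \<gamma> * Kg * \<delta> * s\<^sup>2 + C * s ^ 3) * W3 y y')"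
      using one_step_flow[OF \<delta>] by blast
    have lim: "(\<lambda>n. sqrt (t / real n)) \<longlonglongrightarrow> 0"
      using tendsto_real_sqrt[OF lim_const_over_n[of t]] by simp
    have lim2: "(\<lambda>n. t * (C * sqrt (t / real n)) * (D * real j)) \<longlonglongrightarrow> 0"
      using tendsto_mult_right[OF tendsto_mult_left[OF lim], of "t * C" "D * real j"] by (simp add: mult.assoc)
    have lim3: "(\<lambda>n. t / real n * \<gamma>) \<longlonglongrightarrow> 0"
      using tendsto_mult_right[OF lim_const_over_n[of t], of \<gamma>] by simp
    have "\<forall>\<^sub>F n in sequentially. sqrt (t / real n) < 1" "\<forall>\<^sub>F n in sequentially. t * (C * sqrt (t / real n)) * (D * real j) < r / 2"
      "\<forall>\<^sub>F n in sequentially. t / real n * \<gamma> < 1"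
      using r by (intro order_tendstoD(2)[OF lim] order_tendstoD(2)[OF lim2] order_tendstoD(2)[OF lim3]; simp)+
    then have "\<forall>\<^sub>F n in sequentially. 0 < n \<and> sqrt (t / real n) < 1 \<and> t * (C * sqrt (t / real n)) * (D * real j) < r / 2 \<and> t / real n * \<gamma> < 1"
      using eventually_gt_at_top[of "0::nat"] by eventually_elim simp
    then obtain n where n: "0 < n" "sqrt (t / real n) < 1" "t * (C * sqrt (t / real n)) * (D * real j) < r / 2" "t / real n * \<gamma> < 1"
      using eventually_happens' sequentially_bot by blast
    define s where "s = sqrt (t / real n)"
    have s: "0 < s" "s \<le> 1" "s\<^sup>2 = t / real n" "s\<^sup>2 * \<gamma> \<le> 1" using n t by (simp_all add: s_def)
    define E where "E = K * \<delta> * s\<^sup>2 + C * s ^ 3"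
    have E: "0 \<le> E" unfolding E_def using K \<delta> C(1) s(1) by (intro add_nonneg_nonneg mult_nonneg_nonneg zero_le_power2 zero_le_power) simp_all
    have "(\<integral>\<^sup>+q. ennreal (\<rho> (fst q) (snd q)) \<partial>coupling_iter M B \<delta> (t / real n) n p) \<le> ennreal (exp (- c * t) * \<rho> (fst p) (snd p) + r)"
      if W: "W3 (fst p) (snd p) \<le> real j" for p
    proof -
      have "(\<integral>\<^sup>+q. ennreal (\<rho> (fst q) (snd q)) \<partial>coupling_iter M B \<delta> (s\<^sup>2) n p) \<le> ennreal ((1 - c * s\<^sup>2) ^ n * \<rho> (fst p) (snd p) + real n * (E * (D * W3 (fst p) (snd p))))"
      proof (rule coupling_iter_cost[OF \<delta> s(1,2,4) E D(1)])
        fix p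
        have "(\<integral>\<^sup>+q. ennreal (\<rho> (fst q) (snd q)) \<partial>coupling_step M B \<delta> (s\<^sup>2) p)
            = (\<integral>\<^sup>+\<omega>. ennreal (\<rho> (flow FF SS (s\<^sup>2) (\<lambda>t. B t \<omega>) (fst p)) (flow FF (\<lambda>x. SS (QQ \<delta> (fst p) (snd p) x)) (s\<^sup>2) (\<lambda>t. B t \<omega>) (snd p))) \<partial>M)"
          unfolding coupling_step_def using coupling_pair_measurable'[OF \<delta> zero_le_power2[of s]] rho_measurable
          by (subst nn_integral_distr) simp_all
        then show "(\<integral>\<^sup>+q. ennreal (\<rho> (fst q) (snd q)) \<partial>coupling_step M B \<delta> (s\<^sup>2) p) \<le> ennreal ((1 - c * s\<^sup>2) * \<rho> (fst p) (snd p) + E * W3 (fst p) (snd p))"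
          using C(2)[OF B s(1,2,4), of "fst p" "snd p"] by (simp add: E_def K_def)
      next
        fix k p assume "k < n"
        then have "real k * (t / real n) \<le> real n * (t / real n)" using t by (intro mult_right_mono) simp_all
        then show "(\<integral>\<^sup>+q. ennreal (W3 (fst q) (snd q)) \<partial>coupling_iter M B \<delta> (s\<^sup>2) k p) \<le> ennreal (D * W3 (fst p) (snd p))"
          unfolding s(3) using n t by (intro D(2) \<delta>) simp_all
      qed
      also have "\<dots> \<le> ennreal (exp (- c * t) * \<rho> (fst p) (snd p) + r)"
      proof (rule ennreal_leI, rule add_mono)
        have a: "0 \<le> 1 - c * s\<^sup>2"
        proof -
          have "16 * c * s\<^sup>2 \<le> \<gamma> * lam * s\<^sup>2" using c_bounds(3) by (intro mult_right_mono) simp_all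
          also have "\<dots> = lam * (s\<^sup>2 * \<gamma>)" by simp
          also have "\<dots> \<le> 1 * 1" using lam s(4) gamma_pos by (intro mult_mono mult_nonneg_nonneg zero_le_power2) simp_all
          finally show ?thesis by simp
        qed
        have "(1 - c * s\<^sup>2) ^ n \<le> exp (- (c * s\<^sup>2)) ^ n" using exp_ge_add_one_self[of "- (c * s\<^sup>2)"] a by (intro power_mono) simp_all
        also have "\<dots> = exp (- c * t)" unfolding exp_of_nat_mult[symmetric] s(3) using n by simp
        finally show "(1 - c * s\<^sup>2) ^ n * \<rho> (fst p) (snd p) \<le> exp (- c * t) * \<rho> (fst p) (snd p)" using rho_nonneg by (rule mult_right_mono)
        have "real n * E = t * (K * \<delta>) + t * (C * s)"
        proof -
          have "s ^ 3 = s\<^sup>2 * s" by (simp add: power3_eq_cube power2_eq_square)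
          moreover have "real n * s\<^sup>2 = t" unfolding s(3) using n by simp
          ultimately have "real n * E = (K * \<delta>) * t + (C * s) * t" unfolding E_def by (metis (no_types, opaque_lifting) distrib_left mult.assoc mult.commute)
          then show ?thesis by (simp add: mult.commute)
        qed
        then have "real n * (E * (D * W3 (fst p) (snd p))) = (t * (K * \<delta>) + t * (C * s)) * (D * W3 (fst p) (snd p))" by (simp add: mult.assoc[symmetric])
        also have "\<dots> \<le> (t * (K * \<delta>) + t * (C * s)) * (D * real j)"
          using W D(1) t K \<delta> C(1) s by (intro mult_left_mono) simp_all
        also have "\<dots> \<le> r" using \<delta>_le n(3) unfolding s_def distrib_right by linarith
        finally show "real n * (E * (D * W3 (fst p) (snd p))) \<le> r" .
      qed
      finally show ?thesis unfolding s(3) .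
    qed
    then show ?thesis using \<delta> n(1) by blast
  qed
  from choice[OF allI[OF ex]] obtain \<delta> where "\<forall>j. \<exists>n. 0 < \<delta> j \<and> 0 < n \<and> (\<forall>p. W3 (fst p) (snd p) \<le> real j \<longrightarrow>
      (\<integral>\<^sup>+q. ennreal (\<rho> (fst q) (snd q)) \<partial>coupling_iter M B (\<delta> j) (t / real n) n p) \<le> ennreal (exp (- c * t) * \<rho> (fst p) (snd p) + r))" ..
  from choice[OF this] obtain n where "\<forall>j. 0 < \<delta> j \<and> 0 < n j \<and> (\<forall>p. W3 (fst p) (snd p) \<le> real j \<longrightarrow>
      (\<integral>\<^sup>+q. ennreal (\<rho> (fst q) (snd q)) \<partial>coupling_iter M B (\<delta> j) (t / real (n j)) (n j) p) \<le> ennreal (exp (- c * t) * \<rho> (fst p) (snd p) + r))" ..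
  then show thesis by (intro that[of \<delta> n]) blast+
qed

end

section \<open>From the coupling kernel to the laws of solutions\<close>

lemma langevin_solution_flow:
  assumes sol: "langevin_solution M u \<gamma> gradU B X V" and t: "0 \<le> t" and \<omega>: "\<omega> \<in> space M"
  shows "(X t \<omega>, V t \<omega>) = flow FF SS t (\<lambda>t. B t \<omega>) (X 0 \<omega>, V 0 \<omega>)"
proof -
  have B: "brownian_motion M B" using sol by (simp add: langevin_solution_def)
  have cont: "continuous_on {0..t} (\<lambda>t. X t \<omega>)" "continuous_on {0..t} (\<lambda>t. V t \<omega>)"
    using sol \<omega> by (auto simp: langevin_solution_def intro: continuous_on_subset)
  have eqs: "X r \<omega> = X 0 \<omega> + integral {0..r} (\<lambda>s. V s \<omega>)"
    "V r \<omega> = V 0 \<omega> - integral {0..r} (\<lambda>s. \<gamma> *\<^sub>R V s \<omega> + u *\<^sub>R gradU (X s \<omega>)) + sqrt (2 * \<gamma> * u) *\<^sub>R B r \<omega>" if "0 \<le> r" for r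
    using sol \<omega> that unfolding langevin_solution_def by blast+
  let ?y = "\<lambda>r. (X r \<omega>, V r \<omega>)"
  have y: "continuous_on {0..t} ?y" by (intro continuous_intros cont)
  have "flow FF SS t (\<lambda>t. B t \<omega>) (?y 0) = ?y t"
  proof (rule noise.flow_eq_solution[OF t _ _ y])
    show "continuous_on {0..t} (\<lambda>t. B t \<omega>)" "B 0 \<omega> = 0" using brownian_motion_path[OF B \<omega>] by simp_all
    fix r assume r: "r \<in> {0..t}"
    have "continuous_on {0..r} (\<lambda>s. FF (?y s))"
      using r by (intro continuous_on_compose2[OF noise.continuous_F[of UNIV] continuous_on_subset[OF y]]) auto
    then have int: "(\<lambda>s. FF (?y s)) integrable_on {0..r}" by (rule integrable_continuous_real)
    have "fst (integral {0..r} (\<lambda>s. FF (?y s))) = integral {0..r} (\<lambda>s. V s \<omega>)"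
      using integral_linear[OF int bounded_linear_fst] by (simp add: comp_def FF_def)
    moreover have "snd (integral {0..r} (\<lambda>s. FF (?y s))) = - integral {0..r} (\<lambda>s. \<gamma> *\<^sub>R V s \<omega> + u *\<^sub>R gradU (X s \<omega>))"
      using integral_linear[OF int bounded_linear_snd] unfolding integral_neg[symmetric] by (simp add: comp_def FF_def algebra_simps)
    ultimately show "?y r = ?y 0 + integral {0..r} (\<lambda>s. FF (?y s)) + SS (B r \<omega>)"
      using eqs[of r] r by (simp add: prod_eq_iff SS_def \<sigma>0_def)
  qed
  then show ?thesis by simp
qed

text \<open>The Brownian motion behind the kernel may differ from the one driving the solution, so
  two solutions on different spaces evolve under one and the same kernel.\<close>

lemma law_at_eq_bind:
  assumes B: "brownian_motion M B" and sol: "langevin_solution M' u \<gamma> gradU B' X V" and t: "0 < t"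
  shows "law_at M' X V t = law_at M' X V 0 \<bind> flow_law FF SS M B t"
  unfolding law_at_def
proof (rule noise.distr_flow_eq_bind[OF B _ t])
  show "brownian_motion M' B'" "(\<lambda>\<omega>. (X 0 \<omega>, V 0 \<omega>)) \<in> borel_measurable M'" "(\<lambda>\<omega>. (X t \<omega>, V t \<omega>)) \<in> borel_measurable M'"
    using sol by (simp_all add: langevin_solution_def)
  show "prob_space.indep_set M' (sigma_sets (space M') {(\<lambda>\<omega>. (X 0 \<omega>, V 0 \<omega>)) -` A \<inter> space M' |A. A \<in> sets borel})
     (sigma_sets (space M') {(\<lambda>\<omega>. B' r \<omega>) -` A \<inter> space M' |r A. A \<in> sets borel})"
    using sol by (simp add: langevin_solution_def)
  show "(X t \<omega>, V t \<omega>) = flow FF SS t (\<lambda>t. B' t \<omega>) (X 0 \<omega>, V 0 \<omega>)" if "\<omega> \<in> space M'" for \<omega>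
    using t that by (intro langevin_solution_flow[OF sol]) simp_all
qed

text \<open>Composing a coupling of the initial laws with the coupled chains gives a coupling of the
  laws at time \<open>t\<close> whose cost exceeds the contracted cost by at most \<open>r\<close>,
  with \<open>r\<close> arbitrary.\<close>

lemma W_rho_contraction_pos:
  assumes B: "brownian_motion M B" and t: "0 < t"
  shows "W_rho \<rho> (\<mu> \<bind> flow_law FF SS M B t) (\<nu> \<bind> flow_law FF SS M B t) \<le> ennreal (exp (- c * t)) * W_rho \<rho> \<mu> \<nu>"
proof -
  let ?P = "flow_law FF SS M B t"
  have main: "W_rho \<rho> (\<mu> \<bind> ?P) (\<nu> \<bind> ?P) \<le> ennreal (exp (- c * t)) * (\<integral>\<^sup>+z. ennreal (\<rho> (fst z) (snd z)) \<partial>\<Gamma>)"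
    if \<Gamma>: "\<Gamma> \<in> couplings \<mu> \<nu>" for \<Gamma>
  proof (rule ennreal_le_epsilon)
    fix r :: real assume r: "0 < r"
    obtain \<delta> n where k: "\<And>j. 0 < \<delta> j" "\<And>j. 0 < n j"
      "\<And>(j::nat) p. W3 (fst p) (snd p) \<le> real j \<Longrightarrow>
        (\<integral>\<^sup>+q. ennreal (\<rho> (fst q) (snd q)) \<partial>coupling_iter M B (\<delta> j) (t / real (n j)) (n j) p) \<le> ennreal (exp (- c * t) * \<rho> (fst p) (snd p) + r)"
      using coupling_kernel_exists[OF B t r] by blast
    have \<Gamma>p: "prob_space \<Gamma>" "sets \<Gamma> = sets borel" "distr \<Gamma> borel fst = \<mu>" "distr \<Gamma> borel snd = \<nu>"
      using \<Gamma> by (simp_all add: couplings_def)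
    interpret \<Gamma>: prob_space \<Gamma> by fact
    have sp: "space \<Gamma> = UNIV" using sets_eq_imp_space_eq[OF \<Gamma>p(2)] by simp
    \<comment> \<open>The parameters \<delta> and n are selected by the integer size of the starting
      pair. There are countably many values, which makes the selected kernel measurable.\<close>
    define j where "j p = nat \<lceil>W3 (fst p) (snd p)\<rceil>" for p :: "((real^'d) \<times> (real^'d)) \<times> ((real^'d) \<times> (real^'d))"
    have j: "W3 (fst p) (snd p) \<le> real (j p)" for p unfolding j_def by linarith
    define Kf where "Kf p = coupling_iter M B (\<delta> (j p)) (t / real (n (j p))) (n (j p)) p" for p
    \<comment> \<open>The number of steps varies with the pair, but the total time is always
      \<open>t\<close>, so both marginals are given by \<open>?P\<close>.\<close>
    have h: "0 < t / real (n i)" "real (n i) * (t / real (n i)) = t" for i using t k(2)[of i] by simp_all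
    have jm: "j \<in> measurable borel (count_space UNIV)"
    proof -
      have "(\<lambda>p. \<lceil>W3 (fst p) (snd p)\<rceil>) \<in> measurable borel (count_space UNIV)"
        using measurable_compose[OF W3_measurable[OF B] measurable_real_ceiling] by simp
      from measurable_compose[OF this, of nat "count_space UNIV"] show ?thesis by (simp add: j_def[abs_def])
    qed
    have Kf: "Kf \<in> borel \<rightarrow>\<^sub>M prob_algebra borel"
      unfolding Kf_def[abs_def]
      by (rule measurable_compose_countable[of "\<lambda>i p. coupling_iter M B (\<delta> i) (t / real (n i)) (n i) p", OF _ jm])
        (rule coupling_iter_kernel[OF B k(1) less_imp_le[OF h(1)]])
    then have Kf': "Kf \<in> \<Gamma> \<rightarrow>\<^sub>M subprob_algebra borel"
      using measurable_prob_algebraD[OF Kf] \<Gamma>p(2) by (simp cong: measurable_cong_sets)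
    have fs: "fst \<in> borel_measurable (borel :: (((real^'d) \<times> (real^'d)) \<times> ((real^'d) \<times> (real^'d))) measure)" "snd \<in> borel_measurable (borel :: (((real^'d) \<times> (real^'d)) \<times> ((real^'d) \<times> (real^'d))) measure)"
      by (intro borel_measurable_continuous_onI continuous_intros)+
    have marg: "distr (\<Gamma> \<bind> Kf) borel pr = distr \<Gamma> borel pr \<bind> ?P"
      if pr: "pr \<in> borel_measurable borel" and it: "\<And>p. distr (Kf p) borel pr = ?P (pr p)" for pr
    proof -
      have pr': "pr \<in> \<Gamma> \<rightarrow>\<^sub>M borel" using pr \<Gamma>p(2) by (simp cong: measurable_cong_sets)
      have "distr (\<Gamma> \<bind> Kf) borel pr = \<Gamma> \<bind> (\<lambda>p. ?P (pr p))" using distr_bind[OF Kf' _ pr] sp by (simp add: it)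
      also have "\<dots> = distr \<Gamma> borel pr \<bind> ?P"
        using bind_distr[OF pr' measurable_prob_algebraD[OF noise.flow_law_kernel[OF B less_imp_le[OF t]]]] sp by (simp add: comp_def)
      finally show ?thesis .
    qed
    have it: "distr (Kf p) borel fst = ?P (fst p)" "distr (Kf p) borel snd = ?P (snd p)" for p
      unfolding Kf_def using coupling_iter_marginals[OF B k(1) h(1), of "j p" "j p" "n (j p)" p] h(2)[of "j p"] by simp_all
    have "\<Gamma> \<bind> Kf \<in> couplings (\<mu> \<bind> ?P) (\<nu> \<bind> ?P)"
      unfolding couplings_def mem_Collect_eq
    proof (intro conjI)
      show "prob_space (\<Gamma> \<bind> Kf)"
        using measurable_space[OF Kf] Kf' by (intro \<Gamma>.prob_space_bind[of _ borel]) (auto simp: space_prob_algebra)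
      show "sets (\<Gamma> \<bind> Kf) = sets borel"
        using Kf' sp by (subst sets_bind[where N=borel]) (auto simp: sets_kernel)
      show "distr (\<Gamma> \<bind> Kf) borel fst = \<mu> \<bind> ?P" using marg[OF fs(1) it(1)] \<Gamma>p by simp
      show "distr (\<Gamma> \<bind> Kf) borel snd = \<nu> \<bind> ?P" using marg[OF fs(2) it(2)] \<Gamma>p by simp
    qed
    then have "W_rho \<rho> (\<mu> \<bind> ?P) (\<nu> \<bind> ?P) \<le> (\<integral>\<^sup>+z. ennreal (\<rho> (fst z) (snd z)) \<partial>(\<Gamma> \<bind> Kf))"
      unfolding W_rho_def by (rule INF_lower)
    also have "\<dots> = (\<integral>\<^sup>+p. \<integral>\<^sup>+z. ennreal (\<rho> (fst z) (snd z)) \<partial>Kf p \<partial>\<Gamma>)"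
      using rho_measurable by (intro nn_integral_bind[OF _ Kf']) simp
    also have "\<dots> \<le> (\<integral>\<^sup>+p. ennreal (exp (- c * t)) * ennreal (\<rho> (fst p) (snd p)) + ennreal r \<partial>\<Gamma>)"
    proof (rule nn_integral_mono)
      fix p
      show "(\<integral>\<^sup>+z. ennreal (\<rho> (fst z) (snd z)) \<partial>Kf p) \<le> ennreal (exp (- c * t)) * ennreal (\<rho> (fst p) (snd p)) + ennreal r"
        using k(3)[OF j[of p]] r rho_nonneg[of "fst p" "snd p"] by (simp add: Kf_def ennreal_plus ennreal_mult)
    qed
    also have "\<dots> = ennreal (exp (- c * t)) * (\<integral>\<^sup>+z. ennreal (\<rho> (fst z) (snd z)) \<partial>\<Gamma>) + ennreal r"
    proof -
      have "(\<lambda>p. ennreal (\<rho> (fst p) (snd p))) \<in> borel_measurable \<Gamma>"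
        using rho_measurable \<Gamma>p(2) by (simp cong: measurable_cong_sets)
      then show ?thesis by (simp add: nn_integral_add nn_integral_cmult \<Gamma>.emeasure_space_1)
    qed
    finally show "W_rho \<rho> (\<mu> \<bind> ?P) (\<nu> \<bind> ?P) \<le> ennreal (exp (- c * t)) * (\<integral>\<^sup>+z. ennreal (\<rho> (fst z) (snd z)) \<partial>\<Gamma>) + ennreal r" .
  qed
  \<comment> \<open>The exponential factor is moved to the other side so that the infimum over
    couplings can be taken, and then moved back.\<close>
  have e1: "ennreal (exp (c * t)) * ennreal (exp (- c * t)) = 1" "ennreal (exp (- c * t)) * ennreal (exp (c * t)) = 1"
    by (simp_all add: ennreal_mult[symmetric] exp_add[symmetric])
  have "ennreal (exp (c * t)) * W_rho \<rho> (\<mu> \<bind> ?P) (\<nu> \<bind> ?P) \<le> W_rho \<rho> \<mu> \<nu>"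
    unfolding W_rho_def[of \<rho> \<mu> \<nu>]
  proof (rule INF_greatest)
    fix \<Gamma> assume "\<Gamma> \<in> couplings \<mu> \<nu>"
    from mult_left_mono[OF main[OF this] zero_le, of "ennreal (exp (c * t))"]
    show "ennreal (exp (c * t)) * W_rho \<rho> (\<mu> \<bind> ?P) (\<nu> \<bind> ?P) \<le> (\<integral>\<^sup>+z. ennreal (\<rho> (fst z) (snd z)) \<partial>\<Gamma>)"
      unfolding mult.assoc[symmetric] e1 mult_1 .
  qed
  from mult_left_mono[OF this zero_le, of "ennreal (exp (- c * t))"] show ?thesis
    unfolding mult.assoc[symmetric] e1 mult_1 .
qed

lemma W_rho_contraction:
  assumes t: "0 \<le> t" and sol: "langevin_solution M u \<gamma> gradU B X V" and sol': "langevin_solution M' u \<gamma> gradU B' X' V'"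
  shows "W_rho \<rho> (law_at M X V t) (law_at M' X' V' t) \<le> ennreal (exp (- c * t)) * W_rho \<rho> (law_at M X V 0) (law_at M' X' V' 0)"
proof (cases "t = 0")
  case False
  then have t: "0 < t" using t by simp
  have B: "brownian_motion M B" using sol by (simp add: langevin_solution_def)
  show ?thesis
    unfolding law_at_eq_bind[OF B sol t] law_at_eq_bind[OF B sol' t] by (rule W_rho_contraction_pos[OF B t])
qed simp

end

text \<open>The laws \<mu> p_t and \<nu> p_t are expressed as laws at time \<open>t\<close> of
  solutions started from \<mu> and \<nu>. The two solutions may live on different spaces with
  different Brownian motions, because the inequality concerns their laws alone.\<close>

theorem theorem3p1:
  fixes U :: "real^'d \<Rightarrow> real" and gradU :: "real^'d \<Rightarrow> real^'d"
    and u \<gamma> L A lam \<eta> c t :: real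
    and \<mu> \<nu> :: "((real^'d) \<times> (real^'d)) measure"
    and M :: "'a measure" and B X V :: "real \<Rightarrow> 'a \<Rightarrow> real^'d"
    and M' :: "'b measure" and B' X' V' :: "real \<Rightarrow> 'b \<Rightarrow> real^'d"
  assumes u_pos: "u > 0" and gamma_pos: "\<gamma> > 0"
    and grad: "\<And>x. (U has_derivative (\<lambda>h. gradU x \<bullet> h)) (at x)"
    and C1: "continuous_on UNIV gradU"
    and L_pos: "L > 0" and A_pos: "A > 0" and lam: "0 < lam" "lam \<le> 1 / 4"
    and U_nonneg: "\<And>x. U x \<ge> 0"
    and lipschitz: "\<And>x y. norm (gradU x - gradU y) \<le> L * norm (x - y)"
    and drift: "\<And>x. (x \<bullet> gradU x) / 2 \<ge> lam * (U x + (1 / u) * \<gamma>\<^sup>2 * (norm x)\<^sup>2 / 4) - A"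
    and eta_pos: "\<eta> > 0"
    and c_pos: "c > 0"
    and c_bound:
      "let d = real CARD('d);
           \<alpha> = (1 + \<eta>) * L * u / \<gamma>\<^sup>2;
           \<epsilon> = 4 / \<gamma> * c / (d + A);
           R = R1 d A u \<gamma> lam \<alpha>;
           \<phi> = lphi L \<eta> \<gamma> u \<epsilon> \<alpha>;
           \<Phi> = lPhi L \<eta> \<gamma> u \<epsilon> \<alpha>
       in c \<le> \<gamma> * min (min (2 / 9 * u / \<gamma>\<^sup>2 / integral {0..R} (\<lambda>s. \<Phi> s / \<phi> s))
                             (1 / 18 * (\<eta> / (1 + \<eta>)) * (INF s\<in>{0<..R}. s * \<phi> s / \<Phi> s)))
                        (1 / 16 * lam)"
    and t_nonneg: "t \<ge> 0"
    and mu: "prob_space \<mu>" "sets \<mu> = sets borel"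
    and nu: "prob_space \<nu>" "sets \<nu> = sets borel"
    and sol: "langevin_solution M u \<gamma> gradU B X V" and init: "law_at M X V 0 = \<mu>"
    and sol': "langevin_solution M' u \<gamma> gradU B' X' V'" and init': "law_at M' X' V' 0 = \<nu>"
  shows
    "let d = real CARD('d);
         \<alpha> = (1 + \<eta>) * L * u / \<gamma>\<^sup>2;
         \<epsilon> = 4 / \<gamma> * c / (d + A);
         R = R1 d A u \<gamma> lam \<alpha>;
         f = lf L \<eta> \<gamma> u \<epsilon> \<alpha> c R;
         \<rho> = lrho f (lH U u \<gamma> lam) \<alpha> \<gamma> \<epsilon>
     in W_rho \<rho> (law_at M X V t) (law_at M' X' V' t) \<le> ennreal (exp (- c * t)) * W_rho \<rho> \<mu> \<nu>"
proof -
  interpret langevin U gradU u \<gamma> L A lam \<eta> c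
    by unfold_locales (rule u_pos gamma_pos grad L_pos A_pos lam U_nonneg lipschitz drift eta_pos c_pos c_bound)+
  show ?thesis
    using W_rho_contraction[OF t_nonneg sol sol']
    unfolding init init' Let_def \<rho>_def f_def H_def R_def \<epsilon>_def \<alpha>_def dd_def .
qed

end
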